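(* Let $\alpha\ge1/2$, let $P_0=Gamma(\alpha,1)$, and for each $n\in\mathbb{N}$ let $Q_{n1}$ be a probability measure dominated by $P_0$, with $\frac{dQ_{n1}}{dP_0}=1+n^{-1/2}h_n$. Assume that (A1) the functions $h_n$ are $P_0$-integrable and converge pointwise, $P_0$-almost everywhere, to a function $h$; and (A2) $\sup_{n\in\mathbb{N}}\int|h_n|^4\,dP_0<\infty$. Let $X_{n1},\ldots,X_{nn}$, $n\in\mathbb{N}$, be a triangular array of non-negative row-wise i.i.d. random variables such that $X_{nj}$ has distribution $Q_{n1}$ for every $j=1,\ldots,n$. Let $\overline{X}_n=n^{-1}\sum_{j=1}^nX_{nj}$ and $$Z_n(t)=\frac1{\sqrt n}\sum_{j=1}^n\Big[\Gamma(\alpha)(tX_{nj}/\overline{X}_n)^{(1-\alpha)/2}J_{\alpha-1}\big(2(tX_{nj}/\overline{X}_n)^{1/2}\big)-e^{-t/\alpha}\Big],\qquad t\ge0,$$ and $T_n^2=\int_0^\infty Z_n(t)^2\,dP_0(t)$. Then there exist a centered Gaussian process $Z=\{Z(t),t\ge0\}$ with sample paths in $L^2=L^2(P_0)$ and covariance function $$K(s,t)=e^{-(s+t)/\alpha}\Big[\Gamma(\alpha)(st/\alpha^2)^{(1-\alpha)/2}I_{\alpha-1}\big(2\sqrt{st}/\alpha\big)-\alpha^{-3}st-1\Big],\qquad s,t\ge0,$$ and a function $$c(t)=\int_0^\infty\Big[\Gamma(\alpha)(tx/\alpha)^{(1-\alpha)/2}J_{\alpha-1}\big(2(tx/\alpha)^{1/2}\big)+\frac{x-\alpha}{\alpha^2}\,te^{-t/\alpha}-e^{-t/\alpha}\Big]h(x)\,dP_0(x),\qquad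 t\ge0,$$ such that $Z_n\xrightarrow{d}Z+c$ in $L^2$. Moreover, as $n\to\infty$, $$T_n^2\xrightarrow{d}\int_0^\infty\big(Z(t)+c(t)\big)^2\,dP_0(t).$$
   Context: $Gamma(\alpha,1)$ is the distribution with density $x^{\alpha-1}e^{-x}/\Gamma(\alpha)$, $x>0$. $J_\nu(z)=\sum_{j\ge0}\frac{(-1)^j}{j!\,\Gamma(\nu+1+j)}(z/2)^{2j+\nu}$ and $I_\nu(x)=\sum_{j\ge0}\frac{1}{j!\,\Gamma(\nu+1+j)}(x/2)^{2j+\nu}$; the functions $x^{(1-\alpha)/2}J_{\alpha-1}(2\sqrt x)$ and $x^{(1-\alpha)/2}I_{\alpha-1}(2\sqrt x)$ are power series in $x$ with value $1/\Gamma(\alpha)$ at $x=0$. $L^2(P_0)$ is the Hilbert space of Borel functions on $[0,\infty)$ that are square-integrable with respect to $P_0$. Convergence in distribution is understood with the $n$th row distributed according to $\boldsymbol{Q}_n=Q_{n1}\otimes\cdots\otimes Q_{n1}$ ($n$ factors). *)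

theory Defs
  imports "HOL-Probability.Probability"
begin

definition gamma_distr :: "real \<Rightarrow> real measure" where
  "gamma_distr \<alpha> = density lborel
     (\<lambda>x. ennreal (if x > 0 then x powr (\<alpha> - 1) * exp (- x) / Gamma \<alpha> else 0))"

text \<open>Bessel functions on the positive half-line. Note that \<open>0 powr a = 0\<close> for all \<open>a\<close>, so these
  formulas are meaningful for positive arguments only.\<close>

definition bessel_J :: "real \<Rightarrow> real \<Rightarrow> real" where
  "bessel_J \<nu> z = (\<Sum>j. (- 1) ^ j / (fact j * Gamma (\<nu> + 1 + real j)) * (z / 2) powr (2 * real j + \<nu>))"

definition bessel_I :: "real \<Rightarrow> real \<Rightarrow> real" where
  "bessel_I \<nu> x = (\<Sum>j. 1 / (fact j * Gamma (\<nu> + 1 + real j)) * (x / 2) powr (2 * real j + \<nu>))"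

text \<open>The functions \<open>x\<^bsup>(1-\<alpha>)/2\<^esup> J\<^bsub>\<alpha>-1\<^esub>(2 \<surd>x)\<close> and \<open>x\<^bsup>(1-\<alpha>)/2\<^esup> I\<^bsub>\<alpha>-1\<^esub>(2 \<surd>x)\<close> for \<open>x \<ge> 0\<close>, with the
  value \<open>1 / \<Gamma>(\<alpha>)\<close> of their power series at \<open>x = 0\<close>.\<close>

definition mod_bessel_J :: "real \<Rightarrow> real \<Rightarrow> real" where
  "mod_bessel_J \<alpha> x =
     (if x = 0 then 1 / Gamma \<alpha> else x powr ((1 - \<alpha>) / 2) * bessel_J (\<alpha> - 1) (2 * sqrt x))"

definition mod_bessel_I :: "real \<Rightarrow> real \<Rightarrow> real" where
  "mod_bessel_I \<alpha> x =
     (if x = 0 then 1 / Gamma \<alpha> else x powr ((1 - \<alpha>) / 2) * bessel_I (\<alpha> - 1) (2 * sqrt x))"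

text \<open>\<open>L\<^sup>2(P)\<close> is represented by functions rather than by classes of almost everywhere equal
  functions, with the topology of the seminorm. Its open sets, its Borel sets and the continuous
  real functionals on it are exactly those of the Hilbert space of classes, pulled back along the
  quotient map: an open set that contains \<open>f\<close> contains every function equal to \<open>f\<close>
  almost everywhere. For \<open>P = gamma_distr \<alpha>\<close> the values on the negative half-line, which is a
  null set, are irrelevant, so this is also \<open>L\<^sup>2\<close> of functions on \<open>[0, \<infinity>)\<close>.\<close>

definition L2_fun :: "'a measure \<Rightarrow> ('a \<Rightarrow> real) set" where
  "L2_fun P = {f \<in> borel_measurable P. integrable P (\<lambda>x. (f x)\<^sup>2)}"

definition L2_dist :: "'a measure \<Rightarrow> ('a \<Rightarrow> real) \<Rightarrow> ('a \<Rightarrow> real) \<Rightarrow> real" where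
  "L2_dist P f g = sqrt (\<integral>x. (f x - g x)\<^sup>2 \<partial>P)"

definition L2_open :: "'a measure \<Rightarrow> ('a \<Rightarrow> real) set \<Rightarrow> bool" where
  "L2_open P U \<longleftrightarrow> U \<subseteq> L2_fun P \<and>
     (\<forall>f\<in>U. \<exists>e>0. \<forall>g\<in>L2_fun P. L2_dist P f g < e \<longrightarrow> g \<in> U)"

definition L2_topology :: "'a measure \<Rightarrow> ('a \<Rightarrow> real) topology" where
  "L2_topology P = topology (L2_open P)"

lemma istopology_L2_open: "istopology (L2_open P)"
  unfolding istopology_def
proof (intro conjI allI impI)
  fix S T assume S: "L2_open P S" and T: "L2_open P T"
  show "L2_open P (S \<inter> T)"
    unfolding L2_open_def
  proof (intro conjI ballI)
    show "S \<inter> T \<subseteq> L2_fun P" using S by (auto simp: L2_open_def)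
    fix f assume f: "f \<in> S \<inter> T"
    obtain d where d: "d > 0" "\<And>g. g \<in> L2_fun P \<Longrightarrow> L2_dist P f g < d \<Longrightarrow> g \<in> S"
      using S f unfolding L2_open_def by blast
    obtain e where e: "e > 0" "\<And>g. g \<in> L2_fun P \<Longrightarrow> L2_dist P f g < e \<Longrightarrow> g \<in> T"
      using T f unfolding L2_open_def by blast
    show "\<exists>e>0. \<forall>g\<in>L2_fun P. L2_dist P f g < e \<longrightarrow> g \<in> S \<inter> T"
      by (rule exI[of _ "min d e"]) (use d e in auto)
  qed
next
  fix \<U> assume "\<forall>U\<in>\<U>. L2_open P U"
  then show "L2_open P (\<Union>\<U>)"
    unfolding L2_open_def by (meson Sup_least UnionE UnionI)
qed

lemma openin_L2_topology: "openin (L2_topology P) U \<longleftrightarrow> L2_open P U"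
  by (simp add: L2_topology_def istopology_L2_open topology_inverse')

lemma topspace_L2_topology: "topspace (L2_topology P) = L2_fun P"
proof -
  have "L2_open P (L2_fun P)"
    unfolding L2_open_def by (auto intro: exI[of _ 1])
  then show ?thesis
    unfolding topspace_def openin_L2_topology by (auto simp: L2_open_def)
qed

definition borel_of_topology :: "'b topology \<Rightarrow> 'b measure" where
  "borel_of_topology T = sigma (topspace T) {U. openin T U}"

text \<open>Convergence in distribution of a sequence \<open>X 1, X 2, \<dots>\<close> of random elements of a topological
  space, each on its own probability space. Measurability is part of the definition; the index
  \<open>0\<close> is disregarded.\<close>

definition conv_in_distr ::
  "'b topology \<Rightarrow> (nat \<Rightarrow> 'a measure) \<Rightarrow> (nat \<Rightarrow> 'a \<Rightarrow> 'b) \<Rightarrow> 'c measure \<Rightarrow> ('c \<Rightarrow> 'b) \<Rightarrow> bool" where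
  "conv_in_distr T M X N Y \<longleftrightarrow>
     (\<forall>n\<ge>1. prob_space (M n) \<and> X n \<in> measurable (M n) (borel_of_topology T)) \<and>
     prob_space N \<and> Y \<in> measurable N (borel_of_topology T) \<and>
     (\<forall>F. continuous_map T euclideanreal F \<and> bounded (F ` topspace T) \<longrightarrow>
        (\<lambda>n. \<integral>\<omega>. F (X n \<omega>) \<partial>M n) \<longlonglongrightarrow> (\<integral>\<omega>. F (Y \<omega>) \<partial>N))"

text \<open>Normal law with standard deviation \<open>\<sigma> \<ge> 0\<close>, where \<open>\<sigma> = 0\<close> is the degenerate case.\<close>

definition normal_rv :: "'a measure \<Rightarrow> ('a \<Rightarrow> real) \<Rightarrow> real \<Rightarrow> real \<Rightarrow> bool" where
  "normal_rv M X \<mu> \<sigma> \<longleftrightarrow> X \<in> borel_measurable M \<and>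
     (if \<sigma> = 0 then AE \<omega> in M. X \<omega> = \<mu> else \<sigma> > 0 \<and> distributed M lborel X (normal_density \<mu> \<sigma>))"

definition gaussian_process :: "'a measure \<Rightarrow> 'i set \<Rightarrow> ('i \<Rightarrow> 'a \<Rightarrow> real) \<Rightarrow> bool" where
  "gaussian_process M I Z \<longleftrightarrow> prob_space M \<and> (\<forall>t\<in>I. Z t \<in> borel_measurable M) \<and>
     (\<forall>S a. finite S \<and> S \<subseteq> I \<longrightarrow> (\<exists>\<mu> \<sigma>. normal_rv M (\<lambda>\<omega>. \<Sum>t\<in>S. a t * Z t \<omega>) \<mu> \<sigma>))"

definition centered_process :: "'a measure \<Rightarrow> 'i set \<Rightarrow> ('i \<Rightarrow> 'a \<Rightarrow> real) \<Rightarrow> bool" where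
  "centered_process M I Z \<longleftrightarrow> (\<forall>t\<in>I. integrable M (Z t) \<and> (\<integral>\<omega>. Z t \<omega> \<partial>M) = 0)"

definition covariance :: "'a measure \<Rightarrow> ('a \<Rightarrow> real) \<Rightarrow> ('a \<Rightarrow> real) \<Rightarrow> real" where
  "covariance M X Y = (\<integral>\<omega>. (X \<omega> - (\<integral>\<xi>. X \<xi> \<partial>M)) * (Y \<omega> - (\<integral>\<xi>. Y \<xi> \<partial>M)) \<partial>M)"

definition row_mean :: "(nat \<Rightarrow> nat \<Rightarrow> 'a \<Rightarrow> real) \<Rightarrow> nat \<Rightarrow> 'a \<Rightarrow> real" where
  "row_mean X n \<omega> = (\<Sum>j=1..n. X n j \<omega>) / real n"

text \<open>If the row mean is \<open>0\<close> then so are all the (non-negative) entries of the row, and the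
  quotients below are \<open>0\<close>; this is an event of probability \<open>0\<close>.\<close>

definition Z_stat :: "real \<Rightarrow> (nat \<Rightarrow> nat \<Rightarrow> 'a \<Rightarrow> real) \<Rightarrow> nat \<Rightarrow> real \<Rightarrow> 'a \<Rightarrow> real" where
  "Z_stat \<alpha> X n t \<omega> = 1 / sqrt (real n) *
     (\<Sum>j=1..n. Gamma \<alpha> * mod_bessel_J \<alpha> (t * X n j \<omega> / row_mean X n \<omega>) - exp (- t / \<alpha>))"

definition T2_stat :: "real \<Rightarrow> (nat \<Rightarrow> nat \<Rightarrow> 'a \<Rightarrow> real) \<Rightarrow> nat \<Rightarrow> 'a \<Rightarrow> real" where
  "T2_stat \<alpha> X n \<omega> = (\<integral>t. (Z_stat \<alpha> X n t \<omega>)\<^sup>2 \<partial>gamma_distr \<alpha>)"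

text \<open>The factor \<open>(st / \<alpha>\<^sup>2)\<^bsup>(1-\<alpha>)/2\<^esup> I\<^bsub>\<alpha>-1\<^esub>(2 \<surd>(st) / \<alpha>)\<close> is \<open>mod_bessel_I \<alpha>\<close> at \<open>st / \<alpha>\<^sup>2\<close>.\<close>

definition K_cov :: "real \<Rightarrow> real \<Rightarrow> real \<Rightarrow> real" where
  "K_cov \<alpha> s t = exp (- (s + t) / \<alpha>) *
     (Gamma \<alpha> * mod_bessel_I \<alpha> (s * t / \<alpha>\<^sup>2) - s * t / \<alpha> ^ 3 - 1)"

end

theory Submission
  imports Defs
begin

text \<open>Let \<open>P\<close> be the gamma distribution, \<open>g(x) = \<Gamma>(\<alpha>) x\<^bsup>(1-\<alpha>)/2\<^esup> J\<^bsub>\<alpha>-1\<^esub>(2 \<surd>x)\<close>, which is the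
hypergeometric series \<open>0F1(; \<alpha>; -x)\<close>, and let
\<open>\<psi>(t, x) = g(tx/\<alpha>) + (x - \<alpha>) t exp(-t/\<alpha>) / \<alpha>\<^sup>2 - exp(-t/\<alpha>)\<close> be the kernel of the drift \<open>c\<close>.

\<^bold>\<open>One basis diagonalizes everything.\<close> Let \<open>e\<^sub>j\<close> be the orthonormal Laguerre polynomials of \<open>P\<close>. By
their generating function, \<open>g(tx/\<alpha>)\<close> has the coefficients
\<open>\<phi>\<^sub>j(t) = exp(-t/\<alpha>) (t/\<alpha>)\<^bsup>j\<^esup> / \<surd>(j! (\<alpha>)\<^sub>j)\<close> (\<open>integral_hyp01_lag_on\<close>). The terms of index 0 and 1 are
\<open>exp(-t/\<alpha>)\<close> and \<open>-(x - \<alpha>) t exp(-t/\<alpha>) / \<alpha>\<^sup>2\<close>, so \<open>\<psi>(t, \<cdot>)\<close> is exactly what remains: the sum of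
\<open>\<phi>\<^sub>j(t) e\<^sub>j\<close> over \<open>j \<ge> 2\<close>. Summing \<open>\<phi>\<^sub>j(s) \<phi>\<^sub>j(t)\<close> over \<open>j \<ge> 2\<close> gives the covariance \<open>K(s, t)\<close>
(\<open>K_cov_sums\<close>). The limit process is therefore the series of \<open>\<xi>\<^sub>j \<phi>\<^sub>j\<close>, \<open>j \<ge> 2\<close>, with independent
standard normal \<open>\<xi>\<^sub>j\<close>, and \<open>c\<close> is the series of \<open>\<phi>\<^sub>j \<integral>e\<^sub>j h dP\<close>, \<open>j \<ge> 2\<close>.

\<^bold>\<open>The estimated scale.\<close> The use of the sample mean \<open>m\<close> in place of \<open>\<alpha>\<close> changes the statistic, to first
order, by \<open>\<surd>n (1/m - 1/\<alpha>)\<close> times the sample average of the derivative of \<open>g(tx/m)\<close> with respect to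
\<open>1/m\<close>. That average equals its mean up to an error of order \<open>n\<^bsup>-1/2\<^esup>\<close> (\<open>dscale_mean\<close>), and the mean
produces the linear term of \<open>\<psi>\<close>, the one that removes the index 1. Thus \<open>Z\<^sub>n\<close> is, up to an error of order \<open>n\<^bsup>-1/2\<^esup>\<close> in \<open>L\<^sup>2(P)\<close>,
the normalized sum of \<open>\<psi>(t, X\<^bsub>nj\<^esub>)\<close> (\<open>scale_linearization\<close>, \<open>Z_stat_dist_le\<close>).

\<^bold>\<open>Truncation.\<close> Under the local alternatives, the normalized sum of a centered function \<open>f\<close> has second
moment at most a constant times \<open>\<integral>f\<^sup>2 dP\<close>, up to a term that vanishes with \<open>n\<close>
(\<open>normalized_sum_second_moment\<close>). The Laguerre tail of \<open>\<psi>\<close>, averaged over \<open>t\<close>, has small norm, so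
\<open>Z\<^sub>n\<close> is close to a combination of finitely many \<open>\<phi>\<^sub>j\<close> with random coefficients, uniformly in large
\<open>n\<close> (\<open>Z_stat_approx\<close>); the same tail controls the limit (\<open>limit_approx\<close>).

\<^bold>\<open>Finitely many coefficients.\<close> Any combination of them is a normalized sum of a polynomial \<open>p\<close>, whose
characteristic function tends to \<open>exp(i \<integral>p h dP - \<integral>p\<^sup>2 dP / 2)\<close> (\<open>normalized_sum_char_tendsto\<close>). The
first term in the exponent is the shift that the alternatives cause. Stone--Weierstrass approximation by trigonometric
polynomials extends this to bounded Lipschitz functions (\<open>cosine_conv_imp_lipschitz_conv\<close>). Bounded
continuous functionals on \<open>L\<^sup>2(P)\<close> are increasing limits of Lipschitz ones
(\<open>conv_in_distr_L2_lipschitzI\<close>), and the statement on \<open>T\<^sub>n\<^sup>2\<close> follows by continuous mapping.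

The hypothesis \<open>\<alpha> \<ge> 1/2\<close> makes \<open>\<bar>g\<bar> \<le> 1\<close> on the half-line (\<open>abs_hyp01_neg_le_1\<close>), on which all bounds
for the kernel rest.\<close>

section \<open>Elementary inequalities and limits\<close>

lemma mult_abs_le_sum_squares: "\<bar>a * b\<bar> \<le> a\<^sup>2 + b\<^sup>2" for a b :: real
proof -
  have "0 \<le> (\<bar>a\<bar> - \<bar>b\<bar>)\<^sup>2" by simp
  then have "2 * (\<bar>a\<bar> * \<bar>b\<bar>) \<le> a\<^sup>2 + b\<^sup>2" by (simp add: power2_diff)
  moreover have "0 \<le> \<bar>a\<bar> * \<bar>b\<bar>" by simp
  ultimately show ?thesis by (simp only: abs_mult)
qed

lemma square_le_4: "(a::real)\<^sup>2 \<le> 1 + a ^ 4"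
proof -
  have "0 \<le> (a\<^sup>2 - 1)\<^sup>2" by simp
  then have "2 * a\<^sup>2 \<le> 1 + a ^ 4" by (simp add: power2_diff power_mult[symmetric])
  moreover have "0 \<le> a\<^sup>2" by simp
  ultimately show ?thesis by linarith
qed

lemma sum_two_squares: "(a + b)\<^sup>2 \<le> 2 * a\<^sup>2 + 2 * b\<^sup>2" for a b :: real
proof -
  have "0 \<le> (a - b)\<^sup>2" by simp
  then show ?thesis by (simp add: power2_eq_square algebra_simps)
qed

lemma sum_three_squares: "(a + b + c)\<^sup>2 \<le> 3 * (a\<^sup>2 + b\<^sup>2 + c\<^sup>2)" for a b c :: real
proof -
  have "0 \<le> (a - b)\<^sup>2 + (b - c)\<^sup>2 + (a - c)\<^sup>2" by simp
  then show ?thesis by (simp add: power2_eq_square algebra_simps)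
qed

lemma tendsto_divide_sqrt_0: "(\<lambda>n. d / sqrt (real n)) \<longlonglongrightarrow> 0" for d :: real
  by (intro tendsto_divide_0[OF tendsto_const] filterlim_at_top_imp_at_infinity
      filterlim_compose[OF sqrt_at_top filterlim_real_sequentially])

lemma eventually_sqrt_small:
  assumes "c > 0" shows "eventually (\<lambda>n. d / sqrt (real n) \<le> c) sequentially"
  using order_tendstoD(2)[OF tendsto_divide_sqrt_0[of d] assms] by eventually_elim simp

text \<open>Every limit that involves a truncation, be it of an integrand, of a Laguerre series or of a
functional, is reduced by this rule to the limit of the truncated quantity.\<close>

lemma tendsto_by_approximation:
  fixes a :: "nat \<Rightarrow> real"
  assumes "\<And>e. e > 0 \<Longrightarrow> \<exists>b l. b \<longlonglongrightarrow> l \<and> eventually (\<lambda>n. \<bar>a n - b n\<bar> \<le> e) sequentially \<and> \<bar>c - l\<bar> \<le> e"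
  shows "a \<longlonglongrightarrow> c"
proof (rule tendstoI)
  fix e :: real assume e: "e > 0"
  then obtain b l where b: "b \<longlonglongrightarrow> l" "eventually (\<lambda>n. \<bar>a n - b n\<bar> \<le> e / 4) sequentially" "\<bar>c - l\<bar> \<le> e / 4"
    using assms[of "e / 4"] by auto
  have "eventually (\<lambda>n. dist (b n) l < e / 4) sequentially"
    using b(1) e by (intro tendstoD) auto
  then show "eventually (\<lambda>n. dist (a n) c < e) sequentially"
    using b(2) by eventually_elim (use b(3) e in \<open>auto simp: dist_real_def abs_if split: if_splits\<close>)
qed

section \<open>The hypergeometric series of the Bessel functions\<close>

text \<open>The generalized hypergeometric function \<open>0F1(; a; x)\<close>.\<close>

definition hyp01 :: "real \<Rightarrow> real \<Rightarrow> real" where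
  "hyp01 a x = (\<Sum>k. x ^ k / (fact k * pochhammer a k))"

lemma summable_hyp01:
  fixes a x :: real assumes a: "a > 0"
  shows "summable (\<lambda>k. x ^ k / (fact k * pochhammer a k))"
proof (rule summable_comparison_test)
  have low: "min a 1 ^ k \<le> pochhammer a k" for k
  proof (induction k)
    case (Suc k)
    have "min a 1 ^ k * min a 1 \<le> pochhammer a k * (a + real k)"
      using Suc a by (intro mult_mono) (auto intro!: pochhammer_nonneg)
    then show ?case by (simp add: pochhammer_Suc mult.commute)
  qed simp
  define y where "y = \<bar>x\<bar> / min a 1"
  have "norm (x ^ k / (fact k * pochhammer a k)) \<le> y ^ k / fact k" for k
  proof -
    have "0 < min a 1 ^ k" using a by simp
    then have "\<bar>x\<bar> ^ k / pochhammer a k \<le> \<bar>x\<bar> ^ k / min a 1 ^ k"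
      using low[of k] by (intro divide_left_mono) (auto intro: mult_pos_pos pochhammer_pos a)
    then have "\<bar>x\<bar> ^ k / pochhammer a k / fact k \<le> \<bar>x\<bar> ^ k / min a 1 ^ k / fact k"
      by (rule divide_right_mono) simp
    then show ?thesis using pochhammer_pos[OF a, of k]
      by (simp add: y_def power_divide power_abs abs_mult mult.commute)
  qed
  then show "\<exists>N. \<forall>n\<ge>N. norm (x ^ n / (fact n * pochhammer a n)) \<le> y ^ n / fact n" by blast
  show "summable (\<lambda>k. y ^ k / fact k)"
    using summable_exp[of y] by (simp add: field_simps)
qed

lemma hyp01_0: "hyp01 a 0 = 1"
proof -
  have "(\<lambda>k. 0 ^ k / (fact k * pochhammer a k)) sums (\<Sum>k\<in>{0}. (0::real) ^ k / (fact k * pochhammer a k))"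
    by (rule sums_finite) auto
  then show ?thesis unfolding hyp01_def by (simp add: sums_iff)
qed

lemma DERIV_hyp01:
  assumes a: "a > 0"
  shows "(hyp01 a has_real_derivative hyp01 (a + 1) x / a) (at x)"
proof -
  define c where "c k = 1 / (fact k * pochhammer a k)" for k
  have eq: "hyp01 a = (\<lambda>x. \<Sum>k. c k * x ^ k)" by (simp add: hyp01_def[abs_def] c_def)
  have s: "summable (\<lambda>k. c k * y ^ k)" for y
    using summable_hyp01[OF a, of y] by (simp add: c_def)
  have "((\<lambda>x. \<Sum>k. c k * x ^ k) has_real_derivative (\<Sum>k. diffs c k * x ^ k)) (at x)"
    by (rule termdiffs_strong_converges_everywhere) (rule s)
  moreover have "diffs c k * x ^ k = (x ^ k / (fact k * pochhammer (a + 1) k)) / a" for k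
    by (simp add: diffs_def c_def pochhammer_rec divide_simps) 
  then have "(\<Sum>k. diffs c k * x ^ k) = hyp01 (a + 1) x / a"
    using suminf_divide[OF summable_hyp01[of "a + 1" x], of a] a by (simp add: hyp01_def)
  ultimately show ?thesis by (simp add: eq)
qed

lemma DERIV_hyp01_neg:
  assumes a: "a > 0"
  shows "((\<lambda>x. hyp01 a (- x)) has_real_derivative - hyp01 (a + 1) (- x) / a) (at x)"
  using DERIV_chain2[OF DERIV_hyp01[OF a] DERIV_minus[OF DERIV_ident]] by simp

text \<open>Coefficientwise, \<open>1/(a)\<^sub>k - 1/(a+1)\<^sub>k = k / (a (a+1)\<^sub>k)\<close>. Together with \<open>DERIV_hyp01\<close> this is the
differential equation \<open>x y'' + a y' + y = 0\<close> for \<open>y(x) = 0F1(; a; -x)\<close>.\<close>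

lemma hyp01_contiguous:
  assumes a: "a > 0"
  shows "hyp01 a x = hyp01 (a + 1) x + x * hyp01 (a + 2) x / (a * (a + 1))"
proof -
  define d where "d k = x ^ k / (fact k * pochhammer a k) - x ^ k / (fact k * pochhammer (a + 1) k)" for k
  have d: "summable d"
    unfolding d_def using a by (intro summable_diff summable_hyp01) auto
  have "hyp01 a x - hyp01 (a + 1) x = suminf d"
    unfolding d_def hyp01_def using a by (intro suminf_diff summable_hyp01) auto
  also have "suminf d = (\<Sum>k. d (Suc k)) + d 0"
    using d by (simp add: suminf_split_head)
  also have "d 0 = 0" by (simp add: d_def)
  also have "d (Suc k) = (x / (a * (a + 1))) * (x ^ k / (fact k * pochhammer (a + 2) k))" for k
  proof -
    define p where "p = pochhammer (a + 2) k"
    have p: "p > 0" using a by (auto simp: p_def intro: pochhammer_pos)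
    have e0: "pochhammer (a + 1) (Suc k) = (a + 1) * p"
      by (simp add: pochhammer_rec p_def add.assoc)
    have e1: "pochhammer a (Suc k) * (a + 1 + real k) = a * (a + 1) * p"
      using e0 by (simp add: pochhammer_rec[of a] pochhammer_Suc[of "a+1"])
    define q where "q = pochhammer a (Suc k)"
    have q: "q > 0" using a by (auto simp: q_def intro: pochhammer_pos)
    have z: "a + 1 + real k > 0" using a by simp
    have qe: "q = a * (a + 1) * p / (a + 1 + real k)" using e1 z by (simp add: q_def field_simps)
    have "d (Suc k) = x ^ Suc k / fact (Suc k) * (1 / q - 1 / ((a + 1) * p))"
      unfolding d_def e0 q_def by (simp only: right_diff_distrib times_divide_times_eq mult_1_right)
    also have "1 / q - 1 / ((a + 1) * p) = real (Suc k) / (a * (a + 1) * p)"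
      unfolding qe using a p z by (simp add: divide_simps)
    also have "x ^ Suc k / fact (Suc k) * (real (Suc k) / (a * (a + 1) * p)) = x / (a * (a + 1)) * (x ^ k / (fact k * p))"
      using a p by (simp add: fact_Suc divide_simps del: of_nat_Suc)
    finally show ?thesis by (simp add: p_def)
  qed
  then have "(\<Sum>k. d (Suc k)) = x / (a * (a + 1)) * hyp01 (a + 2) x"
    using suminf_mult[OF summable_hyp01[of "a + 2" x], of "x / (a * (a + 1))"] a by (simp add: hyp01_def)
  finally show ?thesis by (simp add: algebra_simps)
qed

text \<open>By the differential equation, the energy \<open>y\<^sup>2 + x y'\<^sup>2\<close> has the derivative \<open>(1 - 2a) y'\<^sup>2 \<le> 0\<close>, so it
stays below its value 1 at the origin.\<close>

lemma abs_hyp01_neg_le_1: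
  assumes a: "a \<ge> 1 / 2" and x: "x \<ge> 0"
  shows "\<bar>hyp01 a (- x)\<bar> \<le> 1"
proof -
  define y y1 y2 where "y x = hyp01 a (- x)" and "y1 x = - hyp01 (a + 1) (- x) / a"
    and "y2 x = hyp01 (a + 2) (- x) / (a * (a + 1))" for x
  have dy: "(y has_real_derivative y1 x) (at x)" for x
    unfolding y_def[abs_def] y1_def using a by (intro DERIV_hyp01_neg) auto
  have dy1: "(y1 has_real_derivative y2 x) (at x)" for x
  proof -
    have "((\<lambda>x. hyp01 (a + 1) (- x)) has_real_derivative - hyp01 (a + 1 + 1) (- x) / (a + 1)) (at x)"
      using a by (intro DERIV_hyp01_neg) auto
    from DERIV_cdivide[OF DERIV_minus[OF this], of a] show ?thesis
      by (simp add: y1_def[abs_def] y2_def add.assoc mult.commute)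
  qed
  have ode: "x * y2 x + a * y1 x + y x = 0" for x
    using hyp01_contiguous[of a "- x"] a by (simp add: y_def y1_def y2_def)
  define E where "E x = (y x)\<^sup>2 + x * (y1 x)\<^sup>2" for x
  have dE: "(E has_real_derivative (1 - 2 * a) * (y1 x)\<^sup>2) (at x)" for x
  proof -
    have "(E has_real_derivative 2 * y x * y1 x + (y1 x)\<^sup>2 + 2 * y1 x * (x * y2 x)) (at x)"
      unfolding E_def[abs_def]
      by (auto intro!: derivative_eq_intros dy dy1 simp: algebra_simps)
    moreover have "x * y2 x = - a * y1 x - y x" using ode[of x] by simp
    ultimately show ?thesis by (simp add: algebra_simps power2_eq_square)
  qed
  have "E x \<le> E 0"
    by (rule DERIV_nonpos_imp_nonincreasing[OF x])
       (use dE a in \<open>auto intro!: exI mult_nonpos_nonneg\<close>)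
  then have "(y x)\<^sup>2 \<le> 1"
    using x by (simp add: E_def y_def hyp01_0) (smt (verit) mult_nonneg_nonneg zero_le_power2)
  then show ?thesis by (simp add: y_def abs_square_le_1)
qed

text \<open>One computation serves both Bessel functions, with \<open>e = -1\<close> for \<open>J\<close> and \<open>e = 1\<close> for \<open>I\<close>; the
parameter \<open>a - 1 + 1\<close> is left as it stands so that the series is that of their definitions at the
order \<open>a - 1\<close>. The powers of \<open>x\<close> combine to
\<open>x\<^bsup>j\<^esup>\<close> because \<open>(1 - a)/2 + (2j + a - 1)/2 = j\<close>.\<close>

lemma bessel_series:
  assumes a: "a > 0" and x: "x > 0"
  shows "Gamma a * (x powr ((1 - a) / 2) * (\<Sum>j. e ^ j / (fact j * Gamma (a - 1 + 1 + real j)) * (2 * sqrt x / 2) powr (2 * real j + (a - 1))))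
    = hyp01 a (e * x)"
proof -
  have G: "Gamma a > 0" using a by (rule Gamma_real_pos)
  have po: "pochhammer a j = Gamma (a + real j) / Gamma a" for j
    using a by (intro pochhammer_Gamma) (auto elim!: nonpos_Ints_cases)
  have t: "Gamma a * x powr ((1 - a) / 2) * (e ^ j / (fact j * Gamma (a - 1 + 1 + real j)) * (2 * sqrt x / 2) powr (2 * real j + (a - 1)))
     = (e * x) ^ j / (fact j * pochhammer a j)" for j
  proof -
    have "(sqrt x) powr (2 * real j + (a - 1)) = x powr (real j + (a - 1) / 2)"
      using x by (simp add: powr_half_sqrt[symmetric] powr_powr field_simps)
    then have "x powr ((1 - a) / 2) * (sqrt x) powr (2 * real j + (a - 1)) = x ^ j"
      using x by (simp add: powr_add[symmetric] powr_realpow diff_divide_distrib)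
    then show ?thesis
      using G a x by (simp add: po field_simps power_mult_distrib)
  qed
  have s: "summable (\<lambda>j. e ^ j / (fact j * Gamma (a - 1 + 1 + real j)) * (2 * sqrt x / 2) powr (2 * real j + (a - 1)))"
    (is "summable ?f")
  proof -
    have "summable (\<lambda>j. Gamma a * x powr ((1 - a) / 2) * ?f j)"
      unfolding t using summable_hyp01[OF a] .
    moreover have "Gamma a * x powr ((1 - a) / 2) \<noteq> 0" using G x by simp
    ultimately show ?thesis by (simp only: summable_cmult_iff) simp
  qed
  have "Gamma a * x powr ((1 - a) / 2) * suminf ?f = hyp01 a (e * x)"
    unfolding suminf_mult[OF s, symmetric] t hyp01_def ..
  then show ?thesis by (simp only: mult.assoc)
qed

lemma hyp01_mod_bessel_J: "a > 0 \<Longrightarrow> x \<ge> 0 \<Longrightarrow> Gamma a * mod_bessel_J a x = hyp01 a (- x)"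
  using bessel_series[of a x "- 1"] Gamma_real_pos[of a, THEN less_imp_neq]
  by (cases "x = 0") (auto simp: mod_bessel_J_def bessel_J_def hyp01_0)

lemma hyp01_mod_bessel_I: "a > 0 \<Longrightarrow> x \<ge> 0 \<Longrightarrow> Gamma a * mod_bessel_I a x = hyp01 a x"
  using bessel_series[of a x 1] Gamma_real_pos[of a, THEN less_imp_neq]
  by (cases "x = 0") (auto simp: mod_bessel_I_def bessel_I_def hyp01_0)

section \<open>Moments of the gamma distribution\<close>

lemma sets_gamma_distr [simp, measurable_cong]: "sets (gamma_distr \<alpha>) = sets borel"
  by (simp add: gamma_distr_def)

lemma space_gamma_distr [simp]: "space (gamma_distr \<alpha>) = UNIV"
  by (simp add: gamma_distr_def)

lemma AE_gamma_distr_pos: "AE x in gamma_distr \<alpha>. x > 0"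
  unfolding gamma_distr_def
  by (subst AE_density) (auto intro!: AE_I2)

lemma AE_gamma_nonneg: "AE t in gamma_distr \<alpha>. t \<ge> 0"
  using AE_gamma_distr_pos[of \<alpha>] by eventually_elim simp

context
  fixes \<alpha> :: real
  assumes \<alpha>: "\<alpha> > 0"
begin

lemma nn_integral_gamma_distr_power:
  "(\<integral>\<^sup>+x. ennreal (x ^ k) \<partial>gamma_distr \<alpha>) = ennreal (pochhammer \<alpha> k)"
proof -
  have G: "Gamma \<alpha> > 0" using \<alpha> by (rule Gamma_real_pos)
  have po: "pochhammer \<alpha> k = Gamma (\<alpha> + real k) / Gamma \<alpha>"
    using \<alpha> by (intro pochhammer_Gamma) (auto elim!: nonpos_Ints_cases)
  have ak: "\<alpha> + real k > 0" using \<alpha> by simp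
  have "(\<integral>\<^sup>+x. ennreal (x ^ k) \<partial>gamma_distr \<alpha>) =
      (\<integral>\<^sup>+x. ennreal (if x > 0 then x powr (\<alpha> - 1) * exp (- x) / Gamma \<alpha> else 0) * ennreal (x ^ k) \<partial>lborel)"
    unfolding gamma_distr_def by (rule nn_integral_density) measurable
  also have "\<dots> = (\<integral>\<^sup>+x. ennreal (1 / Gamma \<alpha>) * ennreal (indicator {0..} x * x powr (\<alpha> + real k - 1) / exp x) \<partial>lborel)"
  proof (rule nn_integral_cong_AE, rule AE_mp[OF AE_lborel_singleton[of 0]], rule AE_I2, rule impI)
    fix x :: real assume "x \<noteq> 0"
    show "ennreal (if x > 0 then x powr (\<alpha> - 1) * exp (- x) / Gamma \<alpha> else 0) * ennreal (x ^ k) =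
        ennreal (1 / Gamma \<alpha>) * ennreal (indicator {0..} x * x powr (\<alpha> + real k - 1) / exp x)"
    proof (cases "x > 0")
      case True
      have "x powr (\<alpha> + real k - 1) = x powr (\<alpha> - 1) * x ^ k"
        using True by (simp add: powr_realpow[symmetric] powr_add[symmetric] algebra_simps)
      then show ?thesis using True G
        by (simp add: ennreal_mult[symmetric] exp_minus field_simps)
    next
      case False
      with \<open>x \<noteq> 0\<close> have "x < 0" by simp
      then show ?thesis by simp
    qed
  qed
  also have "\<dots> = ennreal (1 / Gamma \<alpha>) * ennreal (Gamma (\<alpha> + real k))"
    by (subst nn_integral_cmult) (measurable, simp add: Gamma_conv_nn_integral_real[OF ak])
  also have "\<dots> = ennreal (pochhammer \<alpha> k)"
    using G Gamma_real_pos[OF ak] by (simp add: po ennreal_mult[symmetric])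
  finally show ?thesis .
qed

lemma prob_space_gamma_distr: "prob_space (gamma_distr \<alpha>)"
  by standard (use nn_integral_gamma_distr_power[of 0] in simp)

lemma has_bochner_integral_gamma_distr_power:
  "has_bochner_integral (gamma_distr \<alpha>) (\<lambda>x. x ^ k) (pochhammer \<alpha> k)"
  by (rule has_bochner_integral_nn_integral)
     (use \<alpha> eventually_mono[OF AE_gamma_distr_pos[of \<alpha>], of "\<lambda>x. 0 \<le> x ^ k"] in
       \<open>auto intro: pochhammer_nonneg simp: nn_integral_gamma_distr_power\<close>)

lemma integrable_gamma_distr_power [simp]: "integrable (gamma_distr \<alpha>) (\<lambda>x. x ^ k)"
  and integral_gamma_distr_power: "(\<integral>x. x ^ k \<partial>gamma_distr \<alpha>) = pochhammer \<alpha> k"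
  using has_bochner_integral_gamma_distr_power[of k] by (auto simp: has_bochner_integral_iff)

end

section \<open>Laguerre polynomials\<close>

text \<open>The terminating series \<open>1F1(-j; \<alpha>; x)\<close>: the classical Laguerre polynomial with parameter \<open>\<alpha> - 1\<close>,
normalized to the value 1 at the origin.\<close>

definition laguerre :: "real \<Rightarrow> nat \<Rightarrow> real \<Rightarrow> real" where
  "laguerre \<alpha> j x = (\<Sum>i\<le>j. (- 1) ^ i * real (j choose i) * x ^ i / pochhammer \<alpha> i)"

lemma laguerre_measurable [measurable]: "laguerre \<alpha> j \<in> borel_measurable borel"
  unfolding laguerre_def[abs_def] by measurable

lemma hyp01_measurable [measurable]: "hyp01 \<alpha> \<in> borel_measurable borel"
  unfolding hyp01_def[abs_def] by measurable

text \<open>Pascal's rule in the form that drives inductions on the order of a finite difference.\<close>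

lemma alternating_binomial_sum_Suc:
  fixes f :: "nat \<Rightarrow> real"
  shows "(\<Sum>i\<le>Suc j. (- 1) ^ i * real (Suc j choose i) * f i) =
    (\<Sum>i\<le>j. (- 1) ^ i * real (j choose i) * f i) - (\<Sum>i\<le>j. (- 1) ^ i * real (j choose i) * f (Suc i))"
proof -
  have "(\<Sum>i\<le>Suc j. (- 1) ^ i * real (Suc j choose i) * f i)
     = f 0 + (\<Sum>i\<le>j. (- 1) ^ Suc i * real (Suc j choose Suc i) * f (Suc i))"
    by (simp only: sum.atMost_Suc_shift) simp
  also have "(\<Sum>i\<le>j. (- 1) ^ Suc i * real (Suc j choose Suc i) * f (Suc i))
     = (\<Sum>i\<le>j. (- 1) ^ Suc i * real (j choose Suc i) * f (Suc i))
       - (\<Sum>i\<le>j. (- 1) ^ i * real (j choose i) * f (Suc i))"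
    by (subst sum_subtractf[symmetric], rule sum.cong) (auto simp: algebra_simps)
  also have "f 0 + ((\<Sum>i\<le>j. (- 1) ^ Suc i * real (j choose Suc i) * f (Suc i))
       - (\<Sum>i\<le>j. (- 1) ^ i * real (j choose i) * f (Suc i)))
     = (\<Sum>i\<le>Suc j. (- 1) ^ i * real (j choose i) * f i)
       - (\<Sum>i\<le>j. (- 1) ^ i * real (j choose i) * f (Suc i))"
    by (simp only: sum.atMost_Suc_shift) simp
  also have "(\<Sum>i\<le>Suc j. (- 1) ^ i * real (j choose i) * f i) = (\<Sum>i\<le>j. (- 1) ^ i * real (j choose i) * f i)"
    by simp
  finally show ?thesis .
qed

lemma pochhammer_shift_diff:
  fixes b :: real
  shows "pochhammer b (Suc m) - pochhammer (b + 1) (Suc m) = - real (Suc m) * pochhammer (b + 1) m"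
  unfolding pochhammer_rec[of b] pochhammer_Suc[of "b + 1"] by (simp add: algebra_simps)

text \<open>Up to sign, the sum is the \<open>j\<close>-th finite difference of the polynomial \<open>a \<mapsto> (a)\<^sub>k\<close> of degree \<open>k\<close>.
Each difference lowers the degree by one, since \<open>(a)\<^sub>k - (a+1)\<^sub>k = -k (a+1)\<^bsub>k-1\<^esub>\<close>, and a polynomial of
degree below \<open>j\<close> is annihilated. Orthogonality of the Laguerre polynomials comes from here.\<close>

lemma alternating_binomial_pochhammer:
  fixes a :: real
  shows "(\<Sum>i\<le>j. (- 1) ^ i * real (j choose i) * pochhammer (a + real i) k) =
    (if k < j then 0 else (- 1) ^ j * (fact k / fact (k - j)) * pochhammer (a + real j) (k - j))"
proof (induction j arbitrary: a)
  case (Suc j)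
  have "(\<Sum>i\<le>Suc j. (- 1) ^ i * real (Suc j choose i) * pochhammer (a + real i) k) =
      (\<Sum>i\<le>j. (- 1) ^ i * real (j choose i) * pochhammer (a + real i) k)
      - (\<Sum>i\<le>j. (- 1) ^ i * real (j choose i) * pochhammer ((a + 1) + real i) k)"
    by (simp only: alternating_binomial_sum_Suc) (simp add: algebra_simps)
  also have "\<dots> = (if k < j then 0 else (- 1) ^ j * (fact k / fact (k - j)) * pochhammer (a + real j) (k - j))
      - (if k < j then 0 else (- 1) ^ j * (fact k / fact (k - j)) * pochhammer (a + 1 + real j) (k - j))"
    unfolding Suc.IH ..
  also have "\<dots> = (if k < Suc j then 0 else
      (- 1) ^ Suc j * (fact k / fact (k - Suc j)) * pochhammer (a + real (Suc j)) (k - Suc j))"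
  proof (cases "k \<le> j")
    case True
    then show ?thesis by (cases "k = j") auto
  next
    case False
    then obtain m where m: "k = Suc (j + m)" by (metis add_Suc_right less_iff_Suc_add not_le)
    have "pochhammer (a + real j) (Suc m) - pochhammer (a + 1 + real j) (Suc m)
        = - real (Suc m) * pochhammer (a + real (Suc j)) m"
      using pochhammer_shift_diff[of "a + real j" m] by (simp add: algebra_simps)
    then have "(- 1) ^ j * (fact k / fact (Suc m)) * pochhammer (a + real j) (Suc m)
       - (- 1) ^ j * (fact k / fact (Suc m)) * pochhammer (a + 1 + real j) (Suc m)
       = (- 1) ^ j * (fact k / fact (Suc m)) * (- real (Suc m) * pochhammer (a + real (Suc j)) m)"
      by (simp only: right_diff_distrib[symmetric])
    also have "\<dots> = (- 1) ^ Suc j * (fact k / fact m) * pochhammer (a + real (Suc j)) m"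
      by (simp add: fact_Suc del: of_nat_Suc)
    finally show ?thesis using m by simp
  qed
  finally show ?case .
qed simp

context
  fixes \<alpha> :: real
  assumes \<alpha>: "\<alpha> > 0"
begin

text \<open>The moments of the gamma distribution are \<open>(\<alpha>)\<^sub>i\<close>, and \<open>(\<alpha>)\<^bsub>i+k\<^esub> / (\<alpha>)\<^sub>i = (\<alpha> + i)\<^sub>k\<close>, so the integral is
the alternating sum just computed.\<close>

lemma integrable_power_laguerre: "integrable (gamma_distr \<alpha>) (\<lambda>x. x ^ k * laguerre \<alpha> j x)"
  and integral_power_laguerre: "(\<integral>x. x ^ k * laguerre \<alpha> j x \<partial>gamma_distr \<alpha>) =
    (if k < j then 0 else (- 1) ^ j * (fact k / fact (k - j)) * pochhammer (\<alpha> + real j) (k - j))"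
proof -
  have eq: "x ^ k * laguerre \<alpha> j x = (\<Sum>i\<le>j. (- 1) ^ i * real (j choose i) / pochhammer \<alpha> i * x ^ (i + k))" for x
    unfolding laguerre_def sum_distrib_left by (intro sum.cong) (auto simp: power_add)
  show "integrable (gamma_distr \<alpha>) (\<lambda>x. x ^ k * laguerre \<alpha> j x)"
    unfolding eq by (intro Bochner_Integration.integrable_sum integrable_mult_right integrable_gamma_distr_power[OF \<alpha>])
  have "(\<integral>x. x ^ k * laguerre \<alpha> j x \<partial>gamma_distr \<alpha>) =
     (\<Sum>i\<le>j. (- 1) ^ i * real (j choose i) / pochhammer \<alpha> i * pochhammer \<alpha> (i + k))"
    unfolding eq by (simp add: Bochner_Integration.integral_sum integrable_gamma_distr_power[OF \<alpha>] integral_gamma_distr_power[OF \<alpha>])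
  also have "\<dots> = (\<Sum>i\<le>j. (- 1) ^ i * real (j choose i) * pochhammer (\<alpha> + real i) k)"
  proof (intro sum.cong refl)
    fix i
    have "pochhammer \<alpha> i > 0" using \<alpha> by (rule pochhammer_pos)
    then show "(- 1) ^ i * real (j choose i) / pochhammer \<alpha> i * pochhammer \<alpha> (i + k) =
        (- 1) ^ i * real (j choose i) * pochhammer (\<alpha> + real i) k"
      by (simp add: pochhammer_product')
  qed
  also note alternating_binomial_pochhammer
  finally show "(\<integral>x. x ^ k * laguerre \<alpha> j x \<partial>gamma_distr \<alpha>) =
    (if k < j then 0 else (- 1) ^ j * (fact k / fact (k - j)) * pochhammer (\<alpha> + real j) (k - j))" .
qed

lemma laguerre_mult_eq: "laguerre \<alpha> i x * laguerre \<alpha> j x =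
    (\<Sum>k\<le>i. (- 1) ^ k * real (i choose k) / pochhammer \<alpha> k * (x ^ k * laguerre \<alpha> j x))"
  unfolding laguerre_def[of \<alpha> i] sum_distrib_right by (intro sum.cong) auto

lemma integrable_laguerre_mult: "integrable (gamma_distr \<alpha>) (\<lambda>x. laguerre \<alpha> i x * laguerre \<alpha> j x)"
  unfolding laguerre_mult_eq
  by (intro Bochner_Integration.integrable_sum integrable_mult_right integrable_power_laguerre)

text \<open>After expansion of the polynomial of lower degree, only a leading term of degree exactly \<open>j\<close> meets a
moment that does not vanish.\<close>

lemma integral_laguerre_mult:
  "(\<integral>x. laguerre \<alpha> i x * laguerre \<alpha> j x \<partial>gamma_distr \<alpha>) = (if i = j then fact j / pochhammer \<alpha> j else 0)"
proof -
  have *: "(\<integral>x. laguerre \<alpha> i x * laguerre \<alpha> j x \<partial>gamma_distr \<alpha>) = (if i = j then fact j / pochhammer \<alpha> j else 0)"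
    if "i \<le> j" for i j
  proof -
    have "(\<integral>x. laguerre \<alpha> i x * laguerre \<alpha> j x \<partial>gamma_distr \<alpha>) =
      (\<Sum>k\<le>i. (- 1) ^ k * real (i choose k) / pochhammer \<alpha> k *
         (if k < j then 0 else (- 1) ^ j * (fact k / fact (k - j)) * pochhammer (\<alpha> + real j) (k - j)))"
      unfolding laguerre_mult_eq
      by (subst Bochner_Integration.integral_sum)
         (auto intro!: integrable_mult_right integrable_power_laguerre simp: integral_power_laguerre)
    also have "\<dots> = (\<Sum>k\<le>i. if k = j then fact j / pochhammer \<alpha> j else 0)"
      using that by (intro sum.cong) (auto simp: power_add[symmetric] mult_ac)
    also have "\<dots> = (if i = j then fact j / pochhammer \<alpha> j else 0)"
      using that by auto
    finally show ?thesis .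
  qed
  show ?thesis
  proof (cases "i \<le> j")
    case False
    then show ?thesis using *[of j i] by (simp add: mult.commute)
  qed (rule *)
qed

text \<open>The Cauchy product of the exponential series with the hypergeometric series.\<close>

lemma laguerre_generating_function:
  "(\<lambda>j. t ^ j / fact j * laguerre \<alpha> j x) sums (exp t * hyp01 \<alpha> (- (t * x)))"
  and laguerre_generating_abs_summable: "summable (\<lambda>j. \<bar>t ^ j / fact j * laguerre \<alpha> j x\<bar>)"
proof -
  define a where "a i = (- (t * x)) ^ i / (fact i * pochhammer \<alpha> i)" for i
  define b where "b k = t ^ k / fact k" for k
  have eq: "(\<Sum>i\<le>j. a i * b (j - i)) = t ^ j / fact j * laguerre \<alpha> j x" for j
    unfolding laguerre_def sum_distrib_left
  proof (rule sum.cong[OF refl])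
    fix i assume "i \<in> {..j}"
    then have i: "i \<le> j" by simp
    have "t ^ j = t ^ i * t ^ (j - i)" using i by (simp add: power_add[symmetric])
    moreover have "real (j choose i) = fact j / (fact i * fact (j - i))"
      using i by (rule binomial_fact)
    ultimately show "a i * b (j - i) = t ^ j / fact j * ((- 1) ^ i * real (j choose i) * x ^ i / pochhammer \<alpha> i)"
      by (simp add: a_def b_def power_mult_distrib power_minus[of "t * x"] mult_ac)
  qed
  have sa: "summable (\<lambda>i. norm (a i))"
  proof -
    have "norm (a i) = \<bar>t * x\<bar> ^ i / (fact i * pochhammer \<alpha> i)" for i
      using pochhammer_pos[OF \<alpha>, of i] by (simp add: a_def abs_mult power_abs)
    then show ?thesis using summable_hyp01[OF \<alpha>, of "\<bar>t * x\<bar>"] by simp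
  qed
  have sb: "summable (\<lambda>k. norm (b k))"
    using summable_norm_exp[of t] by (simp add: b_def field_simps)
  have "(\<lambda>j. \<Sum>i\<le>j. a i * b (j - i)) sums ((\<Sum>k. a k) * (\<Sum>k. b k))"
    by (rule Cauchy_product_sums[OF sa sb])
  moreover have "(\<Sum>k. b k) = exp t" by (simp add: b_def exp_def field_simps)
  moreover have "(\<Sum>k. a k) = hyp01 \<alpha> (- (t * x))" by (simp add: a_def hyp01_def)
  ultimately show "(\<lambda>j. t ^ j / fact j * laguerre \<alpha> j x) sums (exp t * hyp01 \<alpha> (- (t * x)))"
    unfolding eq by (simp add: mult.commute)
  show "summable (\<lambda>j. \<bar>t ^ j / fact j * laguerre \<alpha> j x\<bar>)"
  proof (rule summable_comparison_test)
    have "summable (\<lambda>j. \<Sum>i\<le>j. norm (a i) * norm (b (j - i)))"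
      using Cauchy_product_sums[of "\<lambda>i. norm (a i)" "\<lambda>i. norm (b i)"] sa sb by (auto simp: sums_iff)
    then show "summable (\<lambda>j. \<Sum>i\<le>j. norm (a i) * norm (b (j - i)))" .
    show "\<exists>N. \<forall>n\<ge>N. norm \<bar>t ^ n / fact n * laguerre \<alpha> n x\<bar> \<le> (\<Sum>i\<le>n. norm (a i) * norm (b (n - i)))"
      unfolding eq[symmetric] by (auto intro!: exI[of _ 0] order.trans[OF sum_abs] simp: abs_mult)
  qed
qed

end

text \<open>The squared norm \<open>k! / (\<alpha>)\<^sub>k\<close> of a Laguerre polynomial thus grows at most geometrically, which the
factor \<open>1 / k!\<close> in the generating function absorbs.\<close>

lemma fact_le_pochhammer:
  assumes "(\<alpha>::real) \<ge> 1 / 2"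
  shows "fact k \<le> 2 ^ k * pochhammer \<alpha> k"
proof (induction k)
  case (Suc k)
  have "fact k * real (Suc k) \<le> (2 ^ k * pochhammer \<alpha> k) * (2 * (\<alpha> + real k))"
    using Suc assms pochhammer_pos[of \<alpha> k] by (intro mult_mono) auto
  then show ?case by (simp add: pochhammer_Suc algebra_simps)
qed simp

context
  fixes \<alpha> :: real
  assumes \<alpha>2: "\<alpha> \<ge> 1 / 2"
begin

lemma alpha_pos: "\<alpha> > 0" using \<alpha>2 by simp

lemma integral_laguerre_square_le: "(\<integral>x. (laguerre \<alpha> k x)\<^sup>2 \<partial>gamma_distr \<alpha>) \<le> 2 ^ k"
proof -
  have "(\<integral>x. (laguerre \<alpha> k x)\<^sup>2 \<partial>gamma_distr \<alpha>) = fact k / pochhammer \<alpha> k"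
    using integral_laguerre_mult[OF alpha_pos, of k k] by (simp add: power2_eq_square)
  then show ?thesis
    using fact_le_pochhammer[OF \<alpha>2, of k] pochhammer_pos[OF alpha_pos, of k] by (simp add: pos_divide_le_eq)
qed

text \<open>The generating function, integrated term by term against a square-integrable weight. The
interchange rests on \<open>\<bar>L w\<bar> \<le> L\<^sup>2 + w\<^sup>2\<close> and on the geometric growth of \<open>\<integral>L\<^sup>2\<close> in the degree of \<open>L\<close>.\<close>

lemma integral_hyp01_mult:
  assumes s: "s \<ge> 0" and [measurable]: "w \<in> borel_measurable borel"
    and w2: "integrable (gamma_distr \<alpha>) (\<lambda>x. (w x)\<^sup>2)"
  shows "(\<lambda>k. s ^ k / fact k * (\<integral>x. laguerre \<alpha> k x * w x \<partial>gamma_distr \<alpha>)) sums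
    (exp s * (\<integral>x. hyp01 \<alpha> (- (s * x)) * w x \<partial>gamma_distr \<alpha>))"
proof -
  define f where "f k x = s ^ k / fact k * laguerre \<alpha> k x * w x" for k x
  have L2: "integrable (gamma_distr \<alpha>) (\<lambda>x. (laguerre \<alpha> k x)\<^sup>2)" for k
    using integrable_laguerre_mult[OF alpha_pos, of k k] by (simp add: power2_eq_square)
  have Lw: "integrable (gamma_distr \<alpha>) (\<lambda>x. laguerre \<alpha> k x * w x)" for k
    by (rule Bochner_Integration.integrable_bound[OF Bochner_Integration.integrable_add[OF L2[of k] w2]])
       (use mult_abs_le_sum_squares in \<open>auto intro!: AE_I2\<close>)
  have int: "integrable (gamma_distr \<alpha>) (f k)" for k
    unfolding f_def[abs_def] mult.assoc by (intro integrable_mult_right Lw)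
  have sums1: "(\<lambda>k. f k x) sums (exp s * hyp01 \<alpha> (- (s * x)) * w x)" for x
    unfolding f_def by (intro sums_mult2 laguerre_generating_function[OF alpha_pos])
  have abs1: "summable (\<lambda>k. norm (f k x))" for x
    using summable_mult2[OF laguerre_generating_abs_summable[OF alpha_pos, of s x], of "\<bar>w x\<bar>"]
    by (simp add: f_def abs_mult)
  define W where "W = (\<integral>x. (w x)\<^sup>2 \<partial>gamma_distr \<alpha>)"
  have bound: "(\<integral>x. norm (f k x) \<partial>gamma_distr \<alpha>) \<le> (2 * s) ^ k / fact k + s ^ k / fact k * W" for k
  proof -
    have "(\<integral>x. norm (f k x) \<partial>gamma_distr \<alpha>) = s ^ k / fact k * (\<integral>x. \<bar>laguerre \<alpha> k x * w x\<bar> \<partial>gamma_distr \<alpha>)"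
      using s by (simp add: f_def abs_mult mult.assoc)
    also have "(\<integral>x. \<bar>laguerre \<alpha> k x * w x\<bar> \<partial>gamma_distr \<alpha>) \<le> (\<integral>x. (laguerre \<alpha> k x)\<^sup>2 + (w x)\<^sup>2 \<partial>gamma_distr \<alpha>)"
      by (intro integral_mono Bochner_Integration.integrable_add L2 w2 integrable_abs Lw mult_abs_le_sum_squares)
    also have "\<dots> \<le> 2 ^ k + W"
      using integral_laguerre_square_le[of k] by (simp add: W_def L2 w2)
    finally have "(\<integral>x. norm (f k x) \<partial>gamma_distr \<alpha>) \<le> s ^ k / fact k * (2 ^ k + W)"
      using s by (simp add: mult_left_mono divide_right_mono)
    then show ?thesis by (simp add: algebra_simps power_mult_distrib)
  qed
  have sm: "summable (\<lambda>k. \<integral>x. norm (f k x) \<partial>gamma_distr \<alpha>)"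
  proof (rule summable_comparison_test)
    have "summable (\<lambda>k. y ^ k / fact k)" for y :: real
      using summable_exp[of y] by (simp add: field_simps)
    then show "summable (\<lambda>k. (2 * s) ^ k / fact k + s ^ k / fact k * W)"
      by (intro summable_add summable_mult2)
    show "\<exists>N. \<forall>n\<ge>N. norm (\<integral>x. norm (f n x) \<partial>gamma_distr \<alpha>) \<le> (2 * s) ^ n / fact n + s ^ n / fact n * W"
      using bound by (auto intro!: exI[of _ 0])
  qed
  have "(\<lambda>k. \<integral>x. f k x \<partial>gamma_distr \<alpha>) sums (\<integral>x. (\<Sum>k. f k x) \<partial>gamma_distr \<alpha>)"
    by (rule sums_integral[OF int _ sm]) (use abs1 in simp)
  moreover have "(\<Sum>k. f k x) = exp s * (hyp01 \<alpha> (- (s * x)) * w x)" for x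
    using sums1[of x] by (simp add: sums_iff mult.assoc)
  ultimately show ?thesis
    unfolding f_def mult.assoc by simp
qed

end

section \<open>The Laguerre expansion of the Bessel kernel\<close>

lemma ex_poly_laguerre: "\<exists>p. \<forall>x. laguerre \<alpha> j x = poly p x"
proof (intro exI allI)
  fix x
  show "laguerre \<alpha> j x = poly (\<Sum>i\<le>j. monom ((- 1) ^ i * real (j choose i) / pochhammer \<alpha> i) i) x"
    by (simp add: laguerre_def poly_sum poly_monom)
qed

lemma integrable_gamma_distr_poly:
  assumes "\<alpha> > 0" shows "integrable (gamma_distr \<alpha>) (poly p)"
  unfolding poly_altdef[abs_def]
  by (intro Bochner_Integration.integrable_sum integrable_mult_right integrable_gamma_distr_power assms)

text \<open>The Laguerre polynomials in orthonormal scaling.\<close>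

definition lag_on :: "real \<Rightarrow> nat \<Rightarrow> real \<Rightarrow> real" where
  "lag_on \<alpha> j x = sqrt (pochhammer \<alpha> j / fact j) * laguerre \<alpha> j x"

text \<open>The coefficients of \<open>x \<mapsto> 0F1(; \<alpha>; -tx/\<alpha>)\<close> with respect to \<open>lag_on\<close>, as \<open>integral_hyp01_lag_on\<close>
shows.\<close>

definition lag_coef :: "real \<Rightarrow> nat \<Rightarrow> real \<Rightarrow> real" where
  "lag_coef \<alpha> j t = exp (- t / \<alpha>) * (t / \<alpha>) ^ j / sqrt (fact j * pochhammer \<alpha> j)"

lemma lag_on_measurable [measurable]: "lag_on \<alpha> j \<in> borel_measurable borel"
  unfolding lag_on_def[abs_def] by measurable

lemma lag_coef_measurable [measurable]: "lag_coef \<alpha> j \<in> borel_measurable borel"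
  unfolding lag_coef_def[abs_def] by measurable

lemma lag_on_0: "lag_on \<alpha> 0 x = 1"
  by (simp add: lag_on_def laguerre_def)

lemma lag_coef_0: "lag_coef \<alpha> 0 t = exp (- t / \<alpha>)"
  by (simp add: lag_coef_def)

lemma ex_poly_lag_on: "\<exists>p. \<forall>x. lag_on \<alpha> j x = poly p x"
  using ex_poly_laguerre[of \<alpha> j] unfolding lag_on_def by (metis poly_smult)

lemma ex_poly_lag_on_sum: "\<exists>p. \<forall>x. (\<Sum>j<m. \<theta> j * lag_on \<alpha> (k + j) x) = poly p x"
proof -
  obtain q where q: "\<And>j x. lag_on \<alpha> j x = poly (q j) x"
    using ex_poly_lag_on by metis
  show ?thesis
    by (intro exI[of _ "\<Sum>j<m. smult (\<theta> j) (q (k + j))"]) (simp add: q poly_sum)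
qed

context
  fixes \<alpha> :: real
  assumes \<alpha>2: "\<alpha> \<ge> 1 / 2"
begin

lemma integrable_lag_on_mult: "integrable (gamma_distr \<alpha>) (\<lambda>x. lag_on \<alpha> i x * lag_on \<alpha> j x)"
proof -
  have "integrable (gamma_distr \<alpha>) (\<lambda>x. (sqrt (pochhammer \<alpha> i / fact i) * sqrt (pochhammer \<alpha> j / fact j)) *
      (laguerre \<alpha> i x * laguerre \<alpha> j x))"
    by (intro integrable_mult_right integrable_laguerre_mult alpha_pos[OF \<alpha>2])
  then show ?thesis by (simp add: lag_on_def mult_ac)
qed

lemma integral_lag_on_mult:
  "(\<integral>x. lag_on \<alpha> i x * lag_on \<alpha> j x \<partial>gamma_distr \<alpha>) = (if i = j then 1 else 0)"
proof -
  have eq: "lag_on \<alpha> i x * lag_on \<alpha> j x = (sqrt (pochhammer \<alpha> i / fact i) * sqrt (pochhammer \<alpha> j / fact j)) *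
      (laguerre \<alpha> i x * laguerre \<alpha> j x)" for x
    by (simp add: lag_on_def mult_ac)
  show ?thesis
    unfolding eq using pochhammer_pos[OF alpha_pos[OF \<alpha>2], of j]
    by (simp add: integral_laguerre_mult[OF alpha_pos[OF \<alpha>2]] real_sqrt_divide real_sqrt_mult[symmetric])
qed

lemma integrable_lag_on: "integrable (gamma_distr \<alpha>) (lag_on \<alpha> j)"
  using integrable_lag_on_mult[of 0 j] by (simp add: lag_on_0)

lemma integral_lag_on: "j > 0 \<Longrightarrow> (\<integral>x. lag_on \<alpha> j x \<partial>gamma_distr \<alpha>) = 0"
  using integral_lag_on_mult[of 0 j] by (simp add: lag_on_0)

text \<open>The reason why the centered kernel has no Laguerre term of index 1: the linear term that the
estimation of the scale contributes is the opposite of that term.\<close>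

lemma lag_coef_lag_on_1: "lag_coef \<alpha> 1 t * lag_on \<alpha> 1 x = - ((x - \<alpha>) / \<alpha>\<^sup>2 * t * exp (- t / \<alpha>))"
proof -
  have a: "\<alpha> > 0" by (rule alpha_pos[OF \<alpha>2])
  have "lag_coef \<alpha> 1 t * lag_on \<alpha> 1 x = exp (- t / \<alpha>) * (t / \<alpha>) * (1 - x / \<alpha>)"
    using a by (simp add: lag_coef_def lag_on_def laguerre_def)
  also have "\<dots> = - ((x - \<alpha>) / \<alpha>\<^sup>2 * t * exp (- t / \<alpha>))"
    using a by (simp add: field_simps power2_eq_square)
  finally show ?thesis .
qed

lemma lag_coef_nonneg: "t \<ge> 0 \<Longrightarrow> lag_coef \<alpha> j t \<ge> 0"
  using alpha_pos[OF \<alpha>2] pochhammer_pos[OF alpha_pos[OF \<alpha>2], of j] by (simp add: lag_coef_def)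

lemma lag_coef_mult_sums:
  "(\<lambda>j. lag_coef \<alpha> j s * lag_coef \<alpha> j t) sums (exp (- (s + t) / \<alpha>) * hyp01 \<alpha> (s * t / \<alpha>\<^sup>2))"
proof -
  have a: "\<alpha> > 0" by (rule alpha_pos[OF \<alpha>2])
  have "(\<lambda>j. (s * t / \<alpha>\<^sup>2) ^ j / (fact j * pochhammer \<alpha> j)) sums hyp01 \<alpha> (s * t / \<alpha>\<^sup>2)"
    using summable_hyp01[OF a] by (simp add: hyp01_def summable_sums)
  from sums_mult[OF this, of "exp (- (s + t) / \<alpha>)"] show ?thesis
  proof (rule back_subst[of "\<lambda>f. f sums _"])
    show "(\<lambda>n. exp (- (s + t) / \<alpha>) * ((s * t / \<alpha>\<^sup>2) ^ n / (fact n * pochhammer \<alpha> n))) =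
       (\<lambda>j. lag_coef \<alpha> j s * lag_coef \<alpha> j t)"
    proof
      fix n
      define d where "d = fact n * pochhammer \<alpha> n"
      have d: "d > 0" using pochhammer_pos[OF a, of n] by (simp add: d_def)
      have "exp (- (s + t) / \<alpha>) = exp (- s / \<alpha>) * exp (- t / \<alpha>)"
        by (simp add: exp_add[symmetric] add_divide_distrib diff_divide_distrib)
      moreover have "(s * t / \<alpha>\<^sup>2) ^ n = (s / \<alpha>) ^ n * (t / \<alpha>) ^ n"
        by (simp add: power_mult_distrib[symmetric] power2_eq_square)
      moreover have "d = sqrt d * sqrt d" using d by simp
      ultimately show "exp (- (s + t) / \<alpha>) * ((s * t / \<alpha>\<^sup>2) ^ n / (fact n * pochhammer \<alpha> n)) =
         lag_coef \<alpha> n s * lag_coef \<alpha> n t"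
        unfolding lag_coef_def d_def[symmetric]
        by (metis (no_types, lifting) mult.assoc mult.left_commute times_divide_eq_left times_divide_eq_right times_divide_times_eq)
    qed
  qed
qed

lemma hyp01_neg_bounded_AE:
  assumes t: "t \<ge> 0" shows "AE x in gamma_distr \<alpha>. \<bar>hyp01 \<alpha> (- (t * x / \<alpha>))\<bar> \<le> 1"
  using AE_gamma_distr_pos[of \<alpha>]
  by (rule eventually_mono) (use t alpha_pos[OF \<alpha>2] in \<open>auto intro!: abs_hyp01_neg_le_1 \<alpha>2\<close>)

lemma integrable_hyp01_neg_square:
  assumes t: "t \<ge> 0" shows "integrable (gamma_distr \<alpha>) (\<lambda>x. (hyp01 \<alpha> (- (t * x / \<alpha>)))\<^sup>2)"
proof -
  interpret prob_space "gamma_distr \<alpha>" by (rule prob_space_gamma_distr[OF alpha_pos[OF \<alpha>2]])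
  show ?thesis
    by (rule integrable_const_bound[of _ 1])
       (use hyp01_neg_bounded_AE[OF t] in \<open>auto simp: abs_square_le_1 elim!: eventually_mono\<close>)
qed

text \<open>With a Laguerre polynomial as the weight, orthogonality leaves a single term of the integrated
generating function.\<close>

lemma integral_hyp01_lag_on:
  assumes t: "t \<ge> 0"
  shows "(\<integral>x. hyp01 \<alpha> (- (t * x / \<alpha>)) * lag_on \<alpha> j x \<partial>gamma_distr \<alpha>) = lag_coef \<alpha> j t"
proof -
  have a: "\<alpha> > 0" by (rule alpha_pos[OF \<alpha>2])
  define s where "s = t / \<alpha>"
  have s: "s \<ge> 0" using t a by (simp add: s_def)
  have L2: "integrable (gamma_distr \<alpha>) (\<lambda>x. (laguerre \<alpha> j x)\<^sup>2)"
    using integrable_laguerre_mult[OF a, of j j] by (simp add: power2_eq_square)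
  have p: "pochhammer \<alpha> j > 0" by (rule pochhammer_pos[OF a])
  have 1: "(\<lambda>k. s ^ k / fact k * (\<integral>x. laguerre \<alpha> k x * laguerre \<alpha> j x \<partial>gamma_distr \<alpha>)) sums
    (exp s * (\<integral>x. hyp01 \<alpha> (- (s * x)) * laguerre \<alpha> j x \<partial>gamma_distr \<alpha>))"
    by (rule integral_hyp01_mult[OF \<alpha>2 s _ L2]) simp
  have "(\<lambda>k. s ^ k / fact k * (\<integral>x. laguerre \<alpha> k x * laguerre \<alpha> j x \<partial>gamma_distr \<alpha>)) sums
    (\<Sum>k\<in>{j}. s ^ k / fact k * (\<integral>x. laguerre \<alpha> k x * laguerre \<alpha> j x \<partial>gamma_distr \<alpha>))"
    by (rule sums_finite) (auto simp: integral_laguerre_mult[OF a])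
  then have "exp s * (\<integral>x. hyp01 \<alpha> (- (s * x)) * laguerre \<alpha> j x \<partial>gamma_distr \<alpha>) = s ^ j / pochhammer \<alpha> j"
    using sums_unique2[OF 1] by (simp add: integral_laguerre_mult[OF a])
  then have "exp (- s) * exp s * (\<integral>x. hyp01 \<alpha> (- (s * x)) * laguerre \<alpha> j x \<partial>gamma_distr \<alpha>) = exp (- s) * (s ^ j / pochhammer \<alpha> j)"
    by (simp only: mult.assoc)
  then have "(\<integral>x. hyp01 \<alpha> (- (s * x)) * laguerre \<alpha> j x \<partial>gamma_distr \<alpha>) = exp (- s) * s ^ j / pochhammer \<alpha> j"
    by (simp add: exp_add[symmetric])
  then have "(\<integral>x. hyp01 \<alpha> (- (s * x)) * lag_on \<alpha> j x \<partial>gamma_distr \<alpha>) =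
     sqrt (pochhammer \<alpha> j / fact j) * (exp (- s) * s ^ j / pochhammer \<alpha> j)"
    by (simp add: lag_on_def mult.left_commute[of "hyp01 _ _"])
  also have "\<dots> = exp (- s) * s ^ j / sqrt (fact j * pochhammer \<alpha> j)"
  proof -
    have "sqrt (pochhammer \<alpha> j / fact j) / pochhammer \<alpha> j = 1 / sqrt (fact j * pochhammer \<alpha> j)"
      using p by (simp add: real_sqrt_divide real_sqrt_mult divide_simps)
    then have "exp (- s) * s ^ j * (sqrt (pochhammer \<alpha> j / fact j) / pochhammer \<alpha> j) =
        exp (- s) * s ^ j * (1 / sqrt (fact j * pochhammer \<alpha> j))" by (simp only:)
    then show ?thesis by (simp add: mult_ac)
  qed
  finally show ?thesis by (simp add: s_def lag_coef_def)
qed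

text \<open>Parseval's identity for two kernels: the generating function of the first is integrated against
the second, whose Laguerre coefficients are known by now.\<close>

lemma integral_hyp01_mult_hyp01:
  assumes s: "s \<ge> 0" and t: "t \<ge> 0"
  shows "(\<integral>x. hyp01 \<alpha> (- (s * x / \<alpha>)) * hyp01 \<alpha> (- (t * x / \<alpha>)) \<partial>gamma_distr \<alpha>) =
    exp (- (s + t) / \<alpha>) * hyp01 \<alpha> (s * t / \<alpha>\<^sup>2)"
proof -
  have a: "\<alpha> > 0" by (rule alpha_pos[OF \<alpha>2])
  define u where "u = s / \<alpha>"
  have u: "u \<ge> 0" using s a by (simp add: u_def)
  define w where "w x = hyp01 \<alpha> (- (t * x / \<alpha>))" for x
  have w[measurable]: "w \<in> borel_measurable borel" unfolding w_def[abs_def] by measurable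
  have 1: "(\<lambda>k. u ^ k / fact k * (\<integral>x. laguerre \<alpha> k x * w x \<partial>gamma_distr \<alpha>)) sums
    (exp u * (\<integral>x. hyp01 \<alpha> (- (u * x)) * w x \<partial>gamma_distr \<alpha>))"
    by (rule integral_hyp01_mult[OF \<alpha>2 u w]) (simp add: w_def integrable_hyp01_neg_square t)
  have 2: "u ^ k / fact k * (\<integral>x. laguerre \<alpha> k x * w x \<partial>gamma_distr \<alpha>) = exp u * (lag_coef \<alpha> k s * lag_coef \<alpha> k t)" for k
  proof -
    have p: "pochhammer \<alpha> k > 0" by (rule pochhammer_pos[OF a])
    have "lag_coef \<alpha> k t = sqrt (pochhammer \<alpha> k / fact k) * (\<integral>x. laguerre \<alpha> k x * w x \<partial>gamma_distr \<alpha>)"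
      unfolding integral_hyp01_lag_on[OF t, symmetric] w_def lag_on_def
      by (simp add: mult.left_commute[of "hyp01 _ _"] mult.commute[of "hyp01 _ _"] del: integral_mult_right_zero)
         (simp add: mult.assoc)
    moreover have "lag_coef \<alpha> k s * sqrt (pochhammer \<alpha> k / fact k) = exp (- u) * u ^ k / fact k"
      using p by (simp add: lag_coef_def u_def real_sqrt_divide real_sqrt_mult)
    ultimately have "lag_coef \<alpha> k s * lag_coef \<alpha> k t = exp (- u) * u ^ k / fact k * (\<integral>x. laguerre \<alpha> k x * w x \<partial>gamma_distr \<alpha>)"
      by (simp add: mult.assoc[symmetric])
    then show ?thesis by (simp add: exp_minus)
  qed
  have "(\<lambda>k. exp u * (lag_coef \<alpha> k s * lag_coef \<alpha> k t)) sums (exp u * (exp (- (s + t) / \<alpha>) * hyp01 \<alpha> (s * t / \<alpha>\<^sup>2)))"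
    by (intro sums_mult lag_coef_mult_sums)
  from sums_unique2[OF 1[unfolded 2] this] show ?thesis
    by (simp add: w_def u_def)
qed

lemma lag_coef_square_sums:
  "(\<lambda>j. (lag_coef \<alpha> j t)\<^sup>2) sums (exp (- (t + t) / \<alpha>) * hyp01 \<alpha> (t * t / \<alpha>\<^sup>2))"
  using lag_coef_mult_sums[of t t] by (simp add: power2_eq_square)

lemma summable_lag_coef_square: "summable (\<lambda>j. (lag_coef \<alpha> j t)\<^sup>2)"
  using lag_coef_square_sums by (rule sums_summable)

lemma suminf_lag_coef_square_le_1:
  assumes t: "t \<ge> 0" shows "(\<Sum>j. (lag_coef \<alpha> j t)\<^sup>2) \<le> 1"
proof -
  interpret prob_space "gamma_distr \<alpha>" by (rule prob_space_gamma_distr[OF alpha_pos[OF \<alpha>2]])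
  have "(\<Sum>j. (lag_coef \<alpha> j t)\<^sup>2) = (\<integral>x. (hyp01 \<alpha> (- (t * x / \<alpha>)))\<^sup>2 \<partial>gamma_distr \<alpha>)"
    using integral_hyp01_mult_hyp01[OF t t] lag_coef_square_sums[of t] by (simp add: sums_iff power2_eq_square)
  also have "\<dots> \<le> (\<integral>x. 1 \<partial>gamma_distr \<alpha>)"
    by (intro integral_mono_AE integrable_hyp01_neg_square t)
       (use hyp01_neg_bounded_AE[OF t] in \<open>auto simp: abs_square_le_1 elim!: eventually_mono\<close>)
  finally show ?thesis using prob_space by simp
qed

lemma lag_coef_le_1:
  assumes t: "t \<ge> 0" shows "lag_coef \<alpha> j t \<le> 1"
proof -
  have "(\<Sum>i\<in>{j}. (lag_coef \<alpha> i t)\<^sup>2) \<le> (\<Sum>j. (lag_coef \<alpha> j t)\<^sup>2)"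
    by (rule sum_le_suminf[OF summable_lag_coef_square]) auto
  then have "(lag_coef \<alpha> j t)\<^sup>2 \<le> 1" using suminf_lag_coef_square_le_1[OF t] by simp
  then have "\<bar>lag_coef \<alpha> j t\<bar> \<le> 1" by (simp only: abs_square_le_1)
  then show ?thesis by simp
qed

text \<open>Absolute summability makes the Gaussian series with these coefficients converge almost surely.\<close>

lemma summable_lag_coef: "summable (\<lambda>j. \<bar>lag_coef \<alpha> j t\<bar>)"
proof (rule summable_comparison_test)
  have a: "\<alpha> > 0" by (rule alpha_pos[OF \<alpha>2])
  define y where "y = 4 * (t / \<alpha>)\<^sup>2"
  show "summable (\<lambda>j. exp (- t / \<alpha>) * ((1 / 4) ^ j + y ^ j / (fact j * pochhammer \<alpha> j)))"
    by (intro summable_mult summable_add summable_hyp01 a summable_geometric) simp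
  have "\<bar>lag_coef \<alpha> j t\<bar> \<le> exp (- t / \<alpha>) * ((1 / 4) ^ j + y ^ j / (fact j * pochhammer \<alpha> j))" for j
  proof -
    define d where "d = fact j * pochhammer \<alpha> j"
    have d: "d > 0" using pochhammer_pos[OF a, of j] by (simp add: d_def)
    \<comment> \<open>The factors \<open>2\<^bsup>-j\<^esup>\<close> and \<open>2\<^bsup>j\<^esup>\<close> are inserted so that both squares in \<open>u v \<le> u\<^sup>2 + v\<^sup>2\<close> are summable.\<close>
    define u v where "u = (1 / 2 :: real) ^ j" and "v = (2 * \<bar>t / \<alpha>\<bar>) ^ j / sqrt d"
    have "u\<^sup>2 = (1 / 4) ^ j"
      unfolding u_def power2_eq_square power_mult_distrib[symmetric] by simp
    moreover have "v\<^sup>2 = y ^ j / d"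
    proof -
      have "((2 * \<bar>t / \<alpha>\<bar>) ^ j)\<^sup>2 = ((2 * \<bar>t / \<alpha>\<bar>)\<^sup>2) ^ j"
        by (simp only: power_mult[symmetric] mult.commute)
      also have "(2 * \<bar>t / \<alpha>\<bar>)\<^sup>2 = y" unfolding y_def power_mult_distrib power2_abs by simp
      finally have "((2 * \<bar>t / \<alpha>\<bar>) ^ j)\<^sup>2 = y ^ j" .
      then show ?thesis unfolding v_def power_divide[of _ "sqrt d"] using d by simp
    qed
    moreover have "\<bar>lag_coef \<alpha> j t\<bar> = exp (- t / \<alpha>) * (u * v)"
      using d by (simp add: lag_coef_def u_def v_def d_def[symmetric] abs_mult power_abs power_mult_distrib power_divide)
    moreover have "u * v \<le> u\<^sup>2 + v\<^sup>2"
      using mult_abs_le_sum_squares[of u v] by simp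
    ultimately show ?thesis by (simp add: d_def)
  qed
  then show "\<exists>N. \<forall>n\<ge>N. norm \<bar>lag_coef \<alpha> n t\<bar> \<le> exp (- t / \<alpha>) * ((1 / 4) ^ n + y ^ n / (fact n * pochhammer \<alpha> n))"
    by auto
qed

end

section \<open>Square-integrable functions\<close>

lemma L2_fun_measurable: "f \<in> L2_fun P \<Longrightarrow> f \<in> borel_measurable P"
  and L2_fun_integrable: "f \<in> L2_fun P \<Longrightarrow> integrable P (\<lambda>x. (f x)\<^sup>2)"
  by (auto simp: L2_fun_def)

lemma integrable_L2_mult:
  assumes "f \<in> L2_fun P" "g \<in> L2_fun P"
  shows "integrable P (\<lambda>x. f x * g x)"
proof (rule Bochner_Integration.integrable_bound)
  show "integrable P (\<lambda>x. (f x)\<^sup>2 + (g x)\<^sup>2)" using assms by (auto simp: L2_fun_def)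
  show "(\<lambda>x. f x * g x) \<in> borel_measurable P" using assms by (auto simp: L2_fun_def)
  show "AE x in P. norm (f x * g x) \<le> norm ((f x)\<^sup>2 + (g x)\<^sup>2)"
    using mult_abs_le_sum_squares by (intro AE_I2) auto
qed

lemma L2_fun_add: "f \<in> L2_fun P \<Longrightarrow> g \<in> L2_fun P \<Longrightarrow> (\<lambda>x. f x + g x) \<in> L2_fun P"
  using integrable_L2_mult[of f P g]
  by (auto simp: L2_fun_def power2_sum mult.assoc)

lemma L2_fun_cmult: "f \<in> L2_fun P \<Longrightarrow> (\<lambda>x. c * f x) \<in> L2_fun P"
  by (auto simp: L2_fun_def power_mult_distrib)

lemma L2_fun_diff: "f \<in> L2_fun P \<Longrightarrow> g \<in> L2_fun P \<Longrightarrow> (\<lambda>x. f x - g x) \<in> L2_fun P"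
  using L2_fun_add[OF _ L2_fun_cmult[of g P "- 1"], of f] by simp

lemma L2_fun_zero: "(\<lambda>x. 0) \<in> L2_fun P"
  by (auto simp: L2_fun_def)

lemma L2_fun_sum: "(\<And>i. i \<in> I \<Longrightarrow> f i \<in> L2_fun P) \<Longrightarrow> (\<lambda>x. \<Sum>i\<in>I. f i x) \<in> L2_fun P"
  by (induction I rule: infinite_finite_induct) (auto intro: L2_fun_add L2_fun_zero)

lemma Cauchy_Schwarz_L2:
  assumes f: "f \<in> L2_fun P" and g: "g \<in> L2_fun P"
  shows "(\<integral>x. f x * g x \<partial>P)\<^sup>2 \<le> (\<integral>x. (f x)\<^sup>2 \<partial>P) * (\<integral>x. (g x)\<^sup>2 \<partial>P)"
proof -
  define A B C where "A = (\<integral>x. (f x)\<^sup>2 \<partial>P)" and "B = (\<integral>x. f x * g x \<partial>P)" and "C = (\<integral>x. (g x)\<^sup>2 \<partial>P)"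
  have q: "0 \<le> A - 2 * l * B + l\<^sup>2 * C" for l
  proof -
    have "0 \<le> (\<integral>x. (f x - l * g x)\<^sup>2 \<partial>P)" by simp
    also have "(\<integral>x. (f x - l * g x)\<^sup>2 \<partial>P) = (\<integral>x. (f x)\<^sup>2 - 2 * l * (f x * g x) + l\<^sup>2 * (g x)\<^sup>2 \<partial>P)"
      by (intro Bochner_Integration.integral_cong) (auto simp: power2_eq_square algebra_simps)
    also have "\<dots> = A - 2 * l * B + l\<^sup>2 * C"
      using L2_fun_integrable[OF f] L2_fun_integrable[OF g] integrable_L2_mult[OF f g]
      by (simp add: A_def B_def C_def)
    finally show ?thesis .
  qed
  have "C \<ge> 0" by (simp add: C_def)
  show ?thesis
  proof (cases "C = 0")
    case True
    have "B = 0"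
    proof (rule ccontr)
      assume "B \<noteq> 0"
      then show False using q[of "(A + 1) / (2 * B)"] True by simp
    qed
    then show ?thesis by (simp add: A_def[symmetric] B_def[symmetric] C_def[symmetric] True)
  next
    case False
    then have C: "C > 0" using \<open>C \<ge> 0\<close> by simp
    have "0 \<le> A - B\<^sup>2 / C"
      using q[of "B / C"] C by (simp add: power2_eq_square field_simps)
    then show ?thesis using C
      by (simp add: A_def[symmetric] B_def[symmetric] C_def[symmetric] field_simps)
  qed
qed

lemma L2_dist_nonneg: "L2_dist P f g \<ge> 0"
  by (simp add: L2_dist_def)

lemma L2_dist_self: "L2_dist P f f = 0"
  by (simp add: L2_dist_def)

lemma L2_dist_commute: "L2_dist P f g = L2_dist P g f"
  by (simp add: L2_dist_def power2_commute)

lemma L2_dist_triangle: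
  assumes "f \<in> L2_fun P" "g \<in> L2_fun P" "k \<in> L2_fun P"
  shows "L2_dist P f k \<le> L2_dist P f g + L2_dist P g k"
proof -
  define u v where "u x = f x - g x" and "v x = g x - k x" for x
  have u: "u \<in> L2_fun P" and v: "v \<in> L2_fun P"
    unfolding u_def[abs_def] v_def[abs_def] using assms by (auto intro: L2_fun_diff)
  define A B C where "A = (\<integral>x. (u x)\<^sup>2 \<partial>P)" and "B = (\<integral>x. u x * v x \<partial>P)" and "C = (\<integral>x. (v x)\<^sup>2 \<partial>P)"
  have nn: "A \<ge> 0" "C \<ge> 0" by (simp_all add: A_def C_def)
  have "B \<le> sqrt (B\<^sup>2)" by simp
  also have "\<dots> \<le> sqrt (A * C)"
    using Cauchy_Schwarz_L2[OF u v] by (simp only: A_def B_def C_def real_sqrt_le_iff)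
  finally have B: "B \<le> sqrt A * sqrt C" by (simp add: real_sqrt_mult)
  have "(\<integral>x. (f x - k x)\<^sup>2 \<partial>P) = (\<integral>x. (u x)\<^sup>2 + 2 * (u x * v x) + (v x)\<^sup>2 \<partial>P)"
    by (intro Bochner_Integration.integral_cong) (auto simp: u_def v_def power2_eq_square algebra_simps)
  also have "\<dots> = A + 2 * B + C"
    using L2_fun_integrable[OF u] L2_fun_integrable[OF v] integrable_L2_mult[OF u v]
    by (simp add: A_def B_def C_def)
  also have "\<dots> \<le> (sqrt A + sqrt C)\<^sup>2"
    using B nn by (simp add: power2_sum)
  finally show ?thesis
    unfolding L2_dist_def A_def[symmetric] C_def[symmetric] u_def[symmetric] v_def[symmetric]
    using nn by (intro real_le_lsqrt) auto
qed

lemma L2_continuous_mapD: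
  assumes F: "continuous_map (L2_topology P) euclideanreal F" and f: "f \<in> L2_fun P" and e: "e > 0"
  obtains d where "d > 0" "\<And>g. g \<in> L2_fun P \<Longrightarrow> L2_dist P f g < d \<Longrightarrow> \<bar>F g - F f\<bar> < e"
proof -
  have "openin (L2_topology P) {x \<in> topspace (L2_topology P). F x \<in> ball (F f) e}"
    using F by (rule openin_continuous_map_preimage) auto
  then have "L2_open P {x \<in> L2_fun P. F x \<in> ball (F f) e}"
    by (simp only: openin_L2_topology topspace_L2_topology)
  then obtain d where "d > 0" "\<forall>g\<in>L2_fun P. L2_dist P f g < d \<longrightarrow> F g \<in> ball (F f) e"
    using f e unfolding L2_open_def by force
  then show ?thesis by (intro that[of d]) (auto simp: dist_real_def abs_minus_commute)
qed

lemma L2_continuous_mapI: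
  assumes "\<And>f e. f \<in> L2_fun P \<Longrightarrow> e > 0 \<Longrightarrow>
    \<exists>d>0. \<forall>g\<in>L2_fun P. L2_dist P f g < d \<longrightarrow> \<bar>F g - F f\<bar> < e"
  shows "continuous_map (L2_topology P) euclideanreal F"
  unfolding continuous_map openin_L2_topology topspace_L2_topology
proof (intro conjI allI impI)
  fix U :: "real set" assume "openin euclidean U"
  then have U: "open U" by simp
  show "L2_open P {f \<in> L2_fun P. F f \<in> U}"
    unfolding L2_open_def
  proof (intro conjI ballI)
    fix f assume f: "f \<in> {f \<in> L2_fun P. F f \<in> U}"
    then obtain e where e: "e > 0" "\<And>y. \<bar>y - F f\<bar> < e \<Longrightarrow> y \<in> U"
      using U unfolding open_real by blast
    show "\<exists>d>0. \<forall>g\<in>L2_fun P. L2_dist P f g < d \<longrightarrow> g \<in> {f \<in> L2_fun P. F f \<in> U}"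
      using assms[of f e] f e by force
  qed auto
qed auto

lemma L2_lipschitz_continuous_map:
  assumes "\<And>f g. f \<in> L2_fun P \<Longrightarrow> g \<in> L2_fun P \<Longrightarrow> \<bar>F f - F g\<bar> \<le> L * L2_dist P f g" and L: "L \<ge> 0"
  shows "continuous_map (L2_topology P) euclideanreal F"
proof (rule L2_continuous_mapI)
  fix f and e :: real assume f: "f \<in> L2_fun P" and e: "e > 0"
  show "\<exists>d>0. \<forall>g\<in>L2_fun P. L2_dist P f g < d \<longrightarrow> \<bar>F g - F f\<bar> < e"
  proof (intro exI[of _ "e / (L + 1)"] conjI ballI impI)
    show "e / (L + 1) > 0" using e L by simp
    fix g assume g: "g \<in> L2_fun P" and d: "L2_dist P f g < e / (L + 1)"
    have "\<bar>F g - F f\<bar> \<le> L * L2_dist P f g" using assms(1)[OF f g] by (simp add: abs_minus_commute)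
    also have "\<dots> \<le> L * (e / (L + 1))" using d L by (intro mult_left_mono) auto
    also have "\<dots> < e" using e L by (simp add: field_simps)
    finally show "\<bar>F g - F f\<bar> < e" .
  qed
qed

lemma space_borel_of_L2: "space (borel_of_topology (L2_topology P)) = L2_fun P"
  unfolding borel_of_topology_def topspace_L2_topology openin_L2_topology
  by (rule space_measure_of) (auto simp: L2_open_def)

lemma sets_borel_of_L2: "sets (borel_of_topology (L2_topology P)) = sigma_sets (L2_fun P) {U. L2_open P U}"
  unfolding borel_of_topology_def topspace_L2_topology openin_L2_topology
  by (rule sets_measure_of) (auto simp: L2_open_def)

lemma continuous_map_L2_measurable:
  assumes "continuous_map (L2_topology P) euclideanreal F"
  shows "F \<in> borel_measurable (borel_of_topology (L2_topology P))"
proof (rule borel_measurableI)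
  fix S :: "real set" assume "open S"
  then have "openin (L2_topology P) {x \<in> topspace (L2_topology P). F x \<in> S}"
    using assms by (intro openin_continuous_map_preimage) auto
  then show "F -` S \<inter> space (borel_of_topology (L2_topology P)) \<in> sets (borel_of_topology (L2_topology P))"
    unfolding openin_L2_topology topspace_L2_topology space_borel_of_L2 sets_borel_of_L2
    by (intro sigma_sets.Basic) (auto simp: vimage_def Int_def conj_commute)
qed

text \<open>The preimage of an open set is a countable union of preimages of balls: those with center in the
countable family and rational radius that lie inside the open set. They cover all values of \<open>X\<close> in that set because
the family comes arbitrarily close to each of them.\<close>

lemma measurable_L2I:
  fixes D :: "'d set" and v :: "'d \<Rightarrow> 'b \<Rightarrow> real"
  assumes D: "countable D" "\<And>d. d \<in> D \<Longrightarrow> v d \<in> L2_fun P"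
    and X: "\<And>\<omega>. \<omega> \<in> space M \<Longrightarrow> X \<omega> \<in> L2_fun P"
    and meas: "\<And>d. d \<in> D \<Longrightarrow> (\<lambda>\<omega>. L2_dist P (X \<omega>) (v d)) \<in> borel_measurable M"
    and dense: "\<And>\<omega> e. \<omega> \<in> space M \<Longrightarrow> e > 0 \<Longrightarrow> \<exists>d\<in>D. L2_dist P (X \<omega>) (v d) < e"
  shows "X \<in> measurable M (borel_of_topology (L2_topology P))"
  unfolding borel_of_topology_def topspace_L2_topology openin_L2_topology
proof (rule measurable_measure_of)
  show "{U. L2_open P U} \<subseteq> Pow (L2_fun P)" by (auto simp: L2_open_def)
  show "X \<in> space M \<rightarrow> L2_fun P" using X by auto
  fix U assume "U \<in> {U. L2_open P U}"
  then have U: "L2_open P U" by simp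
  define J where "J = {(d, q). d \<in> D \<and> q \<in> \<rat> \<and> {g \<in> L2_fun P. L2_dist P g (v d) < q} \<subseteq> U}"
  have "J \<subseteq> D \<times> \<rat>" by (auto simp: J_def)
  then have cJ: "countable J"
    using D(1) countable_rat by (meson countable_SIGMA countable_subset)
  have "X -` U \<inter> space M = (\<Union>(d, q)\<in>J. {\<omega> \<in> space M. L2_dist P (X \<omega>) (v d) < q})"
  proof (intro equalityI subsetI)
    fix \<omega> assume "\<omega> \<in> X -` U \<inter> space M"
    then have w: "\<omega> \<in> space M" "X \<omega> \<in> U" by auto
    then obtain e where e: "e > 0" "\<And>g. g \<in> L2_fun P \<Longrightarrow> L2_dist P (X \<omega>) g < e \<Longrightarrow> g \<in> U"
      using U unfolding L2_open_def by blast
    obtain d where d: "d \<in> D" "L2_dist P (X \<omega>) (v d) < e / 2"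
      using dense[OF w(1), of "e / 2"] e by auto
    obtain q where q: "q \<in> \<rat>" "L2_dist P (X \<omega>) (v d) < q" "q < e / 2"
      using Rats_dense_in_real[OF d(2)] by auto
    have "{g \<in> L2_fun P. L2_dist P g (v d) < q} \<subseteq> U"
    proof
      fix g assume g: "g \<in> {g \<in> L2_fun P. L2_dist P g (v d) < q}"
      have "L2_dist P (X \<omega>) g \<le> L2_dist P (X \<omega>) (v d) + L2_dist P (v d) g"
        using L2_dist_triangle[OF X[OF w(1)] D(2)[OF d(1)], of g] g by simp
      also have "\<dots> < e" using d g q by (simp add: L2_dist_commute)
      finally show "g \<in> U" using e g by simp
    qed
    then have "(d, q) \<in> J" using d q by (simp add: J_def)
    then show "\<omega> \<in> (\<Union>(d, q)\<in>J. {\<omega> \<in> space M. L2_dist P (X \<omega>) (v d) < q})"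
      using q w by auto
  qed (use X in \<open>auto simp: J_def\<close>)
  also have "\<dots> \<in> sets M"
  proof (rule sets.countable_UN''[OF cJ])
    fix x assume x: "x \<in> J"
    obtain d q where dq: "x = (d, q)" by (cases x)
    then have [measurable]: "(\<lambda>\<omega>. L2_dist P (X \<omega>) (v d)) \<in> borel_measurable M"
      using meas x by (auto simp: J_def)
    show "(case x of (d, q) \<Rightarrow> {\<omega> \<in> space M. L2_dist P (X \<omega>) (v d) < q}) \<in> sets M"
      unfolding dq by simp
  qed
  finally show "X -` U \<inter> space M \<in> sets M" .
qed

section \<open>Convergence in distribution tested on Lipschitz functionals\<close>

text \<open>The Pasch--Hausdorff regularization: if \<open>F\<close> is bounded below and \<open>k \<ge> 0\<close>, this is the largest
\<open>k\<close>-Lipschitz function below \<open>F\<close>.\<close>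

definition inf_conv :: "'a measure \<Rightarrow> (('a \<Rightarrow> real) \<Rightarrow> real) \<Rightarrow> real \<Rightarrow> ('a \<Rightarrow> real) \<Rightarrow> real" where
  "inf_conv P F k f = (INF g\<in>L2_fun P. F g + k * L2_dist P f g)"

lemma inf_conv_props:
  assumes B: "\<And>f. f \<in> L2_fun P \<Longrightarrow> \<bar>F f\<bar> \<le> B" and k: "k \<ge> 0" and f: "f \<in> L2_fun P"
  shows "inf_conv P F k f \<le> F f" "inf_conv P F k f \<ge> - B"
    "\<And>g. g \<in> L2_fun P \<Longrightarrow> inf_conv P F k f \<le> inf_conv P F k g + k * L2_dist P f g"
proof -
  have low: "- B \<le> F g + k * L2_dist P f' g" if "g \<in> L2_fun P" for f' g
  proof -
    have "- B \<le> F g" using B[OF that] by simp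
    moreover have "0 \<le> k * L2_dist P f' g" using k by (simp add: L2_dist_nonneg)
    ultimately show ?thesis by simp
  qed
  have bdd: "bdd_below ((\<lambda>g. F g + k * L2_dist P f' g) ` L2_fun P)" for f'
    using low by (intro bdd_belowI2[where m = "- B"]) auto
  have ne: "L2_fun P \<noteq> {}" using f by auto
  show "inf_conv P F k f \<le> F f"
    unfolding inf_conv_def using cINF_lower[OF bdd f, of f] by (simp add: L2_dist_self)
  show "inf_conv P F k f \<ge> - B"
    unfolding inf_conv_def using low by (intro cINF_greatest[OF ne]) auto
  fix g assume g: "g \<in> L2_fun P"
  have "inf_conv P F k f - k * L2_dist P f g \<le> F u + k * L2_dist P g u" if u: "u \<in> L2_fun P" for u
  proof -
    have "inf_conv P F k f \<le> F u + k * L2_dist P f u"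
      unfolding inf_conv_def by (rule cINF_lower[OF bdd u])
    also have "\<dots> \<le> F u + k * (L2_dist P f g + L2_dist P g u)"
      using L2_dist_triangle[OF f g u] k by (intro add_left_mono mult_left_mono) auto
    finally show ?thesis by (simp add: algebra_simps)
  qed
  then have "inf_conv P F k f - k * L2_dist P f g \<le> inf_conv P F k g"
    unfolding inf_conv_def[of P F k g] by (intro cINF_greatest[OF ne]) auto
  then show "inf_conv P F k f \<le> inf_conv P F k g + k * L2_dist P f g" by simp
qed

text \<open>A competitor \<open>g\<close> at distance at least \<open>d\<close> pays a penalty \<open>k d\<close>, which for large \<open>k\<close> exceeds the total
oscillation \<open>2 B\<close>; at a smaller distance, continuity keeps \<open>F g\<close> close to \<open>F f\<close>.\<close>

lemma inf_conv_tendsto: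
  assumes F: "continuous_map (L2_topology P) euclideanreal F"
    and B: "\<And>f. f \<in> L2_fun P \<Longrightarrow> \<bar>F f\<bar> \<le> B" and f: "f \<in> L2_fun P"
  shows "(\<lambda>k. inf_conv P F (real k) f) \<longlonglongrightarrow> F f"
proof (rule LIMSEQ_I)
  fix e :: real assume e: "e > 0"
  obtain d where d: "d > 0" "\<And>g. g \<in> L2_fun P \<Longrightarrow> L2_dist P f g < d \<Longrightarrow> \<bar>F g - F f\<bar> < e / 2"
    using L2_continuous_mapD[OF F f, of "e / 2"] e by auto
  obtain k0 :: nat where k0: "real k0 > 2 * B / d" using reals_Archimedean2 by blast
  have "norm (inf_conv P F (real k) f - F f) < e" if k: "k \<ge> k0" for k
  proof -
    have "F f - e / 2 \<le> F g + real k * L2_dist P f g" if g: "g \<in> L2_fun P" for g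
    proof (cases "L2_dist P f g < d")
      case True
      have "0 \<le> real k * L2_dist P f g" by (simp add: L2_dist_nonneg)
      then show ?thesis using d(2)[OF g True] by (simp add: abs_if split: if_splits)
    next
      case False
      have "2 * B < real k0 * d" using k0 d by (simp add: field_simps)
      also have "\<dots> \<le> real k * L2_dist P f g" using False k d by (intro mult_mono) auto
      finally show ?thesis using B[OF f] B[OF g] e by (simp add: abs_le_iff)
    qed
    then have "F f - e / 2 \<le> inf_conv P F (real k) f"
      unfolding inf_conv_def using f by (intro cINF_greatest) auto
    moreover have "inf_conv P F (real k) f \<le> F f"
      using inf_conv_props(1)[of P F B "real k" f] B f by auto
    ultimately show ?thesis using e by simp
  qed
  then show "\<exists>k0. \<forall>k\<ge>k0. norm (inf_conv P F (real k) f - F f) < e" by blast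
qed

text \<open>The Lipschitz minorants \<open>G k\<close> of \<open>F\<close> increase to \<open>F\<close>. Now
\<open>\<integral>F(X n) \<ge> \<integral>G k (X n)\<close>, and for large \<open>n\<close> the latter is close to \<open>\<integral>G k (Y)\<close>, hence, if \<open>k\<close> is large, to \<open>\<integral>F(Y)\<close>. This lower bound,
applied to \<open>F\<close> and to \<open>-F\<close>, gives the limit.\<close>

lemma conv_in_distr_L2_lipschitzI:
  fixes X :: "nat \<Rightarrow> 'a \<Rightarrow> 'b \<Rightarrow> real"
  assumes M: "\<And>n. n \<ge> 1 \<Longrightarrow> prob_space (M n)"
    and X: "\<And>n. n \<ge> 1 \<Longrightarrow> X n \<in> measurable (M n) (borel_of_topology (L2_topology P))"
    and N: "prob_space N" and Y: "Y \<in> measurable N (borel_of_topology (L2_topology P))"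
    and lip: "\<And>F L B. L \<ge> 0 \<Longrightarrow>
       (\<And>f g. f \<in> L2_fun P \<Longrightarrow> g \<in> L2_fun P \<Longrightarrow> \<bar>F f - F g\<bar> \<le> L * L2_dist P f g) \<Longrightarrow>
       (\<And>f. f \<in> L2_fun P \<Longrightarrow> \<bar>F f\<bar> \<le> B) \<Longrightarrow>
       (\<lambda>n. \<integral>\<omega>. F (X n \<omega>) \<partial>M n) \<longlonglongrightarrow> (\<integral>\<omega>. F (Y \<omega>) \<partial>N)"
  shows "conv_in_distr (L2_topology P) M X N Y"
proof -
  have int: "integrable R (\<lambda>\<omega>. F (V \<omega>))"
    if "prob_space R" and V: "V \<in> measurable R (borel_of_topology (L2_topology P))"
      and F: "continuous_map (L2_topology P) euclideanreal F" and B: "\<And>f. f \<in> L2_fun P \<Longrightarrow> \<bar>F f\<bar> \<le> B"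
    for R :: "'z measure" and V F B
  proof -
    interpret prob_space R by fact
    have "\<And>\<omega>. \<omega> \<in> space R \<Longrightarrow> V \<omega> \<in> L2_fun P"
      using measurable_space[OF V] by (simp add: space_borel_of_L2)
    then show ?thesis
      using B measurable_compose[OF V continuous_map_L2_measurable[OF F]]
      by (intro integrable_const_bound[of _ B]) auto
  qed
  have lower: "eventually (\<lambda>n. (\<integral>\<omega>. F (X n \<omega>) \<partial>M n) > (\<integral>\<omega>. F (Y \<omega>) \<partial>N) - e) sequentially"
    if F: "continuous_map (L2_topology P) euclideanreal F" and B: "\<And>f. f \<in> L2_fun P \<Longrightarrow> \<bar>F f\<bar> \<le> B"
      and e: "e > 0" for F B e
  proof -
    define G where "G k = inf_conv P F (real k)" for k
    have GF: "G k f \<le> F f" and GB: "\<bar>G k f\<bar> \<le> B" if "f \<in> L2_fun P" for k f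
      using inf_conv_props(1,2)[of P F B "real k" f] B[OF that] that B unfolding G_def abs_le_iff by force+
    have GL: "\<bar>G k f - G k g\<bar> \<le> real k * L2_dist P f g" if "f \<in> L2_fun P" "g \<in> L2_fun P" for k f g
      using inf_conv_props(3)[of P F B "real k" f g] inf_conv_props(3)[of P F B "real k" g f] that B
      by (auto simp: G_def abs_le_iff L2_dist_commute[of P g f])
    have Gc: "continuous_map (L2_topology P) euclideanreal (G k)" for k
      using GL by (rule L2_lipschitz_continuous_map) auto
    have YL: "\<And>\<omega>. \<omega> \<in> space N \<Longrightarrow> Y \<omega> \<in> L2_fun P"
      using measurable_space[OF Y] by (simp add: space_borel_of_L2)
    have "(\<lambda>k. \<integral>\<omega>. G k (Y \<omega>) \<partial>N) \<longlonglongrightarrow> (\<integral>\<omega>. F (Y \<omega>) \<partial>N)"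
    proof (rule integral_dominated_convergence[where w = "\<lambda>_. B"])
      interpret prob_space N by fact
      show "integrable N (\<lambda>_. B)" by simp
      show "(\<lambda>\<omega>. F (Y \<omega>)) \<in> borel_measurable N" "\<And>k. (\<lambda>\<omega>. G k (Y \<omega>)) \<in> borel_measurable N"
        using int[OF N Y F B] int[OF N Y Gc GB] by auto
      show "AE \<omega> in N. (\<lambda>k. G k (Y \<omega>)) \<longlonglongrightarrow> F (Y \<omega>)"
        unfolding G_def using inf_conv_tendsto[OF F B] YL by (intro AE_I2) auto
      show "\<And>k. AE \<omega> in N. norm (G k (Y \<omega>)) \<le> B"
        using GB YL by (intro AE_I2) auto
    qed
    then have "eventually (\<lambda>k. (\<integral>\<omega>. G k (Y \<omega>) \<partial>N) > (\<integral>\<omega>. F (Y \<omega>) \<partial>N) - e / 2) sequentially"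
      by (rule order_tendstoD) (use e in simp)
    then obtain k where k: "(\<integral>\<omega>. G k (Y \<omega>) \<partial>N) > (\<integral>\<omega>. F (Y \<omega>) \<partial>N) - e / 2"
      by (auto simp: eventually_sequentially)
    have "(\<lambda>n. \<integral>\<omega>. G k (X n \<omega>) \<partial>M n) \<longlonglongrightarrow> (\<integral>\<omega>. G k (Y \<omega>) \<partial>N)"
      by (rule lip[of "real k" "G k" B]) (use GL GB in auto)
    then have "eventually (\<lambda>n. (\<integral>\<omega>. G k (X n \<omega>) \<partial>M n) > (\<integral>\<omega>. G k (Y \<omega>) \<partial>N) - e / 2) sequentially"
      by (rule order_tendstoD) (use e in simp)
    then show ?thesis
      using eventually_ge_at_top[of 1]
    proof eventually_elim
      case (elim n)
      have XL: "\<And>\<omega>. \<omega> \<in> space (M n) \<Longrightarrow> X n \<omega> \<in> L2_fun P"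
        using measurable_space[OF X[OF elim(2)]] by (simp add: space_borel_of_L2)
      have "(\<integral>\<omega>. G k (X n \<omega>) \<partial>M n) \<le> (\<integral>\<omega>. F (X n \<omega>) \<partial>M n)"
        using int[OF M[OF elim(2)] X[OF elim(2)] F B] int[OF M[OF elim(2)] X[OF elim(2)] Gc GB] GF XL
        by (intro integral_mono) auto
      then show ?case using elim(1) k by simp
    qed
  qed
  have "(\<lambda>n. \<integral>\<omega>. F (X n \<omega>) \<partial>M n) \<longlonglongrightarrow> (\<integral>\<omega>. F (Y \<omega>) \<partial>N)"
    if F: "continuous_map (L2_topology P) euclideanreal F" and bF: "bounded (F ` topspace (L2_topology P))" for F
  proof -
    obtain B where B: "\<And>f. f \<in> L2_fun P \<Longrightarrow> \<bar>F f\<bar> \<le> B"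
      using bF unfolding topspace_L2_topology bounded_iff by auto
    have mF: "continuous_map (L2_topology P) euclideanreal (\<lambda>f. - F f)"
    proof (rule L2_continuous_mapI)
      fix f and e :: real assume "f \<in> L2_fun P" "e > 0"
      from L2_continuous_mapD[OF F this] obtain d where
        "d > 0" "\<And>g. g \<in> L2_fun P \<Longrightarrow> L2_dist P f g < d \<Longrightarrow> \<bar>F g - F f\<bar> < e" by blast
      then show "\<exists>d>0. \<forall>g\<in>L2_fun P. L2_dist P f g < d \<longrightarrow> \<bar>- F g - - F f\<bar> < e"
        by (intro exI[of _ d]) (auto simp: abs_minus_commute)
    qed
    show ?thesis
    proof (rule order_tendstoI)
      fix a assume "a < (\<integral>\<omega>. F (Y \<omega>) \<partial>N)"
      then show "eventually (\<lambda>n. a < (\<integral>\<omega>. F (X n \<omega>) \<partial>M n)) sequentially"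
        using lower[OF F B, of "(\<integral>\<omega>. F (Y \<omega>) \<partial>N) - a"] by simp
    next
      fix a assume "(\<integral>\<omega>. F (Y \<omega>) \<partial>N) < a"
      then show "eventually (\<lambda>n. (\<integral>\<omega>. F (X n \<omega>) \<partial>M n) < a) sequentially"
        using lower[OF mF, of B "a - (\<integral>\<omega>. F (Y \<omega>) \<partial>N)"] B by simp
    qed
  qed
  then show ?thesis
    unfolding conv_in_distr_def using M X N Y by auto
qed

text \<open>The Lipschitz property acts off the exceptional event, the bound \<open>2 B\<close> on it.\<close>

lemma (in prob_space) integral_lipschitz_diff_le:
  assumes int: "integrable M (\<lambda>\<omega>. F (U \<omega>))" "integrable M (\<lambda>\<omega>. F (V \<omega>))"
    and L2: "\<And>\<omega>. \<omega> \<in> space M \<Longrightarrow> U \<omega> \<in> L2_fun P" "\<And>\<omega>. \<omega> \<in> space M \<Longrightarrow> V \<omega> \<in> L2_fun P"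
    and L: "L \<ge> 0" "\<And>f g. f \<in> L2_fun P \<Longrightarrow> g \<in> L2_fun P \<Longrightarrow> \<bar>F f - F g\<bar> \<le> L * L2_dist P f g"
    and B: "\<And>f. f \<in> L2_fun P \<Longrightarrow> \<bar>F f\<bar> \<le> B"
    and A: "A \<in> events" "prob A \<le> \<delta>"
    and e: "e \<ge> 0" "\<And>\<omega>. \<omega> \<in> space M - A \<Longrightarrow> L2_dist P (U \<omega>) (V \<omega>) \<le> e"
  shows "\<bar>(\<integral>\<omega>. F (U \<omega>) \<partial>M) - (\<integral>\<omega>. F (V \<omega>) \<partial>M)\<bar> \<le> L * e + 2 * B * \<delta>"
proof -
  have "B \<ge> 0" using B[OF L2_fun_zero] by linarith
  have iA: "integrable M (indicator A :: _ \<Rightarrow> real)"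
    using A by (intro integrable_real_indicator) (auto simp: emeasure_eq_measure)
  have "\<bar>(\<integral>\<omega>. F (U \<omega>) \<partial>M) - (\<integral>\<omega>. F (V \<omega>) \<partial>M)\<bar> = \<bar>\<integral>\<omega>. F (U \<omega>) - F (V \<omega>) \<partial>M\<bar>"
    using int by simp
  also have "\<dots> \<le> (\<integral>\<omega>. \<bar>F (U \<omega>) - F (V \<omega>)\<bar> \<partial>M)" by (rule integral_abs_bound)
  also have "\<dots> \<le> (\<integral>\<omega>. L * e + 2 * B * indicator A \<omega> \<partial>M)"
  proof (rule integral_mono)
    show "integrable M (\<lambda>\<omega>. \<bar>F (U \<omega>) - F (V \<omega>)\<bar>)" using int by simp
    show "integrable M (\<lambda>\<omega>. L * e + 2 * B * indicator A \<omega>)" using iA by simp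
    fix \<omega> assume w: "\<omega> \<in> space M"
    show "\<bar>F (U \<omega>) - F (V \<omega>)\<bar> \<le> L * e + 2 * B * indicator A \<omega>"
    proof (cases "\<omega> \<in> A")
      case True
      have "0 \<le> L * e" using L e by simp
      then show ?thesis using B[OF L2(1)[OF w]] B[OF L2(2)[OF w]] True by (simp add: abs_le_iff)
    next
      case False
      have "\<bar>F (U \<omega>) - F (V \<omega>)\<bar> \<le> L * L2_dist P (U \<omega>) (V \<omega>)" using L2 w L by auto
      also have "\<dots> \<le> L * e" using e(2)[of \<omega>] w False L by (intro mult_left_mono) auto
      finally show ?thesis using False by simp
    qed
  qed
  also have "\<dots> = L * e + 2 * B * prob A" using iA A(1) by (simp add: prob_space)
  also have "\<dots> \<le> L * e + 2 * B * \<delta>" using A \<open>B \<ge> 0\<close> by (simp add: mult_left_mono)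
  finally show ?thesis .
qed

section \<open>From cosines to Lipschitz functions of finitely many coordinates\<close>

text \<open>The span of the functions \<open>s \<mapsto> cos(\<langle>\<theta>, s\<rangle> + b)\<close> with finitely supported frequencies \<open>\<theta>\<close>. Products of
cosines are sums of cosines, so this is an algebra, to which the Stone--Weierstrass theorem applies,
while expectations of its members are linear combinations of expectations of cosines.\<close>

inductive trig_poly :: "((nat \<Rightarrow> real) \<Rightarrow> real) \<Rightarrow> bool" where
  cos: "trig_poly (\<lambda>s. cos ((\<Sum>j<m. \<theta> j * s j) + b))"
| add: "trig_poly f \<Longrightarrow> trig_poly g \<Longrightarrow> trig_poly (\<lambda>s. f s + g s)"
| cmult: "trig_poly f \<Longrightarrow> trig_poly (\<lambda>s. c * f s)"

lemma trig_poly_const: "trig_poly (\<lambda>s. c)"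
  using trig_poly.cmult[OF trig_poly.cos[where m = 0 and b = 0], of c] by simp

lemma trig_poly_sin_coord: "trig_poly (\<lambda>s. sin (a * s j))"
proof -
  have "trig_poly (\<lambda>s. cos ((\<Sum>i<Suc j. (if i = j then a else 0) * s i) + (- pi / 2)))"
    by (rule trig_poly.cos)
  moreover have "cos ((\<Sum>i<Suc j. (if i = j then a else 0) * s i) + (- pi / 2)) = sin (a * s j)" for s :: "nat \<Rightarrow> real"
  proof -
    have "(\<Sum>i<Suc j. (if i = j then a else 0) * s i) = a * s j"
      by (simp add: sum.delta)
    then show ?thesis by (simp add: cos_diff)
  qed
  ultimately show ?thesis by simp
qed

lemma trig_poly_mult_cos:
  assumes "trig_poly g"
  shows "trig_poly (\<lambda>s. cos ((\<Sum>j<m. \<theta> j * s j) + b) * g s)"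
  using assms
proof induction
  case (cos \<theta>' m' b')
  \<comment> \<open>Both frequency vectors are padded with zeros to a common length.\<close>
  define M where "M = max m m'"
  define \<phi> where "\<phi> j = (if j < m then \<theta> j else 0)" for j
  define \<phi>' where "\<phi>' j = (if j < m' then \<theta>' j else 0)" for j
  have e1: "(\<Sum>j<m. \<theta> j * s j) = (\<Sum>j<M. \<phi> j * s j)" for s :: "nat \<Rightarrow> real"
    by (rule sum.mono_neutral_cong_left) (auto simp: M_def \<phi>_def)
  have e2: "(\<Sum>j<m'. \<theta>' j * s j) = (\<Sum>j<M. \<phi>' j * s j)" for s :: "nat \<Rightarrow> real"
    by (rule sum.mono_neutral_cong_left) (auto simp: M_def \<phi>'_def)
  have "trig_poly (\<lambda>s. (1 / 2) * (cos ((\<Sum>j<M. (\<phi> j + \<phi>' j) * s j) + (b + b')) +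
     cos ((\<Sum>j<M. (\<phi> j - \<phi>' j) * s j) + (b - b'))))"
    by (intro trig_poly.intros)
  moreover have "(1 / 2) * (cos ((\<Sum>j<M. (\<phi> j + \<phi>' j) * s j) + (b + b')) +
     cos ((\<Sum>j<M. (\<phi> j - \<phi>' j) * s j) + (b - b'))) =
     cos ((\<Sum>j<m. \<theta> j * s j) + b) * cos ((\<Sum>j<m'. \<theta>' j * s j) + b')" for s :: "nat \<Rightarrow> real"
  proof -
    have "(\<Sum>j<M. (\<phi> j + \<phi>' j) * s j) + (b + b') = ((\<Sum>j<M. \<phi> j * s j) + b) + ((\<Sum>j<M. \<phi>' j * s j) + b')"
      by (simp add: distrib_right sum.distrib)
    moreover have "(\<Sum>j<M. (\<phi> j - \<phi>' j) * s j) + (b - b') = ((\<Sum>j<M. \<phi> j * s j) + b) - ((\<Sum>j<M. \<phi>' j * s j) + b')"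
      by (simp add: left_diff_distrib sum_subtractf)
    ultimately show ?thesis
      unfolding e1 e2 by (simp only: cos_add[of "_ + b" "_ + b'"] cos_diff[of "_ + b" "_ + b'"]) simp
  qed
  ultimately show ?case by simp
next
  case (add f g)
  then show ?case using trig_poly.add by (simp add: distrib_left)
next
  case (cmult f c)
  from trig_poly.cmult[OF cmult.IH, of c] show ?case by (simp add: mult.left_commute)
qed

lemma trig_poly_mult:
  assumes "trig_poly f" "trig_poly g"
  shows "trig_poly (\<lambda>s. f s * g s)"
  using assms(1)
proof induction
  case (cos \<theta> m b)
  then show ?case by (rule trig_poly_mult_cos[OF assms(2)])
next
  case (add f1 f2)
  then show ?case using trig_poly.add by (simp add: distrib_right)
next
  case (cmult f c)
  from trig_poly.cmult[OF cmult.IH, of c] show ?case by (simp add: mult.assoc)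
qed

lemma trig_poly_integrable:
  assumes "prob_space M" and S: "\<And>j. (\<lambda>\<omega>. S \<omega> j) \<in> borel_measurable M" and "trig_poly p"
  shows "integrable M (\<lambda>\<omega>. p (S \<omega>))"
proof -
  interpret prob_space M by fact
  note S[measurable]
  show ?thesis using \<open>trig_poly p\<close>
    by induction (auto intro!: integrable_const_bound[of _ 1] AE_I2)
qed

lemma trig_poly_tendsto:
  fixes M :: "nat \<Rightarrow> 'a measure" and S :: "nat \<Rightarrow> 'a \<Rightarrow> nat \<Rightarrow> real"
  assumes M: "\<And>n. n \<ge> 1 \<Longrightarrow> prob_space (M n)" and N: "prob_space N"
    and S: "\<And>n j. n \<ge> 1 \<Longrightarrow> (\<lambda>\<omega>. S n \<omega> j) \<in> borel_measurable (M n)"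
    and T: "\<And>j. (\<lambda>\<omega>. T \<omega> j) \<in> borel_measurable N"
    and cosines: "\<And>m \<theta> b. (\<lambda>n. \<integral>\<omega>. cos ((\<Sum>j<m. \<theta> j * S n \<omega> j) + b) \<partial>M n)
        \<longlonglongrightarrow> (\<integral>\<omega>. cos ((\<Sum>j<m. \<theta> j * T \<omega> j) + b) \<partial>N)"
    and p: "trig_poly p"
  shows "(\<lambda>n. \<integral>\<omega>. p (S n \<omega>) \<partial>M n) \<longlonglongrightarrow> (\<integral>\<omega>. p (T \<omega>) \<partial>N)"
  using p
proof induction
  case (cos \<theta> m b)
  then show ?case by (rule cosines)
next
  case (add f g)
  have "eventually (\<lambda>n. (\<integral>\<omega>. f (S n \<omega>) \<partial>M n) + (\<integral>\<omega>. g (S n \<omega>) \<partial>M n) = (\<integral>\<omega>. f (S n \<omega>) + g (S n \<omega>) \<partial>M n)) sequentially"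
    using eventually_ge_at_top[of 1]
    by eventually_elim (intro Bochner_Integration.integral_add[symmetric] trig_poly_integrable M S add.hyps)
  moreover have "(\<integral>\<omega>. f (T \<omega>) \<partial>N) + (\<integral>\<omega>. g (T \<omega>) \<partial>N) = (\<integral>\<omega>. f (T \<omega>) + g (T \<omega>) \<partial>N)"
    by (intro Bochner_Integration.integral_add[symmetric] trig_poly_integrable N T add.hyps)
  ultimately show ?case
    using tendsto_add[OF add.IH] by (simp add: filterlim_cong)
next
  case (cmult f c)
  then show ?case by (auto intro: tendsto_intros)
qed

text \<open>Tychonoff's theorem. The cube has all coordinates, so that one space serves functions of any
finite number of them.\<close>

lemma compact_cube: "compact {u :: nat \<Rightarrow> real. \<forall>j. u j \<in> {- 1..1}}"
proof -
  have "compactin (product_topology (\<lambda>i::nat. euclideanreal) UNIV) (PiE UNIV (\<lambda>_. {- 1..1}))"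
    by (subst compactin_PiE) auto
  moreover have "PiE UNIV (\<lambda>_. {- 1..1}) = {u :: nat \<Rightarrow> real. \<forall>j. u j \<in> {- 1..1}}"
    by (auto simp: PiE_def Pi_def)
  ultimately show ?thesis by (simp add: euclidean_product_topology)
qed

text \<open>The map \<open>s \<mapsto> (sin(a s\<^sub>j))\<^sub>j\<close> folds the whole coordinate space onto the compact cube and turns
polynomials on the cube into trigonometric polynomials. Uniform approximation on the cube is
therefore uniform approximation over all \<open>s\<close>.\<close>

lemma trig_poly_approx_folded:
  fixes \<Phi> :: "(nat \<Rightarrow> real) \<Rightarrow> real"
  assumes \<Phi>: "continuous_on {u. \<forall>j. u j \<in> {- 1..1}} \<Phi>" and e: "e > 0"
  obtains p where "trig_poly p" "\<And>s. \<bar>\<Phi> (\<lambda>j. sin (a * s j)) - p s\<bar> < e"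
proof -
  let ?K = "{u :: nat \<Rightarrow> real. \<forall>j. u j \<in> {- 1..1}}"
  define R where "R = {r. continuous_on ?K r \<and> trig_poly (\<lambda>s. r (\<lambda>j. sin (a * s j)))}"
  interpret function_ring_on R ?K
  proof unfold_locales
    show "compact ?K" by (rule compact_cube)
    show "f \<in> R \<Longrightarrow> continuous_on ?K f" for f by (simp add: R_def)
    show "f \<in> R \<Longrightarrow> g \<in> R \<Longrightarrow> (\<lambda>x. f x + g x) \<in> R" for f g
      by (auto simp: R_def intro: continuous_on_add trig_poly.add)
    show "f \<in> R \<Longrightarrow> g \<in> R \<Longrightarrow> (\<lambda>x. f x * g x) \<in> R" for f g
      by (auto simp: R_def intro: continuous_on_mult trig_poly_mult)
    show "(\<lambda>_. c) \<in> R" for c by (simp add: R_def trig_poly_const)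
    fix x y :: "nat \<Rightarrow> real" assume "x \<noteq> y"
    then obtain j where j: "x j \<noteq> y j" by auto
    have "(\<lambda>u. u j) \<in> R"
      unfolding R_def using continuous_on_subset[OF continuous_on_product_coordinates subset_UNIV]
      by (auto intro: trig_poly_sin_coord)
    then show "\<exists>f\<in>R. f x \<noteq> f y" using j by (intro bexI[of _ "\<lambda>u. u j"])
  qed
  obtain r where r: "r \<in> R" "\<And>u. u \<in> ?K \<Longrightarrow> \<bar>\<Phi> u - r u\<bar> < e"
    using Stone_Weierstrass_basic[OF \<Phi> e] by blast
  show ?thesis
    by (rule that[of "\<lambda>s. r (\<lambda>j. sin (a * s j))"]) (use r in \<open>auto simp: R_def\<close>)
qed

lemma finite_lipschitz_continuous_on:
  fixes f :: "(nat \<Rightarrow> real) \<Rightarrow> real"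
  assumes L: "\<And>s s'. \<bar>f s - f s'\<bar> \<le> L * (\<Sum>j<m. \<bar>s j - s' j\<bar>)"
  shows "continuous_on A f"
  unfolding continuous_on_def
proof
  fix s assume "s \<in> A"
  have c: "((\<lambda>s'. s' j) \<longlongrightarrow> s j) (at s within A)" for j
    using continuous_on_subset[OF continuous_on_product_coordinates[of j] subset_UNIV[of A]] \<open>s \<in> A\<close>
    by (auto simp: continuous_on_def)
  have "((\<lambda>s'. L * (\<Sum>j<m. \<bar>s' j - s j\<bar>)) \<longlongrightarrow> L * (\<Sum>j<m. \<bar>s j - s j\<bar>)) (at s within A)"
    by (intro tendsto_intros c)
  then have z: "((\<lambda>s'. L * (\<Sum>j<m. \<bar>s' j - s j\<bar>)) \<longlongrightarrow> 0) (at s within A)" by simp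
  have "((\<lambda>s'. f s' - f s) \<longlongrightarrow> 0) (at s within A)"
    by (rule Lim_null_comparison[OF _ z]) (use L in \<open>auto intro!: always_eventually\<close>)
  then show "(f \<longlongrightarrow> f s) (at s within A)" by (simp add: LIM_zero_iff)
qed

text \<open>A continuity theorem in the style of Levy, with tightness supplied by second moments. The function
\<open>f\<close> is replaced by \<open>s \<mapsto> \<Phi>((sin(a s\<^sub>j))\<^sub>j)\<close>, where \<open>\<Phi>\<close> applies \<open>f\<close> after an inverse of the folding map.
Both agree where the relevant coordinates are at most \<open>R\<close> in absolute value, Chebyshev's inequality controls the rest,
and the folded function is uniformly close to a trigonometric polynomial.\<close>

theorem cosine_conv_imp_lipschitz_conv:
  fixes M :: "nat \<Rightarrow> 'a measure" and S :: "nat \<Rightarrow> 'a \<Rightarrow> nat \<Rightarrow> real"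
  assumes M: "\<And>n. n \<ge> 1 \<Longrightarrow> prob_space (M n)" and N: "prob_space N"
    and S: "\<And>n j. n \<ge> 1 \<Longrightarrow> (\<lambda>\<omega>. S n \<omega> j) \<in> borel_measurable (M n)"
    and T: "\<And>j. (\<lambda>\<omega>. T \<omega> j) \<in> borel_measurable N"
    and cosines: "\<And>m \<theta> b. (\<lambda>n. \<integral>\<omega>. cos ((\<Sum>j<m. \<theta> j * S n \<omega> j) + b) \<partial>M n)
        \<longlonglongrightarrow> (\<integral>\<omega>. cos ((\<Sum>j<m. \<theta> j * T \<omega> j) + b) \<partial>N)"
    and S2: "\<And>n j. n \<ge> 1 \<Longrightarrow> integrable (M n) (\<lambda>\<omega>. (S n \<omega> j)\<^sup>2)"
      "\<And>n j. n \<ge> 1 \<Longrightarrow> (\<integral>\<omega>. (S n \<omega> j)\<^sup>2 \<partial>M n) \<le> C j"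
    and T2: "\<And>j. integrable N (\<lambda>\<omega>. (T \<omega> j)\<^sup>2)" "\<And>j. (\<integral>\<omega>. (T \<omega> j)\<^sup>2 \<partial>N) \<le> C j"
    and L: "\<And>s s'. \<bar>f s - f s'\<bar> \<le> L * (\<Sum>j<m. \<bar>s j - s' j\<bar>)" and B: "\<And>s. \<bar>f s\<bar> \<le> B"
  shows "(\<lambda>n. \<integral>\<omega>. f (S n \<omega>) \<partial>M n) \<longlonglongrightarrow> (\<integral>\<omega>. f (T \<omega>) \<partial>N)"
proof (rule tendsto_by_approximation)
  fix e :: real assume e: "e > 0"
  have fmeas: "f \<in> borel_measurable borel"
    by (rule borel_measurable_continuous_onI, rule finite_lipschitz_continuous_on[OF L])
  have B0: "B \<ge> 0" using B[of "\<lambda>_. 0"] by linarith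
  define D where "D = (\<Sum>j<m. C j)"
  have D0: "D \<ge> 0"
  proof -
    have "0 \<le> (\<integral>\<omega>. (T \<omega> j)\<^sup>2 \<partial>N)" for j by simp
    then show ?thesis unfolding D_def using T2(2) by (intro sum_nonneg) (meson order_trans)
  qed
  \<comment> \<open>Large enough for the Chebyshev term \<open>2 B D / R\<^sup>2\<close> to be at most \<open>e / 2\<close>.\<close>
  define R where "R = sqrt (4 * B * D / e) + 1"
  have R: "R > 0" unfolding R_def using B0 D0 e by (intro add_nonneg_pos) auto
  have R2: "2 * B * D / R\<^sup>2 \<le> e / 2"
  proof -
    have "4 * B * D / e = (sqrt (4 * B * D / e))\<^sup>2" using B0 D0 e by simp
    also have "\<dots> \<le> R\<^sup>2" unfolding R_def using B0 D0 e by (intro power_mono) auto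
    finally show ?thesis using R e by (simp add: field_simps)
  qed
  define \<Phi> where "\<Phi> u = f (\<lambda>j. 2 * R / pi * arcsin (u j))" for u :: "nat \<Rightarrow> real"
  \<comment> \<open>With this frequency, \<open>\<bar>s\<^sub>j\<bar> \<le> R\<close> means \<open>\<bar>a s\<^sub>j\<bar> \<le> \<pi>/2\<close>, where \<open>arcsin\<close> inverts \<open>sin\<close>.\<close>
  define a where "a = pi / (2 * R)"
  have "continuous_on {u. \<forall>j. u j \<in> {- 1..1}} \<Phi>"
    unfolding \<Phi>_def
  proof (rule continuous_on_compose2[OF finite_lipschitz_continuous_on[OF L, of UNIV]])
    have arc: "continuous_on {u. \<forall>j. u j \<in> {- 1..1}} (\<lambda>u :: nat \<Rightarrow> real. arcsin (u j))" for j :: nat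
      by (rule continuous_on_arcsin)
         (auto intro: continuous_on_subset[OF continuous_on_product_coordinates subset_UNIV])
    show "continuous_on {u. \<forall>j. u j \<in> {- 1..1}} (\<lambda>(u :: nat \<Rightarrow> real) j. 2 * R / pi * arcsin (u j))"
      by (intro continuous_on_coordinatewise_then_product continuous_on_mult_left arc)
  qed auto
  then obtain p where p: "trig_poly p" "\<And>s. \<bar>\<Phi> (\<lambda>j. sin (a * s j)) - p s\<bar> < e / 2"
    using trig_poly_approx_folded[of \<Phi> "e / 2" a] e by auto
  have fold: "\<bar>f s - \<Phi> (\<lambda>j. sin (a * s j))\<bar> \<le> 2 * B / R\<^sup>2 * (\<Sum>j<m. (s j)\<^sup>2)" for s
  proof (cases "\<forall>j<m. \<bar>s j\<bar> \<le> R")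
    case True
    have "2 * R / pi * arcsin (sin (a * s j)) = s j" if "j < m" for j
    proof -
      have sj: "- R \<le> s j" "s j \<le> R" using True that by (auto simp: abs_le_iff)
      have "- (pi / 2) \<le> a * s j" "a * s j \<le> pi / 2"
        using mult_left_mono[OF sj(1), of a] mult_left_mono[OF sj(2), of a] R
        by (auto simp: a_def)
      then have "arcsin (sin (a * s j)) = a * s j" by (rule arcsin_sin)
      then show ?thesis using R by (simp add: a_def)
    qed
    then have "\<bar>f s - \<Phi> (\<lambda>j. sin (a * s j))\<bar> \<le> L * (\<Sum>j<m. \<bar>s j - s j\<bar>)"
      unfolding \<Phi>_def by (intro order.trans[OF L] eq_refl arg_cong[where f = "\<lambda>x. L * x"] sum.cong) auto
    moreover have "0 \<le> 2 * B / R\<^sup>2 * (\<Sum>j<m. (s j)\<^sup>2)" using B0 by (intro mult_nonneg_nonneg divide_nonneg_nonneg sum_nonneg) auto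
    ultimately show ?thesis by simp
  next
    case False
    then obtain j where j: "j < m" "R < \<bar>s j\<bar>" by auto
    have "R\<^sup>2 \<le> (s j)\<^sup>2" using j R by (metis abs_of_pos less_imp_le abs_le_square_iff)
    also have "\<dots> \<le> (\<Sum>j<m. (s j)\<^sup>2)" using j by (intro member_le_sum) auto
    finally have "2 * B * 1 \<le> 2 * B * ((\<Sum>j<m. (s j)\<^sup>2) / R\<^sup>2)"
      using R B0 by (intro mult_left_mono) auto
    moreover have "\<bar>f s - \<Phi> (\<lambda>j. sin (a * s j))\<bar> \<le> 2 * B"
      unfolding \<Phi>_def using B[of s] B[of "\<lambda>j. 2 * R / pi * arcsin (sin (a * s j))"] by linarith
    ultimately show ?thesis by simp
  qed
  have est: "\<bar>(\<integral>\<omega>. f (U \<omega>) \<partial>Q) - (\<integral>\<omega>. p (U \<omega>) \<partial>Q)\<bar> \<le> e"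
    if Q: "prob_space Q" and U: "\<And>j. (\<lambda>\<omega>. U \<omega> j) \<in> borel_measurable Q"
      and U2: "\<And>j. integrable Q (\<lambda>\<omega>. (U \<omega> j)\<^sup>2)" "\<And>j. (\<integral>\<omega>. (U \<omega> j)\<^sup>2 \<partial>Q) \<le> C j"
    for Q :: "'z measure" and U
  proof -
    interpret prob_space Q by fact
    have "U \<in> borel_measurable Q" by (rule measurable_coordinatewise_then_product) (rule U)
    then have fi: "integrable Q (\<lambda>\<omega>. f (U \<omega>))"
      using B measurable_compose[OF _ fmeas] by (intro integrable_const_bound[of _ B]) auto
    have pi: "integrable Q (\<lambda>\<omega>. p (U \<omega>))" by (rule trig_poly_integrable[OF Q U p(1)])
    have "\<bar>(\<integral>\<omega>. f (U \<omega>) \<partial>Q) - (\<integral>\<omega>. p (U \<omega>) \<partial>Q)\<bar> = \<bar>\<integral>\<omega>. f (U \<omega>) - p (U \<omega>) \<partial>Q\<bar>"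
      using fi pi by simp
    also have "\<dots> \<le> (\<integral>\<omega>. \<bar>f (U \<omega>) - p (U \<omega>)\<bar> \<partial>Q)" by (rule integral_abs_bound)
    also have "\<dots> \<le> (\<integral>\<omega>. 2 * B / R\<^sup>2 * (\<Sum>j<m. (U \<omega> j)\<^sup>2) + e / 2 \<partial>Q)"
    proof (rule integral_mono)
      show "integrable Q (\<lambda>\<omega>. \<bar>f (U \<omega>) - p (U \<omega>)\<bar>)" using fi pi by simp
      show "integrable Q (\<lambda>\<omega>. 2 * B / R\<^sup>2 * (\<Sum>j<m. (U \<omega> j)\<^sup>2) + e / 2)"
        using U2(1) by (intro Bochner_Integration.integrable_add integrable_mult_right Bochner_Integration.integrable_sum) auto
      fix \<omega> show "\<bar>f (U \<omega>) - p (U \<omega>)\<bar> \<le> 2 * B / R\<^sup>2 * (\<Sum>j<m. (U \<omega> j)\<^sup>2) + e / 2"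
        using fold[of "U \<omega>"] p(2)[of "U \<omega>"] by linarith
    qed
    also have "\<dots> = 2 * B / R\<^sup>2 * (\<Sum>j<m. \<integral>\<omega>. (U \<omega> j)\<^sup>2 \<partial>Q) + e / 2"
    proof -
      have "integrable Q (\<lambda>\<omega>. \<Sum>j<m. (U \<omega> j)\<^sup>2)" using U2(1) by auto
      then show ?thesis using U2(1) by (simp add: prob_space)
    qed
    also have "\<dots> \<le> 2 * B / R\<^sup>2 * D + e / 2"
      unfolding D_def using B0 U2(2) by (intro add_right_mono mult_left_mono sum_mono) auto
    also have "\<dots> \<le> e" using R2 by simp
    finally show ?thesis .
  qed
  show "\<exists>b l. b \<longlonglongrightarrow> l \<and> eventually (\<lambda>n. \<bar>(\<integral>\<omega>. f (S n \<omega>) \<partial>M n) - b n\<bar> \<le> e) sequentially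
      \<and> \<bar>(\<integral>\<omega>. f (T \<omega>) \<partial>N) - l\<bar> \<le> e"
    using trig_poly_tendsto[OF M N S T cosines p(1)] est[OF M S S2] est[OF N T T2]
    by (intro exI[of _ "\<lambda>n. \<integral>\<omega>. p (S n \<omega>) \<partial>M n"] exI[of _ "\<integral>\<omega>. p (T \<omega>) \<partial>N"])
       (auto simp: eventually_sequentially intro!: exI[of _ 1])
qed

section \<open>Local alternatives\<close>

text \<open>The central limit theorem below concerns an arbitrary probability measure \<open>P\<close> on the line; \<open>K\<close> is a common bound
for the fourth moments of the functions \<open>h n\<close>.\<close>

locale local_alternatives = prob_space P for P :: "real measure" +
  fixes h :: "nat \<Rightarrow> real \<Rightarrow> real" and hl :: "real \<Rightarrow> real" and Q :: "nat \<Rightarrow> real measure" and K :: real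
  assumes sets_P [measurable_cong]: "sets P = sets borel"
    and h_meas [measurable]: "\<And>n. n \<ge> 1 \<Longrightarrow> h n \<in> borel_measurable borel"
    and hl_meas [measurable]: "hl \<in> borel_measurable borel"
    and Q_def: "\<And>n. n \<ge> 1 \<Longrightarrow> Q n = density P (\<lambda>x. ennreal (1 + h n x / sqrt (real n)))"
    and Q_nonneg: "\<And>n. n \<ge> 1 \<Longrightarrow> AE x in P. 0 \<le> 1 + h n x / sqrt (real n)"
    and Q_prob: "\<And>n. n \<ge> 1 \<Longrightarrow> prob_space (Q n)"
    and h_int4: "\<And>n. n \<ge> 1 \<Longrightarrow> integrable P (\<lambda>x. h n x ^ 4)"
    and h_bound4: "\<And>n. n \<ge> 1 \<Longrightarrow> (\<integral>x. h n x ^ 4 \<partial>P) \<le> K"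
    and h_conv: "AE x in P. (\<lambda>n. h n x) \<longlonglongrightarrow> hl x"
begin

lemma sets_Q: "n \<ge> 1 \<Longrightarrow> sets (Q n) = sets borel"
  by (simp add: Q_def sets_P)

lemma L2_of_L4:
  assumes [measurable]: "f \<in> borel_measurable borel" and "integrable P (\<lambda>x. f x ^ 4)"
  shows "f \<in> L2_fun P" "(\<integral>x. (f x)\<^sup>2 \<partial>P) \<le> 1 + (\<integral>x. f x ^ 4 \<partial>P)"
proof -
  have i: "integrable P (\<lambda>x. (f x)\<^sup>2)"
    by (rule Bochner_Integration.integrable_bound[of _ "\<lambda>x. 1 + f x ^ 4"])
       (use assms(2) square_le_4 in \<open>auto intro!: AE_I2\<close>)
  then show "f \<in> L2_fun P" by (simp add: L2_fun_def)
  have "(\<integral>x. (f x)\<^sup>2 \<partial>P) \<le> (\<integral>x. 1 + f x ^ 4 \<partial>P)"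
    using assms(2) i square_le_4 by (intro integral_mono) auto
  then show "(\<integral>x. (f x)\<^sup>2 \<partial>P) \<le> 1 + (\<integral>x. f x ^ 4 \<partial>P)"
    using assms(2) prob_space by simp
qed

lemma L1_of_L2:
  assumes "f \<in> L2_fun P" shows "integrable P f"
  using integrable_L2_mult[OF assms, of "\<lambda>x. 1"] by (simp add: L2_fun_def)

lemma h_L2: "n \<ge> 1 \<Longrightarrow> h n \<in> L2_fun P"
  and h_L2_bound: "n \<ge> 1 \<Longrightarrow> (\<integral>x. (h n x)\<^sup>2 \<partial>P) \<le> 1 + K"
  using L2_of_L4[OF h_meas h_int4, of n] h_bound4[of n] by auto

lemma K_nonneg: "K \<ge> 0"
proof -
  have "0 \<le> (\<integral>x. h 1 x ^ 4 \<partial>P)" by simp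
  then show ?thesis using h_bound4[of 1] by linarith
qed

text \<open>Fatou's lemma.\<close>

lemma hl_int4: "integrable P (\<lambda>x. hl x ^ 4)" and hl_bound4: "(\<integral>x. hl x ^ 4 \<partial>P) \<le> K"
proof -
  have "(\<integral>\<^sup>+x. ennreal (hl x ^ 4) \<partial>P) \<le> (\<integral>\<^sup>+x. liminf (\<lambda>n. ennreal (h (Suc n) x ^ 4)) \<partial>P)"
  proof (intro nn_integral_mono_AE, use h_conv in eventually_elim)
    fix x assume "(\<lambda>n. h n x) \<longlonglongrightarrow> hl x"
    then have "(\<lambda>n. h (Suc n) x) \<longlonglongrightarrow> hl x" by (rule LIMSEQ_Suc)
    then have "(\<lambda>n. ennreal (h (Suc n) x ^ 4)) \<longlonglongrightarrow> ennreal (hl x ^ 4)"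
      by (intro tendsto_intros)
    then have "liminf (\<lambda>n. ennreal (h (Suc n) x ^ 4)) = ennreal (hl x ^ 4)"
      by (intro lim_imp_Liminf) auto
    then show "ennreal (hl x ^ 4) \<le> liminf (\<lambda>n. ennreal (h (Suc n) x ^ 4))" by simp
  qed
  also have "\<dots> \<le> liminf (\<lambda>n. \<integral>\<^sup>+x. ennreal (h (Suc n) x ^ 4) \<partial>P)"
    by (intro nn_integral_liminf) auto
  also have "\<dots> \<le> ennreal K"
  proof -
    have "(\<integral>\<^sup>+x. ennreal (h (Suc n) x ^ 4) \<partial>P) \<le> ennreal K" for n
      using h_bound4[of "Suc n"] by (subst nn_integral_eq_integral[OF h_int4]) (auto intro: ennreal_leI)
    then have "liminf (\<lambda>n. \<integral>\<^sup>+x. ennreal (h (Suc n) x ^ 4) \<partial>P) \<le> liminf (\<lambda>n. ennreal K)"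
      by (intro Liminf_mono always_eventually allI)
    then show ?thesis by (simp add: Liminf_const)
  qed
  finally have *: "(\<integral>\<^sup>+x. ennreal (hl x ^ 4) \<partial>P) \<le> ennreal K" .
  show i: "integrable P (\<lambda>x. hl x ^ 4)"
    by (rule integrableI_bounded) (use * in \<open>auto intro: le_less_trans\<close>)
  have "ennreal (\<integral>x. hl x ^ 4 \<partial>P) \<le> ennreal K"
    using * nn_integral_eq_integral[OF i] by simp
  then show "(\<integral>x. hl x ^ 4 \<partial>P) \<le> K" using K_nonneg by (simp add: ennreal_le_iff)
qed

lemma hl_L2: "hl \<in> L2_fun P" and hl_L2_bound: "(\<integral>x. (hl x)\<^sup>2 \<partial>P) \<le> 1 + K"
  using L2_of_L4[OF hl_meas hl_int4] hl_bound4 by auto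

lemma integral_Q:
  assumes n: "n \<ge> 1" and f: "f \<in> L2_fun P"
  shows "integrable (Q n) f" "(\<integral>x. f x \<partial>Q n) = (\<integral>x. f x \<partial>P) + (\<integral>x. f x * h n x \<partial>P) / sqrt (real n)"
proof -
  have [measurable]: "h n \<in> borel_measurable borel" using n by simp
  have [measurable]: "f \<in> borel_measurable P" using f by (rule L2_fun_measurable)
  have eq: "(1 + h n x / sqrt (real n)) *\<^sub>R f x = f x + f x * h n x / sqrt (real n)" for x
    by (simp add: algebra_simps)
  have i: "integrable P f" "integrable P (\<lambda>x. f x * h n x)"
    using L1_of_L2[OF f] integrable_L2_mult[OF f h_L2[OF n]] by auto
  show "integrable (Q n) f"
    unfolding Q_def[OF n]
    by (subst integrable_density) (use Q_nonneg[OF n] i in \<open>auto simp: eq simp del: real_scaleR_def\<close>)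
  have "(\<integral>x. f x \<partial>Q n) = (\<integral>x. (1 + h n x / sqrt (real n)) *\<^sub>R f x \<partial>P)"
    unfolding Q_def[OF n] by (rule integral_density) (use Q_nonneg[OF n] in auto)
  then show "(\<integral>x. f x \<partial>Q n) = (\<integral>x. f x \<partial>P) + (\<integral>x. f x * h n x \<partial>P) / sqrt (real n)"
    unfolding eq using i by simp
qed

text \<open>The functions \<open>h n\<close> converge only almost everywhere, but \<open>f (h n - hl)\<close> is bounded in \<open>L\<^sup>2\<close> and hence
uniformly integrable: its part above a level \<open>R\<close> has integral at most \<open>C / R\<close>, and dominated
convergence applies to the part below.\<close>

lemma integral_mult_h_tendsto:
  assumes [measurable]: "f \<in> borel_measurable borel" and f4: "integrable P (\<lambda>x. f x ^ 4)"
  shows "(\<lambda>n. \<integral>x. f x * h n x \<partial>P) \<longlonglongrightarrow> (\<integral>x. f x * hl x \<partial>P)"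
proof -
  have fL2: "f \<in> L2_fun P" by (rule L2_of_L4[OF assms])
  \<comment> \<open>The successor skips the index 0, at which \<open>h\<close> is arbitrary.\<close>
  define g where "g n x = \<bar>f x * (h (Suc n) x - hl x)\<bar>" for n x
  have [measurable]: "g n \<in> borel_measurable borel" for n unfolding g_def[abs_def] by measurable
  define C where "C = (\<integral>x. f x ^ 4 \<partial>P) + 8 * (K + K)"
  have C0: "C \<ge> 0" using K_nonneg by (simp add: C_def)
  have quart: "(a - b) ^ 4 \<le> 8 * (a ^ 4 + b ^ 4)" for a b :: real
  proof -
    have s': "(u + v)\<^sup>2 \<le> 2 * (u\<^sup>2 + v\<^sup>2)" for u v :: real
      using sum_two_squares[of u v] by simp
    have s: "(u - v)\<^sup>2 \<le> 2 * (u\<^sup>2 + v\<^sup>2)" for u v :: real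
      using s'[of u "- v"] by simp
    have "(a - b) ^ 4 = ((a - b)\<^sup>2)\<^sup>2" by (simp add: power_mult[symmetric])
    also have "\<dots> \<le> (2 * (a\<^sup>2 + b\<^sup>2))\<^sup>2" using s by (intro power_mono) auto
    also have "\<dots> = 4 * (a\<^sup>2 + b\<^sup>2)\<^sup>2" unfolding power_mult_distrib by simp
    also have "\<dots> \<le> 4 * (2 * ((a\<^sup>2)\<^sup>2 + (b\<^sup>2)\<^sup>2))" by (rule mult_left_mono[OF s']) simp
    finally show ?thesis by (simp add: power_mult[symmetric])
  qed
  have gsq: "(g n x)\<^sup>2 \<le> f x ^ 4 + 8 * (h (Suc n) x ^ 4 + hl x ^ 4)" for n x
  proof -
    have "(g n x)\<^sup>2 = \<bar>(f x)\<^sup>2 * (h (Suc n) x - hl x)\<^sup>2\<bar>" by (simp add: g_def power_mult_distrib)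
    also have "\<dots> \<le> ((f x)\<^sup>2)\<^sup>2 + ((h (Suc n) x - hl x)\<^sup>2)\<^sup>2" by (rule mult_abs_le_sum_squares)
    also have "\<dots> \<le> f x ^ 4 + 8 * (h (Suc n) x ^ 4 + hl x ^ 4)"
      using quart[of "h (Suc n) x" "hl x"] by (simp add: power_mult[symmetric])
    finally show ?thesis .
  qed
  have ib: "integrable P (\<lambda>x. f x ^ 4 + 8 * (h (Suc n) x ^ 4 + hl x ^ 4))" for n
    using f4 h_int4[of "Suc n"] hl_int4 by simp
  have gsqi: "integrable P (\<lambda>x. (g n x)\<^sup>2)" for n
    by (rule Bochner_Integration.integrable_bound[OF ib[of n]]) (use gsq in \<open>auto intro!: AE_I2 order.trans[OF _ abs_ge_self]\<close>)
  have gsqC: "(\<integral>x. (g n x)\<^sup>2 \<partial>P) \<le> C" for n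
  proof -
    have "(\<integral>x. (g n x)\<^sup>2 \<partial>P) \<le> (\<integral>x. f x ^ 4 + 8 * (h (Suc n) x ^ 4 + hl x ^ 4) \<partial>P)"
      by (intro integral_mono gsqi ib gsq)
    also have "\<dots> \<le> C"
      using f4 h_int4[of "Suc n"] hl_int4 h_bound4[of "Suc n"] hl_bound4 by (simp add: C_def)
    finally show ?thesis .
  qed
  have gi: "integrable P (g n)" for n
    using gsqi[of n] by (intro L1_of_L2) (simp add: L2_fun_def)
  have g0: "(\<lambda>n. \<integral>x. g n x \<partial>P) \<longlonglongrightarrow> 0"
  proof (rule tendsto_by_approximation)
    fix e :: real assume e: "e > 0"
    define R where "R = C / e + 1"
    have R: "R > 0" using C0 e by (simp add: R_def add_nonneg_pos)
    have Re: "C / R \<le> e" using C0 e R by (simp add: R_def field_simps)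
    have mi: "integrable P (\<lambda>x. min (g n x) R)" for n
      using R by (intro integrable_const_bound[of _ R] AE_I2) (auto simp: g_def)
    have "(\<lambda>n. \<integral>x. min (g n x) R \<partial>P) \<longlonglongrightarrow> (\<integral>x. 0 \<partial>P)"
    proof (rule integral_dominated_convergence[where w = "\<lambda>_. R"])
      show "AE x in P. (\<lambda>n. min (g n x) R) \<longlonglongrightarrow> 0"
        using h_conv
      proof eventually_elim
        case (elim x)
        have "(\<lambda>n. min \<bar>f x * (h (Suc n) x - hl x)\<bar> R) \<longlonglongrightarrow> min \<bar>f x * (hl x - hl x)\<bar> R"
          by (intro tendsto_intros LIMSEQ_Suc[OF elim])
        then show ?case using R by (simp add: g_def)
      qed
    qed (use R in \<open>auto simp: g_def intro!: AE_I2\<close>)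
    moreover have "\<bar>(\<integral>x. g n x \<partial>P) - (\<integral>x. min (g n x) R \<partial>P)\<bar> \<le> e" for n
    proof -
      have p: "g n x - min (g n x) R \<le> (g n x)\<^sup>2 / R" for x
      proof (cases "g n x \<le> R")
        case False
        then have "g n x * R \<le> g n x * g n x" using R by (intro mult_left_mono) auto
        then have "g n x \<le> (g n x)\<^sup>2 / R" using R by (simp add: power2_eq_square field_simps)
        then show ?thesis using False R by simp
      qed (use R in auto)
      have "(\<integral>x. g n x \<partial>P) - (\<integral>x. min (g n x) R \<partial>P) = (\<integral>x. g n x - min (g n x) R \<partial>P)"
        using gi mi by simp
      moreover have "0 \<le> (\<integral>x. g n x - min (g n x) R \<partial>P)" by (intro integral_nonneg_AE AE_I2) simp
      moreover have "(\<integral>x. g n x - min (g n x) R \<partial>P) \<le> (\<integral>x. (g n x)\<^sup>2 / R \<partial>P)"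
        using gi mi gsqi p by (intro integral_mono) auto
      moreover have "(\<integral>x. (g n x)\<^sup>2 / R \<partial>P) \<le> C / R"
        using gsqC[of n] R by (simp add: divide_right_mono)
      ultimately show ?thesis using Re by simp
    qed
    ultimately show "\<exists>b l. b \<longlonglongrightarrow> l \<and> (\<forall>\<^sub>F n in sequentially. \<bar>(\<integral>x. g n x \<partial>P) - b n\<bar> \<le> e) \<and> \<bar>0 - l\<bar> \<le> e"
      using e by (intro exI[of _ "\<lambda>n. \<integral>x. min (g n x) R \<partial>P"] exI[of _ 0]) auto
  qed
  have "(\<lambda>n. (\<integral>x. f x * h (Suc n) x \<partial>P) - (\<integral>x. f x * hl x \<partial>P)) \<longlonglongrightarrow> 0"
  proof (rule Lim_null_comparison[OF _ g0], intro always_eventually allI)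
    fix n
    have "(\<integral>x. f x * h (Suc n) x \<partial>P) - (\<integral>x. f x * hl x \<partial>P) = (\<integral>x. f x * (h (Suc n) x - hl x) \<partial>P)"
      using integrable_L2_mult[OF fL2 h_L2[of "Suc n"]] integrable_L2_mult[OF fL2 hl_L2]
      by (simp add: right_diff_distrib)
    also have "\<bar>\<dots>\<bar> \<le> (\<integral>x. g n x \<partial>P)" unfolding g_def by (rule integral_abs_bound)
    finally show "norm ((\<integral>x. f x * h (Suc n) x \<partial>P) - (\<integral>x. f x * hl x \<partial>P)) \<le> (\<integral>x. g n x \<partial>P)" by simp
  qed
  then have "(\<lambda>n. \<integral>x. f x * h (Suc n) x \<partial>P) \<longlonglongrightarrow> (\<integral>x. f x * hl x \<partial>P)"
    by (rule LIM_zero_cancel)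
  then show ?thesis by (rule LIMSEQ_imp_Suc)
qed

end

section \<open>Normalized sums of a triangular array\<close>

lemma (in prob_space) indep_var_of_indep_vars:
  assumes "indep_vars (\<lambda>_. N) Y I" and i: "i \<in> I" "j \<in> I" "i \<noteq> j"
  shows "indep_var N (Y i) N (Y j)"
proof -
  have "indep_var N ((\<lambda>f. f i) \<circ> (\<lambda>\<omega>. restrict (\<lambda>i. Y i \<omega>) {i}))
      N ((\<lambda>f. f j) \<circ> (\<lambda>\<omega>. restrict (\<lambda>i. Y i \<omega>) {j}))"
    using i by (intro indep_var_compose[OF indep_var_restrict[OF assms(1)]]) auto
  moreover have "((\<lambda>f. f k) \<circ> (\<lambda>\<omega>. restrict (\<lambda>i. Y i \<omega>) {k})) = Y k" for k
    by auto
  ultimately show ?thesis by simp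
qed

locale local_alternatives_array = local_alternatives P h hl Q K for P h hl Q K +
  fixes M :: "nat \<Rightarrow> 'a measure" and X :: "nat \<Rightarrow> nat \<Rightarrow> 'a \<Rightarrow> real"
  assumes M_prob: "\<And>n. n \<ge> 1 \<Longrightarrow> prob_space (M n)"
    and X_indep: "\<And>n. n \<ge> 1 \<Longrightarrow> prob_space.indep_vars (M n) (\<lambda>_. borel) (X n) {1..n}"
    and X_distr: "\<And>n j. 1 \<le> j \<Longrightarrow> j \<le> n \<Longrightarrow> distr (M n) borel (X n j) = Q n"
begin

lemma X_meas: "1 \<le> j \<Longrightarrow> j \<le> n \<Longrightarrow> X n j \<in> borel_measurable (M n)"
proof -
  assume j: "1 \<le> j" "j \<le> n"
  then interpret Mn: prob_space "M n" using M_prob[of n] by simp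
  show ?thesis using X_indep[of n] j unfolding Mn.indep_vars_def by auto
qed

lemma integral_X:
  fixes f :: "real \<Rightarrow> 'c :: {banach, second_countable_topology}"
  assumes j: "1 \<le> j" "j \<le> n" and f: "f \<in> borel_measurable borel"
  shows "(\<integral>\<omega>. f (X n j \<omega>) \<partial>M n) = (\<integral>x. f x \<partial>Q n)"
    "integrable (M n) (\<lambda>\<omega>. f (X n j \<omega>)) \<longleftrightarrow> integrable (Q n) f"
  unfolding X_distr[OF j, symmetric]
  using integral_distr[OF X_meas[OF j] f] integrable_distr_eq[OF X_meas[OF j] f] by simp_all

text \<open>The diagonal terms contribute the second moment of \<open>f\<close> under \<open>Q n\<close>. Each off-diagonal term is the square of the
mean \<open>\<integral>f h\<^sub>n dP / \<surd>n\<close>; together they contribute at most \<open>(\<integral>f h\<^sub>n dP)\<^sup>2\<close>, which Cauchy--Schwarz bounds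
by a multiple of \<open>\<integral>f\<^sup>2 dP\<close>. The fourth moment of \<open>f\<close> enters only with the factor \<open>1 / \<surd>n\<close>, so functions
of small \<open>L\<^sup>2\<close> norm have small normalized sums once \<open>n\<close> is large.\<close>

lemma normalized_sum_second_moment:
  assumes n: "n \<ge> 1" and f[measurable]: "f \<in> borel_measurable borel" and f4: "integrable P (\<lambda>x. f x ^ 4)"
    and f0: "(\<integral>x. f x \<partial>P) = 0"
  shows "integrable (M n) (\<lambda>\<omega>. (1 / sqrt (real n) * (\<Sum>j=1..n. f (X n j \<omega>)))\<^sup>2)"
    "(\<integral>\<omega>. (1 / sqrt (real n) * (\<Sum>j=1..n. f (X n j \<omega>)))\<^sup>2 \<partial>M n) \<le>
      (2 + K) * (\<integral>x. (f x)\<^sup>2 \<partial>P) + ((\<integral>x. f x ^ 4 \<partial>P) + (1 + K)) / sqrt (real n)"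
proof -
  interpret Mn: prob_space "M n" by (rule M_prob[OF n])
  have fL2: "f \<in> L2_fun P" by (rule L2_of_L4[OF f f4])
  have f2L2: "(\<lambda>x. (f x)\<^sup>2) \<in> L2_fun P"
    using f4 by (simp add: L2_fun_def power_mult[symmetric])
  define a where "a = (\<integral>x. f x * h n x \<partial>P)"
  define b where "b = (\<integral>x. (f x)\<^sup>2 \<partial>P) + (\<integral>x. (f x)\<^sup>2 * h n x \<partial>P) / sqrt (real n)"
  have mean: "(\<integral>\<omega>. f (X n j \<omega>) \<partial>M n) = a / sqrt (real n)" "integrable (M n) (\<lambda>\<omega>. f (X n j \<omega>))"
    if "j \<in> {1..n}" for j
    using that integral_X[of j n f] integral_Q[OF n fL2] f0 by (auto simp: a_def)
  have sq: "(\<integral>\<omega>. (f (X n j \<omega>))\<^sup>2 \<partial>M n) = b" "integrable (M n) (\<lambda>\<omega>. (f (X n j \<omega>))\<^sup>2)"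
    if "j \<in> {1..n}" for j
    using that integral_X[of j n "\<lambda>x. (f x)\<^sup>2"] integral_Q[OF n f2L2] by (auto simp: b_def)
  have prod: "integrable (M n) (\<lambda>\<omega>. f (X n i \<omega>) * f (X n j \<omega>))"
    "(\<integral>\<omega>. f (X n i \<omega>) * f (X n j \<omega>) \<partial>M n) = (if i = j then b else a\<^sup>2 / real n)"
    if i: "i \<in> {1..n}" and j: "j \<in> {1..n}" for i j
  proof -
    have "integrable (M n) (\<lambda>\<omega>. f (X n i \<omega>) * f (X n j \<omega>)) \<and>
      (\<integral>\<omega>. f (X n i \<omega>) * f (X n j \<omega>) \<partial>M n) = (if i = j then b else a\<^sup>2 / real n)"
    proof (cases "i = j")
      case True
      then show ?thesis using sq[OF j] by (simp add: power2_eq_square)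
    next
      case False
      have "Mn.indep_vars (\<lambda>_. borel) (\<lambda>j \<omega>. f (X n j \<omega>)) {1..n}"
        by (rule Mn.indep_vars_compose2[OF X_indep[OF n]]) simp
      then have ind: "Mn.indep_var borel (\<lambda>\<omega>. f (X n i \<omega>)) borel (\<lambda>\<omega>. f (X n j \<omega>))"
        by (rule Mn.indep_var_of_indep_vars[where Y = "\<lambda>j \<omega>. f (X n j \<omega>)", OF _ i j False])
      show ?thesis
        using Mn.indep_var_lebesgue_integral[OF ind mean(2)[OF i] mean(2)[OF j]]
          Mn.indep_var_integrable[OF ind mean(2)[OF i] mean(2)[OF j]] mean(1)[OF i] mean(1)[OF j] False n
        by (simp add: power2_eq_square)
    qed
    then show "integrable (M n) (\<lambda>\<omega>. f (X n i \<omega>) * f (X n j \<omega>))"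
      "(\<integral>\<omega>. f (X n i \<omega>) * f (X n j \<omega>) \<partial>M n) = (if i = j then b else a\<^sup>2 / real n)" by auto
  qed
  have eq: "(1 / sqrt (real n) * (\<Sum>j=1..n. f (X n j \<omega>)))\<^sup>2 =
      (\<Sum>i=1..n. \<Sum>j=1..n. f (X n i \<omega>) * f (X n j \<omega>)) / real n" for \<omega>
    using n by (simp add: power_mult_distrib power_divide power2_eq_square[of "sum _ _"] sum_product)
  show "integrable (M n) (\<lambda>\<omega>. (1 / sqrt (real n) * (\<Sum>j=1..n. f (X n j \<omega>)))\<^sup>2)"
    unfolding eq using prod(1) by (intro integrable_divide Bochner_Integration.integrable_sum) auto
  have "(\<integral>\<omega>. (1 / sqrt (real n) * (\<Sum>j=1..n. f (X n j \<omega>)))\<^sup>2 \<partial>M n) =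
      (\<Sum>i=1..n. \<Sum>j=1..n. \<integral>\<omega>. f (X n i \<omega>) * f (X n j \<omega>) \<partial>M n) / real n"
  proof -
    have "(\<integral>\<omega>. (\<Sum>i=1..n. \<Sum>j=1..n. f (X n i \<omega>) * f (X n j \<omega>)) \<partial>M n) =
        (\<Sum>i=1..n. \<integral>\<omega>. (\<Sum>j=1..n. f (X n i \<omega>) * f (X n j \<omega>)) \<partial>M n)"
      using prod(1) by (intro Bochner_Integration.integral_sum Bochner_Integration.integrable_sum) auto
    also have "\<dots> = (\<Sum>i=1..n. \<Sum>j=1..n. \<integral>\<omega>. f (X n i \<omega>) * f (X n j \<omega>) \<partial>M n)"
      using prod(1) by (intro sum.cong refl Bochner_Integration.integral_sum) auto
    finally show ?thesis unfolding eq by simp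
  qed
  also have "\<dots> \<le> (\<Sum>i=1..n. \<Sum>j=1..n. (if i = j then b else 0) + a\<^sup>2 / real n) / real n"
    by (intro divide_right_mono sum_mono) (auto simp: prod(2))
  also have "(\<Sum>i=1..n. \<Sum>j=1..n. (if i = j then b else 0) + a\<^sup>2 / real n) = (\<Sum>i=1..n. b + a\<^sup>2)"
    using n by (intro sum.cong refl) (simp add: sum.distrib)
  also have "(\<Sum>i=1..n. b + a\<^sup>2) / real n = b + a\<^sup>2" using n by simp
  also have "\<dots> \<le> (\<integral>x. (f x)\<^sup>2 \<partial>P) + ((\<integral>x. f x ^ 4 \<partial>P) + (1 + K)) / sqrt (real n) + (\<integral>x. (f x)\<^sup>2 \<partial>P) * (1 + K)"
  proof -
    have "(\<integral>x. (f x)\<^sup>2 * h n x \<partial>P) \<le> (\<integral>x. f x ^ 4 + (h n x)\<^sup>2 \<partial>P)"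
    proof (rule integral_mono)
      show "integrable P (\<lambda>x. (f x)\<^sup>2 * h n x)" by (rule integrable_L2_mult[OF f2L2 h_L2[OF n]])
      show "integrable P (\<lambda>x. f x ^ 4 + (h n x)\<^sup>2)" using f4 L2_fun_integrable[OF h_L2[OF n]] by simp
      show "(f x)\<^sup>2 * h n x \<le> f x ^ 4 + (h n x)\<^sup>2" for x
        using mult_abs_le_sum_squares[of "(f x)\<^sup>2" "h n x"] by (simp add: power_mult[symmetric])
    qed
    also have "\<dots> \<le> (\<integral>x. f x ^ 4 \<partial>P) + (1 + K)"
      using f4 L2_fun_integrable[OF h_L2[OF n]] h_L2_bound[OF n] by simp
    finally have "b \<le> (\<integral>x. (f x)\<^sup>2 \<partial>P) + ((\<integral>x. f x ^ 4 \<partial>P) + (1 + K)) / sqrt (real n)"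
      unfolding b_def by (simp add: divide_right_mono)
    moreover have "a\<^sup>2 \<le> (\<integral>x. (f x)\<^sup>2 \<partial>P) * (1 + K)"
      unfolding a_def
      by (rule order.trans[OF Cauchy_Schwarz_L2[OF fL2 h_L2[OF n]]]) (intro mult_left_mono h_L2_bound n, simp)
    ultimately show ?thesis by simp
  qed
  finally show "(\<integral>\<omega>. (1 / sqrt (real n) * (\<Sum>j=1..n. f (X n j \<omega>)))\<^sup>2 \<partial>M n) \<le>
      (2 + K) * (\<integral>x. (f x)\<^sup>2 \<partial>P) + ((\<integral>x. f x ^ 4 \<partial>P) + (1 + K)) / sqrt (real n)"
    by (simp add: algebra_simps)
qed

text \<open>Let \<open>\<phi>\<^sub>n\<close> be the expectation of \<open>exp(i f / \<surd>n)\<close> under \<open>Q n\<close>. A Taylor expansion gives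
\<open>n (\<phi>\<^sub>n - 1) = i \<integral>f h\<^sub>n dP - \<integral>f\<^sup>2 dP / 2 + O(n\<^bsup>-1/2\<^esup>)\<close>: the first-order term of the exponential meets the
perturbation \<open>h\<^sub>n / \<surd>n\<close> of the density, the second-order term meets \<open>P\<close>, and the remaining term of
order \<open>\<surd>n\<close> vanishes because \<open>f\<close> is centered. Then \<open>\<phi>\<^sub>n\<^bsup>n\<^esup>\<close> is compared with \<open>exp(z / n)\<^bsup>n\<^esup>\<close> by
\<open>\<bar>a\<^bsup>n\<^esup> - b\<^bsup>n\<^esup>\<bar> \<le> n \<bar>a - b\<bar>\<close> in the closed unit disc.\<close>

lemma normalized_sum_char_tendsto:
  assumes f[measurable]: "f \<in> borel_measurable borel" and f4: "integrable P (\<lambda>x. f x ^ 4)"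
    and f0: "(\<integral>x. f x \<partial>P) = 0"
  shows "(\<lambda>n. \<integral>\<omega>. iexp (1 / sqrt (real n) * (\<Sum>j=1..n. f (X n j \<omega>))) \<partial>M n) \<longlonglongrightarrow>
    exp (\<i> * complex_of_real (\<integral>x. f x * hl x \<partial>P) - complex_of_real (\<integral>x. (f x)\<^sup>2 \<partial>P) / 2)"
proof -
  have fL2: "f \<in> L2_fun P" by (rule L2_of_L4[OF f f4])
  have f2L2: "(\<lambda>x. (f x)\<^sup>2) \<in> L2_fun P" using f4 by (simp add: L2_fun_def power_mult[symmetric])
  define z where "z = \<i> * complex_of_real (\<integral>x. f x * hl x \<partial>P) - complex_of_real (\<integral>x. (f x)\<^sup>2 \<partial>P) / 2"
  define z' where "z' n = \<i> * complex_of_real (\<integral>x. f x * h n x \<partial>P) - complex_of_real (\<integral>x. (f x)\<^sup>2 \<partial>P) / 2" for n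
  define \<phi> where "\<phi> n = (\<integral>x. iexp (f x / sqrt (real n)) \<partial>Q n)" for n
  define C where "C = (1 + (\<integral>x. f x ^ 4 \<partial>P)) + ((\<integral>x. f x ^ 4 \<partial>P) + (1 + K))"
  have z'z: "z' \<longlonglongrightarrow> z"
    unfolding z'_def z_def
    by (intro tendsto_diff[OF tendsto_mult[OF tendsto_const tendsto_of_real] tendsto_const] integral_mult_h_tendsto f f4)
  have expand: "cmod (of_nat n * (\<phi> n - 1) - z' n) \<le> C / sqrt (real n)" if n: "n \<ge> 1" for n
  proof -
    define r where "r = sqrt (real n)"
    have r: "r > 0" "r * r = real n" using n by (auto simp: r_def)
    have [measurable]: "h n \<in> borel_measurable borel" using n by simp
    define w where "w x = complex_of_real (1 + h n x / r) * (iexp (f x / r) - 1)" for x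
    have iQ: "integrable (Q n) (\<lambda>x. iexp (f x / sqrt (real n)))"
    proof -
      interpret Qn: prob_space "Q n" by (rule Q_prob[OF n])
      have [measurable]: "f \<in> borel_measurable (Q n)"
        using f unfolding measurable_cong_sets[OF sets_Q[OF n] refl] .
      show ?thesis by (rule Qn.integrable_iexp) auto
    qed
    have w: "\<phi> n - 1 = (\<integral>x. w x \<partial>P)"
    proof -
      interpret Qn: prob_space "Q n" by (rule Q_prob[OF n])
      have "\<phi> n - 1 = (\<integral>x. iexp (f x / r) - 1 \<partial>Q n)"
        unfolding \<phi>_def r_def using iQ Qn.prob_space by simp
      also have "\<dots> = (\<integral>x. (1 + h n x / sqrt (real n)) *\<^sub>R (iexp (f x / r) - 1) \<partial>P)"
        unfolding Q_def[OF n] by (rule integral_density) (use Q_nonneg[OF n] in auto)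
      also have "\<dots> = (\<integral>x. w x \<partial>P)" by (simp add: w_def r_def scaleR_conv_of_real)
      finally show ?thesis .
    qed
    have wi: "integrable P w"
    proof (rule Bochner_Integration.integrable_bound[of _ "\<lambda>x. 2 * (1 + \<bar>h n x\<bar> / r)"])
      show "integrable P (\<lambda>x. 2 * (1 + \<bar>h n x\<bar> / r))" using L1_of_L2[OF h_L2[OF n]] by simp
      show "w \<in> borel_measurable P" unfolding w_def by measurable
      show "AE x in P. norm (w x) \<le> norm (2 * (1 + \<bar>h n x\<bar> / r))"
      proof (intro AE_I2)
        fix x
        have "cmod (iexp (f x / r) - 1) \<le> 2" using norm_triangle_ineq4[of "iexp (f x / r)" 1] by simp
        moreover have "cmod (complex_of_real (1 + h n x / r)) \<le> 1 + \<bar>h n x\<bar> / r"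
          using r by (simp only: norm_of_real) (simp add: abs_triangle_ineq[THEN order.trans])
        ultimately have "norm (w x) \<le> (1 + \<bar>h n x\<bar> / r) * 2"
          unfolding w_def norm_mult using r by (intro mult_mono) auto
        then show "norm (w x) \<le> norm (2 * (1 + \<bar>h n x\<bar> / r))"
          using r by (subst mult.commute) simp
      qed
    qed
    \<comment> \<open>The principal part of \<open>n w\<close>; its last summand integrates to 0 because \<open>f\<close> is centered.\<close>
    define v where "v x = \<i> * complex_of_real (f x * h n x) - complex_of_real ((f x)\<^sup>2) / 2 + \<i> * complex_of_real (r * f x)" for x
    have fi: "integrable P f" "integrable P (\<lambda>x. f x * h n x)" "integrable P (\<lambda>x. (f x)\<^sup>2)"
      using L1_of_L2[OF fL2] integrable_L2_mult[OF fL2 h_L2[OF n]] L2_fun_integrable[OF fL2] by auto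
    have vi: "integrable P v"
      unfolding v_def using fi
      by (intro Bochner_Integration.integrable_add Bochner_Integration.integrable_diff integrable_mult_right integrable_divide integrable_of_real) auto
    have vint: "(\<integral>x. v x \<partial>P) = z' n"
    proof -
      have "(\<integral>x. v x \<partial>P) = \<i> * complex_of_real (\<integral>x. f x * h n x \<partial>P) - complex_of_real (\<integral>x. (f x)\<^sup>2 \<partial>P) / 2
          + \<i> * complex_of_real (r * (\<integral>x. f x \<partial>P))"
        unfolding v_def using fi
        by (simp del: of_real_mult of_real_power add: integrable_of_real)
      then show ?thesis by (simp add: z'_def f0)
    qed
    have pt: "cmod (of_nat n * w x - v x) \<le> ((1 + f x ^ 4) + (f x ^ 4 + (h n x)\<^sup>2)) / r" for x
    proof -
      define y where "y = f x / r"
      \<comment> \<open>Taylor remainders of the exponential after the quadratic and after the linear term.\<close>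
      define e2 where "e2 = iexp y - (\<Sum>k\<le>2. (\<i> * y) ^ k / fact k)"
      define e1 where "e1 = iexp y - (\<Sum>k\<le>1. (\<i> * y) ^ k / fact k)"
      have b2: "cmod e2 \<le> \<bar>y\<bar> ^ 3 / 6"
        using iexp_approx1[of y 2] by (simp add: e2_def fact_numeral eval_nat_numeral)
      have b1: "cmod e1 \<le> \<bar>y\<bar> ^ 2 / 2"
        using iexp_approx1[of y 1] by (simp add: e1_def fact_numeral eval_nat_numeral)
      have e2: "e2 = iexp y - 1 - \<i> * y + (complex_of_real y)\<^sup>2 / 2"
        by (simp add: e2_def eval_nat_numeral algebra_simps)
      have e1: "e1 = iexp y - 1 - \<i> * y" by (simp add: e1_def)
      have nr: "(of_nat n :: complex) = complex_of_real r * complex_of_real r"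
        using r(2) by (metis of_real_mult of_real_of_nat_eq)
      have fy: "f x = r * y" using r by (simp add: y_def)
      have "of_nat n * w x - v x = complex_of_real (r * r) * e2 + complex_of_real (r * h n x) * e1"
      proof -
        have "of_nat n * complex_of_real (1 + h n x / r) = complex_of_real (r * r) + complex_of_real (r * h n x)"
          unfolding nr of_real_mult[symmetric] of_real_add[symmetric] using r(1) by (simp add: field_simps)
        then have "of_nat n * w x = (complex_of_real (r * r) + complex_of_real (r * h n x)) * (iexp y - 1)"
          unfolding w_def y_def by (simp only: mult.assoc[symmetric])
        then show ?thesis
          unfolding v_def e1 e2 fy by (simp add: algebra_simps power2_eq_square)
      qed
      then have "cmod (of_nat n * w x - v x) \<le> (r * r) * cmod e2 + (r * \<bar>h n x\<bar>) * cmod e1"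
        using norm_triangle_ineq[of "complex_of_real (r * r) * e2" "complex_of_real (r * h n x) * e1"] r(1)
        by (simp add: norm_mult abs_mult)
      also have "\<dots> \<le> (r * r) * (\<bar>y\<bar> ^ 3 / 6) + (r * \<bar>h n x\<bar>) * (\<bar>y\<bar> ^ 2 / 2)"
        using r(1) b1 b2 by (intro add_mono mult_left_mono) auto
      also have "\<dots> = (\<bar>f x\<bar> ^ 3 / 6 + \<bar>h n x\<bar> * \<bar>f x\<bar> ^ 2 / 2) / r"
        using r(1) by (simp add: y_def field_simps eval_nat_numeral)
      also have "\<dots> \<le> ((1 + f x ^ 4) + (f x ^ 4 + (h n x)\<^sup>2)) / r"
      proof (intro divide_right_mono add_mono)
        have "\<bar>f x\<bar> ^ 3 = \<bar>\<bar>f x\<bar> * (f x)\<^sup>2\<bar>" by (simp add: eval_nat_numeral abs_mult)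
        also have "\<dots> \<le> \<bar>f x\<bar>\<^sup>2 + ((f x)\<^sup>2)\<^sup>2" by (rule mult_abs_le_sum_squares)
        also have "\<dots> \<le> 1 + f x ^ 4 + f x ^ 4" using square_le_4[of "f x"] by (simp add: power_mult[symmetric])
        finally have c: "\<bar>f x\<bar> ^ 3 \<le> 1 + f x ^ 4 + f x ^ 4" .
        have "0 \<le> f x ^ 4" by simp
        then show "\<bar>f x\<bar> ^ 3 / 6 \<le> 1 + f x ^ 4" using c by linarith
        have "\<bar>h n x\<bar> * \<bar>f x\<bar>\<^sup>2 = \<bar>(f x)\<^sup>2 * h n x\<bar>" by (simp add: abs_mult)
        also have "\<dots> \<le> ((f x)\<^sup>2)\<^sup>2 + (h n x)\<^sup>2" by (rule mult_abs_le_sum_squares)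
        finally have d: "\<bar>h n x\<bar> * \<bar>f x\<bar>\<^sup>2 \<le> f x ^ 4 + (h n x)\<^sup>2" by (simp add: power_mult[symmetric])
        have "0 \<le> f x ^ 4 + (h n x)\<^sup>2" by simp
        then show "\<bar>h n x\<bar> * \<bar>f x\<bar>\<^sup>2 / 2 \<le> f x ^ 4 + (h n x)\<^sup>2" using d by linarith
      qed (use r in simp)
      finally show ?thesis .
    qed
    have bi: "integrable P (\<lambda>x. ((1 + f x ^ 4) + (f x ^ 4 + (h n x)\<^sup>2)) / r)"
      using f4 L2_fun_integrable[OF h_L2[OF n]] by simp
    have "of_nat n * (\<phi> n - 1) - z' n = (\<integral>x. of_nat n * w x - v x \<partial>P)"
      unfolding w vint[symmetric] using wi vi by simp
    also have "cmod (\<integral>x. of_nat n * w x - v x \<partial>P) \<le> (\<integral>x. cmod (of_nat n * w x - v x) \<partial>P)"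
      by (rule integral_norm_bound)
    also have "\<dots> \<le> (\<integral>x. ((1 + f x ^ 4) + (f x ^ 4 + (h n x)\<^sup>2)) / r \<partial>P)"
      using wi vi by (intro integral_mono bi pt integrable_norm) auto
    also have "\<dots> = ((1 + (\<integral>x. f x ^ 4 \<partial>P)) + ((\<integral>x. f x ^ 4 \<partial>P) + (\<integral>x. (h n x)\<^sup>2 \<partial>P))) / r"
      using f4 L2_fun_integrable[OF h_L2[OF n]] prob_space by simp
    also have "\<dots> \<le> C / r"
      unfolding C_def using h_L2_bound[OF n] r by (intro divide_right_mono) auto
    finally show ?thesis by (simp add: r_def)
  qed
  have inv0: "(\<lambda>n. C / sqrt (real n)) \<longlonglongrightarrow> 0"
    by (rule tendsto_divide_sqrt_0)
  have "(\<lambda>n. of_nat n * (\<phi> n - 1) - z' n) \<longlonglongrightarrow> 0"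
    by (rule Lim_null_comparison[OF _ inv0]) (use expand in \<open>auto simp: eventually_sequentially intro!: exI[of _ 1]\<close>)
  from tendsto_add[OF this z'z] have nz: "(\<lambda>n. of_nat n * (\<phi> n - 1)) \<longlonglongrightarrow> z" by simp
  have ez: "(\<lambda>n. of_nat n * (exp (z / of_nat n) - 1)) \<longlonglongrightarrow> z"
  proof (cases "z = 0")
    case False
    have "((\<lambda>w. (exp w - exp 0) / (w - 0)) \<longlongrightarrow> exp 0) (at (0::complex))"
      using DERIV_exp[of "0::complex"] by (simp add: has_field_derivative_iff)
    moreover have "filterlim (\<lambda>n. z / of_nat n) (at 0) sequentially"
      using False by (auto simp: filterlim_at intro!: tendsto_divide_0[OF tendsto_const] tendsto_of_nat
         eventually_sequentiallyI[of 1])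
    ultimately have "(\<lambda>n. (exp (z / of_nat n) - 1) / (z / of_nat n)) \<longlonglongrightarrow> 1"
      using filterlim_compose by fastforce
    from tendsto_mult[OF this tendsto_const[of z]] show ?thesis
      using False by (simp add: mult.commute)
  qed simp
  have powdiff: "(\<lambda>n. \<phi> n ^ n - exp (z / of_nat n) ^ n) \<longlonglongrightarrow> 0"
  proof (rule Lim_null_comparison)
    show "(\<lambda>n. cmod (of_nat n * (\<phi> n - 1) - of_nat n * (exp (z / of_nat n) - 1))) \<longlonglongrightarrow> 0"
      using tendsto_norm[OF tendsto_diff[OF nz ez]] by simp
    have "norm (\<phi> n ^ n - exp (z / of_nat n) ^ n) \<le> cmod (of_nat n * (\<phi> n - 1) - of_nat n * (exp (z / of_nat n) - 1))"
      if n: "n \<ge> 1" for n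
    proof -
      interpret Qn: prob_space "Q n" by (rule Q_prob[OF n])
      have "norm (\<phi> n) \<le> (\<integral>x. norm (iexp (f x / sqrt (real n))) \<partial>Q n)"
        unfolding \<phi>_def by (rule integral_norm_bound)
      also have "\<dots> = 1" by (simp add: Qn.prob_space)
      finally have 1: "norm (\<phi> n) \<le> 1" .
      have "Re (z / of_nat n) = - ((\<integral>x. (f x)\<^sup>2 \<partial>P) / 2) / real n"
        by (simp add: z_def Re_divide_of_nat)
      also have "\<dots> \<le> 0" by (simp add: divide_nonneg_nonneg)
      finally have 2: "norm (exp (z / of_nat n)) \<le> 1" by (simp add: norm_exp_eq_Re)
      have "norm (\<phi> n ^ n - exp (z / of_nat n) ^ n) \<le> n * norm (\<phi> n - exp (z / of_nat n))"
        by (rule norm_power_diff[OF 1 2])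
      also have "\<dots> = norm (of_nat n * (\<phi> n - exp (z / of_nat n)))" by (simp add: norm_mult)
      finally show ?thesis by (simp add: algebra_simps)
    qed
    then show "\<forall>\<^sub>F n in sequentially. norm (\<phi> n ^ n - exp (z / of_nat n) ^ n)
        \<le> cmod (of_nat n * (\<phi> n - 1) - of_nat n * (exp (z / of_nat n) - 1))"
      by (auto simp: eventually_sequentially)
  qed
  have exppow: "exp (z / of_nat n) ^ n = exp z" if "n \<ge> 1" for n
    using that by (simp add: exp_of_nat_mult[symmetric])
  have char: "(\<integral>\<omega>. iexp (1 / sqrt (real n) * (\<Sum>j=1..n. f (X n j \<omega>))) \<partial>M n) = \<phi> n ^ n" if n: "n \<ge> 1" for n
  proof -
    interpret Mn: prob_space "M n" by (rule M_prob[OF n])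
    have ind: "Mn.indep_vars (\<lambda>_. borel) (\<lambda>j \<omega>. f (X n j \<omega>)) {1..n}"
      by (rule Mn.indep_vars_compose2[OF X_indep[OF n]]) simp
    have m: "(\<lambda>\<omega>. f (X n j \<omega>)) \<in> borel_measurable (M n)" if "j \<in> {1..n}" for j
      using that X_meas[of j n] by (intro measurable_compose[OF _ f]) auto
    have "(\<integral>\<omega>. iexp (1 / sqrt (real n) * (\<Sum>j=1..n. f (X n j \<omega>))) \<partial>M n)
       = char (distr (M n) borel (\<lambda>\<omega>. \<Sum>j=1..n. f (X n j \<omega>))) (1 / sqrt (real n))"
      unfolding char_def using m by (subst integral_distr) auto
    also have "\<dots> = (\<Prod>j=1..n. char (distr (M n) borel (\<lambda>\<omega>. f (X n j \<omega>))) (1 / sqrt (real n)))"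
      by (rule Mn.char_distr_sum[OF ind])
    also have "\<dots> = (\<Prod>j=1..n. \<phi> n)"
    proof (rule prod.cong[OF refl])
      fix j assume j: "j \<in> {1..n}"
      have "char (distr (M n) borel (\<lambda>\<omega>. f (X n j \<omega>))) (1 / sqrt (real n)) =
          (\<integral>\<omega>. iexp (f (X n j \<omega>) / sqrt (real n)) \<partial>M n)"
        unfolding char_def using m[OF j] by (subst integral_distr) auto
      also have "\<dots> = \<phi> n"
        unfolding \<phi>_def using j by (intro integral_X) auto
      finally show "char (distr (M n) borel (\<lambda>\<omega>. f (X n j \<omega>))) (1 / sqrt (real n)) = \<phi> n" .
    qed
    also have "\<dots> = \<phi> n ^ n" by simp
    finally show ?thesis .
  qed
  have "(\<lambda>n. (\<phi> n ^ n - exp (z / of_nat n) ^ n) + exp z) \<longlonglongrightarrow> 0 + exp z"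
    by (intro tendsto_add powdiff tendsto_const)
  then have "(\<lambda>n. \<integral>\<omega>. iexp (1 / sqrt (real n) * (\<Sum>j=1..n. f (X n j \<omega>))) \<partial>M n) \<longlonglongrightarrow> 0 + exp z"
    by (rule Lim_transform_eventually)
       (use char exppow in \<open>auto simp: eventually_sequentially intro!: exI[of _ 1]\<close>)
  then show ?thesis by (simp add: z_def)
qed

end

section \<open>Gaussian series\<close>

abbreviation gauss_seq :: "(nat \<Rightarrow> real) measure" where
  "gauss_seq \<equiv> PiM UNIV (\<lambda>_. std_normal_distribution)"

lemma prob_space_std_normal: "prob_space std_normal_distribution"
  by (rule prob_space_normal_density) simp

interpretation gauss_seq: prob_space gauss_seq
  by (intro prob_space_PiM prob_space_std_normal)

lemma sets_gauss_seq [measurable_cong]: "sets gauss_seq = sets (PiM UNIV (\<lambda>_::nat. borel :: real measure))"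
  by (intro sets_PiM_cong) auto

lemma space_gauss_seq: "space gauss_seq = UNIV"
  by (simp add: space_PiM)

lemma distr_gauss_seq_coord: "distr gauss_seq borel (\<lambda>\<omega>. \<omega> j) = std_normal_distribution"
proof -
  have "distr gauss_seq std_normal_distribution (\<lambda>\<omega>. \<omega> j) = std_normal_distribution"
    by (rule distr_PiM_component) (auto intro: prob_space_std_normal)
  moreover have "distr gauss_seq std_normal_distribution (\<lambda>\<omega>. \<omega> j) = distr gauss_seq borel (\<lambda>\<omega>. \<omega> j)"
    by (rule distr_cong) auto
  ultimately show ?thesis by simp
qed

lemma indep_vars_gauss_seq: "gauss_seq.indep_vars (\<lambda>_. borel) (\<lambda>j \<omega>. \<omega> j) UNIV"
proof (subst gauss_seq.indep_vars_iff_distr_eq_PiM')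
  have "distr gauss_seq (PiM UNIV (\<lambda>_. borel)) (\<lambda>x. \<lambda>i\<in>UNIV. x i) = distr gauss_seq gauss_seq (\<lambda>x. x)"
    by (rule distr_cong) (auto simp: sets_gauss_seq)
  also have "\<dots> = gauss_seq" by (rule distr_id)
  finally show "distr gauss_seq (PiM UNIV (\<lambda>_. borel)) (\<lambda>x. \<lambda>i\<in>UNIV. x i)
      = PiM UNIV (\<lambda>i. distr gauss_seq borel (\<lambda>\<omega>. \<omega> i))"
    by (simp add: distr_gauss_seq_coord)
qed auto

lemma gauss_seq_coord_moments:
  shows "integrable gauss_seq (\<lambda>\<omega>. \<omega> j)" "(\<integral>\<omega>. \<omega> j \<partial>gauss_seq) = 0"
    "integrable gauss_seq (\<lambda>\<omega>. (\<omega> j)\<^sup>2)" "(\<integral>\<omega>. (\<omega> j)\<^sup>2 \<partial>gauss_seq) = 1"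
proof -
  have "integrable (distr gauss_seq borel (\<lambda>\<omega>. \<omega> j)) (\<lambda>x. x ^ k)" for k
    unfolding distr_gauss_seq_coord by (rule integrable_std_normal_distribution_moment)
  then have i: "integrable gauss_seq (\<lambda>\<omega>. (\<omega> j) ^ k)" for k
    by (subst (asm) integrable_distr_eq) auto
  have e: "(\<integral>\<omega>. (\<omega> j) ^ k \<partial>gauss_seq) = (\<integral>x. x ^ k \<partial>std_normal_distribution)" for k
  proof -
    have "(\<integral>x. x ^ k \<partial>distr gauss_seq borel (\<lambda>\<omega>. \<omega> j)) = (\<integral>\<omega>. (\<omega> j) ^ k \<partial>gauss_seq)"
      by (rule integral_distr) auto
    then show ?thesis by (simp only: distr_gauss_seq_coord)
  qed
  show "integrable gauss_seq (\<lambda>\<omega>. \<omega> j)" "integrable gauss_seq (\<lambda>\<omega>. (\<omega> j)\<^sup>2)"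
    using i[of 1] i[of 2] by auto
  show "(\<integral>\<omega>. \<omega> j \<partial>gauss_seq) = 0"
    using e[of 1] integral_std_normal_distribution_moment_odd[of 1] by simp
  show "(\<integral>\<omega>. (\<omega> j)\<^sup>2 \<partial>gauss_seq) = 1"
    using e[of 2] std_normal_distribution_even_moments(1)[of 1] by (simp add: eval_nat_numeral)
qed

lemma gauss_seq_coord_mult:
  shows "integrable gauss_seq (\<lambda>\<omega>. \<omega> i * \<omega> j)" "(\<integral>\<omega>. \<omega> i * \<omega> j \<partial>gauss_seq) = (if i = j then 1 else 0)"
proof -
  have "integrable gauss_seq (\<lambda>\<omega>. \<omega> i * \<omega> j) \<and> (\<integral>\<omega>. \<omega> i * \<omega> j \<partial>gauss_seq) = (if i = j then 1 else 0)"
  proof (cases "i = j")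
    case True
    then show ?thesis using gauss_seq_coord_moments[of j] by (simp add: power2_eq_square)
  next
    case False
    have ind: "gauss_seq.indep_var borel (\<lambda>\<omega>. \<omega> i) borel (\<lambda>\<omega>. \<omega> j)"
      by (rule gauss_seq.indep_var_of_indep_vars[where Y = "\<lambda>j \<omega>. \<omega> j", OF indep_vars_gauss_seq UNIV_I UNIV_I False])
    show ?thesis
      using gauss_seq.indep_var_lebesgue_integral[OF ind gauss_seq_coord_moments(1) gauss_seq_coord_moments(1)]
        gauss_seq.indep_var_integrable[OF ind gauss_seq_coord_moments(1) gauss_seq_coord_moments(1)] False
      by (simp add: gauss_seq_coord_moments(2))
  qed
  then show "integrable gauss_seq (\<lambda>\<omega>. \<omega> i * \<omega> j)" "(\<integral>\<omega>. \<omega> i * \<omega> j \<partial>gauss_seq) = (if i = j then 1 else 0)"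
    by auto
qed

lemma gauss_seq_char:
  "(\<integral>\<omega>. iexp (\<Sum>j<m. \<omega> j * \<theta> j) \<partial>gauss_seq) = complex_of_real (exp (- (\<Sum>j<m. (\<theta> j)\<^sup>2) / 2))"
proof -
  have ind: "gauss_seq.indep_vars (\<lambda>_. borel) (\<lambda>j \<omega>. \<omega> j * \<theta> j) {..<m}"
    using gauss_seq.indep_vars_compose2[OF gauss_seq.indep_vars_subset[OF indep_vars_gauss_seq subset_UNIV],
      of "{..<m}" "\<lambda>j x. x * \<theta> j" "\<lambda>_. borel"] by simp
  have "(\<integral>\<omega>. iexp (\<Sum>j<m. \<omega> j * \<theta> j) \<partial>gauss_seq) = char (distr gauss_seq borel (\<lambda>\<omega>. \<Sum>j<m. \<omega> j * \<theta> j)) 1"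
    unfolding char_def by (subst integral_distr) auto
  also have "\<dots> = (\<Prod>j<m. char (distr gauss_seq borel (\<lambda>\<omega>. \<omega> j * \<theta> j)) 1)"
    by (rule gauss_seq.char_distr_sum[OF ind])
  also have "\<dots> = (\<Prod>j<m. complex_of_real (exp (- ((\<theta> j)\<^sup>2) / 2)))"
  proof (rule prod.cong[OF refl])
    fix j
    have "char (distr gauss_seq borel (\<lambda>\<omega>. \<omega> j * \<theta> j)) 1 = (\<integral>\<omega>. iexp (\<theta> j * \<omega> j) \<partial>gauss_seq)"
      unfolding char_def by (subst integral_distr) (auto simp: mult.commute)
    also have "\<dots> = char (distr gauss_seq borel (\<lambda>\<omega>. \<omega> j)) (\<theta> j)"
      unfolding char_def by (subst integral_distr) auto
    finally show "char (distr gauss_seq borel (\<lambda>\<omega>. \<omega> j * \<theta> j)) 1 = complex_of_real (exp (- ((\<theta> j)\<^sup>2) / 2))"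
      by (simp add: distr_gauss_seq_coord char_std_normal_distribution)
  qed
  also have "\<dots> = complex_of_real (exp (- (\<Sum>j<m. (\<theta> j)\<^sup>2) / 2))"
    by (simp add: exp_sum[symmetric] sum_divide_distrib sum_negf of_real_prod[symmetric] del: of_real_exp of_real_prod)
  finally show ?thesis .
qed

text \<open>The weights \<open>\<bar>a\<^sub>j\<bar>\<close> are divided evenly between the two factors. For absolutely summable \<open>a\<close> the resulting
bound does not grow with \<open>m\<close>, which makes it a dominating function for partial sums.\<close>

lemma Cauchy_Schwarz_weighted_sum:
  fixes a x :: "nat \<Rightarrow> real"
  shows "(\<Sum>j<m. x j * a j)\<^sup>2 \<le> (\<Sum>j<m. \<bar>a j\<bar>) * (\<Sum>j<m. \<bar>a j\<bar> * (x j)\<^sup>2)"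
proof -
  have "(\<Sum>j<m. x j * a j)\<^sup>2 = (\<Sum>j<m. sqrt \<bar>a j\<bar> * (sgn (a j) * sqrt \<bar>a j\<bar> * x j))\<^sup>2"
  proof (intro arg_cong[where f = "\<lambda>x. x\<^sup>2"] sum.cong refl)
    fix j
    have "sqrt \<bar>a j\<bar> * (sgn (a j) * sqrt \<bar>a j\<bar> * x j) = sgn (a j) * (sqrt \<bar>a j\<bar>)\<^sup>2 * x j"
      by (simp only: power2_eq_square mult_ac)
    also have "\<dots> = a j * x j" by (simp add: sgn_mult_abs)
    finally show "x j * a j = sqrt \<bar>a j\<bar> * (sgn (a j) * sqrt \<bar>a j\<bar> * x j)"
      by (simp only: mult.commute)
  qed
  also have "\<dots> \<le> (\<Sum>j<m. (sqrt \<bar>a j\<bar>)\<^sup>2) * (\<Sum>j<m. (sgn (a j) * sqrt \<bar>a j\<bar> * x j)\<^sup>2)"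
    by (rule Cauchy_Schwarz_ineq_sum)
  also have "\<dots> \<le> (\<Sum>j<m. \<bar>a j\<bar>) * (\<Sum>j<m. \<bar>a j\<bar> * (x j)\<^sup>2)"
    by (intro mult_mono sum_mono sum_nonneg) (auto simp: power_mult_distrib sgn_if)
  finally show ?thesis .
qed

text \<open>Where the series diverges, the value of the infinite sum is unspecified; for absolutely summable
\<open>a\<close> this is an event of probability 0.\<close>

definition gauss_series :: "(nat \<Rightarrow> real) \<Rightarrow> (nat \<Rightarrow> real) \<Rightarrow> real" where
  "gauss_series a \<omega> = (\<Sum>j. \<omega> j * a j)"

lemma gauss_series_measurable [measurable]: "gauss_series a \<in> borel_measurable gauss_seq"
  unfolding gauss_series_def[abs_def] by measurable

text \<open>Up to the factor \<open>\<Sum>\<bar>a\<^sub>j\<bar>\<close>, this weighted sum of squares dominates the square of every partial sum of the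
Gaussian series (\<open>gauss_partial_sum_bound\<close>).\<close>

lemma gauss_weight:
  assumes a: "summable (\<lambda>j. \<bar>a j\<bar>)"
  shows "AE \<omega> in gauss_seq. summable (\<lambda>j. \<bar>a j\<bar> * (\<omega> j)\<^sup>2)"
    "integrable gauss_seq (\<lambda>\<omega>. \<Sum>j. \<bar>a j\<bar> * (\<omega> j)\<^sup>2)"
proof -
  have "(\<integral>\<^sup>+\<omega>. (\<Sum>j. ennreal (\<bar>a j\<bar> * (\<omega> j)\<^sup>2)) \<partial>gauss_seq) = (\<Sum>j. \<integral>\<^sup>+\<omega>. ennreal (\<bar>a j\<bar> * (\<omega> j)\<^sup>2) \<partial>gauss_seq)"
    by (rule nn_integral_suminf) measurable
  also have "\<dots> = (\<Sum>j. ennreal \<bar>a j\<bar>)"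
    using gauss_seq_coord_moments(3,4)
    by (intro suminf_cong, subst nn_integral_eq_integral) auto
  also have "\<dots> < \<infinity>" using a by (simp add: suminf_ennreal2)
  finally have fin: "(\<integral>\<^sup>+\<omega>. (\<Sum>j. ennreal (\<bar>a j\<bar> * (\<omega> j)\<^sup>2)) \<partial>gauss_seq) < \<infinity>" .
  then have "AE \<omega> in gauss_seq. (\<Sum>j. ennreal (\<bar>a j\<bar> * (\<omega> j)\<^sup>2)) \<noteq> \<infinity>"
    by (intro nn_integral_noteq_infinite) auto
  then show s: "AE \<omega> in gauss_seq. summable (\<lambda>j. \<bar>a j\<bar> * (\<omega> j)\<^sup>2)"
    by eventually_elim (auto intro: summable_suminf_not_top)
  show "integrable gauss_seq (\<lambda>\<omega>. \<Sum>j. \<bar>a j\<bar> * (\<omega> j)\<^sup>2)"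
  proof (rule integrable_suminf)
    show "integrable gauss_seq (\<lambda>\<omega>. \<bar>a j\<bar> * (\<omega> j)\<^sup>2)" for j
      using gauss_seq_coord_moments(3) by simp
    show "AE \<omega> in gauss_seq. summable (\<lambda>j. norm (\<bar>a j\<bar> * (\<omega> j)\<^sup>2))" using s by simp
    show "summable (\<lambda>j. \<integral>\<omega>. norm (\<bar>a j\<bar> * (\<omega> j)\<^sup>2) \<partial>gauss_seq)"
      using a gauss_seq_coord_moments(4) by simp
  qed
qed

lemma gauss_series_AE_sums:
  assumes a: "summable (\<lambda>j. \<bar>a j\<bar>)"
  shows "AE \<omega> in gauss_seq. (\<lambda>j. \<omega> j * a j) sums gauss_series a \<omega>"
  using gauss_weight(1)[OF a]
proof eventually_elim
  case (elim \<omega>)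
  have "summable (\<lambda>j. \<omega> j * a j)"
  proof (rule summable_comparison_test)
    show "summable (\<lambda>j. \<bar>a j\<bar> + \<bar>a j\<bar> * (\<omega> j)\<^sup>2)" using a elim by (rule summable_add)
    have "norm (\<omega> j * a j) \<le> \<bar>a j\<bar> + \<bar>a j\<bar> * (\<omega> j)\<^sup>2" for j
    proof -
      have "\<bar>\<omega> j\<bar> \<le> 1 + (\<omega> j)\<^sup>2"
        using mult_abs_le_sum_squares[of 1 "\<omega> j"] by simp
      then have "\<bar>a j\<bar> * \<bar>\<omega> j\<bar> \<le> \<bar>a j\<bar> * (1 + (\<omega> j)\<^sup>2)" by (intro mult_left_mono) auto
      then show ?thesis by (simp add: abs_mult algebra_simps)
    qed
    then show "\<exists>N. \<forall>n\<ge>N. norm (\<omega> n * a n) \<le> \<bar>a n\<bar> + \<bar>a n\<bar> * (\<omega> n)\<^sup>2" by blast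
  qed
  then show ?case unfolding gauss_series_def by (rule summable_sums)
qed

lemma gauss_partial_sum_bound:
  fixes a \<omega> :: "nat \<Rightarrow> real"
  assumes a: "summable (\<lambda>j. \<bar>a j\<bar>)" and s: "summable (\<lambda>j. \<bar>a j\<bar> * (\<omega> j)\<^sup>2)"
  shows "(\<Sum>j<m. \<omega> j * a j)\<^sup>2 \<le> (\<Sum>j. \<bar>a j\<bar>) * (\<Sum>j. \<bar>a j\<bar> * (\<omega> j)\<^sup>2)"
proof -
  have "(\<Sum>j<m. \<omega> j * a j)\<^sup>2 \<le> (\<Sum>j<m. \<bar>a j\<bar>) * (\<Sum>j<m. \<bar>a j\<bar> * (\<omega> j)\<^sup>2)"
    by (rule Cauchy_Schwarz_weighted_sum)
  also have "\<dots> \<le> (\<Sum>j. \<bar>a j\<bar>) * (\<Sum>j. \<bar>a j\<bar> * (\<omega> j)\<^sup>2)"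
    using a s by (intro mult_mono sum_le_suminf sum_nonneg suminf_nonneg) auto
  finally show ?thesis .
qed

text \<open>Dominated convergence from the partial sums, whose products are bounded by multiples of the
integrable variables of \<open>gauss_weight\<close>.\<close>

lemma gauss_series_mult:
  assumes a: "summable (\<lambda>j. \<bar>a j\<bar>)" and b: "summable (\<lambda>j. \<bar>b j\<bar>)"
  shows "integrable gauss_seq (\<lambda>\<omega>. gauss_series a \<omega> * gauss_series b \<omega>)"
    "(\<lambda>j. a j * b j) sums (\<integral>\<omega>. gauss_series a \<omega> * gauss_series b \<omega> \<partial>gauss_seq)"
proof -
  define w where "w \<omega> = (\<Sum>j. \<bar>a j\<bar>) * (\<Sum>j. \<bar>a j\<bar> * (\<omega> j)\<^sup>2) + (\<Sum>j. \<bar>b j\<bar>) * (\<Sum>j. \<bar>b j\<bar> * (\<omega> j)\<^sup>2)" for \<omega> :: "nat \<Rightarrow> real"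
  have wi: "integrable gauss_seq w"
    unfolding w_def using gauss_weight(2)[OF a] gauss_weight(2)[OF b] by simp
  have lim: "AE \<omega> in gauss_seq. (\<lambda>m. (\<Sum>j<m. \<omega> j * a j) * (\<Sum>j<m. \<omega> j * b j)) \<longlonglongrightarrow> gauss_series a \<omega> * gauss_series b \<omega>"
    using gauss_series_AE_sums[OF a] gauss_series_AE_sums[OF b]
    by eventually_elim (auto simp: sums_def intro: tendsto_mult)
  have dom: "AE \<omega> in gauss_seq. norm ((\<Sum>j<m. \<omega> j * a j) * (\<Sum>j<m. \<omega> j * b j)) \<le> w \<omega>" for m
    using gauss_weight(1)[OF a] gauss_weight(1)[OF b]
  proof eventually_elim
    case (elim \<omega>)
    have "norm ((\<Sum>j<m. \<omega> j * a j) * (\<Sum>j<m. \<omega> j * b j)) \<le> (\<Sum>j<m. \<omega> j * a j)\<^sup>2 + (\<Sum>j<m. \<omega> j * b j)\<^sup>2"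
      using mult_abs_le_sum_squares by simp
    also have "\<dots> \<le> w \<omega>"
      unfolding w_def by (intro add_mono gauss_partial_sum_bound a b elim)
    finally show ?case .
  qed
  show "integrable gauss_seq (\<lambda>\<omega>. gauss_series a \<omega> * gauss_series b \<omega>)"
    by (rule integrable_dominated_convergence[OF _ _ wi lim dom]) measurable
  have "(\<lambda>m. \<integral>\<omega>. (\<Sum>j<m. \<omega> j * a j) * (\<Sum>j<m. \<omega> j * b j) \<partial>gauss_seq) \<longlonglongrightarrow>
      (\<integral>\<omega>. gauss_series a \<omega> * gauss_series b \<omega> \<partial>gauss_seq)"
    by (rule integral_dominated_convergence[OF _ _ wi lim dom]) measurable
  moreover have "(\<integral>\<omega>. (\<Sum>j<m. \<omega> j * a j) * (\<Sum>j<m. \<omega> j * b j) \<partial>gauss_seq) = (\<Sum>j<m. a j * b j)" for m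
  proof -
    have eq: "(\<Sum>j<m. \<omega> j * a j) * (\<Sum>j<m. \<omega> j * b j) = (\<Sum>i<m. \<Sum>j<m. a i * b j * (\<omega> i * \<omega> j))" for \<omega> :: "nat \<Rightarrow> real"
      by (simp add: sum_product mult_ac)
    have "(\<integral>\<omega>. (\<Sum>j<m. \<omega> j * a j) * (\<Sum>j<m. \<omega> j * b j) \<partial>gauss_seq) =
        (\<Sum>i<m. \<integral>\<omega>. (\<Sum>j<m. a i * b j * (\<omega> i * \<omega> j)) \<partial>gauss_seq)"
      unfolding eq using gauss_seq_coord_mult(1)
      by (intro Bochner_Integration.integral_sum Bochner_Integration.integrable_sum) auto
    also have "\<dots> = (\<Sum>i<m. \<Sum>j<m. \<integral>\<omega>. a i * b j * (\<omega> i * \<omega> j) \<partial>gauss_seq)"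
      using gauss_seq_coord_mult(1) by (intro sum.cong refl Bochner_Integration.integral_sum) auto
    also have "\<dots> = (\<Sum>i<m. \<Sum>j<m. if i = j then a i * b j else 0)"
      by (intro sum.cong refl) (simp add: gauss_seq_coord_mult(2))
    also have "\<dots> = (\<Sum>i<m. a i * b i)"
      by (intro sum.cong refl) simp
    finally show ?thesis .
  qed
  ultimately show "(\<lambda>j. a j * b j) sums (\<integral>\<omega>. gauss_series a \<omega> * gauss_series b \<omega> \<partial>gauss_seq)"
    by (simp add: sums_def)
qed

lemma gauss_series_square:
  assumes a: "summable (\<lambda>j. \<bar>a j\<bar>)"
  shows "integrable gauss_seq (\<lambda>\<omega>. (gauss_series a \<omega>)\<^sup>2)"
    "(\<lambda>j. (a j)\<^sup>2) sums (\<integral>\<omega>. (gauss_series a \<omega>)\<^sup>2 \<partial>gauss_seq)"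
  using gauss_series_mult[OF a a] by (auto simp: power2_eq_square)

lemma gauss_series_mean:
  assumes a: "summable (\<lambda>j. \<bar>a j\<bar>)"
  shows "integrable gauss_seq (gauss_series a)" "(\<integral>\<omega>. gauss_series a \<omega> \<partial>gauss_seq) = 0"
proof -
  show i: "integrable gauss_seq (gauss_series a)"
  proof (rule Bochner_Integration.integrable_bound)
    show "integrable gauss_seq (\<lambda>\<omega>. 1 + (gauss_series a \<omega>)\<^sup>2)" using gauss_series_square(1)[OF a] by simp
    show "AE \<omega> in gauss_seq. norm (gauss_series a \<omega>) \<le> norm (1 + (gauss_series a \<omega>)\<^sup>2)"
      using mult_abs_le_sum_squares[of 1] by (intro AE_I2) (simp add: abs_of_nonneg)
  qed measurable
  define w where "w \<omega> = 1 + (\<Sum>j. \<bar>a j\<bar>) * (\<Sum>j. \<bar>a j\<bar> * (\<omega> j)\<^sup>2)" for \<omega> :: "nat \<Rightarrow> real"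
  have wi: "integrable gauss_seq w" unfolding w_def using gauss_weight(2)[OF a] by simp
  have "(\<lambda>m. \<integral>\<omega>. (\<Sum>j<m. \<omega> j * a j) \<partial>gauss_seq) \<longlonglongrightarrow> (\<integral>\<omega>. gauss_series a \<omega> \<partial>gauss_seq)"
  proof (rule integral_dominated_convergence[OF _ _ wi])
    show "AE \<omega> in gauss_seq. (\<lambda>m. \<Sum>j<m. \<omega> j * a j) \<longlonglongrightarrow> gauss_series a \<omega>"
      using gauss_series_AE_sums[OF a] by (simp add: sums_def)
    show "AE \<omega> in gauss_seq. norm (\<Sum>j<m. \<omega> j * a j) \<le> w \<omega>" for m
      using gauss_weight(1)[OF a]
    proof eventually_elim
      case (elim \<omega>)
      have "norm (\<Sum>j<m. \<omega> j * a j) \<le> 1 + (\<Sum>j<m. \<omega> j * a j)\<^sup>2"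
        using mult_abs_le_sum_squares[of 1 "\<Sum>j<m. \<omega> j * a j"] by simp
      also have "\<dots> \<le> w \<omega>" unfolding w_def by (intro add_left_mono gauss_partial_sum_bound a elim)
      finally show ?case .
    qed
  qed measurable
  moreover have "(\<integral>\<omega>. (\<Sum>j<m. \<omega> j * a j) \<partial>gauss_seq) = 0" for m
    by (subst Bochner_Integration.integral_sum) (auto simp: gauss_seq_coord_moments)
  ultimately show "(\<integral>\<omega>. gauss_series a \<omega> \<partial>gauss_seq) = 0"
    by (simp add: LIMSEQ_const_iff)
qed

lemma gauss_series_char:
  assumes a: "summable (\<lambda>j. \<bar>a j\<bar>)" and v: "(\<lambda>j. (a j)\<^sup>2) sums v"
  shows "(\<integral>\<omega>. iexp (\<theta> * gauss_series a \<omega>) \<partial>gauss_seq) = complex_of_real (exp (- (\<theta>\<^sup>2 * v) / 2))"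
proof -
  have "(\<lambda>m. \<integral>\<omega>. iexp (\<Sum>j<m. \<omega> j * (\<theta> * a j)) \<partial>gauss_seq) \<longlonglongrightarrow> (\<integral>\<omega>. iexp (\<theta> * gauss_series a \<omega>) \<partial>gauss_seq)"
  proof (rule integral_dominated_convergence[where w = "\<lambda>_. 1"])
    show "AE \<omega> in gauss_seq. (\<lambda>m. iexp (\<Sum>j<m. \<omega> j * (\<theta> * a j))) \<longlonglongrightarrow> iexp (\<theta> * gauss_series a \<omega>)"
      using gauss_series_AE_sums[OF a]
    proof eventually_elim
      case (elim \<omega>)
      then have "(\<lambda>m. \<theta> * (\<Sum>j<m. \<omega> j * a j)) \<longlonglongrightarrow> \<theta> * gauss_series a \<omega>"
        by (auto simp: sums_def intro: tendsto_mult)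
      then have "(\<lambda>m. \<Sum>j<m. \<omega> j * (\<theta> * a j)) \<longlonglongrightarrow> \<theta> * gauss_series a \<omega>"
        by (simp add: sum_distrib_left mult_ac)
      then show ?case by (intro tendsto_exp tendsto_mult tendsto_const tendsto_of_real)
    qed
  qed auto
  moreover have "(\<lambda>m. complex_of_real (exp (- (\<Sum>j<m. (\<theta> * a j)\<^sup>2) / 2))) \<longlonglongrightarrow> complex_of_real (exp (- (\<theta>\<^sup>2 * v) / 2))"
  proof -
    have "(\<lambda>m. \<Sum>j<m. (\<theta> * a j)\<^sup>2) \<longlonglongrightarrow> \<theta>\<^sup>2 * v"
      using sums_mult[OF v, of "\<theta>\<^sup>2"] by (simp add: sums_def power_mult_distrib)
    then show ?thesis by (intro tendsto_intros) auto
  qed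
  ultimately show ?thesis
    unfolding gauss_seq_char using LIMSEQ_unique by blast
qed

text \<open>The characteristic function determines the law. The degenerate case is separate because the zero variable
has no density.\<close>

lemma gauss_series_normal:
  assumes a: "summable (\<lambda>j. \<bar>a j\<bar>)" and v: "(\<lambda>j. (a j)\<^sup>2) sums v"
  shows "normal_rv gauss_seq (gauss_series a) 0 (sqrt v)"
proof (cases "v = 0")
  case True
  have "(a j)\<^sup>2 \<le> v" for j
    using sum_le_suminf[of "\<lambda>j. (a j)\<^sup>2" "{j}"] v by (auto simp: sums_iff)
  then have "a j = 0" for j using True by simp
  then have "gauss_series a = (\<lambda>_. 0)" by (simp add: gauss_series_def[abs_def])
  then show ?thesis using True by (simp add: normal_rv_def)
next
  case False
  have "v \<ge> 0" using sums_le[OF _ sums_zero v] by simp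
  then have v0: "v > 0" "sqrt v > 0" using False by auto
  interpret S: real_distribution "distr gauss_seq borel (gauss_series a)"
    by (rule gauss_seq.real_distribution_distr) measurable
  define D where "D = density lborel (normal_density 0 (sqrt v))"
  interpret D: prob_space D unfolding D_def by (rule prob_space_normal_density[OF v0(2)])
  interpret D: real_distribution D
    by unfold_locales (auto simp: D_def)
  have "distributed std_normal_distribution lborel (\<lambda>x. x) std_normal_density"
    by (auto simp: distributed_def intro!: distr_id2)
  then have "distributed std_normal_distribution lborel (\<lambda>x. 0 + sqrt v * x) (normal_density (0 + sqrt v * 0) (\<bar>sqrt v\<bar> * 1))"
    using v0 prob_space.normal_density_affine[OF prob_space_std_normal, of "\<lambda>x. x" 0 1 "sqrt v" 0] by simp
  moreover have "distr std_normal_distribution lborel (\<lambda>x. sqrt v * x) = distr std_normal_distribution borel (\<lambda>x. sqrt v * x)"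
    by (rule distr_cong) auto
  ultimately have Dd: "distr std_normal_distribution borel (\<lambda>x. sqrt v * x) = D"
    using v0 by (simp add: distributed_def D_def)
  have "char (distr gauss_seq borel (gauss_series a)) = char D"
  proof
    fix t
    have "char (distr gauss_seq borel (gauss_series a)) t = complex_of_real (exp (- (t\<^sup>2 * v) / 2))"
      unfolding char_def by (subst integral_distr) (auto simp: gauss_series_char[OF a v, simplified])
    also have "\<dots> = char std_normal_distribution (t * sqrt v)"
      using v0 by (simp add: char_std_normal_distribution power_mult_distrib)
    also have "\<dots> = char D t"
      unfolding char_def Dd[symmetric] by (subst integral_distr) (auto simp: mult.assoc)
    finally show "char (distr gauss_seq borel (gauss_series a)) t = char D t" .
  qed
  then have "distr gauss_seq borel (gauss_series a) = D"
    by (rule Levy_uniqueness[OF S.real_distribution_axioms D.real_distribution_axioms])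
  moreover have "distr gauss_seq lborel (gauss_series a) = distr gauss_seq borel (gauss_series a)"
    by (rule distr_cong) auto
  ultimately show ?thesis
    using v0 by (auto simp: normal_rv_def distributed_def D_def)
qed

lemma gauss_series_linear_combination:
  assumes I: "finite I" and a: "\<And>t. t \<in> I \<Longrightarrow> summable (\<lambda>j. \<bar>a t j\<bar>)"
  shows "AE \<omega> in gauss_seq. (\<Sum>t\<in>I. c t * gauss_series (a t) \<omega>) = gauss_series (\<lambda>j. \<Sum>t\<in>I. c t * a t j) \<omega>"
    "summable (\<lambda>j. \<bar>\<Sum>t\<in>I. c t * a t j\<bar>)"
proof -
  have "AE \<omega> in gauss_seq. \<forall>t\<in>I. (\<lambda>j. \<omega> j * a t j) sums gauss_series (a t) \<omega>"
    using I a by (intro AE_finite_allI gauss_series_AE_sums) auto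
  then show "AE \<omega> in gauss_seq. (\<Sum>t\<in>I. c t * gauss_series (a t) \<omega>) = gauss_series (\<lambda>j. \<Sum>t\<in>I. c t * a t j) \<omega>"
  proof eventually_elim
    case (elim \<omega>)
    have "(\<lambda>j. \<Sum>t\<in>I. c t * (\<omega> j * a t j)) sums (\<Sum>t\<in>I. c t * gauss_series (a t) \<omega>)"
      using elim by (intro sums_sum sums_mult) auto
    then show ?case
      by (simp add: gauss_series_def sums_iff sum_distrib_left mult.left_commute)
  qed
  show "summable (\<lambda>j. \<bar>\<Sum>t\<in>I. c t * a t j\<bar>)"
  proof (rule summable_comparison_test)
    show "summable (\<lambda>j. \<Sum>t\<in>I. \<bar>c t\<bar> * \<bar>a t j\<bar>)"
      using a by (intro summable_sum summable_mult) auto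
    show "\<exists>N. \<forall>n\<ge>N. norm \<bar>\<Sum>t\<in>I. c t * a t n\<bar> \<le> (\<Sum>t\<in>I. \<bar>c t\<bar> * \<bar>a t n\<bar>)"
      by (auto intro!: exI[of _ 0] order.trans[OF sum_abs] simp: abs_mult)
  qed
qed

text \<open>The remainder is again a Gaussian series, with the first \<open>m\<close> coefficients replaced by 0.\<close>

lemma gauss_series_tail:
  assumes a: "summable (\<lambda>j. \<bar>a j\<bar>)"
  shows "integrable gauss_seq (\<lambda>\<omega>. (gauss_series a \<omega> - (\<Sum>j<m. \<omega> j * a j))\<^sup>2)"
    "(\<integral>\<omega>. (gauss_series a \<omega> - (\<Sum>j<m. \<omega> j * a j))\<^sup>2 \<partial>gauss_seq) = (\<Sum>j. (a (j + m))\<^sup>2)"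
proof -
  define b where "b j = (if j < m then 0 else a j)" for j
  have b: "summable (\<lambda>j. \<bar>b j\<bar>)"
    by (rule summable_comparison_test[OF _ a]) (auto simp: b_def)
  have AE: "AE \<omega> in gauss_seq. gauss_series b \<omega> = gauss_series a \<omega> - (\<Sum>j<m. \<omega> j * a j)"
    using gauss_series_AE_sums[OF a]
  proof eventually_elim
    case (elim \<omega>)
    have "(\<lambda>j. if j < m then \<omega> j * a j else 0) sums (\<Sum>j<m. \<omega> j * a j)"
      using sums_If_finite_set[of "{..<m}" "\<lambda>j. \<omega> j * a j"] by (simp add: lessThan_def)
    from sums_diff[OF elim this] have "(\<lambda>j. \<omega> j * b j) sums (gauss_series a \<omega> - (\<Sum>j<m. \<omega> j * a j))"
      by (rule back_subst[of "\<lambda>f. f sums _"]) (auto simp: b_def fun_eq_iff)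
    then show ?case by (simp add: gauss_series_def sums_iff)
  qed
  then have AE2: "AE \<omega> in gauss_seq. (gauss_series b \<omega>)\<^sup>2 = (gauss_series a \<omega> - (\<Sum>j<m. \<omega> j * a j))\<^sup>2"
    by eventually_elim simp
  show "integrable gauss_seq (\<lambda>\<omega>. (gauss_series a \<omega> - (\<Sum>j<m. \<omega> j * a j))\<^sup>2)"
    using gauss_series_square(1)[OF b] by (subst integrable_cong_AE[OF _ _ AE2, symmetric]) measurable
  have "(\<integral>\<omega>. (gauss_series a \<omega> - (\<Sum>j<m. \<omega> j * a j))\<^sup>2 \<partial>gauss_seq) = (\<integral>\<omega>. (gauss_series b \<omega>)\<^sup>2 \<partial>gauss_seq)"
    by (rule integral_cong_AE[OF _ _ AE2, symmetric]) measurable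
  also have "\<dots> = (\<Sum>j. (b j)\<^sup>2)" using gauss_series_square(2)[OF b] by (simp add: sums_iff)
  also have "\<dots> = (\<Sum>j. (b (j + m))\<^sup>2) + (\<Sum>j<m. (b j)\<^sup>2)"
    using gauss_series_square(2)[OF b] by (intro suminf_split_initial_segment sums_summable)
  also have "\<dots> = (\<Sum>j. (a (j + m))\<^sup>2)" by (simp add: b_def)
  finally show "(\<integral>\<omega>. (gauss_series a \<omega> - (\<Sum>j<m. \<omega> j * a j))\<^sup>2 \<partial>gauss_seq) = (\<Sum>j. (a (j + m))\<^sup>2)" .
qed

section \<open>The centered kernel and its Laguerre remainder\<close>

lemma mod_bessel_J_measurable [measurable]: "mod_bessel_J \<alpha> \<in> borel_measurable borel"
  unfolding mod_bessel_J_def[abs_def] bessel_J_def[abs_def] by measurable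

lemma gamma_distr_borel_measurable: "f \<in> borel_measurable borel \<Longrightarrow> f \<in> borel_measurable (gamma_distr \<alpha>)"
  unfolding measurable_cong_sets[OF sets_gamma_distr refl] .

text \<open>Pythagoras, one basis vector at a time.\<close>

lemma orthonormal_residual:
  fixes c :: "nat \<Rightarrow> real"
  assumes f: "f \<in> L2_fun P" and e: "\<And>j. e j \<in> L2_fun P"
    and on: "\<And>i j. (\<integral>x. e i x * e j x \<partial>P) = (if i = j then 1 else 0 :: real)"
    and c: "\<And>j. (\<integral>x. f x * e j x \<partial>P) = c j"
  shows "(\<integral>x. (f x - (\<Sum>j<k. c j * e j x))\<^sup>2 \<partial>P) = (\<integral>x. (f x)\<^sup>2 \<partial>P) - (\<Sum>j<k. (c j)\<^sup>2)"
proof (induction k)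
  case (Suc k)
  define r where "r x = f x - (\<Sum>j<k. c j * e j x)" for x
  have r: "r \<in> L2_fun P"
    unfolding r_def[abs_def] by (intro L2_fun_diff L2_fun_sum L2_fun_cmult f e)
  have re: "(\<integral>x. r x * e k x \<partial>P) = c k"
  proof -
    have "(\<integral>x. r x * e k x \<partial>P) = (\<integral>x. f x * e k x - (\<Sum>j<k. c j * (e j x * e k x)) \<partial>P)"
      by (simp add: r_def left_diff_distrib sum_distrib_right mult.assoc)
    also have "\<dots> = (\<integral>x. f x * e k x \<partial>P) - (\<integral>x. (\<Sum>j<k. c j * (e j x * e k x)) \<partial>P)"
      using integrable_L2_mult[OF f e] integrable_L2_mult[OF e e]
      by (intro Bochner_Integration.integral_diff Bochner_Integration.integrable_sum integrable_mult_right) auto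
    also have "(\<integral>x. (\<Sum>j<k. c j * (e j x * e k x)) \<partial>P) = (\<Sum>j<k. \<integral>x. c j * (e j x * e k x) \<partial>P)"
      using integrable_L2_mult[OF e e] by (intro Bochner_Integration.integral_sum integrable_mult_right)
    also have "\<dots> = 0" by (auto simp: on intro!: sum.neutral)
    finally show ?thesis using c by simp
  qed
  have "(\<integral>x. (f x - (\<Sum>j<Suc k. c j * e j x))\<^sup>2 \<partial>P) = (\<integral>x. (r x)\<^sup>2 - 2 * c k * (r x * e k x) + (c k)\<^sup>2 * (e k x * e k x) \<partial>P)"
    by (intro Bochner_Integration.integral_cong) (auto simp: r_def power2_eq_square algebra_simps)
  also have "\<dots> = (\<integral>x. (r x)\<^sup>2 \<partial>P) - 2 * c k * c k + (c k)\<^sup>2"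
    using L2_fun_integrable[OF r] integrable_L2_mult[OF r e] integrable_L2_mult[OF e e]
    by (simp add: re on)
  also have "\<dots> = (\<integral>x. (f x)\<^sup>2 \<partial>P) - (\<Sum>j<Suc k. (c j)\<^sup>2)"
    using Suc by (simp add: r_def power2_eq_square)
  finally show ?case .
qed simp

text \<open>The kernel of the drift: the summand of the statistic with the sample mean replaced by \<open>\<alpha>\<close>, together
with the first-order effect of this replacement.\<close>

definition psi :: "real \<Rightarrow> real \<Rightarrow> real \<Rightarrow> real" where
  "psi \<alpha> t x = Gamma \<alpha> * mod_bessel_J \<alpha> (t * x / \<alpha>)
               + (x - \<alpha>) / \<alpha>\<^sup>2 * t * exp (- t / \<alpha>) - exp (- t / \<alpha>)"

text \<open>The remainder of \<open>psi\<close> after \<open>m\<close> Laguerre terms; its expansion begins with the index 2.\<close>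

definition psi_rem :: "real \<Rightarrow> nat \<Rightarrow> real \<Rightarrow> real \<Rightarrow> real" where
  "psi_rem \<alpha> m t x = psi \<alpha> t x - (\<Sum>j<m. lag_coef \<alpha> (2 + j) t * lag_on \<alpha> (2 + j) x)"

lemma psi_measurable:
  assumes [measurable]: "f \<in> borel_measurable M" "g \<in> borel_measurable M"
  shows "(\<lambda>x. psi \<alpha> (f x) (g x)) \<in> borel_measurable M"
  unfolding psi_def[abs_def] by measurable

lemma psi_rem_measurable:
  assumes [measurable]: "f \<in> borel_measurable M" "g \<in> borel_measurable M"
  shows "(\<lambda>x. psi_rem \<alpha> m (f x) (g x)) \<in> borel_measurable M"
  unfolding psi_rem_def[abs_def] psi_def[abs_def] by measurable

lemma psi_section_measurable [measurable]: "psi \<alpha> t \<in> borel_measurable borel"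
  unfolding psi_def[abs_def] by measurable

lemma psi_rem_section_measurable [measurable]: "psi_rem \<alpha> m t \<in> borel_measurable borel"
  unfolding psi_rem_def[abs_def] by measurable

context
  fixes \<alpha> :: real
  assumes \<alpha>2: "\<alpha> \<ge> 1 / 2"
begin

interpretation P: prob_space "gamma_distr \<alpha>" by (rule prob_space_gamma_distr[OF alpha_pos[OF \<alpha>2]])

lemma integrable_gamma_poly_power:
  assumes "\<And>x. f x = poly p x" shows "integrable (gamma_distr \<alpha>) (\<lambda>x. f x ^ k)"
proof -
  have "poly (p ^ k) = (\<lambda>x. f x ^ k)" by (auto simp: assms fun_eq_iff)
  then show ?thesis using integrable_gamma_distr_poly[OF alpha_pos[OF \<alpha>2], of "p ^ k"] by simp
qed

lemma lag_on_L2: "lag_on \<alpha> j \<in> L2_fun (gamma_distr \<alpha>)"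
  using integrable_lag_on_mult[OF \<alpha>2, of j j]
  by (simp add: L2_fun_def power2_eq_square gamma_distr_borel_measurable)

lemma hyp01_L2: "t \<ge> 0 \<Longrightarrow> (\<lambda>x. hyp01 \<alpha> (- (t * x / \<alpha>))) \<in> L2_fun (gamma_distr \<alpha>)"
  using integrable_hyp01_neg_square[OF \<alpha>2] by (simp add: L2_fun_def gamma_distr_borel_measurable)

text \<open>The two elementary terms of \<open>psi\<close> cancel the Laguerre terms of index 0 and 1 of the hypergeometric
function.\<close>

lemma psi_rem_eq:
  assumes "t \<ge> 0" "x \<ge> 0"
  shows "psi_rem \<alpha> m t x = hyp01 \<alpha> (- (t * x / \<alpha>)) - (\<Sum>j<m+2. lag_coef \<alpha> j t * lag_on \<alpha> j x)"
proof -
  have "(\<Sum>j<m+2. lag_coef \<alpha> j t * lag_on \<alpha> j x) =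
      lag_coef \<alpha> 0 t * lag_on \<alpha> 0 x + (lag_coef \<alpha> 1 t * lag_on \<alpha> 1 x + (\<Sum>j<m. lag_coef \<alpha> (2 + j) t * lag_on \<alpha> (2 + j) x))"
    by (simp add: sum.lessThan_Suc_shift del: sum.lessThan_Suc)
  also have "lag_coef \<alpha> 0 t * lag_on \<alpha> 0 x = exp (- t / \<alpha>)"
    by (simp add: lag_coef_0 lag_on_0)
  also note lag_coef_lag_on_1[OF \<alpha>2, of t x]
  finally show ?thesis
    using hyp01_mod_bessel_J[OF alpha_pos[OF \<alpha>2], of "t * x / \<alpha>"] assms alpha_pos[OF \<alpha>2]
    by (simp add: psi_rem_def psi_def)
qed

lemma psi_rem_AE:
  assumes "t \<ge> 0"
  shows "AE x in gamma_distr \<alpha>. psi_rem \<alpha> m t x = hyp01 \<alpha> (- (t * x / \<alpha>)) - (\<Sum>j<m+2. lag_coef \<alpha> j t * lag_on \<alpha> j x)"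
  using AE_gamma_distr_pos[of \<alpha>] by eventually_elim (rule psi_rem_eq[OF assms], simp)

text \<open>By \<open>psi_rem_eq\<close> the function is, almost everywhere, the residual of the hypergeometric function after
projection on \<open>m + 2\<close> orthonormal functions.\<close>

lemma psi_rem_L2:
  assumes t: "t \<ge> 0" shows "psi_rem \<alpha> m t \<in> L2_fun (gamma_distr \<alpha>)"
    "(\<lambda>j. (lag_coef \<alpha> (2 + (j + m)) t)\<^sup>2) sums (\<integral>x. (psi_rem \<alpha> m t x)\<^sup>2 \<partial>gamma_distr \<alpha>)"
    "(\<integral>x. psi_rem \<alpha> m t x \<partial>gamma_distr \<alpha>) = 0"
proof -
  define r where "r x = hyp01 \<alpha> (- (t * x / \<alpha>)) - (\<Sum>j<m+2. lag_coef \<alpha> j t * lag_on \<alpha> j x)" for x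
  have r[measurable]: "r \<in> borel_measurable borel" unfolding r_def[abs_def] by measurable
  have pm: "psi_rem \<alpha> m t \<in> borel_measurable (gamma_distr \<alpha>)"
    by (rule gamma_distr_borel_measurable[OF psi_rem_section_measurable])
  have rm: "r \<in> borel_measurable (gamma_distr \<alpha>)" by (rule gamma_distr_borel_measurable[OF r])
  have AE: "AE x in gamma_distr \<alpha>. psi_rem \<alpha> m t x = r x"
    unfolding r_def by (rule psi_rem_AE[OF t])
  then have AE2: "AE x in gamma_distr \<alpha>. (psi_rem \<alpha> m t x)\<^sup>2 = (r x)\<^sup>2"
    by eventually_elim simp
  have rL2: "r \<in> L2_fun (gamma_distr \<alpha>)"
    unfolding r_def[abs_def] by (intro L2_fun_diff L2_fun_sum L2_fun_cmult lag_on_L2 hyp01_L2 t)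
  show "psi_rem \<alpha> m t \<in> L2_fun (gamma_distr \<alpha>)"
    unfolding L2_fun_def
  proof safe
    show "psi_rem \<alpha> m t \<in> borel_measurable (gamma_distr \<alpha>)" by (rule pm)
    show "integrable (gamma_distr \<alpha>) (\<lambda>x. (psi_rem \<alpha> m t x)\<^sup>2)"
      using L2_fun_integrable[OF rL2]
      by (subst integrable_cong_AE[OF borel_measurable_power[OF pm] borel_measurable_power[OF rm] AE2])
  qed
  have "(\<integral>x. (psi_rem \<alpha> m t x)\<^sup>2 \<partial>gamma_distr \<alpha>) = (\<integral>x. (r x)\<^sup>2 \<partial>gamma_distr \<alpha>)"
    by (rule integral_cong_AE[OF borel_measurable_power[OF pm] borel_measurable_power[OF rm] AE2])
  also have "\<dots> = (\<integral>x. (hyp01 \<alpha> (- (t * x / \<alpha>)))\<^sup>2 \<partial>gamma_distr \<alpha>) - (\<Sum>j<m+2. (lag_coef \<alpha> j t)\<^sup>2)"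
    unfolding r_def
    by (rule orthonormal_residual[OF hyp01_L2[OF t] lag_on_L2 integral_lag_on_mult[OF \<alpha>2] integral_hyp01_lag_on[OF \<alpha>2 t]])
  also have "(\<integral>x. (hyp01 \<alpha> (- (t * x / \<alpha>)))\<^sup>2 \<partial>gamma_distr \<alpha>) = (\<Sum>j. (lag_coef \<alpha> j t)\<^sup>2)"
    using integral_hyp01_mult_hyp01[OF \<alpha>2 t t] lag_coef_square_sums[OF \<alpha>2, of t]
    by (simp add: sums_iff power2_eq_square)
  also have "(\<Sum>j. (lag_coef \<alpha> j t)\<^sup>2) - (\<Sum>j<m+2. (lag_coef \<alpha> j t)\<^sup>2) = (\<Sum>j. (lag_coef \<alpha> (j + (m + 2)) t)\<^sup>2)"
    using suminf_split_initial_segment[OF summable_lag_coef_square[OF \<alpha>2, of t], of "m + 2"] by simp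
  finally have "(\<integral>x. (psi_rem \<alpha> m t x)\<^sup>2 \<partial>gamma_distr \<alpha>) = (\<Sum>j. (lag_coef \<alpha> (j + (m + 2)) t)\<^sup>2)" .
  moreover have "summable (\<lambda>j. (lag_coef \<alpha> (j + (m + 2)) t)\<^sup>2)"
    using summable_lag_coef_square[OF \<alpha>2, of t] by (rule summable_ignore_initial_segment)
  moreover have "j + (m + 2) = 2 + (j + m)" for j by simp
  ultimately show "(\<lambda>j. (lag_coef \<alpha> (2 + (j + m)) t)\<^sup>2) sums (\<integral>x. (psi_rem \<alpha> m t x)\<^sup>2 \<partial>gamma_distr \<alpha>)"
    by (simp only: sums_iff)
  have i1: "integrable (gamma_distr \<alpha>) (\<lambda>x. hyp01 \<alpha> (- (t * x / \<alpha>)))"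
    using integrable_L2_mult[OF hyp01_L2[OF t] lag_on_L2[of 0]] by (simp add: lag_on_0)
  have h0: "(\<integral>x. hyp01 \<alpha> (- (t * x / \<alpha>)) \<partial>gamma_distr \<alpha>) = lag_coef \<alpha> 0 t"
    using integral_hyp01_lag_on[OF \<alpha>2 t, of 0] by (simp add: lag_on_0)
  have "(\<integral>x. psi_rem \<alpha> m t x \<partial>gamma_distr \<alpha>) = (\<integral>x. r x \<partial>gamma_distr \<alpha>)"
    by (rule integral_cong_AE[OF pm rm AE])
  also have "\<dots> = lag_coef \<alpha> 0 t - (\<Sum>j<m+2. lag_coef \<alpha> j t * (\<integral>x. lag_on \<alpha> j x \<partial>gamma_distr \<alpha>))"
    unfolding r_def using i1 h0 integrable_lag_on[OF \<alpha>2]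
    by (simp add: Bochner_Integration.integral_sum del: sum.lessThan_Suc)
  also have "(\<Sum>j<m+2. lag_coef \<alpha> j t * (\<integral>x. lag_on \<alpha> j x \<partial>gamma_distr \<alpha>)) = (\<Sum>j<m+2. if j = 0 then lag_coef \<alpha> 0 t else 0)"
    by (intro sum.cong refl) (auto simp: integral_lag_on[OF \<alpha>2] lag_on_0 P.prob_space[simplified])
  also have "\<dots> = lag_coef \<alpha> 0 t" by simp
  finally show "(\<integral>x. psi_rem \<alpha> m t x \<partial>gamma_distr \<alpha>) = 0" by simp
qed

text \<open>Uniformity in \<open>t\<close> is the point: the bound for normalized sums contains the fourth moment, and it is
to be integrated over \<open>t\<close>.\<close>

lemma fourth_moment_bound:
  assumes F: "\<And>t. F t \<in> borel_measurable borel" and b: "\<And>x. b x = poly p x"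
    and le: "\<And>t x. t \<ge> 0 \<Longrightarrow> x > 0 \<Longrightarrow> \<bar>F t x\<bar> \<le> b x"
  obtains B where "B \<ge> 0" "\<And>t. t \<ge> 0 \<Longrightarrow> integrable (gamma_distr \<alpha>) (\<lambda>x. F t x ^ 4)"
    "\<And>t. t \<ge> 0 \<Longrightarrow> (\<integral>x. F t x ^ 4 \<partial>gamma_distr \<alpha>) \<le> B"
proof -
  have bi: "integrable (gamma_distr \<alpha>) (\<lambda>x. b x ^ 4)" by (rule integrable_gamma_poly_power[OF b])
  have AE: "AE x in gamma_distr \<alpha>. F t x ^ 4 \<le> b x ^ 4" if t: "t \<ge> 0" for t
    using AE_gamma_distr_pos[of \<alpha>]
  proof eventually_elim
    case (elim x)
    have "\<bar>F t x\<bar> ^ 4 \<le> b x ^ 4" using le[OF t elim] by (intro power_mono) auto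
    then show ?case by simp
  qed
  have i: "integrable (gamma_distr \<alpha>) (\<lambda>x. F t x ^ 4)" if t: "t \<ge> 0" for t
  proof (rule Bochner_Integration.integrable_bound[OF bi])
    show "(\<lambda>x. F t x ^ 4) \<in> borel_measurable (gamma_distr \<alpha>)"
      by (intro borel_measurable_power gamma_distr_borel_measurable F)
    show "AE x in gamma_distr \<alpha>. norm (F t x ^ 4) \<le> norm (b x ^ 4)"
      using AE[OF t] by eventually_elim simp
  qed
  show ?thesis
  proof (rule that[of "\<integral>x. b x ^ 4 \<partial>gamma_distr \<alpha>"])
    show "0 \<le> (\<integral>x. b x ^ 4 \<partial>gamma_distr \<alpha>)" by simp
    show "(\<integral>x. F t x ^ 4 \<partial>gamma_distr \<alpha>) \<le> (\<integral>x. b x ^ 4 \<partial>gamma_distr \<alpha>)" if "t \<ge> 0" for t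
      by (intro integral_mono_AE i bi AE that)
  qed (rule i)
qed

lemma psi_rem_fourth_moment:
  obtains B where "B \<ge> 0" "\<And>t. t \<ge> 0 \<Longrightarrow> integrable (gamma_distr \<alpha>) (\<lambda>x. psi_rem \<alpha> m t x ^ 4)"
    "\<And>t. t \<ge> 0 \<Longrightarrow> (\<integral>x. psi_rem \<alpha> m t x ^ 4 \<partial>gamma_distr \<alpha>) \<le> B"
proof -
  define b where "b x = 1 + (\<Sum>j<m+2. (1 + (lag_on \<alpha> j x)\<^sup>2))" for x
  obtain q where q: "\<And>j x. lag_on \<alpha> j x = poly (q j) x"
    using ex_poly_lag_on by metis
  have "b x = poly (1 + (\<Sum>j<m+2. (1 + (q j)\<^sup>2))) x" for x
    by (simp add: b_def q poly_sum del: sum.lessThan_Suc)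
  moreover have "\<bar>psi_rem \<alpha> m t x\<bar> \<le> b x" if t: "t \<ge> 0" and x: "x > 0" for t x
  proof -
    have "\<bar>psi_rem \<alpha> m t x\<bar> \<le> \<bar>hyp01 \<alpha> (- (t * x / \<alpha>))\<bar> + (\<Sum>j<m+2. \<bar>lag_coef \<alpha> j t * lag_on \<alpha> j x\<bar>)"
      unfolding psi_rem_eq[OF t less_imp_le[OF x]]
      by (intro order.trans[OF abs_triangle_ineq4] add_left_mono sum_abs)
    also have "\<dots> \<le> b x"
      unfolding b_def
    proof (intro add_mono sum_mono)
      show "\<bar>hyp01 \<alpha> (- (t * x / \<alpha>))\<bar> \<le> 1"
        using t x alpha_pos[OF \<alpha>2] by (intro abs_hyp01_neg_le_1[OF \<alpha>2]) auto
      fix j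
      have "\<bar>lag_coef \<alpha> j t * lag_on \<alpha> j x\<bar> \<le> (lag_coef \<alpha> j t)\<^sup>2 + (lag_on \<alpha> j x)\<^sup>2"
        by (rule mult_abs_le_sum_squares)
      also have "(lag_coef \<alpha> j t)\<^sup>2 \<le> 1"
        using lag_coef_le_1[OF \<alpha>2 t, of j] lag_coef_nonneg[OF \<alpha>2 t, of j] by (simp add: power_le_one)
      finally show "\<bar>lag_coef \<alpha> j t * lag_on \<alpha> j x\<bar> \<le> 1 + (lag_on \<alpha> j x)\<^sup>2" by simp
    qed
    finally show ?thesis .
  qed
  ultimately show ?thesis
    using fourth_moment_bound[of "psi_rem \<alpha> m" b] psi_rem_section_measurable that by blast
qed

text \<open>At a fixed \<open>t\<close> this is both the squared norm of the remainder of the kernel and the variance of the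
remainder of the Gaussian series, so that one quantity controls the truncation of the statistic and
of its limit.\<close>

definition tail_energy :: "nat \<Rightarrow> real \<Rightarrow> real" where
  "tail_energy m t = (\<Sum>j. (lag_coef \<alpha> (2 + (j + m)) t)\<^sup>2)"

lemma tail_energy_measurable [measurable]: "tail_energy m \<in> borel_measurable borel"
  unfolding tail_energy_def[abs_def] by measurable

lemma summable_lag_coef_square_shift: "summable (\<lambda>j. (lag_coef \<alpha> (2 + j) t)\<^sup>2)"
  using summable_ignore_initial_segment[OF summable_lag_coef_square[OF \<alpha>2, of t], of 2] by (simp add: add.commute)

lemma tail_energy_bounds:
  assumes "t \<ge> 0" shows "0 \<le> tail_energy m t" "tail_energy m t \<le> 1"
proof -
  have s: "summable (\<lambda>j. (lag_coef \<alpha> (2 + (j + m)) t)\<^sup>2)"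
    using summable_ignore_initial_segment[OF summable_lag_coef_square[OF \<alpha>2, of t], of "m + 2"]
    by (simp add: ac_simps)
  then show "0 \<le> tail_energy m t" unfolding tail_energy_def by (rule suminf_nonneg) simp
  have "(\<Sum>j. (lag_coef \<alpha> j t)\<^sup>2) = (\<Sum>j. (lag_coef \<alpha> (j + (m + 2)) t)\<^sup>2) + (\<Sum>j<m+2. (lag_coef \<alpha> j t)\<^sup>2)"
    by (rule suminf_split_initial_segment[OF summable_lag_coef_square[OF \<alpha>2]])
  moreover have "0 \<le> (\<Sum>j<m+2. (lag_coef \<alpha> j t)\<^sup>2)" by (rule sum_nonneg) simp
  moreover have "(\<Sum>j. (lag_coef \<alpha> (j + (m + 2)) t)\<^sup>2) = tail_energy m t"
    unfolding tail_energy_def by (simp add: ac_simps)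
  ultimately show "tail_energy m t \<le> 1"
    using suminf_lag_coef_square_le_1[OF \<alpha>2 assms] by linarith
qed

lemma integrable_tail_energy: "integrable (gamma_distr \<alpha>) (tail_energy m)"
  by (rule P.integrable_const_bound[of _ 1])
     (use AE_gamma_nonneg[of \<alpha>] tail_energy_bounds in \<open>auto elim!: eventually_mono intro: gamma_distr_borel_measurable\<close>)

lemma integral_tail_energy_tendsto: "(\<lambda>m. \<integral>t. tail_energy m t \<partial>gamma_distr \<alpha>) \<longlonglongrightarrow> 0"
proof -
  have "(\<lambda>m. \<integral>t. tail_energy m t \<partial>gamma_distr \<alpha>) \<longlonglongrightarrow> (\<integral>t. 0 \<partial>gamma_distr \<alpha>)"
  proof (rule integral_dominated_convergence[where w = "\<lambda>_. 1"])
    show "AE t in gamma_distr \<alpha>. (\<lambda>m. tail_energy m t) \<longlonglongrightarrow> 0"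
    proof (intro AE_I2)
      fix t
      show "(\<lambda>m. tail_energy m t) \<longlonglongrightarrow> 0"
        unfolding tail_energy_def by (rule suminf_exist_split2[OF summable_lag_coef_square_shift])
    qed
    show "AE t in gamma_distr \<alpha>. norm (tail_energy m t) \<le> 1" for m
      using AE_gamma_nonneg[of \<alpha>] tail_energy_bounds by (auto elim!: eventually_mono)
  qed (auto intro: gamma_distr_borel_measurable)
  then show ?thesis by simp
qed

lemma psi_rem_square_integral:
  "t \<ge> 0 \<Longrightarrow> (\<integral>x. (psi_rem \<alpha> m t x)\<^sup>2 \<partial>gamma_distr \<alpha>) = tail_energy m t"
  using psi_rem_L2(2)[of t m] by (simp add: tail_energy_def sums_iff)

lemma lag_coef_L2: "lag_coef \<alpha> j \<in> L2_fun (gamma_distr \<alpha>)"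
  unfolding L2_fun_def
proof (safe)
  show "integrable (gamma_distr \<alpha>) (\<lambda>t. (lag_coef \<alpha> j t)\<^sup>2)"
    by (rule P.integrable_const_bound[of _ 1])
       (use AE_gamma_nonneg[of \<alpha>] lag_coef_le_1[OF \<alpha>2] lag_coef_nonneg[OF \<alpha>2] in \<open>auto simp: power_le_one elim!: eventually_mono intro!: gamma_distr_borel_measurable\<close>)
qed (rule gamma_distr_borel_measurable[OF lag_coef_measurable])

text \<open>The terms of index 0 and 1 of the series in \<open>lag_coef_mult_sums\<close> add up to
\<open>exp(-(s+t)/\<alpha>) (1 + st/\<alpha>\<^sup>3)\<close>, which is what the covariance function subtracts.\<close>

lemma K_cov_sums:
  assumes s: "s \<ge> 0" and t: "t \<ge> 0"
  shows "(\<lambda>j. lag_coef \<alpha> (2 + j) s * lag_coef \<alpha> (2 + j) t) sums K_cov \<alpha> s t"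
proof -
  have eq: "exp (- (s + t) / \<alpha>) = exp (- s / \<alpha>) * exp (- t / \<alpha>)"
    by (simp add: exp_add[symmetric] add_divide_distrib diff_divide_distrib)
  have "(\<Sum>j<2. lag_coef \<alpha> j s * lag_coef \<alpha> j t) = exp (- (s + t) / \<alpha>) * (1 + s * t / \<alpha> ^ 3)"
    unfolding eq using alpha_pos[OF \<alpha>2] by (simp add: lag_coef_def eval_nat_numeral field_simps)
  then have "(\<lambda>j. lag_coef \<alpha> (j + 2) s * lag_coef \<alpha> (j + 2) t) sums
      (exp (- (s + t) / \<alpha>) * hyp01 \<alpha> (s * t / \<alpha>\<^sup>2) - exp (- (s + t) / \<alpha>) * (1 + s * t / \<alpha> ^ 3))"
    using sums_split_initial_segment[OF lag_coef_mult_sums[OF \<alpha>2, of s t], of 2] by simp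
  moreover have "hyp01 \<alpha> (s * t / \<alpha>\<^sup>2) = Gamma \<alpha> * mod_bessel_I \<alpha> (s * t / \<alpha>\<^sup>2)"
    using hyp01_mod_bessel_I[OF alpha_pos[OF \<alpha>2], of "s * t / \<alpha>\<^sup>2"] s t by simp
  ultimately show ?thesis
    by (simp add: K_cov_def add.commute right_diff_distrib[symmetric] algebra_simps)
qed

lemma summable_lag_coef_shift: "summable (\<lambda>j. \<bar>lag_coef \<alpha> (2 + j) t\<bar>)"
  using summable_ignore_initial_segment[OF summable_lag_coef[OF \<alpha>2, of t], of 2] by (simp add: add.commute)

end

section \<open>The limit process\<close>

text \<open>The passage from moments at fixed \<open>t\<close> to paths: by Tonelli's theorem the expected energy of the path is
at most \<open>b0\<close>, and Markov's inequality bounds the energy off an event of small probability.\<close>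

lemma markov_energy:
  assumes M: "prob_space M" and \<nu>: "prob_space \<nu>"
    and B: "(\<lambda>(\<omega>, t). B \<omega> t) \<in> borel_measurable (M \<Otimes>\<^sub>M \<nu>)"
    and b: "AE t in \<nu>. (\<integral>\<^sup>+\<omega>. ennreal ((B \<omega> t)\<^sup>2) \<partial>M) \<le> ennreal (b t)"
    and b0: "(\<integral>\<^sup>+t. ennreal (b t) \<partial>\<nu>) \<le> ennreal b0" "b0 \<ge> 0" and T: "T > 0"
  obtains A where "A \<in> sets M" "measure M A \<le> b0 / T"
    "\<And>\<omega>. \<omega> \<in> space M - A \<Longrightarrow> integrable \<nu> (\<lambda>t. (B \<omega> t)\<^sup>2)"
    "\<And>\<omega>. \<omega> \<in> space M - A \<Longrightarrow> (\<integral>t. (B \<omega> t)\<^sup>2 \<partial>\<nu>) \<le> T"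
proof -
  interpret M: prob_space M by fact
  interpret \<nu>: prob_space \<nu> by fact
  interpret pair_sigma_finite M \<nu> ..
  note B[measurable]
  define g where "g \<omega> = (\<integral>\<^sup>+t. ennreal ((B \<omega> t)\<^sup>2) \<partial>\<nu>)" for \<omega>
  have g[measurable]: "g \<in> borel_measurable M"
    unfolding g_def by measurable
  have "(\<integral>\<^sup>+\<omega>. g \<omega> \<partial>M) = (\<integral>\<^sup>+t. \<integral>\<^sup>+\<omega>. ennreal ((B \<omega> t)\<^sup>2) \<partial>M \<partial>\<nu>)"
    unfolding g_def by (rule Fubini'[symmetric]) measurable
  also have "\<dots> \<le> (\<integral>\<^sup>+t. ennreal (b t) \<partial>\<nu>)" by (rule nn_integral_mono_AE[OF b])
  also have "\<dots> \<le> ennreal b0" by (rule b0)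
  finally have g0: "(\<integral>\<^sup>+\<omega>. g \<omega> \<partial>M) \<le> ennreal b0" .
  define A where "A = {\<omega> \<in> space M. 1 \<le> ennreal (1 / T) * g \<omega>}"
  have A: "A \<in> sets M" unfolding A_def by measurable
  have "emeasure M A \<le> ennreal (1 / T) * (\<integral>\<^sup>+\<omega>. g \<omega> * indicator (space M) \<omega> \<partial>M)"
    unfolding A_def by (rule nn_integral_Markov_inequality) auto
  also have "(\<integral>\<^sup>+\<omega>. g \<omega> * indicator (space M) \<omega> \<partial>M) = (\<integral>\<^sup>+\<omega>. g \<omega> \<partial>M)"
    by (rule nn_integral_cong) simp
  also have "ennreal (1 / T) * \<dots> \<le> ennreal (1 / T) * ennreal b0" using g0 by (rule mult_left_mono) simp
  also have "\<dots> = ennreal (b0 / T)" using b0 T by (simp add: ennreal_mult[symmetric])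
  finally have mA: "measure M A \<le> b0 / T"
    using b0 T by (simp add: M.emeasure_eq_measure ennreal_le_iff)
  have gT: "g \<omega> \<le> ennreal T" if "\<omega> \<in> space M - A" for \<omega>
  proof -
    have "ennreal (1 / T) * g \<omega> < 1" using that by (auto simp: A_def not_le)
    then have "ennreal T * (ennreal (1 / T) * g \<omega>) \<le> ennreal T * 1" by (intro mult_left_mono) auto
    then show ?thesis using T by (simp add: mult.assoc[symmetric] ennreal_mult[symmetric])
  qed
  have Bm: "(\<lambda>t. B \<omega> t) \<in> borel_measurable \<nu>" if "\<omega> \<in> space M" for \<omega>
    using measurable_compose_Pair1[OF that B] by simp
  have Bi: "integrable \<nu> (\<lambda>t. (B \<omega> t)\<^sup>2)" if w: "\<omega> \<in> space M - A" for \<omega>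
  proof (rule integrableI_bounded)
    show "(\<lambda>t. (B \<omega> t)\<^sup>2) \<in> borel_measurable \<nu>" using Bm[of \<omega>] w by simp
    show "(\<integral>\<^sup>+t. ennreal (norm ((B \<omega> t)\<^sup>2)) \<partial>\<nu>) < \<infinity>"
      using gT[OF w] by (simp add: g_def le_less_trans)
  qed
  have Bb: "(\<integral>t. (B \<omega> t)\<^sup>2 \<partial>\<nu>) \<le> T" if w: "\<omega> \<in> space M - A" for \<omega>
  proof -
    have "ennreal (\<integral>t. (B \<omega> t)\<^sup>2 \<partial>\<nu>) \<le> ennreal T"
      using gT[OF w] nn_integral_eq_integral[OF Bi[OF w]] by (simp add: g_def)
    then show ?thesis using T by (simp add: ennreal_le_iff)
  qed
  show ?thesis by (rule that[OF A mA Bi Bb])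
qed

lemma L2_dist_lincomb:
  fixes \<phi> :: "nat \<Rightarrow> 'a \<Rightarrow> real"
  assumes \<phi>: "\<And>j. \<phi> j \<in> L2_fun P" "\<And>j. (\<integral>x. (\<phi> j x)\<^sup>2 \<partial>P) \<le> 1"
  shows "L2_dist P (\<lambda>x. \<Sum>j<m. a j * \<phi> j x) (\<lambda>x. \<Sum>j<m. b j * \<phi> j x) \<le> (\<Sum>j<m. \<bar>a j - b j\<bar>)"
proof (induction m)
  case 0
  then show ?case by (simp add: L2_dist_def)
next
  case (Suc m)
  define f where "f c k x = (\<Sum>j<k. c j * \<phi> j x)" for c :: "nat \<Rightarrow> real" and k x
  have f: "f c k \<in> L2_fun P" for c k unfolding f_def[abs_def] by (intro L2_fun_sum L2_fun_cmult \<phi>)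
  define u where "u x = f a m x + b m * \<phi> m x" for x
  have u: "u \<in> L2_fun P" unfolding u_def[abs_def] by (intro L2_fun_add L2_fun_cmult f \<phi>)
  have "L2_dist P (f a (Suc m)) (f b (Suc m)) \<le> L2_dist P (f a (Suc m)) u + L2_dist P u (f b (Suc m))"
    by (rule L2_dist_triangle[OF f u f])
  also have "L2_dist P u (f b (Suc m)) = L2_dist P (f a m) (f b m)"
    by (simp add: L2_dist_def u_def f_def)
  also have "\<dots> \<le> (\<Sum>j<m. \<bar>a j - b j\<bar>)" using Suc by (simp add: f_def[abs_def])
  also have "L2_dist P (f a (Suc m)) u = sqrt (\<integral>x. (a m - b m)\<^sup>2 * (\<phi> m x)\<^sup>2 \<partial>P)"
    by (simp add: L2_dist_def u_def f_def left_diff_distrib[symmetric] power_mult_distrib)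
  also have "\<dots> = \<bar>a m - b m\<bar> * sqrt (\<integral>x. (\<phi> m x)\<^sup>2 \<partial>P)"
    by (simp add: real_sqrt_mult)
  also have "\<dots> \<le> \<bar>a m - b m\<bar> * 1"
    using \<phi>(2)[of m] by (intro mult_left_mono) auto
  finally show ?case by (simp add: f_def[abs_def])
qed

text \<open>The Gaussian series at a fixed \<open>t\<close>. It converges almost surely, but the exceptional event depends on \<open>t\<close>.\<close>

definition zser :: "real \<Rightarrow> real \<Rightarrow> (nat \<Rightarrow> real) \<Rightarrow> real" where
  "zser \<alpha> t = gauss_series (\<lambda>j. lag_coef \<alpha> (2 + j) t)"

text \<open>The coordinates \<open>s\<close> will be the Gaussian sequence as well as the normalized sums of Laguerre
polynomials over the sample, and their shifts.\<close>

definition zpart :: "real \<Rightarrow> nat \<Rightarrow> (nat \<Rightarrow> real) \<Rightarrow> real \<Rightarrow> real" where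
  "zpart \<alpha> m s t = (\<Sum>j<m. s j * lag_coef \<alpha> (2 + j) t)"

text \<open>The event that the path of \<open>zser\<close> is approximated arbitrarily well in \<open>L\<^sup>2\<close> by its partial sums. This
is less than convergence and follows from Markov's inequality at once, but it already makes the path
square-integrable and a limit of members of a countable family.\<close>

definition z_good :: "real \<Rightarrow> (nat \<Rightarrow> real) set" where
  "z_good \<alpha> = {\<omega>. \<forall>k::nat. \<exists>m. (\<integral>\<^sup>+t. ennreal ((zser \<alpha> t \<omega> - zpart \<alpha> m \<omega> t)\<^sup>2) \<partial>gamma_distr \<alpha>) \<le> ennreal (1 / (real k + 1))}"

text \<open>The modification makes every path square-integrable and changes \<open>zser\<close> on a null event only, the
same for all \<open>t\<close>.\<close>

definition zproc :: "real \<Rightarrow> real \<Rightarrow> (nat \<Rightarrow> real) \<Rightarrow> real" where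
  "zproc \<alpha> t \<omega> = (if \<omega> \<in> z_good \<alpha> then zser \<alpha> t \<omega> else 0)"

lemma zser_section_measurable: "(\<lambda>t. zser \<alpha> t \<omega>) \<in> borel_measurable (gamma_distr \<alpha>)"
  unfolding zser_def gauss_series_def
  by (intro borel_measurable_suminf borel_measurable_times borel_measurable_const
      gamma_distr_borel_measurable[OF lag_coef_measurable])

lemma zser_joint_measurable [measurable]:
  "(\<lambda>(\<omega>, t). zser \<alpha> t \<omega>) \<in> borel_measurable (gauss_seq \<Otimes>\<^sub>M gamma_distr \<alpha>)"
  unfolding zser_def gauss_series_def by measurable

lemma zpart_joint_measurable [measurable]:
  "(\<lambda>(\<omega>, t). zpart \<alpha> m \<omega> t) \<in> borel_measurable (gauss_seq \<Otimes>\<^sub>M gamma_distr \<alpha>)"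
  unfolding zpart_def by measurable

context
  fixes \<alpha> :: real
  assumes \<alpha>2: "\<alpha> \<ge> 1 / 2"
begin

interpretation P: prob_space "gamma_distr \<alpha>" by (rule prob_space_gamma_distr[OF alpha_pos[OF \<alpha>2]])

lemma z_rem_energy_measurable:
  "(\<lambda>\<omega>. \<integral>\<^sup>+t. ennreal ((zser \<alpha> t \<omega> - zpart \<alpha> m \<omega> t)\<^sup>2) \<partial>gamma_distr \<alpha>) \<in> borel_measurable gauss_seq"
  by measurable

lemma z_good_sets: "z_good \<alpha> \<in> sets gauss_seq"
proof -
  note z_rem_energy_measurable[measurable]
  have "z_good \<alpha> = {\<omega> \<in> space gauss_seq. \<forall>k::nat. \<exists>m. (\<integral>\<^sup>+t. ennreal ((zser \<alpha> t \<omega> - zpart \<alpha> m \<omega> t)\<^sup>2) \<partial>gamma_distr \<alpha>) \<le> ennreal (1 / (real k + 1))}"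
    by (simp add: z_good_def space_gauss_seq)
  also have "\<dots> \<in> sets gauss_seq" by measurable
  finally show ?thesis .
qed

lemma z_rem_markov:
  assumes T: "T > 0"
  obtains A where "A \<in> sets gauss_seq" "measure gauss_seq A \<le> (\<integral>t. tail_energy \<alpha> m t \<partial>gamma_distr \<alpha>) / T"
    "\<And>\<omega>. \<omega> \<notin> A \<Longrightarrow> integrable (gamma_distr \<alpha>) (\<lambda>t. (zser \<alpha> t \<omega> - zpart \<alpha> m \<omega> t)\<^sup>2)"
    "\<And>\<omega>. \<omega> \<notin> A \<Longrightarrow> (\<integral>t. (zser \<alpha> t \<omega> - zpart \<alpha> m \<omega> t)\<^sup>2 \<partial>gamma_distr \<alpha>) \<le> T"
proof (rule markov_energy[OF gauss_seq.prob_space_axioms P.prob_space_axioms, where B = "\<lambda>\<omega> t. zser \<alpha> t \<omega> - zpart \<alpha> m \<omega> t"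
      and b = "tail_energy \<alpha> m" and ?b0.0 = "\<integral>t. tail_energy \<alpha> m t \<partial>gamma_distr \<alpha>" and T = T])
  show "(\<lambda>(\<omega>, t). zser \<alpha> t \<omega> - zpart \<alpha> m \<omega> t) \<in> borel_measurable (gauss_seq \<Otimes>\<^sub>M gamma_distr \<alpha>)"
    by measurable
  have "(\<integral>\<^sup>+\<omega>. ennreal ((zser \<alpha> t \<omega> - zpart \<alpha> m \<omega> t)\<^sup>2) \<partial>gauss_seq) = ennreal (tail_energy \<alpha> m t)" for t
    unfolding zser_def zpart_def tail_energy_def[OF \<alpha>2]
    using gauss_series_tail[OF summable_lag_coef_shift[OF \<alpha>2, of t], of m]
    by (subst nn_integral_eq_integral) (auto simp: ac_simps)
  then show "AE t in gamma_distr \<alpha>. (\<integral>\<^sup>+\<omega>. ennreal ((zser \<alpha> t \<omega> - zpart \<alpha> m \<omega> t)\<^sup>2) \<partial>gauss_seq) \<le> ennreal (tail_energy \<alpha> m t)"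
    by simp
  have AE0: "AE t in gamma_distr \<alpha>. 0 \<le> tail_energy \<alpha> m t"
    using AE_gamma_nonneg[of \<alpha>] by eventually_elim (rule tail_energy_bounds[OF \<alpha>2])
  show "(\<integral>\<^sup>+t. ennreal (tail_energy \<alpha> m t) \<partial>gamma_distr \<alpha>) \<le> ennreal (\<integral>t. tail_energy \<alpha> m t \<partial>gamma_distr \<alpha>)"
    by (subst nn_integral_eq_integral[OF integrable_tail_energy[OF \<alpha>2] AE0]) simp
  show "0 \<le> (\<integral>t. tail_energy \<alpha> m t \<partial>gamma_distr \<alpha>)" by (rule integral_nonneg_AE[OF AE0])
  show "T > 0" by (rule T)
qed (use that in \<open>auto simp: space_gauss_seq\<close>)

text \<open>For given \<open>k\<close>, the event that no partial sum comes within the required accuracy lies in the exceptional event of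
\<open>z_rem_markov\<close> for every \<open>m\<close>, and their probabilities tend to 0.\<close>

lemma z_good_AE: "AE \<omega> in gauss_seq. \<omega> \<in> z_good \<alpha>"
proof -
  note z_rem_energy_measurable[measurable]
  have "AE \<omega> in gauss_seq. \<exists>m. (\<integral>\<^sup>+t. ennreal ((zser \<alpha> t \<omega> - zpart \<alpha> m \<omega> t)\<^sup>2) \<partial>gamma_distr \<alpha>) \<le> ennreal (1 / (real k + 1))" for k :: nat
  proof -
    define C where "C = {\<omega> \<in> space gauss_seq. \<not> (\<exists>m. (\<integral>\<^sup>+t. ennreal ((zser \<alpha> t \<omega> - zpart \<alpha> m \<omega> t)\<^sup>2) \<partial>gamma_distr \<alpha>) \<le> ennreal (1 / (real k + 1)))}"
    have C: "C \<in> sets gauss_seq" unfolding C_def by measurable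
    define \<rho> where "\<rho> m = (\<integral>t. tail_energy \<alpha> m t \<partial>gamma_distr \<alpha>) / (1 / (real k + 1))" for m
    have "measure gauss_seq C \<le> \<rho> m" for m
    proof -
      obtain A where A: "A \<in> sets gauss_seq" "measure gauss_seq A \<le> \<rho> m"
        "\<And>\<omega>. \<omega> \<notin> A \<Longrightarrow> integrable (gamma_distr \<alpha>) (\<lambda>t. (zser \<alpha> t \<omega> - zpart \<alpha> m \<omega> t)\<^sup>2)"
        "\<And>\<omega>. \<omega> \<notin> A \<Longrightarrow> (\<integral>t. (zser \<alpha> t \<omega> - zpart \<alpha> m \<omega> t)\<^sup>2 \<partial>gamma_distr \<alpha>) \<le> 1 / (real k + 1)"
        using z_rem_markov[of "1 / (real k + 1)" m] unfolding \<rho>_def by auto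
      have "C \<subseteq> A"
      proof
        fix \<omega> assume w: "\<omega> \<in> C"
        show "\<omega> \<in> A"
        proof (rule ccontr)
          assume n: "\<omega> \<notin> A"
          have "(\<integral>\<^sup>+t. ennreal ((zser \<alpha> t \<omega> - zpart \<alpha> m \<omega> t)\<^sup>2) \<partial>gamma_distr \<alpha>) \<le> ennreal (1 / (real k + 1))"
            using A(4)[OF n] by (subst nn_integral_eq_integral[OF A(3)[OF n]]) (auto intro: ennreal_leI)
          then show False using w by (auto simp: C_def)
        qed
      qed
      then have "measure gauss_seq C \<le> measure gauss_seq A"
        using A(1) by (intro gauss_seq.finite_measure_mono) auto
      then show ?thesis using A(2) by simp
    qed
    moreover have "\<rho> \<longlonglongrightarrow> 0"
      unfolding \<rho>_def by (intro tendsto_divide_zero integral_tail_energy_tendsto \<alpha>2)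
    ultimately have "measure gauss_seq C \<le> 0"
      by (intro tendsto_lowerbound[of \<rho>]) (auto intro: always_eventually)
    then have "emeasure gauss_seq C = 0"
      by (simp add: gauss_seq.emeasure_eq_measure measure_le_0_iff)
    then show ?thesis using C by (intro AE_I[of _ _ C]) (auto simp: C_def)
  qed
  then have "AE \<omega> in gauss_seq. \<forall>k::nat. \<exists>m. (\<integral>\<^sup>+t. ennreal ((zser \<alpha> t \<omega> - zpart \<alpha> m \<omega> t)\<^sup>2) \<partial>gamma_distr \<alpha>) \<le> ennreal (1 / (real k + 1))"
    by (simp add: AE_all_countable)
  then show ?thesis by (simp add: z_good_def)
qed

lemma zproc_AE: "AE \<omega> in gauss_seq. zproc \<alpha> t \<omega> = zser \<alpha> t \<omega>"
  using z_good_AE by eventually_elim (simp add: zproc_def)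

lemma zproc_measurable [measurable]: "zproc \<alpha> t \<in> borel_measurable gauss_seq"
  unfolding zproc_def[abs_def] zser_def using z_good_sets by measurable

lemma zproc_joint_measurable [measurable]:
  "(\<lambda>(\<omega>, t). zproc \<alpha> t \<omega>) \<in> borel_measurable (gauss_seq \<Otimes>\<^sub>M gamma_distr \<alpha>)"
  unfolding zproc_def using z_good_sets by measurable

lemma zpart_L2: "zpart \<alpha> m s \<in> L2_fun (gamma_distr \<alpha>)"
  unfolding zpart_def[abs_def] by (intro L2_fun_sum L2_fun_cmult lag_coef_L2 \<alpha>2)

lemma z_good_approx:
  assumes w: "\<omega> \<in> z_good \<alpha>" and e: "e > 0"
  obtains m where "integrable (gamma_distr \<alpha>) (\<lambda>t. (zser \<alpha> t \<omega> - zpart \<alpha> m \<omega> t)\<^sup>2)"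
    "(\<integral>t. (zser \<alpha> t \<omega> - zpart \<alpha> m \<omega> t)\<^sup>2 \<partial>gamma_distr \<alpha>) < e"
proof -
  obtain k :: nat where "1 / e < real k" using reals_Archimedean2 by blast
  then have k: "1 / (real k + 1) < e"
    using e by (simp add: field_simps)
  obtain m where m: "(\<integral>\<^sup>+t. ennreal ((zser \<alpha> t \<omega> - zpart \<alpha> m \<omega> t)\<^sup>2) \<partial>gamma_distr \<alpha>) \<le> ennreal (1 / (real k + 1))"
    using w unfolding z_good_def by blast
  have meas: "(\<lambda>t. zser \<alpha> t \<omega> - zpart \<alpha> m \<omega> t) \<in> borel_measurable (gamma_distr \<alpha>)"
    by (intro borel_measurable_diff zser_section_measurable L2_fun_measurable[OF zpart_L2])
  have i: "integrable (gamma_distr \<alpha>) (\<lambda>t. (zser \<alpha> t \<omega> - zpart \<alpha> m \<omega> t)\<^sup>2)"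
    by (rule integrableI_bounded) (use meas m in \<open>auto intro: le_less_trans\<close>)
  have "ennreal (\<integral>t. (zser \<alpha> t \<omega> - zpart \<alpha> m \<omega> t)\<^sup>2 \<partial>gamma_distr \<alpha>) \<le> ennreal (1 / (real k + 1))"
    using m nn_integral_eq_integral[OF i] by simp
  then have "(\<integral>t. (zser \<alpha> t \<omega> - zpart \<alpha> m \<omega> t)\<^sup>2 \<partial>gamma_distr \<alpha>) \<le> 1 / (real k + 1)"
    by (simp add: ennreal_le_iff)
  then show ?thesis using k by (intro that[OF i]) simp
qed

lemma zproc_L2: "(\<lambda>t. zproc \<alpha> t \<omega>) \<in> L2_fun (gamma_distr \<alpha>)"
proof (cases "\<omega> \<in> z_good \<alpha>")
  case False
  then show ?thesis by (simp add: zproc_def L2_fun_zero)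
next
  case True
  then obtain m where m: "integrable (gamma_distr \<alpha>) (\<lambda>t. (zser \<alpha> t \<omega> - zpart \<alpha> m \<omega> t)\<^sup>2)"
    using z_good_approx[OF True, of 1] by auto
  have meas: "(\<lambda>t. zser \<alpha> t \<omega> - zpart \<alpha> m \<omega> t) \<in> borel_measurable (gamma_distr \<alpha>)"
    by (intro borel_measurable_diff zser_section_measurable L2_fun_measurable[OF zpart_L2])
  have "(\<lambda>t. (zser \<alpha> t \<omega> - zpart \<alpha> m \<omega> t) + zpart \<alpha> m \<omega> t) \<in> L2_fun (gamma_distr \<alpha>)"
    using m meas by (intro L2_fun_add zpart_L2) (auto simp: L2_fun_def)
  then show ?thesis using True by (simp add: zproc_def)
qed

lemma zproc_gaussian: "gaussian_process gauss_seq {0..} (zproc \<alpha>)"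
  unfolding gaussian_process_def
proof (intro conjI ballI allI impI)
  show "prob_space gauss_seq" by unfold_locales
  show "zproc \<alpha> t \<in> borel_measurable gauss_seq" for t by measurable
  fix S :: "real set" and a :: "real \<Rightarrow> real" assume S: "finite S \<and> S \<subseteq> {0..}"
  define b where "b j = (\<Sum>t\<in>S. a t * lag_coef \<alpha> (2 + j) t)" for j
  have b: "summable (\<lambda>j. \<bar>b j\<bar>)"
    and AEb: "AE \<omega> in gauss_seq. (\<Sum>t\<in>S. a t * gauss_series (\<lambda>j. lag_coef \<alpha> (2 + j) t) \<omega>) = gauss_series b \<omega>"
    using gauss_series_linear_combination[of S "\<lambda>t j. lag_coef \<alpha> (2 + j) t" a] S summable_lag_coef_shift[OF \<alpha>2]
    by (auto simp: b_def[abs_def])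
  obtain v where v: "(\<lambda>j. (b j)\<^sup>2) sums v" using gauss_series_square(2)[OF b] by blast
  have "AE \<omega> in gauss_seq. \<forall>t\<in>S. zproc \<alpha> t \<omega> = zser \<alpha> t \<omega>"
    using S zproc_AE by (intro AE_finite_allI) auto
  then have AE: "AE \<omega> in gauss_seq. gauss_series b \<omega> = (\<Sum>t\<in>S. a t * zproc \<alpha> t \<omega>)"
    using AEb by eventually_elim (simp add: zser_def)
  have n: "normal_rv gauss_seq (gauss_series b) 0 (sqrt v)" by (rule gauss_series_normal[OF b v])
  have "normal_rv gauss_seq (\<lambda>\<omega>. \<Sum>t\<in>S. a t * zproc \<alpha> t \<omega>) 0 (sqrt v)"
    unfolding normal_rv_def
  proof (intro conjI)
    show m: "(\<lambda>\<omega>. \<Sum>t\<in>S. a t * zproc \<alpha> t \<omega>) \<in> borel_measurable gauss_seq" by measurable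
    show "if sqrt v = 0 then AE \<omega> in gauss_seq. (\<Sum>t\<in>S. a t * zproc \<alpha> t \<omega>) = 0
      else 0 < sqrt v \<and> distributed gauss_seq lborel (\<lambda>\<omega>. \<Sum>t\<in>S. a t * zproc \<alpha> t \<omega>) (normal_density 0 (sqrt v))"
    proof (cases "sqrt v = 0")
      case True
      then have "AE \<omega> in gauss_seq. gauss_series b \<omega> = 0" using n by (simp add: normal_rv_def)
      then have "AE \<omega> in gauss_seq. (\<Sum>t\<in>S. a t * zproc \<alpha> t \<omega>) = 0" using AE by eventually_elim simp
      then show ?thesis using True by simp
    next
      case False
      then have d: "0 < sqrt v" "distributed gauss_seq lborel (gauss_series b) (normal_density 0 (sqrt v))"
        using n unfolding normal_rv_def by auto
      have "distr gauss_seq lborel (gauss_series b) = distr gauss_seq lborel (\<lambda>\<omega>. \<Sum>t\<in>S. a t * zproc \<alpha> t \<omega>)"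
        using m by (intro distr_cong_AE AE) auto
      then show ?thesis using d m False by (auto simp: distributed_def)
    qed
  qed
  then show "\<exists>\<mu> \<sigma>. normal_rv gauss_seq (\<lambda>\<omega>. \<Sum>t\<in>S. a t * zproc \<alpha> t \<omega>) \<mu> \<sigma>" by blast
qed

lemma zproc_mean: "integrable gauss_seq (zproc \<alpha> t)" "(\<integral>\<omega>. zproc \<alpha> t \<omega> \<partial>gauss_seq) = 0"
proof -
  note g = gauss_series_mean[OF summable_lag_coef_shift[OF \<alpha>2, of t], folded zser_def]
  have zm: "zser \<alpha> t \<in> borel_measurable gauss_seq" unfolding zser_def by measurable
  show "integrable gauss_seq (zproc \<alpha> t)"
    using g(1) integrable_cong_AE[OF zproc_measurable zm zproc_AE] by simp
  show "(\<integral>\<omega>. zproc \<alpha> t \<omega> \<partial>gauss_seq) = 0"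
    using g(2) integral_cong_AE[OF zproc_measurable zm zproc_AE] by simp
qed

lemma zproc_covariance:
  assumes "s \<ge> 0" "t \<ge> 0"
  shows "covariance gauss_seq (zproc \<alpha> s) (zproc \<alpha> t) = K_cov \<alpha> s t"
proof -
  have zm: "zser \<alpha> t \<in> borel_measurable gauss_seq" for t unfolding zser_def by measurable
  have "covariance gauss_seq (zproc \<alpha> s) (zproc \<alpha> t) = (\<integral>\<omega>. zproc \<alpha> s \<omega> * zproc \<alpha> t \<omega> \<partial>gauss_seq)"
    by (simp add: covariance_def zproc_mean)
  also have "\<dots> = (\<integral>\<omega>. zser \<alpha> s \<omega> * zser \<alpha> t \<omega> \<partial>gauss_seq)"
  proof (rule integral_cong_AE)
    show "AE \<omega> in gauss_seq. zproc \<alpha> s \<omega> * zproc \<alpha> t \<omega> = zser \<alpha> s \<omega> * zser \<alpha> t \<omega>"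
      using zproc_AE[of s] zproc_AE[of t] by eventually_elim simp
  qed (use zm in auto)
  also have "\<dots> = K_cov \<alpha> s t"
    using gauss_series_mult(2)[OF summable_lag_coef_shift[OF \<alpha>2, of s] summable_lag_coef_shift[OF \<alpha>2, of t]]
      K_cov_sums[OF \<alpha>2 assms] sums_unique2 unfolding zser_def by blast
  finally show ?thesis .
qed

lemma lag_coef_L2_norm: "(\<integral>t. (lag_coef \<alpha> j t)\<^sup>2 \<partial>gamma_distr \<alpha>) \<le> 1"
proof -
  have "(\<integral>t. (lag_coef \<alpha> j t)\<^sup>2 \<partial>gamma_distr \<alpha>) \<le> (\<integral>t. 1 \<partial>gamma_distr \<alpha>)"
  proof (rule integral_mono_AE)
    show "AE t in gamma_distr \<alpha>. (lag_coef \<alpha> j t)\<^sup>2 \<le> 1"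
      using AE_gamma_nonneg[of \<alpha>]
      by eventually_elim (simp add: power_le_one lag_coef_le_1[OF \<alpha>2] lag_coef_nonneg[OF \<alpha>2])
  qed (use L2_fun_integrable[OF lag_coef_L2[OF \<alpha>2]] in auto)
  then show ?thesis using P.prob_space by simp
qed

lemma zpart_dist: "L2_dist (gamma_distr \<alpha>) (zpart \<alpha> m s) (zpart \<alpha> m s') \<le> (\<Sum>j<m. \<bar>s j - s' j\<bar>)"
  unfolding zpart_def[abs_def]
  by (rule L2_dist_lincomb) (auto intro: lag_coef_L2 \<alpha>2 lag_coef_L2_norm)

text \<open>The countable family consists of the finite sums with rational coefficients, translated by \<open>c\<close>.\<close>

lemma zproc_add_measurable_L2:
  assumes c: "c \<in> L2_fun (gamma_distr \<alpha>)"
  shows "(\<lambda>\<omega> t. zproc \<alpha> t \<omega> + c t) \<in> measurable gauss_seq (borel_of_topology (L2_topology (gamma_distr \<alpha>)))"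
proof (rule measurable_L2I[where D = "UNIV :: rat list set" and
      v = "\<lambda>qs t. zpart \<alpha> (length qs) (\<lambda>j. of_rat (qs ! j)) t + c t"])
  let ?P = "gamma_distr \<alpha>"
  have cm: "c \<in> borel_measurable ?P" using c by (rule L2_fun_measurable)
  show "countable (UNIV :: rat list set)" by simp
  show vL2: "(\<lambda>t. zpart \<alpha> (length qs) (\<lambda>j. of_rat (qs ! j)) t + c t) \<in> L2_fun ?P" for qs
    by (intro L2_fun_add zpart_L2 c)
  show "(\<lambda>t. zproc \<alpha> t \<omega> + c t) \<in> L2_fun ?P" for \<omega>
    by (intro L2_fun_add zproc_L2 c)
  show "(\<lambda>\<omega>. L2_dist ?P (\<lambda>t. zproc \<alpha> t \<omega> + c t) (\<lambda>t. zpart \<alpha> (length qs) (\<lambda>j. of_rat (qs ! j)) t + c t)) \<in> borel_measurable gauss_seq" for qs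
  proof -
    have [measurable]: "zpart \<alpha> (length qs) (\<lambda>j. of_rat (qs ! j)) \<in> borel_measurable ?P"
      by (rule L2_fun_measurable[OF zpart_L2])
    show ?thesis unfolding L2_dist_def using cm by measurable
  qed
  fix \<omega> and e :: real assume e: "e > 0"
  show "\<exists>qs\<in>UNIV. L2_dist ?P (\<lambda>t. zproc \<alpha> t \<omega> + c t) (\<lambda>t. zpart \<alpha> (length qs) (\<lambda>j. of_rat (qs ! j)) t + c t) < e"
  proof (cases "\<omega> \<in> z_good \<alpha>")
    case False
    \<comment> \<open>Off the good event the path is \<open>c\<close> itself, the member of the family with the empty list.\<close>
    then have "L2_dist ?P (\<lambda>t. zproc \<alpha> t \<omega> + c t) (\<lambda>t. zpart \<alpha> (length []) (\<lambda>j. of_rat ([] ! j)) t + c t) = 0"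
      by (simp add: zproc_def zpart_def L2_dist_def)
    then show ?thesis using e by (metis UNIV_I)
  next
    case True
    have "(e / 2)\<^sup>2 > 0" using e by simp
    then obtain m where m: "(\<integral>t. (zser \<alpha> t \<omega> - zpart \<alpha> m \<omega> t)\<^sup>2 \<partial>?P) < (e / 2)\<^sup>2"
      using z_good_approx[OF True] by blast
    have "\<exists>q. \<bar>\<omega> j - of_rat q\<bar> < e / (2 * (real m + 1))" for j
    proof -
      obtain q where "q \<in> \<rat>" "\<omega> j - e / (2 * (real m + 1)) < q" "q < \<omega> j"
        using Rats_dense_in_real[of "\<omega> j - e / (2 * (real m + 1))" "\<omega> j"] e by auto
      moreover from this obtain r where "q = of_rat r" by (auto elim: Rats_cases)
      ultimately show ?thesis by (intro exI[of _ r]) auto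
    qed
    then obtain q where q: "\<And>j. \<bar>\<omega> j - of_rat (q j)\<bar> < e / (2 * (real m + 1))" by metis
    define qs where "qs = map q [0..<m]"
    have qs: "length qs = m" "\<And>j. j < m \<Longrightarrow> qs ! j = q j" by (auto simp: qs_def)
    have d1: "L2_dist ?P (\<lambda>t. zproc \<alpha> t \<omega> + c t) (\<lambda>t. zpart \<alpha> m \<omega> t + c t) < e / 2"
    proof -
      have "L2_dist ?P (\<lambda>t. zproc \<alpha> t \<omega> + c t) (\<lambda>t. zpart \<alpha> m \<omega> t + c t) =
          sqrt (\<integral>t. (zser \<alpha> t \<omega> - zpart \<alpha> m \<omega> t)\<^sup>2 \<partial>?P)"
        using True by (simp add: L2_dist_def zproc_def)
      also have "\<dots> < sqrt ((e / 2)\<^sup>2)" using m by (simp only: real_sqrt_less_iff)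
      also have "\<dots> = e / 2" using e by simp
      finally show ?thesis .
    qed
    have d2: "L2_dist ?P (\<lambda>t. zpart \<alpha> m \<omega> t + c t) (\<lambda>t. zpart \<alpha> (length qs) (\<lambda>j. of_rat (qs ! j)) t + c t) \<le> e / 2"
    proof -
      have "L2_dist ?P (\<lambda>t. zpart \<alpha> m \<omega> t + c t) (\<lambda>t. zpart \<alpha> (length qs) (\<lambda>j. of_rat (qs ! j)) t + c t)
         = L2_dist ?P (zpart \<alpha> m \<omega>) (zpart \<alpha> m (\<lambda>j. of_rat (qs ! j)))"
        by (simp add: L2_dist_def qs)
      also have "\<dots> \<le> (\<Sum>j<m. \<bar>\<omega> j - of_rat (qs ! j)\<bar>)" by (rule zpart_dist)
      also have "\<dots> \<le> (\<Sum>j<m. e / (2 * (real m + 1)))"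
        using q by (intro sum_mono) (auto simp: qs less_imp_le)
      also have "\<dots> \<le> e / 2" using e by (simp add: field_simps)
      finally show ?thesis .
    qed
    have "L2_dist ?P (\<lambda>t. zproc \<alpha> t \<omega> + c t) (\<lambda>t. zpart \<alpha> (length qs) (\<lambda>j. of_rat (qs ! j)) t + c t) < e"
      using L2_dist_triangle[of "\<lambda>t. zproc \<alpha> t \<omega> + c t" ?P "\<lambda>t. zpart \<alpha> m \<omega> t + c t"
          "\<lambda>t. zpart \<alpha> (length qs) (\<lambda>j. of_rat (qs ! j)) t + c t"] d1 d2
      by (simp add: L2_fun_add zproc_L2 zpart_L2 c)
    then show ?thesis by blast
  qed
qed

end

section \<open>Linearization in the estimated scale\<close>

text \<open>The derivative is \<open>-1/a\<close> times a function of the same kind with the parameter \<open>a + 1\<close>, which is bounded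
by 1. Applied to that derivative, the lemma yields the second-order bound \<open>hyp01_neg_taylor\<close>.\<close>

lemma hyp01_neg_lipschitz:
  assumes a: "a \<ge> 1 / 2" and u: "u \<ge> 0" and v: "v \<ge> 0"
  shows "\<bar>hyp01 a (- u) - hyp01 a (- v)\<bar> \<le> \<bar>u - v\<bar> / a"
proof -
  have "norm (hyp01 a (- u) - hyp01 a (- v)) \<le> (1 / a) * norm (u - v)"
  proof (rule field_differentiable_bound[of "{0..}" _ "\<lambda>x. - hyp01 (a + 1) (- x) / a"])
    fix x :: real assume x: "x \<in> {0..}"
    show "((\<lambda>x. hyp01 a (- x)) has_field_derivative - hyp01 (a + 1) (- x) / a) (at x within {0..})"
    proof -
      have "a > 0" using a by simp
      from DERIV_hyp01_neg[OF this, of x] show ?thesis by (rule has_field_derivative_at_within)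
    qed
    show "norm (- hyp01 (a + 1) (- x) / a) \<le> 1 / a"
    proof -
      have "\<bar>hyp01 (a + 1) (- x)\<bar> \<le> 1" using a x by (intro abs_hyp01_neg_le_1) auto
      then have "\<bar>hyp01 (a + 1) (- x)\<bar> / a \<le> 1 / a" using a by (intro divide_right_mono) auto
      then show ?thesis using a by simp
    qed
  qed (use u v in auto)
  then show ?thesis by simp
qed

lemma hyp01_neg_taylor:
  assumes a: "a \<ge> 1 / 2" and u: "u \<ge> 0" and v: "v \<ge> 0"
  shows "\<bar>hyp01 a (- u) - hyp01 a (- v) - (- hyp01 (a + 1) (- v) / a) * (u - v)\<bar> \<le> (u - v)\<^sup>2 / (a * (a + 1))"
proof -
  have lip: "\<bar>hyp01 (a + 1) (- s) - hyp01 (a + 1) (- v)\<bar> \<le> \<bar>s - v\<bar> / (a + 1)" if "s \<ge> 0" for s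
    using a v that by (intro hyp01_neg_lipschitz) auto
  define S where "S = closed_segment u v"
  have S0: "s \<ge> 0" "\<bar>s - v\<bar> \<le> \<bar>u - v\<bar>" if "s \<in> S" for s
    using that u v by (auto simp: S_def closed_segment_eq_real_ivl split: if_splits)
  define \<phi> where "\<phi> x = hyp01 a (- x) - (- hyp01 (a + 1) (- v) / a) * x" for x
  have "norm (\<phi> u - \<phi> v) \<le> (\<bar>u - v\<bar> / (a * (a + 1))) * norm (u - v)"
  proof (rule field_differentiable_bound[of S _ "\<lambda>x. - hyp01 (a + 1) (- x) / a - (- hyp01 (a + 1) (- v) / a)"])
    show "convex S" by (simp add: S_def)
    show "u \<in> S" "v \<in> S" by (simp_all add: S_def)
    fix x assume x: "x \<in> S"
    have d: "((\<lambda>x. hyp01 a (- x)) has_field_derivative - hyp01 (a + 1) (- x) / a) (at x)"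
      using a by (intro DERIV_hyp01_neg) simp
    show "(\<phi> has_field_derivative - hyp01 (a + 1) (- x) / a - (- hyp01 (a + 1) (- v) / a)) (at x within S)"
      unfolding \<phi>_def[abs_def]
      by (rule has_field_derivative_at_within[OF DERIV_diff[OF d DERIV_cmult_Id]])
    have "norm (- hyp01 (a + 1) (- x) / a - (- hyp01 (a + 1) (- v) / a)) = \<bar>hyp01 (a + 1) (- x) - hyp01 (a + 1) (- v)\<bar> / a"
      using a by (simp add: diff_divide_distrib[symmetric] abs_divide abs_minus_commute)
    also have "\<dots> \<le> (\<bar>u - v\<bar> / (a + 1)) / a"
    proof (rule divide_right_mono)
      have "\<bar>x - v\<bar> / (a + 1) \<le> \<bar>u - v\<bar> / (a + 1)" using S0(2)[OF x] a by (intro divide_right_mono) auto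
      then show "\<bar>hyp01 (a + 1) (- x) - hyp01 (a + 1) (- v)\<bar> \<le> \<bar>u - v\<bar> / (a + 1)"
        using lip[OF S0(1)[OF x]] by simp
    qed (use a in simp)
    finally show "norm (- hyp01 (a + 1) (- x) / a - (- hyp01 (a + 1) (- v) / a)) \<le> \<bar>u - v\<bar> / (a * (a + 1))"
      by (simp add: mult.commute)
  qed
  moreover have "\<phi> u - \<phi> v = hyp01 a (- u) - hyp01 a (- v) - (- hyp01 (a + 1) (- v) / a) * (u - v)"
    unfolding \<phi>_def right_diff_distrib by simp
  moreover have "(\<bar>u - v\<bar> / (a * (a + 1))) * norm (u - v) = (u - v)\<^sup>2 / (a * (a + 1))"
    by (simp add: power2_eq_square)
  ultimately show ?thesis by (simp only: real_norm_def)
qed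

text \<open>With \<open>g(x) = 0F1(; \<alpha>; -x)\<close> this is \<open>x g'(tx/\<alpha>) + exp(-t/\<alpha>)\<close>. Up to the factor \<open>t\<close>, the first summand is
the derivative of \<open>g(txr)\<close> in the inverse scale \<open>r\<close> at \<open>r = 1/\<alpha>\<close>; the second one centers it.\<close>

definition dscale :: "real \<Rightarrow> real \<Rightarrow> real \<Rightarrow> real" where
  "dscale \<alpha> t x = exp (- t / \<alpha>) - x * hyp01 (\<alpha> + 1) (- (t * x / \<alpha>)) / \<alpha>"

lemma dscale_section_measurable [measurable]: "dscale \<alpha> t \<in> borel_measurable borel"
  unfolding dscale_def[abs_def] by measurable

text \<open>Write \<open>\<kappa> = 1/xb - 1/\<alpha>\<close>. Taylor expansion of \<open>g(t x\<^sub>i / xb)\<close> at \<open>t x\<^sub>i / \<alpha>\<close> gives a first-order sum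
\<open>t \<kappa> \<Sum> x\<^sub>i g'(t x\<^sub>i / \<alpha>)\<close>, in which \<open>x\<^sub>i g'\<close> is the centered \<open>dscale\<close> minus \<open>exp(-t/\<alpha>)\<close>. Since \<open>\<surd>n \<kappa>\<close> equals
\<open>-U / \<alpha>\<^sup>2\<close> to first order, the constant part reproduces the linear term of the kernel. Three errors
remain, in the order of the bound: \<open>\<kappa>\<close> times the centered sum, the second-order part of \<open>\<kappa>\<close>, and the
Taylor remainders. Each is of order \<open>1/\<surd>n\<close> when \<open>U\<close>, \<open>A\<close> and \<open>V\<close> are bounded; the constants come from
\<open>1/xb \<le> 2/\<alpha>\<close>.\<close>

lemma scale_linearization:
  fixes x :: "nat \<Rightarrow> real"
  assumes \<alpha>: "\<alpha> \<ge> 1 / 2" and n: "n \<ge> 1" and x: "\<And>i. i \<in> {1..n} \<Longrightarrow> x i \<ge> 0" and t: "t \<ge> 0"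
    and xb: "xb = (\<Sum>i=1..n. x i) / real n" "xb \<ge> \<alpha> / 2"
    and U: "U = 1 / sqrt (real n) * (\<Sum>i=1..n. x i - \<alpha>)"
    and V: "V = (\<Sum>i=1..n. (x i)\<^sup>2) / real n"
    and A: "A = 1 / sqrt (real n) * (\<Sum>i=1..n. dscale \<alpha> t (x i))"
  shows "\<bar>1 / sqrt (real n) * (\<Sum>i=1..n. hyp01 \<alpha> (- (t * x i / xb)) - exp (- t / \<alpha>))
      - 1 / sqrt (real n) * (\<Sum>i=1..n. hyp01 \<alpha> (- (t * x i / \<alpha>)) + (x i - \<alpha>) / \<alpha>\<^sup>2 * t * exp (- t / \<alpha>) - exp (- t / \<alpha>))\<bar>
    \<le> 1 / sqrt (real n) * (2 / \<alpha>\<^sup>2 * (\<bar>U\<bar> * \<bar>t * A\<bar>) + 2 / \<alpha> ^ 3 * (t * U\<^sup>2) + 4 / (\<alpha> ^ 5 * (\<alpha> + 1)) * (t\<^sup>2 * U\<^sup>2 * V))"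
proof -
  have a0: "\<alpha> > 0" using \<alpha> by simp
  define r where "r = sqrt (real n)"
  have r: "r > 0" "r * r = real n" using n by (auto simp: r_def)
  have xb0: "xb > 0" using xb(2) a0 by simp
  define \<kappa> where "\<kappa> = 1 / xb - 1 / \<alpha>"
  have sumx: "(\<Sum>i=1..n. x i) = real n * xb" using n xb(1) by simp
  have Ur: "U = r * (xb - \<alpha>)"
  proof -
    have "U = (real n * xb - real n * \<alpha>) / r"
    proof -
      have "(\<Sum>i=1..n. x i - \<alpha>) = (\<Sum>i=1..n. x i) - real n * \<alpha>" by (simp add: sum_subtractf)
      then show ?thesis unfolding U r_def[symmetric] sumx by simp
    qed
    also have "\<dots> = r * (xb - \<alpha>)" using r by (simp add: field_simps flip: r(2))
    finally show ?thesis .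
  qed
  have \<kappa>: "\<kappa> = - U / (r * \<alpha> * xb)"
    unfolding Ur \<kappa>_def using r a0 xb0 by (simp add: field_simps)
  have invxb: "1 / xb \<le> 2 / \<alpha>" using xb(2) xb0 a0 by (simp add: field_simps)
  have \<kappa>b: "\<bar>\<kappa>\<bar> \<le> 2 / \<alpha>\<^sup>2 * \<bar>U\<bar> / r"
  proof -
    have "\<bar>\<kappa>\<bar> = \<bar>U\<bar> / (r * \<alpha>) * (1 / xb)" using r a0 xb0 by (simp add: \<kappa> abs_mult)
    also have "\<dots> \<le> \<bar>U\<bar> / (r * \<alpha>) * (2 / \<alpha>)" using invxb r a0 by (intro mult_left_mono) auto
    also have "\<dots> = 2 / \<alpha>\<^sup>2 * \<bar>U\<bar> / r" by (simp add: power2_eq_square mult_ac)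
    finally show ?thesis .
  qed
  define e where "e = exp (- t / \<alpha>)"
  have e: "0 \<le> e" "e \<le> 1" using t a0 by (auto simp: e_def)
  define v \<delta> g' where "v i = t * x i / \<alpha>" and "\<delta> i = t * x i * \<kappa>" and "g' i = - hyp01 (\<alpha> + 1) (- v i) / \<alpha>" for i
  have uv: "t * x i / xb = v i + \<delta> i" for i
    by (simp add: v_def \<delta>_def \<kappa>_def field_simps)
  define R where "R i = hyp01 \<alpha> (- (t * x i / xb)) - hyp01 \<alpha> (- v i) - g' i * \<delta> i" for i
  have Rb: "\<bar>R i\<bar> \<le> t\<^sup>2 * (x i)\<^sup>2 * \<kappa>\<^sup>2 / (\<alpha> * (\<alpha> + 1))" if i: "i \<in> {1..n}" for i
  proof -
    have p: "t * x i / xb \<ge> 0" "v i \<ge> 0" using x[OF i] t xb0 a0 by (auto simp: v_def)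
    have de: "\<delta> i = t * x i / xb - v i" using uv by simp
    have "\<bar>R i\<bar> \<le> (t * x i / xb - v i)\<^sup>2 / (\<alpha> * (\<alpha> + 1))"
      using hyp01_neg_taylor[OF \<alpha> p] unfolding R_def g'_def de .
    also have "t * x i / xb - v i = \<delta> i" using uv by simp
    finally show ?thesis by (simp add: \<delta>_def power_mult_distrib)
  qed
  have ds: "dscale \<alpha> t (x i) = e + x i * g' i" for i
    by (simp add: dscale_def e_def g'_def v_def)
  have Ar: "(\<Sum>i=1..n. x i * g' i) = r * A - real n * e"
    using r by (simp add: A ds sum.distrib r_def[symmetric])
  have "1 / r * (\<Sum>i=1..n. hyp01 \<alpha> (- (t * x i / xb)) - e)
      - 1 / r * (\<Sum>i=1..n. hyp01 \<alpha> (- v i) + (x i - \<alpha>) / \<alpha>\<^sup>2 * t * e - e)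
      = 1 / r * (\<Sum>i=1..n. R i + g' i * \<delta> i) - 1 / r * (\<Sum>i=1..n. (x i - \<alpha>) / \<alpha>\<^sup>2 * t * e)"
    unfolding right_diff_distrib[symmetric] sum_subtractf[symmetric]
    by (intro arg_cong[where f = "\<lambda>x. 1 / r * x"] sum.cong refl) (simp add: R_def)
  also have "(\<Sum>i=1..n. R i + g' i * \<delta> i) = (\<Sum>i=1..n. R i) + t * \<kappa> * (r * A - real n * e)"
    unfolding Ar[symmetric] by (simp add: sum.distrib \<delta>_def sum_distrib_left mult_ac)
  also have "1 / r * (\<Sum>i=1..n. (x i - \<alpha>) / \<alpha>\<^sup>2 * t * e) = U * (t * e / \<alpha>\<^sup>2)"
    unfolding U r_def[symmetric] by (simp add: sum_distrib_left sum_distrib_right sum_divide_distrib mult_ac)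
  also have "1 / r * ((\<Sum>i=1..n. R i) + t * \<kappa> * (r * A - real n * e)) - U * (t * e / \<alpha>\<^sup>2)
      = 1 / r * (\<Sum>i=1..n. R i) + t * \<kappa> * A - t * e * (r * \<kappa> + U / \<alpha>\<^sup>2)"
    using r by (simp add: field_simps flip: r(2))
  also have "r * \<kappa> + U / \<alpha>\<^sup>2 = U\<^sup>2 / (r * \<alpha>\<^sup>2 * xb)"
    unfolding \<kappa> Ur using r a0 xb0 by (simp add: field_simps power2_eq_square)
  finally have D: "1 / r * (\<Sum>i=1..n. hyp01 \<alpha> (- (t * x i / xb)) - e)
      - 1 / r * (\<Sum>i=1..n. hyp01 \<alpha> (- v i) + (x i - \<alpha>) / \<alpha>\<^sup>2 * t * e - e)
      = 1 / r * (\<Sum>i=1..n. R i) + t * \<kappa> * A - t * e * (U\<^sup>2 / (r * \<alpha>\<^sup>2 * xb))" .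
  have b1: "\<bar>1 / r * (\<Sum>i=1..n. R i)\<bar> \<le> 1 / r * (4 / (\<alpha> ^ 5 * (\<alpha> + 1)) * (t\<^sup>2 * U\<^sup>2 * V))"
  proof -
    have \<kappa>2: "\<kappa>\<^sup>2 \<le> 4 * U\<^sup>2 / (\<alpha> ^ 4 * real n)"
    proof -
      have "\<kappa>\<^sup>2 \<le> (2 / \<alpha>\<^sup>2 * \<bar>U\<bar> / r)\<^sup>2" using \<kappa>b by (metis abs_ge_zero power2_abs power_mono)
      also have "\<dots> = 4 * U\<^sup>2 / (\<alpha> ^ 4 * real n)"
        by (simp add: power_mult_distrib power_divide flip: r(2)) (simp add: power2_eq_square eval_nat_numeral mult_ac)
      finally show ?thesis .
    qed
    have "\<bar>\<Sum>i=1..n. R i\<bar> \<le> (\<Sum>i=1..n. t\<^sup>2 * (x i)\<^sup>2 * \<kappa>\<^sup>2 / (\<alpha> * (\<alpha> + 1)))"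
      by (intro order.trans[OF sum_abs] sum_mono Rb)
    also have "\<dots> = t\<^sup>2 * (real n * V) / (\<alpha> * (\<alpha> + 1)) * \<kappa>\<^sup>2"
      using n by (simp add: V sum_distrib_left sum_divide_distrib sum_distrib_right mult_ac)
    also have "\<dots> \<le> t\<^sup>2 * (real n * V) / (\<alpha> * (\<alpha> + 1)) * (4 * U\<^sup>2 / (\<alpha> ^ 4 * real n))"
      using \<kappa>2 a0 by (intro mult_left_mono divide_nonneg_nonneg mult_nonneg_nonneg) (auto simp: V sum_nonneg)
    also have "\<dots> = 4 / (\<alpha> ^ 5 * (\<alpha> + 1)) * (t\<^sup>2 * U\<^sup>2 * V)"
    proof -
      have "\<alpha> ^ 5 = \<alpha> * \<alpha> ^ 4" by (simp add: eval_nat_numeral)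
      then show ?thesis using n by (simp add: mult_ac)
    qed
    finally have "\<bar>\<Sum>i=1..n. R i\<bar> \<le> 4 / (\<alpha> ^ 5 * (\<alpha> + 1)) * (t\<^sup>2 * U\<^sup>2 * V)" .
    then have "1 / r * \<bar>\<Sum>i=1..n. R i\<bar> \<le> 1 / r * (4 / (\<alpha> ^ 5 * (\<alpha> + 1)) * (t\<^sup>2 * U\<^sup>2 * V))"
      using r by (intro mult_left_mono) auto
    then show ?thesis using r by (simp add: abs_mult)
  qed
  have b2: "\<bar>t * \<kappa> * A\<bar> \<le> 1 / r * (2 / \<alpha>\<^sup>2 * (\<bar>U\<bar> * \<bar>t * A\<bar>))"
  proof -
    have "\<bar>t * \<kappa> * A\<bar> = \<bar>\<kappa>\<bar> * \<bar>t * A\<bar>" by (simp add: abs_mult mult_ac)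
    also have "\<dots> \<le> 2 / \<alpha>\<^sup>2 * \<bar>U\<bar> / r * \<bar>t * A\<bar>" using \<kappa>b by (intro mult_right_mono) auto
    finally show ?thesis by (simp add: mult_ac)
  qed
  have b3: "\<bar>t * e * (U\<^sup>2 / (r * \<alpha>\<^sup>2 * xb))\<bar> \<le> 1 / r * (2 / \<alpha> ^ 3 * (t * U\<^sup>2))"
  proof -
    have "\<bar>t * e * (U\<^sup>2 / (r * \<alpha>\<^sup>2 * xb))\<bar> = (t * U\<^sup>2 / (r * \<alpha>\<^sup>2)) * (e * (1 / xb))"
      using t e r a0 xb0 by (simp add: abs_mult)
    also have "\<dots> \<le> (t * U\<^sup>2 / (r * \<alpha>\<^sup>2)) * (1 * (2 / \<alpha>))"
      using t e r a0 xb0 invxb by (intro mult_left_mono mult_mono) auto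
    also have "\<dots> = 1 / r * (2 / \<alpha> ^ 3 * (t * U\<^sup>2))"
      by (simp add: power2_eq_square eval_nat_numeral mult_ac)
    finally show ?thesis .
  qed
  have "\<bar>1 / r * (\<Sum>i=1..n. R i) + t * \<kappa> * A - t * e * (U\<^sup>2 / (r * \<alpha>\<^sup>2 * xb))\<bar>
     \<le> 1 / r * (4 / (\<alpha> ^ 5 * (\<alpha> + 1)) * (t\<^sup>2 * U\<^sup>2 * V)) + 1 / r * (2 / \<alpha>\<^sup>2 * (\<bar>U\<bar> * \<bar>t * A\<bar>)) + 1 / r * (2 / \<alpha> ^ 3 * (t * U\<^sup>2))"
    using b1 b2 b3 by linarith
  then show ?thesis
    unfolding D[unfolded e_def v_def r_def, folded r_def] r_def[symmetric]
    by (simp only: D[unfolded e_def v_def] distrib_left) (simp add: e_def algebra_simps)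
qed

context
  fixes \<alpha> :: real
  assumes \<alpha>2: "\<alpha> \<ge> 1 / 2"
begin

interpretation P: prob_space "gamma_distr \<alpha>" by (rule prob_space_gamma_distr[OF alpha_pos[OF \<alpha>2]])

text \<open>The function \<open>x / \<alpha>\<close> is the density of the gamma distribution with parameter \<open>\<alpha> + 1\<close> with respect to
that with parameter \<open>\<alpha>\<close>.\<close>

lemma gamma_size_bias:
  assumes [measurable]: "f \<in> borel_measurable borel"
  shows "(\<integral>x. x * f x / \<alpha> \<partial>gamma_distr \<alpha>) = (\<integral>x. f x \<partial>gamma_distr (\<alpha> + 1))"
proof -
  have a0: "\<alpha> > 0" by (rule alpha_pos[OF \<alpha>2])
  have G: "Gamma \<alpha> > 0" using a0 by (rule Gamma_real_pos)
  have G1: "Gamma (\<alpha> + 1) = \<alpha> * Gamma \<alpha>" using a0 by (intro Gamma_plus1) (auto elim!: nonpos_Ints_cases)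
  define d where "d a x = (if x > 0 then x powr (a - 1) * exp (- x) / Gamma a else 0)" for a x :: real
  have [measurable]: "d a \<in> borel_measurable borel" for a unfolding d_def[abs_def] by measurable
  have dens: "gamma_distr a = density lborel (\<lambda>x. ennreal (d a x))" for a
    by (simp add: gamma_distr_def d_def)
  have nn: "AE x in lborel. 0 \<le> d a x" if "a > 0" for a
    using Gamma_real_pos[OF that] by (intro AE_I2) (simp add: d_def)
  have "(\<integral>x. x * f x / \<alpha> \<partial>gamma_distr \<alpha>) = (\<integral>x. d \<alpha> x *\<^sub>R (x * f x / \<alpha>) \<partial>lborel)"
    unfolding dens by (rule integral_density) (use nn[OF a0] in auto)
  also have "\<dots> = (\<integral>x. d (\<alpha> + 1) x *\<^sub>R f x \<partial>lborel)"
  proof (intro Bochner_Integration.integral_cong refl)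
    fix x :: real
    show "d \<alpha> x *\<^sub>R (x * f x / \<alpha>) = d (\<alpha> + 1) x *\<^sub>R f x"
    proof (cases "x > 0")
      case True
      have "x powr \<alpha> = x powr (\<alpha> - 1) * x"
        using True powr_add[of x "\<alpha> - 1" 1] by simp
      then show ?thesis using True G a0 by (simp add: d_def G1 mult_ac)
    qed (simp add: d_def)
  qed
  also have "\<dots> = (\<integral>x. f x \<partial>gamma_distr (\<alpha> + 1))"
    unfolding dens by (rule integral_density[symmetric]) (use nn[of "\<alpha> + 1"] a0 in auto)
  finally show ?thesis .
qed

text \<open>Size biasing turns the mean of \<open>x 0F1(; \<alpha>+1; -tx/\<alpha>) / \<alpha>\<close> into a Laguerre coefficient of index 0 for
the parameter \<open>\<alpha> + 1\<close>.\<close>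

lemma dscale_mean:
  assumes t: "t \<ge> 0" shows "(\<integral>x. dscale \<alpha> t x \<partial>gamma_distr \<alpha>) = 0"
proof -
  have a0: "\<alpha> > 0" by (rule alpha_pos[OF \<alpha>2])
  have a12: "\<alpha> + 1 \<ge> 1 / 2" using a0 by simp
  have [measurable]: "(\<lambda>x. hyp01 (\<alpha> + 1) (- (t * x / \<alpha>))) \<in> borel_measurable borel" by measurable
  \<comment> \<open>The argument for which \<open>s x / (\<alpha> + 1) = t x / \<alpha>\<close>.\<close>
  define s where "s = t * (\<alpha> + 1) / \<alpha>"
  have s: "s \<ge> 0" using t a0 by (simp add: s_def)
  have eq: "s * x / (\<alpha> + 1) = t * x / \<alpha>" for x using a0 by (simp add: s_def)
  have 1: "(\<integral>x. x * hyp01 (\<alpha> + 1) (- (t * x / \<alpha>)) / \<alpha> \<partial>gamma_distr \<alpha>) = exp (- t / \<alpha>)"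
  proof -
    have "(\<integral>x. x * hyp01 (\<alpha> + 1) (- (t * x / \<alpha>)) / \<alpha> \<partial>gamma_distr \<alpha>) = (\<integral>x. hyp01 (\<alpha> + 1) (- (t * x / \<alpha>)) \<partial>gamma_distr (\<alpha> + 1))"
      by (rule gamma_size_bias) measurable
    also have "\<dots> = (\<integral>x. hyp01 (\<alpha> + 1) (- (s * x / (\<alpha> + 1))) * lag_on (\<alpha> + 1) 0 x \<partial>gamma_distr (\<alpha> + 1))"
      by (simp add: eq lag_on_0)
    also have "\<dots> = lag_coef (\<alpha> + 1) 0 s" by (rule integral_hyp01_lag_on[OF a12 s])
    also have "\<dots> = exp (- t / \<alpha>)" using a0 by (simp add: lag_coef_0 s_def)
    finally show ?thesis .
  qed
  have i: "integrable (gamma_distr \<alpha>) (\<lambda>x. x * hyp01 (\<alpha> + 1) (- (t * x / \<alpha>)) / \<alpha>)"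
  proof (rule Bochner_Integration.integrable_bound)
    show "integrable (gamma_distr \<alpha>) (\<lambda>x. x ^ 1 / \<alpha>)"
      using integrable_gamma_distr_power[OF a0, of 1] by simp
    show "AE x in gamma_distr \<alpha>. norm (x * hyp01 (\<alpha> + 1) (- (t * x / \<alpha>)) / \<alpha>) \<le> norm (x ^ 1 / \<alpha>)"
      using AE_gamma_distr_pos[of \<alpha>]
    proof eventually_elim
      case (elim x)
      have "\<bar>hyp01 (\<alpha> + 1) (- (t * x / \<alpha>))\<bar> \<le> 1" using elim t a0 by (intro abs_hyp01_neg_le_1 a12) auto
      then show ?case using elim a0 by (simp add: abs_mult divide_right_mono mult_left_le)
    qed
  qed (intro gamma_distr_borel_measurable, measurable)
  show ?thesis
    unfolding dscale_def using i 1 P.prob_space by (simp del: space_gamma_distr)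
qed

lemma dscale_fourth_moment:
  obtains B where "B \<ge> 0" "\<And>t. t \<ge> 0 \<Longrightarrow> integrable (gamma_distr \<alpha>) (\<lambda>x. dscale \<alpha> t x ^ 4)"
    "\<And>t. t \<ge> 0 \<Longrightarrow> (\<integral>x. dscale \<alpha> t x ^ 4 \<partial>gamma_distr \<alpha>) \<le> B"
proof -
  have a0: "\<alpha> > 0" by (rule alpha_pos[OF \<alpha>2])
  have "\<bar>dscale \<alpha> t x\<bar> \<le> poly [:1, 1 / \<alpha>:] x" if t: "t \<ge> 0" and x: "x > 0" for t x
  proof -
    have h: "\<bar>hyp01 (\<alpha> + 1) (- (t * x / \<alpha>))\<bar> \<le> 1" using x t a0 \<alpha>2 by (intro abs_hyp01_neg_le_1) auto
    have "\<bar>dscale \<alpha> t x\<bar> \<le> \<bar>exp (- t / \<alpha>)\<bar> + \<bar>x * hyp01 (\<alpha> + 1) (- (t * x / \<alpha>)) / \<alpha>\<bar>"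
      unfolding dscale_def by (rule abs_triangle_ineq4)
    also have "\<dots> \<le> 1 + x / \<alpha>"
      using h t x a0 by (intro add_mono) (auto simp: abs_mult divide_right_mono mult_left_le)
    finally show ?thesis by simp
  qed
  then show ?thesis
    using fourth_moment_bound[OF \<alpha>2, of "dscale \<alpha>" "poly [:1, 1 / \<alpha>:]"] dscale_section_measurable that by blast
qed

end

section \<open>Scores and drift of a gamma array\<close>

locale gamma_array = local_alternatives_array "gamma_distr \<alpha>" h hl Q K M X
  for \<alpha> h hl Q K and M :: "nat \<Rightarrow> 'a measure" and X +
  assumes \<alpha>2: "\<alpha> \<ge> 1 / 2"
    and X_nonneg: "\<And>n j \<omega>. 1 \<le> j \<Longrightarrow> j \<le> n \<Longrightarrow> \<omega> \<in> space (M n) \<Longrightarrow> X n j \<omega> \<ge> 0"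
begin

abbreviation P where "P \<equiv> gamma_distr \<alpha>"

lemma a0: "\<alpha> > 0" using \<alpha>2 by simp

text \<open>The combination of \<open>markov_energy\<close> with the second-moment bound for normalized sums. For large \<open>n\<close> only
the integrated bound \<open>s2\<close> for the variances matters.\<close>

lemma array_energy:
  assumes n: "n \<ge> 1" and F: "(\<lambda>p. F (fst p) (snd p)) \<in> borel_measurable (borel \<Otimes>\<^sub>M borel)"
    and F4: "\<And>t. t \<ge> 0 \<Longrightarrow> integrable P (\<lambda>x. F t x ^ 4)"
    and F0: "\<And>t. t \<ge> 0 \<Longrightarrow> (\<integral>x. F t x \<partial>P) = 0"
    and s2: "\<And>t. t \<ge> 0 \<Longrightarrow> (\<integral>x. (F t x)\<^sup>2 \<partial>P) \<le> s2 t" "integrable P s2"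
    and s4: "\<And>t. t \<ge> 0 \<Longrightarrow> (\<integral>x. F t x ^ 4 \<partial>P) \<le> s4 t" "integrable P s4"
    and T: "T > 0"
  obtains A where "A \<in> sets (M n)"
    "measure (M n) A \<le> ((2 + K) * (\<integral>t. s2 t \<partial>P) + ((\<integral>t. s4 t \<partial>P) + (1 + K)) / sqrt (real n)) / T"
    "\<And>\<omega>. \<omega> \<in> space (M n) - A \<Longrightarrow> integrable P (\<lambda>t. (1 / sqrt (real n) * (\<Sum>i=1..n. F t (X n i \<omega>)))\<^sup>2)"
    "\<And>\<omega>. \<omega> \<in> space (M n) - A \<Longrightarrow> (\<integral>t. (1 / sqrt (real n) * (\<Sum>i=1..n. F t (X n i \<omega>)))\<^sup>2 \<partial>P) \<le> T"
proof -
  define b where "b t = (2 + K) * s2 t + (s4 t + (1 + K)) / sqrt (real n)" for t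
  define b0 where "b0 = (2 + K) * (\<integral>t. s2 t \<partial>P) + ((\<integral>t. s4 t \<partial>P) + (1 + K)) / sqrt (real n)"
  have Ft: "F t \<in> borel_measurable borel" for t
    using measurable_compose[OF measurable_Pair1' F, of t] by simp
  have nn: "0 \<le> s2 t" "0 \<le> s4 t" if "t \<ge> 0" for t
  proof -
    have "0 \<le> (\<integral>x. (F t x)\<^sup>2 \<partial>P)" "0 \<le> (\<integral>x. F t x ^ 4 \<partial>P)" by simp_all
    then show "0 \<le> s2 t" "0 \<le> s4 t" using s2(1)[OF that] s4(1)[OF that] by linarith+
  qed
  have bnn: "0 \<le> b t" if "t \<ge> 0" for t
    unfolding b_def using nn[OF that] K_nonneg by (intro add_nonneg_nonneg mult_nonneg_nonneg divide_nonneg_nonneg) auto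
  have bi: "integrable P b" unfolding b_def using s2(2) s4(2) by simp
  have bint: "(\<integral>t. b t \<partial>P) = b0" unfolding b_def b0_def using s2(2) s4(2) prob_space by simp
  have AE0: "AE t in P. 0 \<le> b t" using AE_gamma_nonneg[of \<alpha>] by eventually_elim (rule bnn)
  show ?thesis
  proof (rule markov_energy[OF M_prob[OF n] prob_space_axioms, where B = "\<lambda>\<omega> t. 1 / sqrt (real n) * (\<Sum>i=1..n. F t (X n i \<omega>))"
        and b = b and ?b0.0 = b0 and T = T])
    have "(\<lambda>p. F (snd p) (X n i (fst p))) \<in> borel_measurable (M n \<Otimes>\<^sub>M P)" if i: "i \<in> {1..n}" for i
    proof -
      have "(\<lambda>p. X n i (fst p)) \<in> borel_measurable (M n \<Otimes>\<^sub>M P)"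
        using i by (intro measurable_compose[OF measurable_fst X_meas]) auto
      moreover have "snd \<in> measurable (M n \<Otimes>\<^sub>M P) borel"
        using measurable_snd[of "M n" P] unfolding measurable_cong_sets[OF refl sets_gamma_distr] .
      ultimately have "(\<lambda>p. (snd p, X n i (fst p))) \<in> measurable (M n \<Otimes>\<^sub>M P) (borel \<Otimes>\<^sub>M borel)"
        by (intro measurable_Pair) auto
      from measurable_compose[OF this F] show ?thesis by simp
    qed
    then have "(\<lambda>p. 1 / sqrt (real n) * (\<Sum>i=1..n. F (snd p) (X n i (fst p)))) \<in> borel_measurable (M n \<Otimes>\<^sub>M P)"
      by (intro borel_measurable_times borel_measurable_const borel_measurable_sum)
    then show "(\<lambda>(\<omega>, t). 1 / sqrt (real n) * (\<Sum>i=1..n. F t (X n i \<omega>))) \<in> borel_measurable (M n \<Otimes>\<^sub>M P)"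
      by (simp add: case_prod_beta)
    show "AE t in P. (\<integral>\<^sup>+\<omega>. ennreal ((1 / sqrt (real n) * (\<Sum>i=1..n. F t (X n i \<omega>)))\<^sup>2) \<partial>M n) \<le> ennreal (b t)"
      using AE_gamma_nonneg[of \<alpha>]
    proof eventually_elim
      case (elim t)
      note m = normalized_sum_second_moment[OF n Ft F4[OF elim] F0[OF elim]]
      have "(\<integral>\<omega>. (1 / sqrt (real n) * (\<Sum>i=1..n. F t (X n i \<omega>)))\<^sup>2 \<partial>M n) \<le> b t"
        unfolding b_def using s2(1)[OF elim] s4(1)[OF elim] K_nonneg
        by (intro order.trans[OF m(2)] add_mono mult_left_mono divide_right_mono) auto
      then show ?case by (subst nn_integral_eq_integral[OF m(1)]) (auto intro: ennreal_leI)
    qed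
    show "(\<integral>\<^sup>+t. ennreal (b t) \<partial>P) \<le> ennreal b0"
      by (subst nn_integral_eq_integral[OF bi AE0]) (simp add: bint)
    show "0 \<le> b0" unfolding bint[symmetric] by (rule integral_nonneg_AE[OF AE0])
    show "T > 0" by (rule T)
  qed (use that in \<open>auto simp: b0_def\<close>)
qed

text \<open>The coordinates of the normalized sum of \<open>psi\<close> in the Laguerre basis; their joint limit is the
standard Gaussian sequence translated by \<open>shift\<close>.\<close>

definition score :: "nat \<Rightarrow> 'a \<Rightarrow> nat \<Rightarrow> real" where
  "score n \<omega> j = 1 / sqrt (real n) * (\<Sum>i=1..n. lag_on \<alpha> (2 + j) (X n i \<omega>))"

definition shift :: "nat \<Rightarrow> real" where
  "shift j = (\<integral>x. lag_on \<alpha> (2 + j) x * hl x \<partial>P)"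

definition drift :: "real \<Rightarrow> real" where
  "drift t = (\<integral>x. psi \<alpha> t x * hl x \<partial>P)"

lemma psi_L2: "t \<ge> 0 \<Longrightarrow> psi \<alpha> t \<in> L2_fun P"
proof -
  assume t: "t \<ge> 0"
  have "psi_rem \<alpha> 0 t = psi \<alpha> t" by (simp add: psi_rem_def fun_eq_iff)
  then show ?thesis using psi_rem_L2(1)[OF \<alpha>2 t, of 0] by simp
qed

lemma drift_has_integral: "t \<ge> 0 \<Longrightarrow> has_bochner_integral P (\<lambda>x. psi \<alpha> t x * hl x) (drift t)"
  unfolding drift_def by (intro has_bochner_integral_integrable integrable_L2_mult psi_L2 hl_L2)

lemma drift_measurable: "drift \<in> borel_measurable P"
proof -
  have "(\<lambda>p. psi \<alpha> (fst p) (snd p)) \<in> borel_measurable (P \<Otimes>\<^sub>M P)"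
    by (rule psi_measurable) (measurable, measurable)
  moreover have "(\<lambda>p. hl (snd p)) \<in> borel_measurable (P \<Otimes>\<^sub>M P)"
    by measurable
  ultimately have "(\<lambda>(t, x). psi \<alpha> t x * hl x) \<in> borel_measurable (P \<Otimes>\<^sub>M P)"
    by (simp add: case_prod_beta)
  then show ?thesis
    unfolding drift_def[abs_def] by (rule borel_measurable_lebesgue_integral)
qed

lemma drift_rem_le:
  assumes t: "t \<ge> 0" shows "(drift t - zpart \<alpha> m shift t)\<^sup>2 \<le> tail_energy \<alpha> m t * (1 + K)"
proof -
  note L = integrable_L2_mult[OF _ hl_L2]
  have "(\<integral>x. psi_rem \<alpha> m t x * hl x \<partial>P) =
      (\<integral>x. psi \<alpha> t x * hl x - (\<Sum>j<m. lag_coef \<alpha> (2 + j) t * (lag_on \<alpha> (2 + j) x * hl x)) \<partial>P)"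
    by (simp add: psi_rem_def left_diff_distrib sum_distrib_right mult.assoc)
  also have "\<dots> = drift t - (\<integral>x. (\<Sum>j<m. lag_coef \<alpha> (2 + j) t * (lag_on \<alpha> (2 + j) x * hl x)) \<partial>P)"
    unfolding drift_def
    by (intro Bochner_Integration.integral_diff L psi_L2 t Bochner_Integration.integrable_sum integrable_mult_right lag_on_L2 \<alpha>2)
  also have "(\<integral>x. (\<Sum>j<m. lag_coef \<alpha> (2 + j) t * (lag_on \<alpha> (2 + j) x * hl x)) \<partial>P)
      = (\<Sum>j<m. \<integral>x. lag_coef \<alpha> (2 + j) t * (lag_on \<alpha> (2 + j) x * hl x) \<partial>P)"
    by (intro Bochner_Integration.integral_sum integrable_mult_right L lag_on_L2 \<alpha>2)
  also have "\<dots> = zpart \<alpha> m shift t" by (simp add: zpart_def shift_def mult.commute)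
  finally have eq: "drift t - zpart \<alpha> m shift t = (\<integral>x. psi_rem \<alpha> m t x * hl x \<partial>P)" by simp
  have "(\<integral>x. psi_rem \<alpha> m t x * hl x \<partial>P)\<^sup>2 \<le> (\<integral>x. (psi_rem \<alpha> m t x)\<^sup>2 \<partial>P) * (\<integral>x. (hl x)\<^sup>2 \<partial>P)"
    by (rule Cauchy_Schwarz_L2[OF psi_rem_L2(1)[OF \<alpha>2 t] hl_L2])
  also have "\<dots> \<le> tail_energy \<alpha> m t * (1 + K)"
    unfolding psi_rem_square_integral[OF \<alpha>2 t] using tail_energy_bounds(1)[OF \<alpha>2 t] hl_L2_bound
    by (intro mult_left_mono) auto
  finally show ?thesis unfolding eq .
qed

lemma drift_L2: "drift \<in> L2_fun P"
  unfolding L2_fun_def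
proof (safe, rule drift_measurable)
  have "(\<lambda>t. (drift t)\<^sup>2) \<in> borel_measurable P" using drift_measurable by simp
  then show "integrable P (\<lambda>t. (drift t)\<^sup>2)"
  proof (rule Bochner_Integration.integrable_bound[rotated])
    show "integrable P (\<lambda>t. tail_energy \<alpha> 0 t * (1 + K))" using integrable_tail_energy[OF \<alpha>2] by simp
    show "AE t in P. norm ((drift t)\<^sup>2) \<le> norm (tail_energy \<alpha> 0 t * (1 + K))"
      using AE_gamma_nonneg[of \<alpha>]
    proof eventually_elim
      case (elim t)
      show ?case using drift_rem_le[OF elim, of 0] by (simp add: zpart_def order.trans[OF _ abs_ge_self])
    qed
  qed
qed

lemma drift_dist_le: "(L2_dist P drift (zpart \<alpha> m shift))\<^sup>2 \<le> (\<integral>t. tail_energy \<alpha> m t \<partial>P) * (1 + K)"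
proof -
  have "(\<integral>t. (drift t - zpart \<alpha> m shift t)\<^sup>2 \<partial>P) \<le> (\<integral>t. tail_energy \<alpha> m t * (1 + K) \<partial>P)"
  proof (rule integral_mono_AE)
    show "integrable P (\<lambda>t. (drift t - zpart \<alpha> m shift t)\<^sup>2)"
      using L2_fun_integrable[OF L2_fun_diff[OF drift_L2 zpart_L2[OF \<alpha>2]]] .
    show "integrable P (\<lambda>t. tail_energy \<alpha> m t * (1 + K))" using integrable_tail_energy[OF \<alpha>2] by simp
    show "AE t in P. (drift t - zpart \<alpha> m shift t)\<^sup>2 \<le> tail_energy \<alpha> m t * (1 + K)"
      using AE_gamma_nonneg[of \<alpha>] by eventually_elim (rule drift_rem_le)
  qed
  then show ?thesis by (simp add: L2_dist_def)
qed

lemma lag_on_fourth: "integrable P (\<lambda>x. lag_on \<alpha> j x ^ 4)"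
  using ex_poly_lag_on[of \<alpha> j] integrable_gamma_poly_power[OF \<alpha>2] by blast

lemma score_measurable: "n \<ge> 1 \<Longrightarrow> (\<lambda>\<omega>. score n \<omega> j) \<in> borel_measurable (M n)"
  unfolding score_def
  by (intro borel_measurable_times borel_measurable_const borel_measurable_sum measurable_compose[OF X_meas lag_on_measurable]) auto

text \<open>A single bound for the second moments of a score, for all \<open>n\<close>, and of its Gaussian limit.\<close>

definition score_bound :: "nat \<Rightarrow> real" where
  "score_bound j = (2 + K) + ((\<integral>x. lag_on \<alpha> (2 + j) x ^ 4 \<partial>P) + (1 + K)) + (1 + (shift j)\<^sup>2)"

lemma score_second_moment:
  assumes n: "n \<ge> 1"
  shows "integrable (M n) (\<lambda>\<omega>. (score n \<omega> j)\<^sup>2)" "(\<integral>\<omega>. (score n \<omega> j)\<^sup>2 \<partial>M n) \<le> score_bound j"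
proof -
  have l0: "(\<integral>x. lag_on \<alpha> (2 + j) x \<partial>P) = 0" by (rule integral_lag_on[OF \<alpha>2]) simp
  note m = normalized_sum_second_moment[OF n lag_on_measurable lag_on_fourth l0]
  show "integrable (M n) (\<lambda>\<omega>. (score n \<omega> j)\<^sup>2)" unfolding score_def by (rule m(1))
  have "(\<integral>x. (lag_on \<alpha> (2 + j) x)\<^sup>2 \<partial>P) = 1"
    using integral_lag_on_mult[OF \<alpha>2, of "2 + j" "2 + j"] by (simp add: power2_eq_square)
  moreover have "((\<integral>x. lag_on \<alpha> (2 + j) x ^ 4 \<partial>P) + (1 + K)) / sqrt (real n) \<le> ((\<integral>x. lag_on \<alpha> (2 + j) x ^ 4 \<partial>P) + (1 + K)) / 1"
    using n K_nonneg by (intro divide_left_mono add_nonneg_nonneg) auto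
  ultimately show "(\<integral>\<omega>. (score n \<omega> j)\<^sup>2 \<partial>M n) \<le> score_bound j"
    using m(2) unfolding score_def score_bound_def
    by (smt (verit) div_by_1 mult_cancel_left2 zero_le_power2 mult_1_right)
qed

lemma shifted_gauss_second_moment:
  "integrable gauss_seq (\<lambda>\<omega>. (\<omega> j + shift j)\<^sup>2)" "(\<integral>\<omega>. (\<omega> j + shift j)\<^sup>2 \<partial>gauss_seq) \<le> score_bound j"
proof -
  have eq: "(\<omega> j + shift j)\<^sup>2 = (\<omega> j)\<^sup>2 + 2 * shift j * \<omega> j + (shift j)\<^sup>2" for \<omega> :: "nat \<Rightarrow> real"
    by (simp add: power2_sum)
  show "integrable gauss_seq (\<lambda>\<omega>. (\<omega> j + shift j)\<^sup>2)"
    unfolding eq using gauss_seq_coord_moments[of j] by simp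
  have "(\<integral>\<omega>. (\<omega> j + shift j)\<^sup>2 \<partial>gauss_seq) = 1 + (shift j)\<^sup>2"
    unfolding eq using gauss_seq_coord_moments[of j] gauss_seq.prob_space by simp
  moreover have "0 \<le> (2 + K) + ((\<integral>x. lag_on \<alpha> (2 + j) x ^ 4 \<partial>P) + (1 + K))"
    using K_nonneg by (intro add_nonneg_nonneg) auto
  ultimately show "(\<integral>\<omega>. (\<omega> j + shift j)\<^sup>2 \<partial>gauss_seq) \<le> score_bound j"
    unfolding score_bound_def by linarith
qed

text \<open>The Cramer--Wold device. A combination of scores is the normalized sum of the polynomial
\<open>p = \<Sum> \<theta>\<^sub>j e\<^bsub>2+j\<^esub>\<close>, for which orthonormality gives \<open>\<integral>p\<^sup>2 = \<Sum> \<theta>\<^sub>j\<^sup>2\<close>, and \<open>\<integral>p hl = \<Sum> \<theta>\<^sub>j shift\<^sub>j\<close>.\<close>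

lemma score_cosines:
  "(\<lambda>n. \<integral>\<omega>. cos ((\<Sum>j<m. \<theta> j * score n \<omega> j) + b) \<partial>M n)
    \<longlonglongrightarrow> (\<integral>\<omega>. cos ((\<Sum>j<m. \<theta> j * (\<omega> j + shift j)) + b) \<partial>gauss_seq)"
proof -
  define p where "p x = (\<Sum>j<m. \<theta> j * lag_on \<alpha> (2 + j) x)" for x
  obtain q where q: "\<And>x. p x = poly q x" using ex_poly_lag_on_sum unfolding p_def by blast
  have pm: "p \<in> borel_measurable borel" unfolding p_def[abs_def] by measurable
  have p4: "integrable P (\<lambda>x. p x ^ 4)" by (rule integrable_gamma_poly_power[OF \<alpha>2 q])
  have p0: "(\<integral>x. p x \<partial>P) = 0"
  proof -
    have "(\<integral>x. p x \<partial>P) = (\<Sum>j<m. \<integral>x. \<theta> j * lag_on \<alpha> (2 + j) x \<partial>P)"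
      unfolding p_def by (intro Bochner_Integration.integral_sum integrable_mult_right integrable_lag_on \<alpha>2)
    also have "\<dots> = 0" by (simp add: integral_lag_on[OF \<alpha>2])
    finally show ?thesis .
  qed
  have ph: "(\<integral>x. p x * hl x \<partial>P) = (\<Sum>j<m. \<theta> j * shift j)"
  proof -
    have "(\<integral>x. p x * hl x \<partial>P) = (\<integral>x. (\<Sum>j<m. \<theta> j * (lag_on \<alpha> (2 + j) x * hl x)) \<partial>P)"
      by (simp add: p_def sum_distrib_right mult.assoc)
    also have "\<dots> = (\<Sum>j<m. \<integral>x. \<theta> j * (lag_on \<alpha> (2 + j) x * hl x) \<partial>P)"
      by (intro Bochner_Integration.integral_sum integrable_mult_right integrable_L2_mult lag_on_L2 hl_L2 \<alpha>2)
    finally show ?thesis by (simp add: shift_def)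
  qed
  have p2: "(\<integral>x. (p x)\<^sup>2 \<partial>P) = (\<Sum>j<m. (\<theta> j)\<^sup>2)"
  proof -
    have "(p x)\<^sup>2 = (\<Sum>i<m. \<Sum>j<m. \<theta> i * \<theta> j * (lag_on \<alpha> (2 + i) x * lag_on \<alpha> (2 + j) x))" for x
      unfolding p_def power2_eq_square sum_product by (simp add: mult_ac)
    then have "(\<integral>x. (p x)\<^sup>2 \<partial>P) = (\<Sum>i<m. \<integral>x. (\<Sum>j<m. \<theta> i * \<theta> j * (lag_on \<alpha> (2 + i) x * lag_on \<alpha> (2 + j) x)) \<partial>P)"
      using integrable_lag_on_mult[OF \<alpha>2]
      by (simp only:) (intro Bochner_Integration.integral_sum Bochner_Integration.integrable_sum integrable_mult_right)
    also have "\<dots> = (\<Sum>i<m. \<Sum>j<m. \<integral>x. \<theta> i * \<theta> j * (lag_on \<alpha> (2 + i) x * lag_on \<alpha> (2 + j) x) \<partial>P)"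
      by (intro sum.cong refl Bochner_Integration.integral_sum integrable_mult_right integrable_lag_on_mult \<alpha>2)
    also have "\<dots> = (\<Sum>i<m. \<Sum>j<m. if i = j then \<theta> i * \<theta> j else 0)"
      by (intro sum.cong refl) (simp add: integral_lag_on_mult[OF \<alpha>2])
    also have "\<dots> = (\<Sum>j<m. (\<theta> j)\<^sup>2)" by (simp add: power2_eq_square)
    finally show ?thesis .
  qed
  have sc: "(\<Sum>j<m. \<theta> j * score n \<omega> j) = 1 / sqrt (real n) * (\<Sum>i=1..n. p (X n i \<omega>))" for n \<omega>
  proof -
    have "(\<Sum>j<m. \<theta> j * score n \<omega> j) = (\<Sum>j<m. \<Sum>i=1..n. 1 / sqrt (real n) * (\<theta> j * lag_on \<alpha> (2 + j) (X n i \<omega>)))"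
      by (simp add: score_def sum_distrib_left mult_ac)
    also have "\<dots> = (\<Sum>i=1..n. \<Sum>j<m. 1 / sqrt (real n) * (\<theta> j * lag_on \<alpha> (2 + j) (X n i \<omega>)))"
      by (rule sum.swap)
    finally show ?thesis by (simp add: p_def sum_distrib_left)
  qed
  have re: "(\<integral>\<omega>. cos (Y \<omega> + b) \<partial>R) = Re (iexp b * (\<integral>\<omega>. iexp (Y \<omega>) \<partial>R))"
    if "prob_space R" "Y \<in> borel_measurable R" for R :: "'z measure" and Y
  proof -
    interpret R: prob_space R by fact
    have i: "integrable R (\<lambda>\<omega>. iexp (Y \<omega>))"
      using that by (intro R.integrable_iexp) auto
    have "(\<integral>\<omega>. cos (Y \<omega> + b) \<partial>R) = (\<integral>\<omega>. Re (iexp b * iexp (Y \<omega>)) \<partial>R)"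
      by (intro Bochner_Integration.integral_cong) (auto simp: cos_add Re_exp Im_exp algebra_simps)
    also have "\<dots> = Re (\<integral>\<omega>. iexp b * iexp (Y \<omega>) \<partial>R)"
      using i by (intro integral_Re integrable_mult_right)
    also have "(\<integral>\<omega>. iexp b * iexp (Y \<omega>) \<partial>R) = iexp b * (\<integral>\<omega>. iexp (Y \<omega>) \<partial>R)"
      by simp
    finally show ?thesis .
  qed
  have lim: "(\<integral>\<omega>. iexp (\<Sum>j<m. \<theta> j * (\<omega> j + shift j)) \<partial>gauss_seq) =
      exp (\<i> * complex_of_real (\<integral>x. p x * hl x \<partial>P) - complex_of_real (\<integral>x. (p x)\<^sup>2 \<partial>P) / 2)"
  proof -
    have "iexp (\<Sum>j<m. \<theta> j * (\<omega> j + shift j)) = iexp (\<Sum>j<m. \<theta> j * shift j) * iexp (\<Sum>j<m. \<omega> j * \<theta> j)" for \<omega> :: "nat \<Rightarrow> real"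
    proof -
      have "(\<Sum>j<m. \<theta> j * (\<omega> j + shift j)) = (\<Sum>j<m. \<theta> j * shift j) + (\<Sum>j<m. \<omega> j * \<theta> j)"
        by (simp add: distrib_left sum.distrib mult.commute)
      then show ?thesis by (simp only: of_real_add distrib_left exp_add)
    qed
    then have "(\<integral>\<omega>. iexp (\<Sum>j<m. \<theta> j * (\<omega> j + shift j)) \<partial>gauss_seq) =
        iexp (\<Sum>j<m. \<theta> j * shift j) * (\<integral>\<omega>. iexp (\<Sum>j<m. \<omega> j * \<theta> j) \<partial>gauss_seq)"
      by (simp only: integral_mult_right_zero)
    also have "\<dots> = iexp (\<Sum>j<m. \<theta> j * shift j) * exp (complex_of_real (- (\<Sum>j<m. (\<theta> j)\<^sup>2) / 2))"
      unfolding gauss_seq_char by (simp only: exp_of_real)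
    also have "\<dots> = exp (\<i> * complex_of_real (\<Sum>j<m. \<theta> j * shift j) - complex_of_real (\<Sum>j<m. (\<theta> j)\<^sup>2) / 2)"
      by (simp add: exp_add[symmetric])
    finally show ?thesis unfolding ph p2 .
  qed
  have "(\<lambda>n. Re (iexp b * (\<integral>\<omega>. iexp (1 / sqrt (real n) * (\<Sum>i=1..n. p (X n i \<omega>))) \<partial>M n))) \<longlonglongrightarrow>
      Re (iexp b * (\<integral>\<omega>. iexp (\<Sum>j<m. \<theta> j * (\<omega> j + shift j)) \<partial>gauss_seq))"
    unfolding lim
    by (intro tendsto_Re tendsto_mult tendsto_const normalized_sum_char_tendsto pm p4 p0)
  moreover have "Re (iexp b * (\<integral>\<omega>. iexp (\<Sum>j<m. \<theta> j * (\<omega> j + shift j)) \<partial>gauss_seq)) =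
      (\<integral>\<omega>. cos ((\<Sum>j<m. \<theta> j * (\<omega> j + shift j)) + b) \<partial>gauss_seq)"
    by (rule re[symmetric]) (unfold_locales, measurable)
  ultimately have "(\<lambda>n. Re (iexp b * (\<integral>\<omega>. iexp (1 / sqrt (real n) * (\<Sum>i=1..n. p (X n i \<omega>))) \<partial>M n))) \<longlonglongrightarrow>
      (\<integral>\<omega>. cos ((\<Sum>j<m. \<theta> j * (\<omega> j + shift j)) + b) \<partial>gauss_seq)" by simp
  then show ?thesis
  proof (rule Lim_transform_eventually)
    show "\<forall>\<^sub>F n in sequentially. Re (iexp b * (\<integral>\<omega>. iexp (1 / sqrt (real n) * (\<Sum>i=1..n. p (X n i \<omega>))) \<partial>M n)) =
        (\<integral>\<omega>. cos ((\<Sum>j<m. \<theta> j * score n \<omega> j) + b) \<partial>M n)"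
      using eventually_ge_at_top[of 1]
    proof eventually_elim
      case (elim n)
      have "(\<lambda>\<omega>. \<Sum>j<m. \<theta> j * score n \<omega> j) \<in> borel_measurable (M n)"
        by (intro borel_measurable_sum borel_measurable_times borel_measurable_const score_measurable elim)
      from re[OF M_prob[OF elim] this] show ?case by (simp only: sc)
    qed
  qed
qed

end

context gamma_array
begin

section \<open>Approximation of the statistic by finite Laguerre sums\<close>

lemma row_mean_nonneg: "\<omega> \<in> space (M n) \<Longrightarrow> row_mean X n \<omega> \<ge> 0"
  unfolding row_mean_def by (intro divide_nonneg_nonneg sum_nonneg) (auto intro: X_nonneg)

lemma Z_stat_eq:
  assumes w: "\<omega> \<in> space (M n)" and t: "t \<ge> 0"
  shows "Z_stat \<alpha> X n t \<omega> = 1 / sqrt (real n) * (\<Sum>i=1..n. hyp01 \<alpha> (- (t * X n i \<omega> / row_mean X n \<omega>)) - exp (- t / \<alpha>))"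
  unfolding Z_stat_def
proof (intro arg_cong[where f = "\<lambda>x. 1 / sqrt (real n) * x"] sum.cong refl)
  fix i assume i: "i \<in> {1..n}"
  have "t * X n i \<omega> / row_mean X n \<omega> \<ge> 0"
    using X_nonneg[of i n \<omega>] i w t row_mean_nonneg[OF w] by (intro divide_nonneg_nonneg mult_nonneg_nonneg) auto
  from hyp01_mod_bessel_J[OF a0 this]
  show "Gamma \<alpha> * mod_bessel_J \<alpha> (t * X n i \<omega> / row_mean X n \<omega>) - exp (- t / \<alpha>) =
      hyp01 \<alpha> (- (t * X n i \<omega> / row_mean X n \<omega>)) - exp (- t / \<alpha>)" by simp
qed

lemma Z_stat_section_measurable: "(\<lambda>t. Z_stat \<alpha> X n t \<omega>) \<in> borel_measurable P"
proof (rule gamma_distr_borel_measurable)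
  show "(\<lambda>t. Z_stat \<alpha> X n t \<omega>) \<in> borel_measurable borel" unfolding Z_stat_def by measurable
qed

lemma Z_stat_L2:
  assumes w: "\<omega> \<in> space (M n)"
  shows "(\<lambda>t. Z_stat \<alpha> X n t \<omega>) \<in> L2_fun P"
  unfolding L2_fun_def
proof (safe, rule Z_stat_section_measurable)
  show "integrable P (\<lambda>t. (Z_stat \<alpha> X n t \<omega>)\<^sup>2)"
  proof (rule integrable_const_bound[where B = "(1 / sqrt (real n) * (\<Sum>i=1..n. 2))\<^sup>2"])
    show "AE t in P. norm ((Z_stat \<alpha> X n t \<omega>)\<^sup>2) \<le> (1 / sqrt (real n) * (\<Sum>i=1..n. 2))\<^sup>2"
      using AE_gamma_nonneg[of \<alpha>]
    proof eventually_elim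
      case (elim t)
      have "\<bar>hyp01 \<alpha> (- (t * X n i \<omega> / row_mean X n \<omega>)) - exp (- t / \<alpha>)\<bar> \<le> 2" if i: "i \<in> {1..n}" for i
      proof -
        have "t * X n i \<omega> / row_mean X n \<omega> \<ge> 0"
          using X_nonneg[of i n \<omega>] i w elim row_mean_nonneg[OF w] by (intro divide_nonneg_nonneg mult_nonneg_nonneg) auto
        then have "\<bar>hyp01 \<alpha> (- (t * X n i \<omega> / row_mean X n \<omega>))\<bar> \<le> 1" by (rule abs_hyp01_neg_le_1[OF \<alpha>2])
        moreover have "\<bar>exp (- t / \<alpha>)\<bar> \<le> 1" using elim a0 by simp
        ultimately show ?thesis by linarith
      qed
      then have "\<bar>\<Sum>i=1..n. hyp01 \<alpha> (- (t * X n i \<omega> / row_mean X n \<omega>)) - exp (- t / \<alpha>)\<bar> \<le> (\<Sum>i=1..n. 2)"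
        by (intro order.trans[OF sum_abs] sum_mono)
      then have "\<bar>Z_stat \<alpha> X n t \<omega>\<bar> \<le> 1 / sqrt (real n) * (\<Sum>i=1..n. 2)"
        unfolding Z_stat_eq[OF w elim] abs_mult by (intro mult_mono) auto
      then have "\<bar>Z_stat \<alpha> X n t \<omega>\<bar>\<^sup>2 \<le> (1 / sqrt (real n) * (\<Sum>i=1..n. 2))\<^sup>2" by (intro power_mono) auto
      then show ?case by simp
    qed
    show "(\<lambda>t. (Z_stat \<alpha> X n t \<omega>)\<^sup>2) \<in> borel_measurable P"
      using Z_stat_section_measurable by (rule borel_measurable_power)
  qed
qed

lemma psi_sum_decomposition:
  "1 / sqrt (real n) * (\<Sum>i=1..n. psi \<alpha> t (X n i \<omega>)) - zpart \<alpha> m (score n \<omega>) t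
    = 1 / sqrt (real n) * (\<Sum>i=1..n. psi_rem \<alpha> m t (X n i \<omega>))"
proof -
  have "zpart \<alpha> m (score n \<omega>) t = (\<Sum>j<m. \<Sum>i=1..n. 1 / sqrt (real n) * (lag_coef \<alpha> (2 + j) t * lag_on \<alpha> (2 + j) (X n i \<omega>)))"
    by (simp add: zpart_def score_def sum_distrib_left sum_distrib_right mult_ac)
  also have "\<dots> = (\<Sum>i=1..n. \<Sum>j<m. 1 / sqrt (real n) * (lag_coef \<alpha> (2 + j) t * lag_on \<alpha> (2 + j) (X n i \<omega>)))"
    by (rule sum.swap)
  also have "\<dots> = 1 / sqrt (real n) * (\<Sum>i=1..n. \<Sum>j<m. lag_coef \<alpha> (2 + j) t * lag_on \<alpha> (2 + j) (X n i \<omega>))"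
    by (simp add: sum_distrib_left)
  finally show ?thesis
    by (simp add: psi_rem_def sum_subtractf right_diff_distrib)
qed

lemma psi_eq:
  assumes "t \<ge> 0" "x \<ge> 0"
  shows "psi \<alpha> t x = hyp01 \<alpha> (- (t * x / \<alpha>)) + (x - \<alpha>) / \<alpha>\<^sup>2 * t * exp (- t / \<alpha>) - exp (- t / \<alpha>)"
  using hyp01_mod_bessel_J[OF a0, of "t * x / \<alpha>"] assms a0 by (simp add: psi_def)

text \<open>The linearization is squared and integrated over \<open>t\<close>, on an event where the fluctuations of the first two
sample moments and the energies of the two normalized sums are bounded. The bound on the first sample moment
keeps the sample mean above \<open>\<alpha>/2\<close>.\<close>

lemma Z_stat_dist_le:
  assumes n: "n \<ge> 1" and w: "\<omega> \<in> space (M n)" and T: "T \<ge> 1" "T / real n \<le> (\<alpha> / 2)\<^sup>2"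
    and U: "(1 / sqrt (real n) * (\<Sum>i=1..n. X n i \<omega> - \<alpha>))\<^sup>2 \<le> T"
    and S: "(1 / sqrt (real n) * (\<Sum>i=1..n. (X n i \<omega>)\<^sup>2 - m2))\<^sup>2 \<le> T" and m2: "m2 \<ge> 0"
    and A: "integrable P (\<lambda>t. (1 / sqrt (real n) * (\<Sum>i=1..n. t * dscale \<alpha> t (X n i \<omega>)))\<^sup>2)"
      "(\<integral>t. (1 / sqrt (real n) * (\<Sum>i=1..n. t * dscale \<alpha> t (X n i \<omega>)))\<^sup>2 \<partial>P) \<le> T"
    and B: "integrable P (\<lambda>t. (1 / sqrt (real n) * (\<Sum>i=1..n. psi_rem \<alpha> m t (X n i \<omega>)))\<^sup>2)"
      "(\<integral>t. (1 / sqrt (real n) * (\<Sum>i=1..n. psi_rem \<alpha> m t (X n i \<omega>)))\<^sup>2 \<partial>P) \<le> T'"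
  shows "(L2_dist P (\<lambda>t. Z_stat \<alpha> X n t \<omega>) (zpart \<alpha> m (score n \<omega>)))\<^sup>2 \<le>
    6 / real n * ((2 / \<alpha>\<^sup>2)\<^sup>2 * T\<^sup>2 + (2 / \<alpha> ^ 3)\<^sup>2 * T\<^sup>2 * (\<integral>t. t ^ 2 \<partial>P)
      + (4 / (\<alpha> ^ 5 * (\<alpha> + 1)))\<^sup>2 * (T * (m2 + 1 + T))\<^sup>2 * (\<integral>t. t ^ 4 \<partial>P)) + 2 * T'"
proof -
  define u where "u = 1 / sqrt (real n) * (\<Sum>i=1..n. X n i \<omega> - \<alpha>)"
  define v where "v = (\<Sum>i=1..n. (X n i \<omega>)\<^sup>2) / real n"
  define xb where "xb = row_mean X n \<omega>"
  define a where "a t = 1 / sqrt (real n) * (\<Sum>i=1..n. dscale \<alpha> t (X n i \<omega>))" for t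
  define b where "b t = 1 / sqrt (real n) * (\<Sum>i=1..n. psi_rem \<alpha> m t (X n i \<omega>))" for t
  define c1 c2 c3 where "c1 = 2 / \<alpha>\<^sup>2" and "c2 = 2 / \<alpha> ^ 3" and "c3 = 4 / (\<alpha> ^ 5 * (\<alpha> + 1))"
  have rn: "sqrt (real n) * sqrt (real n) = real n" "sqrt (real n) > 0" "sqrt (real n) \<ge> 1" using n by auto
  have u2: "u\<^sup>2 \<le> T" using U by (simp add: u_def)
  have ueq: "u = sqrt (real n) * (xb - \<alpha>)"
  proof -
    have "(\<Sum>i=1..n. X n i \<omega> - \<alpha>) = real n * xb - real n * \<alpha>"
      using n by (simp add: sum_subtractf xb_def row_mean_def)
    also have "\<dots> = sqrt (real n) * (sqrt (real n) * (xb - \<alpha>))"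
      by (simp add: mult.assoc[symmetric] right_diff_distrib)
    finally show ?thesis using rn by (simp add: u_def)
  qed
  have xb: "xb \<ge> \<alpha> / 2"
  proof -
    have "(xb - \<alpha>)\<^sup>2 = u\<^sup>2 / real n" using n by (simp add: ueq power_mult_distrib)
    also have "\<dots> \<le> T / real n" using u2 by (intro divide_right_mono) auto
    also have "\<dots> \<le> (\<alpha> / 2)\<^sup>2" by (rule T(2))
    finally have "\<bar>xb - \<alpha>\<bar> \<le> \<alpha> / 2" using a0 by (simp add: abs_le_square_iff[symmetric])
    then show ?thesis by linarith
  qed
  have v: "0 \<le> v" "v \<le> m2 + 1 + T"
  proof -
    show "0 \<le> v" unfolding v_def by (intro divide_nonneg_nonneg sum_nonneg) auto
    define S' where "S' = 1 / sqrt (real n) * (\<Sum>i=1..n. (X n i \<omega>)\<^sup>2 - m2)"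
    have "(\<Sum>i=1..n. (X n i \<omega>)\<^sup>2 - m2) = real n * v - real n * m2"
      using n by (simp add: sum_subtractf v_def)
    also have "\<dots> = sqrt (real n) * (sqrt (real n) * (v - m2))"
      by (simp add: mult.assoc[symmetric] right_diff_distrib)
    finally have S': "S' = sqrt (real n) * (v - m2)" using rn by (simp add: S'_def)
    have "v - m2 \<le> \<bar>S'\<bar>"
    proof -
      have "\<bar>v - m2\<bar> \<le> sqrt (real n) * \<bar>v - m2\<bar>" using rn(3) by (simp add: mult_le_cancel_right1)
      then show ?thesis by (simp add: S' abs_mult)
    qed
    also have "\<bar>S'\<bar> \<le> 1 + S'\<^sup>2" using mult_abs_le_sum_squares[of 1 S'] by simp
    also have "S'\<^sup>2 \<le> T" using S by (simp add: S'_def)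
    finally show "v \<le> m2 + 1 + T" by simp
  qed
  define E where "E t = 6 / real n * (c1\<^sup>2 * (T * (t * a t)\<^sup>2) + c2\<^sup>2 * T\<^sup>2 * t ^ 2 + c3\<^sup>2 * (T * (m2 + 1 + T))\<^sup>2 * t ^ 4) + 2 * (b t)\<^sup>2" for t
  have ta: "t * a t = 1 / sqrt (real n) * (\<Sum>i=1..n. t * dscale \<alpha> t (X n i \<omega>))" for t
    by (simp add: a_def sum_distrib_left mult_ac)
  have tai: "integrable P (\<lambda>t. (t * a t)\<^sup>2)" "(\<integral>t. (t * a t)\<^sup>2 \<partial>P) \<le> T"
    unfolding ta using A by auto
  have bi: "integrable P (\<lambda>t. (b t)\<^sup>2)" "(\<integral>t. (b t)\<^sup>2 \<partial>P) \<le> T'"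
    unfolding b_def using B by auto
  have Ei: "integrable P E"
    unfolding E_def[abs_def] using tai(1) bi(1) integrable_gamma_distr_power[OF a0] by simp
  have Eint: "(\<integral>t. E t \<partial>P) \<le> 6 / real n * (c1\<^sup>2 * T\<^sup>2 + c2\<^sup>2 * T\<^sup>2 * (\<integral>t. t ^ 2 \<partial>P)
      + c3\<^sup>2 * (T * (m2 + 1 + T))\<^sup>2 * (\<integral>t. t ^ 4 \<partial>P)) + 2 * T'"
  proof -
    have "(\<integral>t. E t \<partial>P) = 6 / real n * (c1\<^sup>2 * (T * (\<integral>t. (t * a t)\<^sup>2 \<partial>P)) + c2\<^sup>2 * T\<^sup>2 * (\<integral>t. t ^ 2 \<partial>P)
      + c3\<^sup>2 * (T * (m2 + 1 + T))\<^sup>2 * (\<integral>t. t ^ 4 \<partial>P)) + 2 * (\<integral>t. (b t)\<^sup>2 \<partial>P)"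
      unfolding E_def using tai(1) bi(1) integrable_gamma_distr_power[OF a0] by simp
    also have "\<dots> \<le> 6 / real n * (c1\<^sup>2 * (T * T) + c2\<^sup>2 * T\<^sup>2 * (\<integral>t. t ^ 2 \<partial>P)
      + c3\<^sup>2 * (T * (m2 + 1 + T))\<^sup>2 * (\<integral>t. t ^ 4 \<partial>P)) + 2 * T'"
      using tai(2) bi(2) T(1) by (intro add_mono mult_left_mono order_refl) auto
    finally show ?thesis by (simp add: power2_eq_square)
  qed
  have pt: "(Z_stat \<alpha> X n t \<omega> - zpart \<alpha> m (score n \<omega>) t)\<^sup>2 \<le> E t" if t: "t \<ge> 0" for t
  proof -
    define D where "D = Z_stat \<alpha> X n t \<omega> - 1 / sqrt (real n) * (\<Sum>i=1..n. psi \<alpha> t (X n i \<omega>))"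
    have Xn: "X n i \<omega> \<ge> 0" if "i \<in> {1..n}" for i using X_nonneg[of i n \<omega>] that w by auto
    have "(\<Sum>i=1..n. psi \<alpha> t (X n i \<omega>)) = (\<Sum>i=1..n. hyp01 \<alpha> (- (t * X n i \<omega> / \<alpha>)) + (X n i \<omega> - \<alpha>) / \<alpha>\<^sup>2 * t * exp (- t / \<alpha>) - exp (- t / \<alpha>))"
      by (intro sum.cong refl psi_eq t Xn)
    then have "\<bar>D\<bar> \<le> 1 / sqrt (real n) * (c1 * (\<bar>u\<bar> * \<bar>t * a t\<bar>) + c2 * (t * u\<^sup>2) + c3 * (t\<^sup>2 * u\<^sup>2 * v))"
      unfolding D_def Z_stat_eq[OF w t] c1_def c2_def c3_def
      using scale_linearization[OF \<alpha>2 n Xn t _ xb u_def v_def a_def]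
      by (simp only: xb_def[unfolded row_mean_def] row_mean_def)
    then have "\<bar>D\<bar>\<^sup>2 \<le> (1 / sqrt (real n) * (c1 * (\<bar>u\<bar> * \<bar>t * a t\<bar>) + c2 * (t * u\<^sup>2) + c3 * (t\<^sup>2 * u\<^sup>2 * v)))\<^sup>2"
      by (intro power_mono) auto
    also have "\<dots> = 1 / real n * (c1 * (\<bar>u\<bar> * \<bar>t * a t\<bar>) + c2 * (t * u\<^sup>2) + c3 * (t\<^sup>2 * u\<^sup>2 * v))\<^sup>2"
      using n by (simp add: power_mult_distrib power_divide)
    also have "\<dots> \<le> 1 / real n * (3 * ((c1 * (\<bar>u\<bar> * \<bar>t * a t\<bar>))\<^sup>2 + (c2 * (t * u\<^sup>2))\<^sup>2 + (c3 * (t\<^sup>2 * u\<^sup>2 * v))\<^sup>2))"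
      by (intro mult_left_mono sum_three_squares) auto
    also have "\<dots> \<le> 1 / real n * (3 * (c1\<^sup>2 * (T * (t * a t)\<^sup>2) + c2\<^sup>2 * T\<^sup>2 * t ^ 2 + c3\<^sup>2 * (T * (m2 + 1 + T))\<^sup>2 * t ^ 4))"
    proof (intro mult_left_mono add_mono)
      have "(c1 * (\<bar>u\<bar> * \<bar>t * a t\<bar>))\<^sup>2 = c1\<^sup>2 * (u\<^sup>2 * (t * a t)\<^sup>2)"
        unfolding power_mult_distrib power2_abs ..
      also have "\<dots> \<le> c1\<^sup>2 * (T * (t * a t)\<^sup>2)" using u2 by (intro mult_left_mono mult_right_mono) auto
      finally show "(c1 * (\<bar>u\<bar> * \<bar>t * a t\<bar>))\<^sup>2 \<le> c1\<^sup>2 * (T * (t * a t)\<^sup>2)" .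
      have "(c2 * (t * u\<^sup>2))\<^sup>2 = c2\<^sup>2 * (u\<^sup>2)\<^sup>2 * t ^ 2" by (simp add: power_mult_distrib mult_ac)
      also have "\<dots> \<le> c2\<^sup>2 * T\<^sup>2 * t ^ 2" using u2 by (intro mult_left_mono mult_right_mono power_mono) auto
      finally show "(c2 * (t * u\<^sup>2))\<^sup>2 \<le> c2\<^sup>2 * T\<^sup>2 * t ^ 2" .
      have "t ^ 4 = (t\<^sup>2)\<^sup>2" by (simp add: power_mult[symmetric])
      then have "(c3 * (t\<^sup>2 * u\<^sup>2 * v))\<^sup>2 = c3\<^sup>2 * (u\<^sup>2 * v)\<^sup>2 * t ^ 4" by (simp add: power_mult_distrib mult_ac)
      also have "\<dots> \<le> c3\<^sup>2 * (T * (m2 + 1 + T))\<^sup>2 * t ^ 4"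
        using u2 v T m2 by (intro mult_left_mono mult_right_mono power_mono mult_mono) auto
      finally show "(c3 * (t\<^sup>2 * u\<^sup>2 * v))\<^sup>2 \<le> c3\<^sup>2 * (T * (m2 + 1 + T))\<^sup>2 * t ^ 4" .
    qed auto
    finally have "2 * \<bar>D\<bar>\<^sup>2 \<le> 2 * (1 / real n * (3 * (c1\<^sup>2 * (T * (t * a t)\<^sup>2) + c2\<^sup>2 * T\<^sup>2 * t ^ 2 + c3\<^sup>2 * (T * (m2 + 1 + T))\<^sup>2 * t ^ 4)))"
      by (rule mult_left_mono) simp
    moreover have "2 * (1 / real n * (3 * Y)) = 6 / real n * Y" for Y by simp
    ultimately have D2: "2 * D\<^sup>2 \<le> 6 / real n * (c1\<^sup>2 * (T * (t * a t)\<^sup>2) + c2\<^sup>2 * T\<^sup>2 * t ^ 2 + c3\<^sup>2 * (T * (m2 + 1 + T))\<^sup>2 * t ^ 4)"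
      by (simp only: power2_abs)
    have "Z_stat \<alpha> X n t \<omega> - zpart \<alpha> m (score n \<omega>) t = D + b t"
      unfolding D_def b_def psi_sum_decomposition[symmetric] by simp
    then have "(Z_stat \<alpha> X n t \<omega> - zpart \<alpha> m (score n \<omega>) t)\<^sup>2 \<le> 2 * D\<^sup>2 + 2 * (b t)\<^sup>2"
      using sum_two_squares[of D "b t"] by simp
    then show ?thesis using D2 by (simp add: E_def)
  qed
  have "(L2_dist P (\<lambda>t. Z_stat \<alpha> X n t \<omega>) (zpart \<alpha> m (score n \<omega>)))\<^sup>2
      = (\<integral>t. (Z_stat \<alpha> X n t \<omega> - zpart \<alpha> m (score n \<omega>) t)\<^sup>2 \<partial>P)"
    by (simp add: L2_dist_def)
  also have "\<dots> \<le> (\<integral>t. E t \<partial>P)"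
  proof (rule integral_mono_AE[OF _ Ei])
    show "integrable P (\<lambda>t. (Z_stat \<alpha> X n t \<omega> - zpart \<alpha> m (score n \<omega>) t)\<^sup>2)"
      by (rule L2_fun_integrable[OF L2_fun_diff[OF Z_stat_L2[OF w] zpart_L2[OF \<alpha>2]]])
    show "AE t in P. (Z_stat \<alpha> X n t \<omega> - zpart \<alpha> m (score n \<omega>) t)\<^sup>2 \<le> E t"
      using AE_gamma_nonneg[of \<alpha>] by eventually_elim (rule pt)
  qed
  finally show ?thesis using Eint unfolding c1_def c2_def c3_def by linarith
qed

text \<open>First \<open>m\<close> is taken so large that the tail energy is small, then \<open>n\<close> so large that all terms with a
negative power of \<open>n\<close> are. A fixed level \<open>T\<close> serves the three sums that need only be bounded: their
contribution to the distance carries the factor \<open>1/n\<close>. The tail sum must be small itself, below \<open>T'\<close>.\<close>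

lemma Z_stat_approx:
  assumes e: "e > 0" and \<delta>: "\<delta> > 0"
  shows "eventually (\<lambda>m. eventually (\<lambda>n. \<exists>A\<in>sets (M n). measure (M n) A \<le> \<delta> \<and>
    (\<forall>\<omega>\<in>space (M n) - A. L2_dist P (\<lambda>t. Z_stat \<alpha> X n t \<omega>) (zpart \<alpha> m (score n \<omega>)) \<le> e)) sequentially) sequentially"
proof -
  define m2 where "m2 = (\<integral>x. x ^ 2 \<partial>P)"
  have m20: "m2 \<ge> 0" by (simp add: m2_def)
  obtain Bd where Bd: "Bd \<ge> 0" "\<And>t. t \<ge> 0 \<Longrightarrow> integrable P (\<lambda>x. dscale \<alpha> t x ^ 4)"
    "\<And>t. t \<ge> 0 \<Longrightarrow> (\<integral>x. dscale \<alpha> t x ^ 4 \<partial>P) \<le> Bd" using dscale_fourth_moment[OF \<alpha>2] by blast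
  have L4: "(\<integral>x. (f x)\<^sup>2 \<partial>P) \<le> 1 + (\<integral>x. f x ^ 4 \<partial>P)"
    if "f \<in> borel_measurable borel" "integrable P (\<lambda>x. f x ^ 4)" for f :: "real \<Rightarrow> real"
    using L2_of_L4(2)[OF that] .
  define f1 f2 where "f1 x = x - \<alpha>" and "f2 x = x\<^sup>2 - m2" for x :: real
  have f1p: "f1 x = poly [:- \<alpha>, 1:] x" and f2p: "f2 x = poly [:- m2, 0, 1:] x" for x
    by (simp_all add: f1_def f2_def power2_eq_square)
  have f14: "integrable P (\<lambda>x. f1 x ^ 4)" "integrable P (\<lambda>x. f2 x ^ 4)"
    by (rule integrable_gamma_poly_power[OF \<alpha>2 f1p], rule integrable_gamma_poly_power[OF \<alpha>2 f2p])
  have fm: "f1 \<in> borel_measurable borel" "f2 \<in> borel_measurable borel"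
    unfolding f1_def[abs_def] f2_def[abs_def] by measurable
  have f10: "(\<integral>x. f1 x \<partial>P) = 0" "(\<integral>x. f2 x \<partial>P) = 0"
    using integrable_gamma_distr_power[OF a0, of 1] integral_gamma_distr_power[OF a0, of 1]
      integrable_gamma_distr_power[OF a0, of 2] prob_space
    unfolding f1_def f2_def m2_def by simp_all
  define s2 s4 where "s2 f t = 1 + (\<integral>x. f x ^ 4 \<partial>P)" and "s4 f t = (\<integral>x. f x ^ 4 \<partial>P)" for f :: "real \<Rightarrow> real" and t :: real
  have si: "integrable P (s2 f)" "integrable P (s4 f)" for f
    unfolding s2_def[abs_def] s4_def[abs_def] by simp_all
  define C where "C a b = (2 + K) * (\<integral>t. a t \<partial>P) + ((\<integral>t. b t \<partial>P) + (1 + K))" for a b :: "real \<Rightarrow> real"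
  define d2 d4 where "d2 t = t ^ 2 * (1 + Bd)" and "d4 t = t ^ 4 * Bd" for t :: real
  define CC where "CC = \<bar>C (s2 f1) (s4 f1)\<bar> + \<bar>C (s2 f2) (s4 f2)\<bar> + \<bar>C d2 d4\<bar>"
  \<comment> \<open>Three events are each to have probability at most \<open>CC / T \<le> \<delta> / 6\<close>; the tail event gets \<open>\<delta> / 2\<close>.\<close>
  define T where "T = 1 + 6 * CC / \<delta>"
  have CC0: "CC \<ge> 0" by (simp add: CC_def)
  have T: "T \<ge> 1" using CC0 \<delta> by (simp add: T_def)
  have CT: "c / T \<le> \<delta> / 6" if "c \<le> CC" for c
  proof -
    have "6 * CC \<le> \<delta> * T" using \<delta> by (simp add: T_def algebra_simps)
    then have "c \<le> \<delta> / 6 * T" using that by simp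
    then show ?thesis using T by (simp add: pos_divide_le_eq)
  qed
  define T' where "T' = e\<^sup>2 / 4"
  have T': "T' > 0" using e by (simp add: T'_def)
  define G where "G = (2 / \<alpha>\<^sup>2)\<^sup>2 * T\<^sup>2 + (2 / \<alpha> ^ 3)\<^sup>2 * T\<^sup>2 * (\<integral>t. t ^ 2 \<partial>P)
      + (4 / (\<alpha> ^ 5 * (\<alpha> + 1)))\<^sup>2 * (T * (m2 + 1 + T))\<^sup>2 * (\<integral>t. t ^ 4 \<partial>P)"
  have "(\<lambda>m. (2 + K) * (\<integral>t. tail_energy \<alpha> m t \<partial>P)) \<longlonglongrightarrow> (2 + K) * 0"
    by (intro tendsto_mult tendsto_const integral_tail_energy_tendsto \<alpha>2)
  then have "eventually (\<lambda>m. (2 + K) * (\<integral>t. tail_energy \<alpha> m t \<partial>P) < \<delta> / 4 * T') sequentially"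
    using \<delta> T' by (intro order_tendstoD) auto
  then show ?thesis
  proof eventually_elim
    case (elim m)
    obtain Bm where Bm: "Bm \<ge> 0" "\<And>t. t \<ge> 0 \<Longrightarrow> integrable P (\<lambda>x. psi_rem \<alpha> m t x ^ 4)"
      "\<And>t. t \<ge> 0 \<Longrightarrow> (\<integral>x. psi_rem \<alpha> m t x ^ 4 \<partial>P) \<le> Bm" using psi_rem_fourth_moment[OF \<alpha>2, of m] by blast
    have ev1: "eventually (\<lambda>n. (Bm + (1 + K)) / sqrt (real n) \<le> \<delta> / 4 * T') sequentially"
      using \<delta> T' by (intro eventually_sqrt_small) auto
    have ev2: "eventually (\<lambda>n. T / sqrt (real n) \<le> (\<alpha> / 2)\<^sup>2) sequentially"
      using a0 by (intro eventually_sqrt_small) auto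
    have ev3: "eventually (\<lambda>n. 6 * G / sqrt (real n) \<le> e\<^sup>2 / 2) sequentially"
      using e by (intro eventually_sqrt_small) auto
    show ?case using ev1 ev2 ev3 eventually_ge_at_top[of 1]
    proof eventually_elim
      case (elim n)
      note n = \<open>1 \<le> n\<close>
      interpret Mn: prob_space "M n" by (rule M_prob[OF n])
      have sq: "c / real n \<le> c / sqrt (real n)" if "c \<ge> 0" for c
      proof -
        have "sqrt (real n) \<le> real n" using n by (intro real_sqrt_le_iff[THEN iffD2, of "real n" "(real n)\<^sup>2", simplified]) (auto simp: power2_eq_square)
        then show ?thesis using that n by (intro divide_left_mono) auto
      qed
      have Cn: "((2 + K) * a + (b + (1 + K)) / sqrt (real n)) / T \<le> ((2 + K) * a + (b + (1 + K))) / T" if "b \<ge> 0" for a b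
      proof -
        have "(b + (1 + K)) / sqrt (real n) \<le> (b + (1 + K)) / 1"
          using n that K_nonneg by (intro divide_left_mono) auto
        then show ?thesis using T by (intro divide_right_mono) auto
      qed
      have s4n: "(\<integral>t. s4 f t \<partial>P) \<ge> 0" for f unfolding s4_def by simp
      obtain A1 where A1: "A1 \<in> sets (M n)" "measure (M n) A1 \<le> ((2 + K) * (\<integral>t. s2 f1 t \<partial>P) + ((\<integral>t. s4 f1 t \<partial>P) + (1 + K)) / sqrt (real n)) / T"
        "\<And>\<omega>. \<omega> \<in> space (M n) - A1 \<Longrightarrow> (\<integral>t. (1 / sqrt (real n) * (\<Sum>i=1..n. f1 (X n i \<omega>)))\<^sup>2 \<partial>P) \<le> T"
        by (rule array_energy[OF n, of "\<lambda>t. f1" "s2 f1" "s4 f1" T])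
           (use fm f14 f10 L4[OF fm(1) f14(1)] T si in \<open>auto simp: s2_def s4_def\<close>)
      obtain A2 where A2: "A2 \<in> sets (M n)" "measure (M n) A2 \<le> ((2 + K) * (\<integral>t. s2 f2 t \<partial>P) + ((\<integral>t. s4 f2 t \<partial>P) + (1 + K)) / sqrt (real n)) / T"
        "\<And>\<omega>. \<omega> \<in> space (M n) - A2 \<Longrightarrow> (\<integral>t. (1 / sqrt (real n) * (\<Sum>i=1..n. f2 (X n i \<omega>)))\<^sup>2 \<partial>P) \<le> T"
        by (rule array_energy[OF n, of "\<lambda>t. f2" "s2 f2" "s4 f2" T])
           (use fm f14 f10 L4[OF fm(2) f14(2)] T si in \<open>auto simp: s2_def s4_def\<close>)
      have dsm: "(\<lambda>p. fst p * dscale \<alpha> (fst p) (snd p)) \<in> borel_measurable (borel \<Otimes>\<^sub>M borel)"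
        unfolding dscale_def by measurable
      have ds4: "integrable P (\<lambda>x. (t * dscale \<alpha> t x) ^ 4)" if "t \<ge> 0" for t
        using Bd(2)[OF that] by (simp add: power_mult_distrib)
      have ds0: "(\<integral>x. t * dscale \<alpha> t x \<partial>P) = 0" if "t \<ge> 0" for t
        using dscale_mean[OF \<alpha>2 that] by simp
      have ds2: "(\<integral>x. (t * dscale \<alpha> t x)\<^sup>2 \<partial>P) \<le> d2 t" if "t \<ge> 0" for t
        using L4[OF dscale_section_measurable Bd(2)[OF that]] Bd(3)[OF that]
        by (simp add: power_mult_distrib d2_def mult_left_mono)
      have ds4': "(\<integral>x. (t * dscale \<alpha> t x) ^ 4 \<partial>P) \<le> d4 t" if "t \<ge> 0" for t
        using Bd(3)[OF that] by (simp add: power_mult_distrib d4_def mult_left_mono)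
      have d2i: "integrable P d2" "integrable P d4"
        unfolding d2_def[abs_def] d4_def[abs_def] using integrable_gamma_distr_power[OF a0] by simp_all
      have d4n: "(\<integral>t. d4 t \<partial>P) \<ge> 0" unfolding d4_def using Bd(1) by simp
      obtain A3 where A3: "A3 \<in> sets (M n)" "measure (M n) A3 \<le> ((2 + K) * (\<integral>t. d2 t \<partial>P) + ((\<integral>t. d4 t \<partial>P) + (1 + K)) / sqrt (real n)) / T"
        "\<And>\<omega>. \<omega> \<in> space (M n) - A3 \<Longrightarrow> integrable P (\<lambda>t. (1 / sqrt (real n) * (\<Sum>i=1..n. t * dscale \<alpha> t (X n i \<omega>)))\<^sup>2)"
        "\<And>\<omega>. \<omega> \<in> space (M n) - A3 \<Longrightarrow> (\<integral>t. (1 / sqrt (real n) * (\<Sum>i=1..n. t * dscale \<alpha> t (X n i \<omega>)))\<^sup>2 \<partial>P) \<le> T"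
        using array_energy[OF n dsm ds4 ds0 ds2 d2i(1) ds4' d2i(2), of T] T by auto
      have prm: "(\<lambda>p. psi_rem \<alpha> m (fst p) (snd p)) \<in> borel_measurable (borel \<Otimes>\<^sub>M borel)"
        by (rule psi_rem_measurable) measurable
      have pr2: "(\<integral>x. (psi_rem \<alpha> m t x)\<^sup>2 \<partial>P) \<le> tail_energy \<alpha> m t" if "t \<ge> 0" for t
        using psi_rem_square_integral[OF \<alpha>2 that] by simp
      have Bmi: "integrable P (\<lambda>t. Bm)" by simp
      obtain A4 where A4: "A4 \<in> sets (M n)" "measure (M n) A4 \<le> ((2 + K) * (\<integral>t. tail_energy \<alpha> m t \<partial>P) + ((\<integral>t. Bm \<partial>P) + (1 + K)) / sqrt (real n)) / T'"
        "\<And>\<omega>. \<omega> \<in> space (M n) - A4 \<Longrightarrow> integrable P (\<lambda>t. (1 / sqrt (real n) * (\<Sum>i=1..n. psi_rem \<alpha> m t (X n i \<omega>)))\<^sup>2)"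
        "\<And>\<omega>. \<omega> \<in> space (M n) - A4 \<Longrightarrow> (\<integral>t. (1 / sqrt (real n) * (\<Sum>i=1..n. psi_rem \<alpha> m t (X n i \<omega>)))\<^sup>2 \<partial>P) \<le> T'"
        using array_energy[OF n prm Bm(2) psi_rem_L2(3)[OF \<alpha>2] pr2 integrable_tail_energy[OF \<alpha>2] Bm(3) Bmi T'] by blast
      define A where "A = A1 \<union> A2 \<union> A3 \<union> A4"
      have pA1: "measure (M n) A1 \<le> \<delta> / 6"
        by (rule order.trans[OF A1(2) order.trans[OF Cn[OF s4n] CT]]) (simp add: CC_def C_def)
      have pA2: "measure (M n) A2 \<le> \<delta> / 6"
        by (rule order.trans[OF A2(2) order.trans[OF Cn[OF s4n] CT]]) (simp add: CC_def C_def)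
      have pA3: "measure (M n) A3 \<le> \<delta> / 6"
        by (rule order.trans[OF A3(2) order.trans[OF Cn[OF d4n] CT]]) (simp add: CC_def C_def)
      have pA4: "measure (M n) A4 \<le> \<delta> / 2"
      proof -
        have i: "(\<integral>t. Bm \<partial>P) = Bm" using prob_space by simp
        have "(2 + K) * (\<integral>t. tail_energy \<alpha> m t \<partial>P) + ((\<integral>t. Bm \<partial>P) + (1 + K)) / sqrt (real n) \<le> \<delta> / 4 * T' + \<delta> / 4 * T'"
          unfolding i
          by (rule add_mono[OF less_imp_le[OF \<open>(2 + K) * (\<integral>t. tail_energy \<alpha> m t \<partial>P) < \<delta> / 4 * T'\<close>] elim(1)])
        also have "\<dots> = \<delta> / 2 * T'" by simp
        finally have "((2 + K) * (\<integral>t. tail_energy \<alpha> m t \<partial>P) + ((\<integral>t. Bm \<partial>P) + (1 + K)) / sqrt (real n)) / T' \<le> \<delta> / 2"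
          using T' by (simp add: pos_divide_le_eq)
        from order.trans[OF A4(2) this] show ?thesis .
      qed
      have "measure (M n) A \<le> measure (M n) A1 + measure (M n) A2 + measure (M n) A3 + measure (M n) A4"
        unfolding A_def using A1(1) A2(1) A3(1) A4(1)
        by (intro order.trans[OF measure_Un_le] add_mono order_refl) auto
      then have pA: "measure (M n) A \<le> \<delta>" using pA1 pA2 pA3 pA4 by simp
      have As: "A \<in> sets (M n)" unfolding A_def using A1(1) A2(1) A3(1) A4(1) by auto
      have "L2_dist P (\<lambda>t. Z_stat \<alpha> X n t \<omega>) (zpart \<alpha> m (score n \<omega>)) \<le> e" if w: "\<omega> \<in> space (M n) - A" for \<omega>
      proof -
        have wA: "\<omega> \<in> space (M n) - A1" "\<omega> \<in> space (M n) - A2" "\<omega> \<in> space (M n) - A3" "\<omega> \<in> space (M n) - A4"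
          "\<omega> \<in> space (M n)" using w by (auto simp: A_def)
        have Tn: "T / real n \<le> (\<alpha> / 2)\<^sup>2" using sq[of T] T elim(2) by simp
        have U: "(1 / sqrt (real n) * (\<Sum>i=1..n. X n i \<omega> - \<alpha>))\<^sup>2 \<le> T"
          using A1(3)[OF wA(1)] prob_space by (simp add: f1_def)
        have S: "(1 / sqrt (real n) * (\<Sum>i=1..n. (X n i \<omega>)\<^sup>2 - m2))\<^sup>2 \<le> T"
          using A2(3)[OF wA(2)] prob_space by (simp add: f2_def)
        have "(L2_dist P (\<lambda>t. Z_stat \<alpha> X n t \<omega>) (zpart \<alpha> m (score n \<omega>)))\<^sup>2 \<le> 6 / real n * G + 2 * T'"
          unfolding G_def
          by (rule Z_stat_dist_le[OF n wA(5) T Tn U S m20 A3(3)[OF wA(3)] A3(4)[OF wA(3)] A4(3)[OF wA(4)] A4(4)[OF wA(4)]])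
        also have "\<dots> \<le> e\<^sup>2"
        proof -
          have "G \<ge> 0" unfolding G_def by (intro add_nonneg_nonneg mult_nonneg_nonneg) auto
          then have "6 * G / real n \<le> e\<^sup>2 / 2" using sq[of "6 * G"] elim(3) by simp
          then show ?thesis by (simp add: T'_def)
        qed
        finally show ?thesis using e L2_dist_nonneg by (simp add: power2_le_iff_abs_le abs_le_square_iff[symmetric])
      qed
      then show ?case using As pA by blast
    qed
  qed
qed

section \<open>Convergence of the statistic\<close>

lemma row_mean_measurable: "n \<ge> 1 \<Longrightarrow> row_mean X n \<in> borel_measurable (M n)"
  unfolding row_mean_def[abs_def]
  by (intro borel_measurable_divide borel_measurable_const borel_measurable_sum X_meas) auto

lemma Z_stat_joint_measurable:
  assumes n: "n \<ge> 1"
  shows "(\<lambda>p. Z_stat \<alpha> X n (snd p) (fst p)) \<in> borel_measurable (M n \<Otimes>\<^sub>M P)"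
proof -
  have s: "snd \<in> measurable (M n \<Otimes>\<^sub>M P) borel"
    using measurable_snd[of "M n" P] unfolding measurable_cong_sets[OF refl sets_gamma_distr] .
  have "(\<lambda>p. Gamma \<alpha> * mod_bessel_J \<alpha> (snd p * X n j (fst p) / row_mean X n (fst p)) - exp (- snd p / \<alpha>)) \<in> borel_measurable (M n \<Otimes>\<^sub>M P)"
    if j: "j \<in> {1..n}" for j
  proof -
    have x: "(\<lambda>p. X n j (fst p)) \<in> borel_measurable (M n \<Otimes>\<^sub>M P)"
      using j by (intro measurable_compose[OF measurable_fst X_meas]) auto
    have r: "(\<lambda>p. row_mean X n (fst p)) \<in> borel_measurable (M n \<Otimes>\<^sub>M P)"
      by (intro measurable_compose[OF measurable_fst row_mean_measurable] n)
    have "(\<lambda>p. snd p * X n j (fst p) / row_mean X n (fst p)) \<in> borel_measurable (M n \<Otimes>\<^sub>M P)"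
      by (intro borel_measurable_divide borel_measurable_times s x r)
    from measurable_compose[OF this mod_bessel_J_measurable]
    have "(\<lambda>p. mod_bessel_J \<alpha> (snd p * X n j (fst p) / row_mean X n (fst p))) \<in> borel_measurable (M n \<Otimes>\<^sub>M P)" .
    moreover have "(\<lambda>p. exp (- snd p / \<alpha>)) \<in> borel_measurable (M n \<Otimes>\<^sub>M P)"
      using s by (intro measurable_compose[OF _ borel_measurable_exp] borel_measurable_divide borel_measurable_uminus borel_measurable_const)
    ultimately show ?thesis by (intro borel_measurable_diff borel_measurable_times borel_measurable_const)
  qed
  then show ?thesis
    unfolding Z_stat_def by (intro borel_measurable_times borel_measurable_const borel_measurable_sum)
qed

text \<open>The statistic with the ratios of observations to the row mean replaced by rational numbers. Lists
are indexed from 0 and rows from 1.\<close>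

definition bessel_mean :: "nat \<Rightarrow> rat list \<Rightarrow> real \<Rightarrow> real" where
  "bessel_mean n qs t = 1 / sqrt (real n) *
     (\<Sum>i=1..n. Gamma \<alpha> * mod_bessel_J \<alpha> (t * of_rat (qs ! (i - 1))) - exp (- t / \<alpha>))"

lemma bessel_mean_measurable: "bessel_mean n qs \<in> borel_measurable P"
proof (rule gamma_distr_borel_measurable)
  show "bessel_mean n qs \<in> borel_measurable borel" unfolding bessel_mean_def[abs_def] by measurable
qed

text \<open>The Lipschitz bound for the hypergeometric function, integrated over \<open>t\<close>.\<close>

lemma Z_stat_bessel_mean_dist:
  assumes n: "n \<ge> 1" and w: "\<omega> \<in> space (M n)"
    and q: "\<And>i. i \<in> {1..n} \<Longrightarrow> (of_rat (qs ! (i - 1)) :: real) \<ge> 0"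
  shows "(\<lambda>t. bessel_mean n qs t) \<in> L2_fun P"
    "L2_dist P (\<lambda>t. Z_stat \<alpha> X n t \<omega>) (bessel_mean n qs) \<le>
      (\<Sum>i=1..n. \<bar>X n i \<omega> / row_mean X n \<omega> - of_rat (qs ! (i - 1))\<bar>) * sqrt ((\<integral>t. t ^ 2 \<partial>P) / \<alpha>\<^sup>2)"
proof -
  define y where "y i = X n i \<omega> / row_mean X n \<omega>" for i
  define r where "r i = (of_rat (qs ! (i - 1)) :: real)" for i
  define S where "S = (\<Sum>i=1..n. \<bar>y i - r i\<bar>)"
  have y0: "y i \<ge> 0" if "i \<in> {1..n}" for i
    using that X_nonneg[of i n \<omega>] w row_mean_nonneg[OF w] by (auto simp: y_def)
  have pt: "\<bar>Z_stat \<alpha> X n t \<omega> - bessel_mean n qs t\<bar> \<le> S * (t / \<alpha>)" if t: "t \<ge> 0" for t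
  proof -
    have bm: "bessel_mean n qs t = 1 / sqrt (real n) * (\<Sum>i=1..n. hyp01 \<alpha> (- (t * r i)) - exp (- t / \<alpha>))"
      unfolding bessel_mean_def r_def[symmetric]
      using hyp01_mod_bessel_J[OF a0] t q by (intro arg_cong[where f = "\<lambda>x. 1 / sqrt (real n) * x"] sum.cong refl) (simp add: r_def)
    have zs: "Z_stat \<alpha> X n t \<omega> = 1 / sqrt (real n) * (\<Sum>i=1..n. hyp01 \<alpha> (- (t * y i)) - exp (- t / \<alpha>))"
      unfolding Z_stat_eq[OF w t] y_def by simp
    have "Z_stat \<alpha> X n t \<omega> - bessel_mean n qs t = 1 / sqrt (real n) * (\<Sum>i=1..n. hyp01 \<alpha> (- (t * y i)) - hyp01 \<alpha> (- (t * r i)))"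
      unfolding zs bm right_diff_distrib[symmetric] sum_subtractf[symmetric] by simp
    then have "\<bar>Z_stat \<alpha> X n t \<omega> - bessel_mean n qs t\<bar> = 1 / sqrt (real n) * \<bar>\<Sum>i=1..n. hyp01 \<alpha> (- (t * y i)) - hyp01 \<alpha> (- (t * r i))\<bar>"
      by (simp add: abs_mult)
    also have "\<dots> \<le> 1 * (\<Sum>i=1..n. \<bar>y i - r i\<bar> * (t / \<alpha>))"
    proof (intro mult_mono order.trans[OF sum_abs] sum_mono)
      show "1 / sqrt (real n) \<le> 1" using n by simp
      fix i assume i: "i \<in> {1..n}"
      have "\<bar>hyp01 \<alpha> (- (t * y i)) - hyp01 \<alpha> (- (t * r i))\<bar> \<le> \<bar>t * y i - t * r i\<bar> / \<alpha>"
        using y0[OF i] q[OF i] t by (intro hyp01_neg_lipschitz \<alpha>2) (auto simp: r_def)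
      also have "\<dots> = \<bar>y i - r i\<bar> * (t / \<alpha>)"
        using t by (simp add: right_diff_distrib[symmetric] abs_mult)
      finally show "\<bar>hyp01 \<alpha> (- (t * y i)) - hyp01 \<alpha> (- (t * r i))\<bar> \<le> \<bar>y i - r i\<bar> * (t / \<alpha>)" .
    qed auto
    finally show ?thesis by (simp only: S_def sum_distrib_right mult_1_left)
  qed
  have sq: "AE t in P. (Z_stat \<alpha> X n t \<omega> - bessel_mean n qs t)\<^sup>2 \<le> S\<^sup>2 / \<alpha>\<^sup>2 * t ^ 2"
    using AE_gamma_nonneg[of \<alpha>]
  proof eventually_elim
    case (elim t)
    have "\<bar>Z_stat \<alpha> X n t \<omega> - bessel_mean n qs t\<bar>\<^sup>2 \<le> (S * (t / \<alpha>))\<^sup>2"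
      using pt[OF elim] by (intro power_mono) auto
    then show ?case by (simp add: power_mult_distrib power_divide)
  qed
  have bi: "integrable P (\<lambda>t. S\<^sup>2 / \<alpha>\<^sup>2 * t ^ 2)" using integrable_gamma_distr_power[OF a0] by simp
  have dm: "(\<lambda>t. Z_stat \<alpha> X n t \<omega> - bessel_mean n qs t) \<in> borel_measurable P"
    by (intro borel_measurable_diff Z_stat_section_measurable bessel_mean_measurable)
  have di: "integrable P (\<lambda>t. (Z_stat \<alpha> X n t \<omega> - bessel_mean n qs t)\<^sup>2)"
  proof (rule Bochner_Integration.integrable_bound[OF bi])
    show "(\<lambda>t. (Z_stat \<alpha> X n t \<omega> - bessel_mean n qs t)\<^sup>2) \<in> borel_measurable P"
      using dm by (rule borel_measurable_power)
    show "AE t in P. norm ((Z_stat \<alpha> X n t \<omega> - bessel_mean n qs t)\<^sup>2) \<le> norm (S\<^sup>2 / \<alpha>\<^sup>2 * t ^ 2)"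
      using sq by eventually_elim simp
  qed
  have dL2: "(\<lambda>t. Z_stat \<alpha> X n t \<omega> - bessel_mean n qs t) \<in> L2_fun P"
    using dm di by (simp add: L2_fun_def)
  show "(\<lambda>t. bessel_mean n qs t) \<in> L2_fun P"
    using L2_fun_diff[OF Z_stat_L2[OF w] dL2] by simp
  have S0: "S \<ge> 0" unfolding S_def by (intro sum_nonneg) auto
  have "(\<integral>t. (Z_stat \<alpha> X n t \<omega> - bessel_mean n qs t)\<^sup>2 \<partial>P) \<le> (\<integral>t. S\<^sup>2 / \<alpha>\<^sup>2 * t ^ 2 \<partial>P)"
    by (rule integral_mono_AE[OF di bi sq])
  also have "\<dots> = S\<^sup>2 * ((\<integral>t. t ^ 2 \<partial>P) / \<alpha>\<^sup>2)" by simp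
  finally have "L2_dist P (\<lambda>t. Z_stat \<alpha> X n t \<omega>) (bessel_mean n qs) \<le> sqrt (S\<^sup>2 * ((\<integral>t. t ^ 2 \<partial>P) / \<alpha>\<^sup>2))"
    unfolding L2_dist_def by (rule real_sqrt_le_mono)
  also have "\<dots> = S * sqrt ((\<integral>t. t ^ 2 \<partial>P) / \<alpha>\<^sup>2)"
    unfolding real_sqrt_mult using S0 by simp
  finally show "L2_dist P (\<lambda>t. Z_stat \<alpha> X n t \<omega>) (bessel_mean n qs) \<le>
      (\<Sum>i=1..n. \<bar>X n i \<omega> / row_mean X n \<omega> - of_rat (qs ! (i - 1))\<bar>) * sqrt ((\<integral>t. t ^ 2 \<partial>P) / \<alpha>\<^sup>2)"
    by (simp add: S_def y_def r_def)
qed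

text \<open>A path depends on the sample only through the ratios of the observations to their mean, so rational approximation of these ratios gives
the countable family that \<open>measurable_L2I\<close> asks for.\<close>

lemma Z_stat_measurable_L2:
  assumes n: "n \<ge> 1"
  shows "(\<lambda>\<omega> t. Z_stat \<alpha> X n t \<omega>) \<in> measurable (M n) (borel_of_topology (L2_topology P))"
proof -
  interpret Mn: prob_space "M n" by (rule M_prob[OF n])
  obtain \<omega>0 where w0: "\<omega>0 \<in> space (M n)" using Mn.not_empty by blast
  define D where "D = {qs :: rat list. length qs = n \<and> (\<forall>q\<in>set qs. q \<ge> 0)}"
  have q0: "(of_rat (qs ! (i - 1)) :: real) \<ge> 0" if "qs \<in> D" "i \<in> {1..n}" for qs i
    using that by (auto simp: D_def)
  show ?thesis
  proof (rule measurable_L2I[where D = D and v = "bessel_mean n"])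
    show "countable D" by (rule countableI_type)
    show vL2: "bessel_mean n qs \<in> L2_fun P" if "qs \<in> D" for qs
      using Z_stat_bessel_mean_dist(1)[OF n w0 q0[OF that]] .
    show "(\<lambda>t. Z_stat \<alpha> X n t \<omega>) \<in> L2_fun P" if "\<omega> \<in> space (M n)" for \<omega>
      by (rule Z_stat_L2[OF that])
    show "(\<lambda>\<omega>. L2_dist P (\<lambda>t. Z_stat \<alpha> X n t \<omega>) (bessel_mean n qs)) \<in> borel_measurable (M n)" for qs
    proof -
      have "(\<lambda>p. bessel_mean n qs (snd p)) \<in> borel_measurable (M n \<Otimes>\<^sub>M P)"
        by (rule measurable_compose[OF measurable_snd bessel_mean_measurable])
      then have "(\<lambda>(\<omega>, t). (Z_stat \<alpha> X n t \<omega> - bessel_mean n qs t)\<^sup>2) \<in> borel_measurable (M n \<Otimes>\<^sub>M P)"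
        unfolding case_prod_beta
        by (intro borel_measurable_power borel_measurable_diff Z_stat_joint_measurable n)
      then have "(\<lambda>\<omega>. \<integral>t. (Z_stat \<alpha> X n t \<omega> - bessel_mean n qs t)\<^sup>2 \<partial>P) \<in> borel_measurable (M n)"
        by (rule borel_measurable_lebesgue_integral)
      then show ?thesis unfolding L2_dist_def by measurable
    qed
    fix \<omega> and e :: real assume w: "\<omega> \<in> space (M n)" and e: "e > 0"
    define c where "c = sqrt ((\<integral>t. t ^ 2 \<partial>P) / \<alpha>\<^sup>2)"
    have c: "c \<ge> 0" unfolding c_def by simp
    define \<eta> where "\<eta> = e / (2 * (real n * c + 1))"
    have \<eta>: "\<eta> > 0" unfolding \<eta>_def using e c by (intro divide_pos_pos mult_pos_pos add_nonneg_pos mult_nonneg_nonneg) auto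
    have "\<exists>q::rat. q \<ge> 0 \<and> \<bar>X n i \<omega> / row_mean X n \<omega> - of_rat q\<bar> \<le> \<eta>" if i: "i \<in> {1..n}" for i
    proof -
      have y: "X n i \<omega> / row_mean X n \<omega> \<ge> 0"
        using i X_nonneg[of i n \<omega>] w row_mean_nonneg[OF w] by auto
      obtain q where q: "q \<in> \<rat>" "X n i \<omega> / row_mean X n \<omega> < q" "q < X n i \<omega> / row_mean X n \<omega> + \<eta>"
        using Rats_dense_in_real[of "X n i \<omega> / row_mean X n \<omega>" "X n i \<omega> / row_mean X n \<omega> + \<eta>"] \<eta> by auto
      then obtain r where r: "q = of_rat r" by (auto elim: Rats_cases)
      have "(0::real) < of_rat r" using y q(2) r by linarith
      then have "r \<ge> 0" by simp
      then show ?thesis using q r by (intro exI[of _ r]) auto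
    qed
    then obtain q where q: "\<And>i. i \<in> {1..n} \<Longrightarrow> q i \<ge> 0" "\<And>i. i \<in> {1..n} \<Longrightarrow> \<bar>X n i \<omega> / row_mean X n \<omega> - of_rat (q i)\<bar> \<le> \<eta>"
      by metis
    define qs where "qs = map (\<lambda>i. q (Suc i)) [0..<n]"
    have qsi: "qs ! (i - 1) = q i" if "i \<in> {1..n}" for i using that by (auto simp: qs_def)
    have qsD: "qs \<in> D" using q(1) by (auto simp: D_def qs_def)
    have "L2_dist P (\<lambda>t. Z_stat \<alpha> X n t \<omega>) (bessel_mean n qs) \<le>
        (\<Sum>i=1..n. \<bar>X n i \<omega> / row_mean X n \<omega> - of_rat (qs ! (i - 1))\<bar>) * c"
      unfolding c_def by (rule Z_stat_bessel_mean_dist(2)[OF n w q0[OF qsD]])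
    also have "\<dots> \<le> (\<Sum>i=1..n. \<eta>) * c"
    proof (intro mult_right_mono sum_mono)
      fix i assume i: "i \<in> {1..n}"
      show "\<bar>X n i \<omega> / row_mean X n \<omega> - of_rat (qs ! (i - 1))\<bar> \<le> \<eta>"
        unfolding qsi[OF i] by (rule q(2)[OF i])
    qed (rule c)
    also have "\<dots> = e * (real n * c) / (2 * (real n * c + 1))" by (simp add: \<eta>_def)
    also have "\<dots> < e"
    proof -
      define w where "w = real n * c"
      have "w \<ge> 0" using c by (simp add: w_def)
      then have "e * w < e * (2 * (w + 1))" using e by (intro mult_strict_left_mono) auto
      then have "e * w / (2 * (w + 1)) < e" using \<open>w \<ge> 0\<close> by (simp add: pos_divide_less_eq)
      then show ?thesis by (simp add: w_def)
    qed
    finally show "\<exists>qs\<in>D. L2_dist P (\<lambda>t. Z_stat \<alpha> X n t \<omega>) (bessel_mean n qs) < e" using qsD by blast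
  qed
qed

text \<open>The process and the drift are truncated separately; the integrated tail energy bounds both errors.\<close>

lemma limit_approx:
  assumes e: "e > 0" and \<delta>: "\<delta> > 0"
  shows "eventually (\<lambda>m. \<exists>A\<in>sets gauss_seq. measure gauss_seq A \<le> \<delta> \<and>
    (\<forall>\<omega>. \<omega> \<notin> A \<longrightarrow> L2_dist P (\<lambda>t. zproc \<alpha> t \<omega> + drift t) (zpart \<alpha> m (\<lambda>j. \<omega> j + shift j)) \<le> e)) sequentially"
proof -
  define T where "T = (e / 2)\<^sup>2"
  have T: "T > 0" using e by (simp add: T_def)
  have "(\<lambda>m. (\<integral>t. tail_energy \<alpha> m t \<partial>P) / T) \<longlonglongrightarrow> 0"
    by (intro tendsto_divide_zero integral_tail_energy_tendsto \<alpha>2)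
  then have e1: "eventually (\<lambda>m. (\<integral>t. tail_energy \<alpha> m t \<partial>P) / T < \<delta>) sequentially"
    by (rule order_tendstoD) (rule \<delta>)
  have "(\<lambda>m. (\<integral>t. tail_energy \<alpha> m t \<partial>P) * (1 + K)) \<longlonglongrightarrow> 0 * (1 + K)"
    by (intro tendsto_mult tendsto_const integral_tail_energy_tendsto \<alpha>2)
  then have e2: "eventually (\<lambda>m. (\<integral>t. tail_energy \<alpha> m t \<partial>P) * (1 + K) < T) sequentially"
    using T by (intro order_tendstoD) auto
  show ?thesis using e1 e2
  proof eventually_elim
    case (elim m)
    obtain A where A: "A \<in> sets gauss_seq" "measure gauss_seq A \<le> (\<integral>t. tail_energy \<alpha> m t \<partial>P) / T"
      "\<And>\<omega>. \<omega> \<notin> A \<Longrightarrow> integrable P (\<lambda>t. (zser \<alpha> t \<omega> - zpart \<alpha> m \<omega> t)\<^sup>2)"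
      "\<And>\<omega>. \<omega> \<notin> A \<Longrightarrow> (\<integral>t. (zser \<alpha> t \<omega> - zpart \<alpha> m \<omega> t)\<^sup>2 \<partial>P) \<le> T"
      by (rule z_rem_markov[OF \<alpha>2 T, of m]) (rule that)
    define A' where "A' = A \<union> (space gauss_seq - z_good \<alpha>)"
    have null: "measure gauss_seq (space gauss_seq - z_good \<alpha>) = 0"
    proof -
      have "measure gauss_seq (z_good \<alpha>) = 1"
        using z_good_AE[OF \<alpha>2] z_good_sets[OF \<alpha>2] by (simp add: gauss_seq.prob_eq_1)
      then show ?thesis using gauss_seq.prob_compl[OF z_good_sets[OF \<alpha>2]] by simp
    qed
    have A's: "A' \<in> sets gauss_seq" unfolding A'_def using A(1) z_good_sets[OF \<alpha>2] by auto
    have "measure gauss_seq A' \<le> measure gauss_seq A + measure gauss_seq (space gauss_seq - z_good \<alpha>)"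
      unfolding A'_def using A(1) z_good_sets[OF \<alpha>2] by (intro measure_Un_le) auto
    then have mA': "measure gauss_seq A' \<le> \<delta>" using null A(2) elim(1) by simp
    have "L2_dist P (\<lambda>t. zproc \<alpha> t \<omega> + drift t) (zpart \<alpha> m (\<lambda>j. \<omega> j + shift j)) \<le> e" if w: "\<omega> \<notin> A'" for \<omega>
    proof -
      have wg: "\<omega> \<in> z_good \<alpha>" "\<omega> \<notin> A" using w by (auto simp: A'_def space_gauss_seq)
      define u where "u t = zpart \<alpha> m \<omega> t + drift t" for t
      have uL2: "u \<in> L2_fun P" unfolding u_def[abs_def] by (intro L2_fun_add zpart_L2 drift_L2 \<alpha>2)
      have zeq: "zpart \<alpha> m (\<lambda>j. \<omega> j + shift j) t = zpart \<alpha> m \<omega> t + zpart \<alpha> m shift t" for t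
        by (simp add: zpart_def distrib_right sum.distrib)
      have d1: "L2_dist P (\<lambda>t. zproc \<alpha> t \<omega> + drift t) u \<le> e / 2"
      proof -
        have "L2_dist P (\<lambda>t. zproc \<alpha> t \<omega> + drift t) u = sqrt (\<integral>t. (zser \<alpha> t \<omega> - zpart \<alpha> m \<omega> t)\<^sup>2 \<partial>P)"
          using wg(1) by (simp add: L2_dist_def u_def zproc_def)
        also have "\<dots> \<le> sqrt T" using A(4)[OF wg(2)] by (rule real_sqrt_le_mono)
        also have "\<dots> = e / 2" using e by (simp add: T_def)
        finally show ?thesis .
      qed
      have d2: "L2_dist P u (zpart \<alpha> m (\<lambda>j. \<omega> j + shift j)) \<le> e / 2"
      proof -
        have "L2_dist P u (zpart \<alpha> m (\<lambda>j. \<omega> j + shift j)) = L2_dist P drift (zpart \<alpha> m shift)"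
          by (simp add: L2_dist_def u_def zeq)
        moreover have "(L2_dist P drift (zpart \<alpha> m shift))\<^sup>2 \<le> (e / 2)\<^sup>2"
          using drift_dist_le[of m] elim(2) by (simp add: T_def)
        ultimately show ?thesis using e by (metis half_gt_zero less_imp_le power2_le_imp_le)
      qed
      have "L2_dist P (\<lambda>t. zproc \<alpha> t \<omega> + drift t) (zpart \<alpha> m (\<lambda>j. \<omega> j + shift j)) \<le>
          L2_dist P (\<lambda>t. zproc \<alpha> t \<omega> + drift t) u + L2_dist P u (zpart \<alpha> m (\<lambda>j. \<omega> j + shift j))"
        by (rule L2_dist_triangle[OF L2_fun_add[OF zproc_L2[OF \<alpha>2] drift_L2] uL2 zpart_L2[OF \<alpha>2]])
      then show ?thesis using d1 d2 by simp
    qed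
    then show ?case using A's mA' by blast
  qed
qed

text \<open>For a Lipschitz functional, both expectations are compared with those after truncation to \<open>m\<close> Laguerre
terms, and the truncated functional is a Lipschitz function of \<open>m\<close> scores.\<close>

theorem Z_stat_conv_in_distr:
  "conv_in_distr (L2_topology P) M (\<lambda>n \<omega> t. Z_stat \<alpha> X n t \<omega>) gauss_seq (\<lambda>\<omega> t. zproc \<alpha> t \<omega> + drift t)"
proof (rule conv_in_distr_L2_lipschitzI[OF M_prob Z_stat_measurable_L2 gauss_seq.prob_space_axioms
      zproc_add_measurable_L2[OF \<alpha>2 drift_L2]])
  fix F :: "(real \<Rightarrow> real) \<Rightarrow> real" and L B :: real
  assume L: "L \<ge> 0" and lip: "\<And>f g. f \<in> L2_fun P \<Longrightarrow> g \<in> L2_fun P \<Longrightarrow> \<bar>F f - F g\<bar> \<le> L * L2_dist P f g"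
    and B: "\<And>f. f \<in> L2_fun P \<Longrightarrow> \<bar>F f\<bar> \<le> B"
  have B0: "B \<ge> 0" using B[OF L2_fun_zero] by linarith
  have Fm: "F \<in> borel_measurable (borel_of_topology (L2_topology P))"
    by (rule continuous_map_L2_measurable[OF L2_lipschitz_continuous_map[OF lip L]])
  define f where "f m s = F (zpart \<alpha> m s)" for m s
  have fB: "\<bar>f m s\<bar> \<le> B" for m s unfolding f_def by (rule B[OF zpart_L2[OF \<alpha>2]])
  have fL: "\<bar>f m s - f m s'\<bar> \<le> L * (\<Sum>j<m. \<bar>s j - s' j\<bar>)" for m s s'
    unfolding f_def
    by (rule order.trans[OF lip[OF zpart_L2[OF \<alpha>2] zpart_L2[OF \<alpha>2]] mult_left_mono[OF zpart_dist[OF \<alpha>2] L]])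
  have fm: "f m \<in> borel_measurable borel" for m
    by (rule borel_measurable_continuous_onI, rule finite_lipschitz_continuous_on[OF fL])
  have lim: "(\<lambda>n. \<integral>\<omega>. f m (score n \<omega>) \<partial>M n) \<longlonglongrightarrow> (\<integral>\<omega>. f m (\<lambda>j. \<omega> j + shift j) \<partial>gauss_seq)" for m
    by (rule cosine_conv_imp_lipschitz_conv[OF M_prob gauss_seq.prob_space_axioms score_measurable _ score_cosines
        score_second_moment shifted_gauss_second_moment fL fB]) measurable
  show "(\<lambda>n. \<integral>\<omega>. F (\<lambda>t. Z_stat \<alpha> X n t \<omega>) \<partial>M n) \<longlonglongrightarrow> (\<integral>\<omega>. F (\<lambda>t. zproc \<alpha> t \<omega> + drift t) \<partial>gauss_seq)"
  proof (rule tendsto_by_approximation)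
    fix e :: real assume e: "e > 0"
    define \<epsilon> where "\<epsilon> = e / (2 * (L + 1))"
    define \<delta> where "\<delta> = e / (4 * (B + 1))"
    have pos: "\<epsilon> > 0" "\<delta> > 0" using e L B0 by (auto simp: \<epsilon>_def \<delta>_def)
    have small: "L * \<epsilon> + 2 * B * \<delta> \<le> e"
    proof -
      have "L * \<epsilon> \<le> (L + 1) * \<epsilon>" using pos by (intro mult_right_mono) auto
      also have "\<dots> = e / 2" using L by (simp add: \<epsilon>_def field_simps)
      finally have 1: "L * \<epsilon> \<le> e / 2" .
      have "2 * B * \<delta> \<le> 2 * (B + 1) * \<delta>" using pos by (intro mult_right_mono) auto
      also have "\<dots> = e / 2" using B0 by (simp add: \<delta>_def field_simps)
      finally show ?thesis using 1 by simp
    qed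
    have "eventually (\<lambda>m. eventually (\<lambda>n. \<exists>A\<in>sets (M n). measure (M n) A \<le> \<delta> \<and>
        (\<forall>\<omega>\<in>space (M n) - A. L2_dist P (\<lambda>t. Z_stat \<alpha> X n t \<omega>) (zpart \<alpha> m (score n \<omega>)) \<le> \<epsilon>)) sequentially \<and>
        (\<exists>A\<in>sets gauss_seq. measure gauss_seq A \<le> \<delta> \<and>
        (\<forall>\<omega>. \<omega> \<notin> A \<longrightarrow> L2_dist P (\<lambda>t. zproc \<alpha> t \<omega> + drift t) (zpart \<alpha> m (\<lambda>j. \<omega> j + shift j)) \<le> \<epsilon>))) sequentially"
      by (intro eventually_conj Z_stat_approx limit_approx pos)
    then obtain m where m1: "eventually (\<lambda>n. \<exists>A\<in>sets (M n). measure (M n) A \<le> \<delta> \<and>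
        (\<forall>\<omega>\<in>space (M n) - A. L2_dist P (\<lambda>t. Z_stat \<alpha> X n t \<omega>) (zpart \<alpha> m (score n \<omega>)) \<le> \<epsilon>)) sequentially"
      and m2: "\<exists>A\<in>sets gauss_seq. measure gauss_seq A \<le> \<delta> \<and>
        (\<forall>\<omega>. \<omega> \<notin> A \<longrightarrow> L2_dist P (\<lambda>t. zproc \<alpha> t \<omega> + drift t) (zpart \<alpha> m (\<lambda>j. \<omega> j + shift j)) \<le> \<epsilon>)"
      using eventually_happens'[OF sequentially_bot] by blast
    have 1: "eventually (\<lambda>n. \<bar>(\<integral>\<omega>. F (\<lambda>t. Z_stat \<alpha> X n t \<omega>) \<partial>M n) - (\<integral>\<omega>. f m (score n \<omega>) \<partial>M n)\<bar> \<le> e) sequentially"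
      using m1 eventually_ge_at_top[of 1]
    proof eventually_elim
      case (elim n)
      interpret Mn: prob_space "M n" by (rule M_prob[OF elim(2)])
      obtain A where A: "A \<in> sets (M n)" "measure (M n) A \<le> \<delta>"
        "\<And>\<omega>. \<omega> \<in> space (M n) - A \<Longrightarrow> L2_dist P (\<lambda>t. Z_stat \<alpha> X n t \<omega>) (zpart \<alpha> m (score n \<omega>)) \<le> \<epsilon>"
        using elim(1) by blast
      have sm: "score n \<in> borel_measurable (M n)"
        by (rule measurable_coordinatewise_then_product) (rule score_measurable[OF elim(2)])
      have i1: "integrable (M n) (\<lambda>\<omega>. F (\<lambda>t. Z_stat \<alpha> X n t \<omega>))"
        using measurable_compose[OF Z_stat_measurable_L2[OF elim(2)] Fm] B Z_stat_L2
        by (intro Mn.integrable_const_bound[of _ B]) auto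
      have i2: "integrable (M n) (\<lambda>\<omega>. F (zpart \<alpha> m (score n \<omega>)))"
        using measurable_compose[OF sm fm[of m]] fB[of m] unfolding f_def
        by (intro Mn.integrable_const_bound[of _ B]) auto
      have "\<bar>(\<integral>\<omega>. F (\<lambda>t. Z_stat \<alpha> X n t \<omega>) \<partial>M n) - (\<integral>\<omega>. F (zpart \<alpha> m (score n \<omega>)) \<partial>M n)\<bar> \<le> L * \<epsilon> + 2 * B * \<delta>"
        by (rule Mn.integral_lipschitz_diff_le[OF i1 i2 Z_stat_L2 zpart_L2[OF \<alpha>2] L lip B A(1,2) less_imp_le[OF pos(1)] A(3)])
      then show ?case using small by (simp add: f_def)
    qed
    have 2: "\<bar>(\<integral>\<omega>. F (\<lambda>t. zproc \<alpha> t \<omega> + drift t) \<partial>gauss_seq) - (\<integral>\<omega>. f m (\<lambda>j. \<omega> j + shift j) \<partial>gauss_seq)\<bar> \<le> e"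
    proof -
      obtain A where A: "A \<in> sets gauss_seq" "measure gauss_seq A \<le> \<delta>"
        "\<And>\<omega>. \<omega> \<in> space gauss_seq - A \<Longrightarrow> L2_dist P (\<lambda>t. zproc \<alpha> t \<omega> + drift t) (zpart \<alpha> m (\<lambda>j. \<omega> j + shift j)) \<le> \<epsilon>"
        using m2 by blast
      have zL2: "(\<lambda>t. zproc \<alpha> t \<omega> + drift t) \<in> L2_fun P" for \<omega> by (intro L2_fun_add zproc_L2 drift_L2 \<alpha>2)
      have sm: "(\<lambda>\<omega> j. \<omega> j + shift j) \<in> borel_measurable gauss_seq"
        by (rule measurable_coordinatewise_then_product) measurable
      have i1: "integrable gauss_seq (\<lambda>\<omega>. F (\<lambda>t. zproc \<alpha> t \<omega> + drift t))"
        using measurable_compose[OF zproc_add_measurable_L2[OF \<alpha>2 drift_L2] Fm] B zL2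
        by (intro gauss_seq.integrable_const_bound[of _ B]) auto
      have i2: "integrable gauss_seq (\<lambda>\<omega>. F (zpart \<alpha> m (\<lambda>j. \<omega> j + shift j)))"
        using measurable_compose[OF sm fm[of m]] fB[of m] unfolding f_def
        by (intro gauss_seq.integrable_const_bound[of _ B]) auto
      have "\<bar>(\<integral>\<omega>. F (\<lambda>t. zproc \<alpha> t \<omega> + drift t) \<partial>gauss_seq) - (\<integral>\<omega>. F (zpart \<alpha> m (\<lambda>j. \<omega> j + shift j)) \<partial>gauss_seq)\<bar> \<le> L * \<epsilon> + 2 * B * \<delta>"
        by (rule gauss_seq.integral_lipschitz_diff_le[OF i1 i2 zL2 zpart_L2[OF \<alpha>2] L lip B A(1,2) less_imp_le[OF pos(1)] A(3)])
      then show ?thesis using small by (simp add: f_def)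
    qed
    show "\<exists>b l. b \<longlonglongrightarrow> l \<and> (\<forall>\<^sub>F n in sequentially. \<bar>(\<integral>\<omega>. F (\<lambda>t. Z_stat \<alpha> X n t \<omega>) \<partial>M n) - b n\<bar> \<le> e) \<and>
        \<bar>(\<integral>\<omega>. F (\<lambda>t. zproc \<alpha> t \<omega> + drift t) \<partial>gauss_seq) - l\<bar> \<le> e"
      using lim[of m] 1 2 by blast
  qed
qed

end

section \<open>The square-integral statistic\<close>

lemma L2_norm_square_continuous_map:
  "continuous_map (L2_topology P) euclideanreal (\<lambda>f. \<integral>x. (f x)\<^sup>2 \<partial>P)"
proof -
  have "continuous_map (L2_topology P) euclideanreal (\<lambda>f. L2_dist P f (\<lambda>x. 0))"
  proof (rule L2_lipschitz_continuous_map[where L = 1])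
    fix f g assume fg: "f \<in> L2_fun P" "g \<in> L2_fun P"
    show "\<bar>L2_dist P f (\<lambda>x. 0) - L2_dist P g (\<lambda>x. 0)\<bar> \<le> 1 * L2_dist P f g"
      using L2_dist_triangle[OF fg L2_fun_zero] L2_dist_triangle[OF fg(2,1) L2_fun_zero]
      by (simp add: abs_le_iff L2_dist_commute[of P g f])
  qed simp
  then have "continuous_map (L2_topology P) euclideanreal (\<lambda>f. (L2_dist P f (\<lambda>x. 0))\<^sup>2)"
    by (intro continuous_map_real_pow)
  then show ?thesis by (simp add: L2_dist_def)
qed

text \<open>The continuous mapping theorem for a real-valued map.\<close>

lemma conv_in_distr_imp_weak_conv_m:
  assumes c: "conv_in_distr T M Y N Z" and F: "continuous_map T euclideanreal F"
    and meas: "F \<in> borel_measurable (borel_of_topology T)"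
  shows "weak_conv_m (\<lambda>n. distr (M n) borel (\<lambda>\<omega>. F (Y n \<omega>))) (distr N borel (\<lambda>\<omega>. F (Z \<omega>)))"
proof -
  \<comment> \<open>Nothing is known about the index 0; the limit law is put there so that all members are probability
  measures.\<close>
  define \<mu> where "\<mu> n = (if n = 0 then distr N borel (\<lambda>\<omega>. F (Z \<omega>)) else distr (M n) borel (\<lambda>\<omega>. F (Y n \<omega>)))" for n
  have Zm: "(\<lambda>\<omega>. F (Z \<omega>)) \<in> borel_measurable N" and N: "prob_space N"
    using c meas unfolding conv_in_distr_def by (auto intro: measurable_compose)
  have Ym: "(\<lambda>\<omega>. F (Y n \<omega>)) \<in> borel_measurable (M n)" and M: "prob_space (M n)" if "n \<ge> 1" for n
    using c meas that unfolding conv_in_distr_def by (auto intro: measurable_compose)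
  have rdZ: "real_distribution (distr N borel (\<lambda>\<omega>. F (Z \<omega>)))"
    by (rule prob_space.real_distribution_distr[OF N Zm])
  have rd: "real_distribution (\<mu> n)" for n
    using rdZ prob_space.real_distribution_distr[OF M Ym, of n] by (simp add: \<mu>_def)
  have weak: "weak_conv_m \<mu> (distr N borel (\<lambda>\<omega>. F (Z \<omega>)))"
  proof (rule integral_bdd_continuous_conv_imp_weak_conv[OF rd rdZ])
    fix u :: "real \<Rightarrow> real" assume u: "\<And>x. isCont u x" "\<And>x. \<bar>u x\<bar> \<le> 1"
    have uc: "continuous_on UNIV u" using u(1) by (simp add: continuous_at_imp_continuous_on)
    then have um: "u \<in> borel_measurable borel" by (rule borel_measurable_continuous_onI)
    have "continuous_map T euclideanreal (u \<circ> F)"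
      using F uc by (intro continuous_map_compose) auto
    moreover have "bounded ((u \<circ> F) ` topspace T)"
      using u(2) by (intro boundedI[of _ 1]) auto
    ultimately have lim: "(\<lambda>n. \<integral>\<omega>. u (F (Y n \<omega>)) \<partial>M n) \<longlonglongrightarrow> (\<integral>\<omega>. u (F (Z \<omega>)) \<partial>N)"
      using c unfolding conv_in_distr_def comp_def by blast
    have "(\<integral>x. u x \<partial>distr N borel (\<lambda>\<omega>. F (Z \<omega>))) = (\<integral>\<omega>. u (F (Z \<omega>)) \<partial>N)"
      by (rule integral_distr[OF Zm um])
    moreover have "eventually (\<lambda>n. (\<integral>\<omega>. u (F (Y n \<omega>)) \<partial>M n) = (\<integral>x. u x \<partial>\<mu> n)) sequentially"
      using eventually_ge_at_top[of 1]
      by eventually_elim (simp add: \<mu>_def integral_distr[OF Ym um])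
    ultimately show "(\<lambda>n. \<integral>x. u x \<partial>\<mu> n) \<longlonglongrightarrow> (\<integral>x. u x \<partial>distr N borel (\<lambda>\<omega>. F (Z \<omega>)))"
      using Lim_transform_eventually[OF lim] by simp
  qed
  have same: "eventually (\<lambda>n. cdf (\<mu> n) x = cdf (distr (M n) borel (\<lambda>\<omega>. F (Y n \<omega>))) x) sequentially" for x
    using eventually_ge_at_top[of 1] by eventually_elim (simp add: \<mu>_def)
  show ?thesis
    unfolding weak_conv_m_def weak_conv_def
  proof (intro allI impI)
    fix x assume "isCont (cdf (distr N borel (\<lambda>\<omega>. F (Z \<omega>)))) x"
    then have "(\<lambda>n. cdf (\<mu> n) x) \<longlonglongrightarrow> cdf (distr N borel (\<lambda>\<omega>. F (Z \<omega>))) x"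
      using weak unfolding weak_conv_m_def weak_conv_def by simp
    then show "(\<lambda>n. cdf (distr (M n) borel (\<lambda>\<omega>. F (Y n \<omega>))) x) \<longlonglongrightarrow> cdf (distr N borel (\<lambda>\<omega>. F (Z \<omega>))) x"
      by (rule Lim_transform_eventually) (rule same)
  qed
qed

theorem theorem4p2:
  fixes \<alpha> :: real
    and Q :: "nat \<Rightarrow> real measure"
    and h :: "nat \<Rightarrow> real \<Rightarrow> real"
    and h_lim :: "real \<Rightarrow> real"
    and M :: "nat \<Rightarrow> 'a measure"
    and X :: "nat \<Rightarrow> nat \<Rightarrow> 'a \<Rightarrow> real"
  assumes alpha: "\<alpha> \<ge> 1 / 2"
    and Q_prob: "\<And>n. n \<ge> 1 \<Longrightarrow> prob_space (Q n)"
    and Q_sets: "\<And>n. n \<ge> 1 \<Longrightarrow> sets (Q n) = sets borel"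
    and Q_dominated: "\<And>n. n \<ge> 1 \<Longrightarrow> absolutely_continuous (gamma_distr \<alpha>) (Q n)"
    and Q_deriv: "\<And>n. n \<ge> 1 \<Longrightarrow>
      AE x in gamma_distr \<alpha>. enn2real (RN_deriv (gamma_distr \<alpha>) (Q n) x) = 1 + h n x / sqrt (real n)"
    and A1_integrable: "\<And>n. n \<ge> 1 \<Longrightarrow> integrable (gamma_distr \<alpha>) (h n)"
    and A1_measurable: "h_lim \<in> borel_measurable borel"
    and A1_conv: "AE x in gamma_distr \<alpha>. (\<lambda>n. h n x) \<longlonglongrightarrow> h_lim x"
    and A2: "(SUP n\<in>{1..}. \<integral>\<^sup>+x. ennreal (\<bar>h n x\<bar> ^ 4) \<partial>gamma_distr \<alpha>) < \<infinity>"
    and M_prob: "\<And>n. n \<ge> 1 \<Longrightarrow> prob_space (M n)"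
    and X_nonneg: "\<And>n j \<omega>. 1 \<le> j \<Longrightarrow> j \<le> n \<Longrightarrow> \<omega> \<in> space (M n) \<Longrightarrow> X n j \<omega> \<ge> 0"
    and X_indep: "\<And>n. n \<ge> 1 \<Longrightarrow> prob_space.indep_vars (M n) (\<lambda>_. borel) (X n) {1..n}"
    and X_distr: "\<And>n j. 1 \<le> j \<Longrightarrow> j \<le> n \<Longrightarrow> distr (M n) borel (X n j) = Q n"
  shows "\<exists>(N :: (nat \<Rightarrow> real) measure) (Z :: real \<Rightarrow> (nat \<Rightarrow> real) \<Rightarrow> real) (c :: real \<Rightarrow> real).
      gaussian_process N {0..} Z \<and> centered_process N {0..} Z \<and>
      (\<forall>s\<ge>0. \<forall>t\<ge>0. covariance N (Z s) (Z t) = K_cov \<alpha> s t) \<and>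
      (\<forall>\<omega>\<in>space N. (\<lambda>t. Z t \<omega>) \<in> L2_fun (gamma_distr \<alpha>)) \<and>
      (\<forall>t\<ge>0. has_bochner_integral (gamma_distr \<alpha>)
         (\<lambda>x. (Gamma \<alpha> * mod_bessel_J \<alpha> (t * x / \<alpha>)
               + (x - \<alpha>) / \<alpha>\<^sup>2 * t * exp (- t / \<alpha>) - exp (- t / \<alpha>)) * h_lim x) (c t)) \<and>
      conv_in_distr (L2_topology (gamma_distr \<alpha>))
        M (\<lambda>n \<omega> t. Z_stat \<alpha> X n t \<omega>) N (\<lambda>\<omega> t. Z t \<omega> + c t) \<and>
      weak_conv_m (\<lambda>n. distr (M n) borel (T2_stat \<alpha> X n))
        (distr N borel (\<lambda>\<omega>. \<integral>t. (Z t \<omega> + c t)\<^sup>2 \<partial>gamma_distr \<alpha>))"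
proof -
  have a0: "\<alpha> > 0" using alpha by simp
  interpret P: prob_space "gamma_distr \<alpha>" by (rule prob_space_gamma_distr[OF a0])
  have h_meas: "h n \<in> borel_measurable borel" if "n \<ge> 1" for n
    using borel_measurable_integrable[OF A1_integrable[OF that]]
    unfolding measurable_cong_sets[OF sets_gamma_distr refl] .
  have nonneg: "AE x in gamma_distr \<alpha>. 0 \<le> 1 + h n x / sqrt (real n)" if "n \<ge> 1" for n
    using Q_deriv[OF that] by eventually_elim (metis enn2real_nonneg)
  have Q_eq: "Q n = density (gamma_distr \<alpha>) (\<lambda>x. ennreal (1 + h n x / sqrt (real n)))" if n: "n \<ge> 1" for n
  proof -
    interpret Q: prob_space "Q n" by (rule Q_prob[OF n])
    have s: "sets (Q n) = sets (gamma_distr \<alpha>)" using Q_sets[OF n] by simp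
    have "Q n = density (gamma_distr \<alpha>) (RN_deriv (gamma_distr \<alpha>) (Q n))"
      by (rule P.density_RN_deriv[OF Q_dominated[OF n] s, symmetric])
    also have "\<dots> = density (gamma_distr \<alpha>) (\<lambda>x. ennreal (1 + h n x / sqrt (real n)))"
    proof (rule density_cong)
      show "AE x in gamma_distr \<alpha>. RN_deriv (gamma_distr \<alpha>) (Q n) x = ennreal (1 + h n x / sqrt (real n))"
        using Q_deriv[OF n] P.RN_deriv_finite[OF Q.sigma_finite_measure_axioms Q_dominated[OF n] s]
      proof eventually_elim
        case (elim x)
        then show ?case by (metis ennreal_enn2real infinity_ennreal_def less_top)
      qed
      show "(\<lambda>x. ennreal (1 + h n x / sqrt (real n))) \<in> borel_measurable (gamma_distr \<alpha>)"
        by (intro gamma_distr_borel_measurable measurable_compose[OF _ measurable_ennreal] borel_measurable_add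
            borel_measurable_divide borel_measurable_const h_meas n)
    qed simp
    finally show ?thesis .
  qed
  define S where "S = (SUP n\<in>{1..}. \<integral>\<^sup>+x. ennreal (\<bar>h n x\<bar> ^ 4) \<partial>gamma_distr \<alpha>)"
  have hS: "(\<integral>\<^sup>+x. ennreal (h n x ^ 4) \<partial>gamma_distr \<alpha>) \<le> S" if "n \<ge> 1" for n
  proof -
    have "(\<integral>\<^sup>+x. ennreal (\<bar>h n x\<bar> ^ 4) \<partial>gamma_distr \<alpha>) \<le> S"
      unfolding S_def using that by (intro SUP_upper) simp
    then show ?thesis by simp
  qed
  have S: "S < \<infinity>" using A2 by (simp add: S_def)
  have h4: "integrable (gamma_distr \<alpha>) (\<lambda>x. h n x ^ 4)" if n: "n \<ge> 1" for n
  proof (rule integrableI_bounded)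
    show "(\<lambda>x. h n x ^ 4) \<in> borel_measurable (gamma_distr \<alpha>)"
      by (intro borel_measurable_power gamma_distr_borel_measurable h_meas n)
    show "(\<integral>\<^sup>+x. ennreal (norm (h n x ^ 4)) \<partial>gamma_distr \<alpha>) < \<infinity>"
      using hS[OF n] S by simp
  qed
  \<comment> \<open>The supremum of the fourth moments plays the role of the common bound.\<close>
  interpret gamma_array \<alpha> h h_lim Q "enn2real S" M X
  proof (intro gamma_array.intro gamma_array_axioms.intro local_alternatives_array.intro
      local_alternatives_array_axioms.intro local_alternatives.intro local_alternatives_axioms.intro)
    show "prob_space (gamma_distr \<alpha>)" by unfold_locales
    show "(\<integral>x. h n x ^ 4 \<partial>gamma_distr \<alpha>) \<le> enn2real S" if n: "n \<ge> 1" for n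
    proof -
      have "(\<integral>x. h n x ^ 4 \<partial>gamma_distr \<alpha>) = enn2real (\<integral>\<^sup>+x. ennreal (h n x ^ 4) \<partial>gamma_distr \<alpha>)"
        by (intro integral_eq_nn_integral borel_measurable_power gamma_distr_borel_measurable h_meas n) auto
      also have "\<dots> \<le> enn2real S" using hS[OF n] S by (intro enn2real_mono) auto
      finally show ?thesis .
    qed
    show "\<alpha> \<ge> 1 / 2" by (rule alpha)
    show "AE x in gamma_distr \<alpha>. (\<lambda>n. h n x) \<longlonglongrightarrow> h_lim x" by (rule A1_conv)
  qed (simp_all only: sets_gamma_distr Q_prob h_meas A1_measurable nonneg Q_eq[symmetric] h4 M_prob X_indep X_distr X_nonneg)
  have T2: "weak_conv_m (\<lambda>n. distr (M n) borel (T2_stat \<alpha> X n))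
      (distr gauss_seq borel (\<lambda>\<omega>. \<integral>t. (zproc \<alpha> t \<omega> + drift t)\<^sup>2 \<partial>gamma_distr \<alpha>))"
    using conv_in_distr_imp_weak_conv_m[OF Z_stat_conv_in_distr L2_norm_square_continuous_map
        continuous_map_L2_measurable[OF L2_norm_square_continuous_map]]
    by (simp add: T2_stat_def[abs_def])
  have "centered_process gauss_seq {0..} (zproc \<alpha>)"
    unfolding centered_process_def using zproc_mean[OF alpha] by auto
  then show ?thesis
    using zproc_gaussian[OF alpha] zproc_covariance[OF alpha] zproc_L2[OF alpha]
      drift_has_integral Z_stat_conv_in_distr T2
    unfolding psi_def
    by (intro exI[of _ gauss_seq] exI[of _ "zproc \<alpha>"] exI[of _ drift]) auto
qed

end
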